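(* Let $k$ be a field, let $\mathcal{C}\to\mathcal{B}=\mathcal{C}/G$ be a Galois covering of $k$-categories with group $G$, and let $\mathcal{M}$ be a locally finite $\mathcal{B}$-bimodule. Then there is a first quadrant spectral sequence of cohomological type converging to $H^n(\mathcal{B},\mathcal{M})$ with level $2$ term $$E_2^{p,q}=H^p\bigl(G,\,H^q(\mathcal{C},L\mathcal{M})\bigr),$$ where $H^p(G,X)$ denotes the usual group cohomology of $G$ with coefficients in a $kG$-module $X$.
   Context: $k$-categories and bimodules. A $k$-category is a small category whose morphism sets are $k$-vector spaces and whose composition is $k$-bilinear. $\mathcal{C}_0$ is the set of objects and ${}_y\mathcal{C}_x$ is the space of morphisms from $x$ to $y$, so composition is ${}_z\mathcal{C}_y\otimes_k{}_y\mathcal{C}_x\to{}_z\mathcal{C}_x$. A $\mathcal{C}$-bimodule $\mathcal{M}$ is a family of vector spaces $\{{}_y\mathcal{M}_x\}_{x,y\in\mathcal{C}_0}$ with $k$-bilinear left and right actions ${}_z\mathcal{C}_y\otimes{}_y\mathcal{M}_x\to{}_z\mathcal{M}_x$ and ${}_y\mathcal{M}_x\otimes{}_x\mathcal{C}_u\to{}_y\mathcal{M}_u$ that are associative, unital and commute with each other. A bimodule is locally finite if every ${}_y\mathcal{M}_x$ is finite dimensional over $k$. Hochschild-Mitchell cohomology. $H^*(\mathcal{C},\mathcal{M})$ is the cohomology of the cochain complex with $C^0(\mathcal{C},\mathcal{M})=\prod_x{}_x\mathcal{M}_x$ and, for $n\ge1$, $$C^n(\mathcal{C},\mathcal{M})=\prod_{(x_{n+1},\dots,x_1)}\operatorname{Hom}_k({}_{x_{n+1}}\mathcal{C}_{x_n}\otimes\cdots\otimes{}_{x_2}\mathcal{C}_{x_1},\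 {}_{x_{n+1}}\mathcal{M}_{x_1}),$$ with the usual Hochschild coboundary $df(c_{n+1}\otimes\cdots\otimes c_1)=(-1)^{n+1}c_{n+1}f(c_n\otimes\cdots\otimes c_1)+\sum_{i=1}^n(-1)^if(c_{n+1}\otimes\cdots\otimes c_{i+1}c_i\otimes\cdots\otimes c_1)+f(c_{n+1}\otimes\cdots\otimes c_2)c_1$ (in degree $0$: $(d(m_x)_x)(c)=-c\,m_x+m_y\,c$ for $c\in{}_y\mathcal{C}_x$). Galois coverings. A group $G$ acts freely on $\mathcal{C}$ if $G$ acts on $\mathcal{C}_0$ with $sx=x$ for some $x$ only when $s=1$, and acts on morphisms by $k$-linear maps $s:{}_y\mathcal{C}_x\to{}_{sy}\mathcal{C}_{sx}$ with $s(dc)=(sd)(sc)$ and $s(tc)=(st)c$. For a $kG$-module $X$, $X/G$ denotes the coinvariants $X/(\operatorname{Ker}\epsilon)X$, where $\epsilon:kG\to k$ is the augmentation. The quotient category $\mathcal{C}/G$ has as objects the $G$-orbits of objects of $\mathcal{C}$, and for orbits $u,v$, ${}_v(\mathcal{C}/G)_u=\bigl(\bigoplus_{x\in u,\,y\in v}{}_y\mathcal{C}_x\bigr)/G$. The composition of the class of $d\in{}_z\mathcal{C}_{y'}$ with the class of $c\in{}_y\mathcal{C}_x$ ($y,y'$ in the same orbit) is the class of $(sd)c$, where $s$ is the unique element of $G$ with $sy'=y$. A Galois covering with group $G$ is the projection functor $\mathcal{C}\to\mathcal{B}=\mathcal{C}/G$ for a free action of $G$ on $\mathcal{C}$. Write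 $\overline{x}$ for the orbit of $x$ and $\overline{c}$ for the class of $c$. Lifted bimodule. For a $\mathcal{B}$-bimodule $\mathcal{M}$, the $\mathcal{C}$-bimodule $L\mathcal{M}$ is ${}_y(L\mathcal{M})_x={}_{\overline{y}}\mathcal{M}_{\overline{x}}$ with actions $c\cdot m=\overline{c}\,m$, $m\cdot c=m\,\overline{c}$. Action of $G$ on cohomology. $G$ acts on $C^*(\mathcal{C},L\mathcal{M})$, hence on $H^*(\mathcal{C},L\mathcal{M})$, by $(sf)(c_n\otimes\cdots\otimes c_1)=f(s^{-1}c_n\otimes\cdots\otimes s^{-1}c_1)$ (in degree $0$, $(sm)_x=m_{s^{-1}x}$), using the equalities ${}_{sy}(L\mathcal{M})_{sx}={}_y(L\mathcal{M})_x$. *)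

theory Defs
  imports "HOL-Algebra.Group_Action" "HOL-Algebra.QuotRing" "Jordan_Normal_Form.Missing_VectorSpace"
begin

section \<open>Linear algebra\<close>

text \<open>The record \<^typ>\<open>('k, 'a) module\<close> extends the record of rings; its fields \<open>mult\<close> and \<open>one\<close> play
  no role for modules and are left unspecified in the constructions below.\<close>

definition bilinear_map ::
  "('k, 'r) ring_scheme \<Rightarrow> ('k, 'a) module \<Rightarrow> ('k, 'b) module \<Rightarrow> ('k, 'c) module \<Rightarrow> ('a \<Rightarrow> 'b \<Rightarrow> 'c) \<Rightarrow> bool"
  where "bilinear_map k U V W f \<longleftrightarrow>
    (\<forall>u \<in> carrier U. (\<lambda>v. f u v) \<in> module_hom k V W) \<and>
    (\<forall>v \<in> carrier V. (\<lambda>u. f u v) \<in> module_hom k U W)"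

definition module_isomorphic ::
  "('k, 'r) ring_scheme \<Rightarrow> ('k, 'a) module \<Rightarrow> ('k, 'b) module \<Rightarrow> bool"
  where "module_isomorphic k V W \<longleftrightarrow> (\<exists>h \<in> module_hom k V W. bij_betw h (carrier V) (carrier W))"

definition quotient_module :: "('k, 'a) module \<Rightarrow> 'a set \<Rightarrow> ('k, 'a set) module"
  where "quotient_module V W =
    \<lparr>carrier = a_rcosets\<^bsub>V\<^esub> W, mult = undefined, one = undefined, zero = W, add = set_add V,
     smult = (\<lambda>a X. \<Union>x \<in> X. W +>\<^bsub>V\<^esub> (a \<odot>\<^bsub>V\<^esub> x))\<rparr>"

definition product_module :: "'i set \<Rightarrow> ('i \<Rightarrow> ('k, 'a) module) \<Rightarrow> ('k, 'i \<Rightarrow> 'a) module"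
  where "product_module I V =
    \<lparr>carrier = (\<Pi>\<^sub>E i\<in>I. carrier (V i)), mult = undefined, one = undefined,
     zero = (\<lambda>i\<in>I. \<zero>\<^bsub>V i\<^esub>), add = (\<lambda>f g. \<lambda>i\<in>I. f i \<oplus>\<^bsub>V i\<^esub> g i),
     smult = (\<lambda>a f. \<lambda>i\<in>I. a \<odot>\<^bsub>V i\<^esub> f i)\<rparr>"

definition direct_sum_module :: "'i set \<Rightarrow> ('i \<Rightarrow> ('k, 'a) module) \<Rightarrow> ('k, 'i \<Rightarrow> 'a) module"
  where "direct_sum_module I V = (product_module I V)
    \<lparr>carrier := {f \<in> \<Pi>\<^sub>E i\<in>I. carrier (V i). finite {i \<in> I. f i \<noteq> \<zero>\<^bsub>V i\<^esub>}}\<rparr>"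

definition direct_sum_single :: "'i set \<Rightarrow> ('i \<Rightarrow> ('k, 'a) module) \<Rightarrow> 'i \<Rightarrow> 'a \<Rightarrow> ('i \<Rightarrow> 'a)"
  where "direct_sum_single I V i v = (\<lambda>j\<in>I. if j = i then v else \<zero>\<^bsub>V j\<^esub>)"

definition alt_sign :: "('k, 'a) module \<Rightarrow> nat \<Rightarrow> 'a \<Rightarrow> 'a"
  where "alt_sign V i x = (if even i then x else \<ominus>\<^bsub>V\<^esub> x)"


section \<open>Cohomology of cochain complexes in nonnegative degrees\<close>

definition cocycles :: "(nat \<Rightarrow> ('k, 'a) module) \<Rightarrow> (nat \<Rightarrow> 'a \<Rightarrow> 'a) \<Rightarrow> nat \<Rightarrow> 'a set"
  where "cocycles A d n = {x \<in> carrier (A n). d n x = \<zero>\<^bsub>A (Suc n)\<^esub>}"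

definition coboundaries :: "(nat \<Rightarrow> ('k, 'a) module) \<Rightarrow> (nat \<Rightarrow> 'a \<Rightarrow> 'a) \<Rightarrow> nat \<Rightarrow> 'a set"
  where "coboundaries A d n = (case n of 0 \<Rightarrow> {\<zero>\<^bsub>A 0\<^esub>} | Suc m \<Rightarrow> d m ` carrier (A m))"

definition cohomology :: "(nat \<Rightarrow> ('k, 'a) module) \<Rightarrow> (nat \<Rightarrow> 'a \<Rightarrow> 'a) \<Rightarrow> nat \<Rightarrow> ('k, 'a set) module"
  where "cohomology A d n =
    quotient_module ((A n)\<lparr>carrier := cocycles A d n\<rparr>) (coboundaries A d n)"


section \<open>Modules over a group algebra\<close>

text \<open>A \<open>kG\<close>-module is given by a \<open>k\<close>-module \<open>X\<close> and a map \<open>\<rho>\<close> such that \<open>\<rho> s\<close> is the action of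
  \<open>s \<in> G\<close> on \<open>X\<close>. An element of \<open>kG\<close> is a finitely supported function on \<open>G\<close>.\<close>

definition augmentation_ideal :: "('k, 'r) ring_scheme \<Rightarrow> ('g, 'n) monoid_scheme \<Rightarrow> ('g \<Rightarrow> 'k) set"
  where "augmentation_ideal k G =
    {a \<in> carrier G \<rightarrow>\<^sub>E carrier k. finite {s \<in> carrier G. a s \<noteq> \<zero>\<^bsub>k\<^esub>} \<and>
       (\<Oplus>\<^bsub>k\<^esub>s \<in> {s \<in> carrier G. a s \<noteq> \<zero>\<^bsub>k\<^esub>}. a s) = \<zero>\<^bsub>k\<^esub>}"

definition group_algebra_action ::
  "('k, 'r) ring_scheme \<Rightarrow> ('g, 'n) monoid_scheme \<Rightarrow> ('k, 'a) module \<Rightarrow> ('g \<Rightarrow> 'a \<Rightarrow> 'a) \<Rightarrow>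
   ('g \<Rightarrow> 'k) \<Rightarrow> 'a \<Rightarrow> 'a"
  where "group_algebra_action k G X \<rho> a x =
    (\<Oplus>\<^bsub>X\<^esub>s \<in> {s \<in> carrier G. a s \<noteq> \<zero>\<^bsub>k\<^esub>}. a s \<odot>\<^bsub>X\<^esub> \<rho> s x)"

definition augmentation_submodule ::
  "('k, 'r) ring_scheme \<Rightarrow> ('g, 'n) monoid_scheme \<Rightarrow> ('k, 'a) module \<Rightarrow> ('g \<Rightarrow> 'a \<Rightarrow> 'a) \<Rightarrow> 'a set"
  where "augmentation_submodule k G X \<rho> = module.span k X
    {group_algebra_action k G X \<rho> a x | a x. a \<in> augmentation_ideal k G \<and> x \<in> carrier X}"

definition coinvariants ::
  "('k, 'r) ring_scheme \<Rightarrow> ('g, 'n) monoid_scheme \<Rightarrow> ('k, 'a) module \<Rightarrow> ('g \<Rightarrow> 'a \<Rightarrow> 'a) \<Rightarrow>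
   ('k, 'a set) module"
  where "coinvariants k G X \<rho> = quotient_module X (augmentation_submodule k G X \<rho>)"

text \<open>Group cohomology is computed by inhomogeneous cochains; \<open>[g\<^sub>1, \<dots>, g\<^sub>p]\<close> stands for
  \<open>(g\<^sub>1, \<dots>, g\<^sub>p) \<in> G\<^sup>p\<close>.\<close>

definition group_tuples :: "('g, 'n) monoid_scheme \<Rightarrow> nat \<Rightarrow> 'g list set"
  where "group_tuples G p = {gs. length gs = p \<and> set gs \<subseteq> carrier G}"

definition group_cochains ::
  "('g, 'n) monoid_scheme \<Rightarrow> ('k, 'a) module \<Rightarrow> nat \<Rightarrow> ('k, 'g list \<Rightarrow> 'a) module"
  where "group_cochains G X p = product_module (group_tuples G p) (\<lambda>_. X)"

definition group_coboundary ::
  "('g, 'n) monoid_scheme \<Rightarrow> ('k, 'a) module \<Rightarrow> ('g \<Rightarrow> 'a \<Rightarrow> 'a) \<Rightarrow> nat \<Rightarrow>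
   ('g list \<Rightarrow> 'a) \<Rightarrow> ('g list \<Rightarrow> 'a)"
  where "group_coboundary G X \<rho> p f = (\<lambda>gs \<in> group_tuples G (Suc p).
     \<rho> (hd gs) (f (tl gs))
     \<oplus>\<^bsub>X\<^esub> (\<Oplus>\<^bsub>X\<^esub>i \<in> {1..p}. alt_sign X i
            (f (take (i - 1) gs @ [gs ! (i - 1) \<otimes>\<^bsub>G\<^esub> gs ! i] @ drop (i + 1) gs)))
     \<oplus>\<^bsub>X\<^esub> alt_sign X (p + 1) (f (butlast gs)))"

definition group_cohomology ::
  "('g, 'n) monoid_scheme \<Rightarrow> ('k, 'a) module \<Rightarrow> ('g \<Rightarrow> 'a \<Rightarrow> 'a) \<Rightarrow> nat \<Rightarrow>
   ('k, ('g list \<Rightarrow> 'a) set) module"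
  where "group_cohomology G X \<rho> = cohomology (group_cochains G X) (group_coboundary G X \<rho>)"


section \<open>Linear categories and bimodules\<close>

text \<open>Indices run from target to source, as in \<open>\<^sub>y\<C>\<^sub>x\<close>: \<open>Mor C y x\<close> is the space of morphisms from
  \<open>x\<close> to \<open>y\<close>, and \<open>Cmp C z y x d c\<close> is the composite \<open>dc\<close> of \<open>c \<in> \<^sub>y\<C>\<^sub>x\<close> and \<open>d \<in> \<^sub>z\<C>\<^sub>y\<close>. Since the
  carriers of different morphism spaces may overlap, all operations take the objects as arguments.\<close>

record ('o, 'k, 'm) kcat =
  Obj :: "'o set"
  Mor :: "'o \<Rightarrow> 'o \<Rightarrow> ('k, 'm) module"
  Cmp :: "'o \<Rightarrow> 'o \<Rightarrow> 'o \<Rightarrow> 'm \<Rightarrow> 'm \<Rightarrow> 'm"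
  Idn :: "'o \<Rightarrow> 'm"

locale k_category = field k
  for k :: "('k, 'r) ring_scheme" and C :: "('o, 'k, 'm) kcat" +
  assumes Mor_vectorspace: "\<lbrakk>x \<in> Obj C; y \<in> Obj C\<rbrakk> \<Longrightarrow> vectorspace k (Mor C y x)"
    and Cmp_bilinear: "\<lbrakk>x \<in> Obj C; y \<in> Obj C; z \<in> Obj C\<rbrakk> \<Longrightarrow>
      bilinear_map k (Mor C z y) (Mor C y x) (Mor C z x) (Cmp C z y x)"
    and Cmp_assoc: "\<lbrakk>x \<in> Obj C; y \<in> Obj C; z \<in> Obj C; w \<in> Obj C;
        c \<in> carrier (Mor C y x); d \<in> carrier (Mor C z y); e \<in> carrier (Mor C w z)\<rbrakk> \<Longrightarrow>
      Cmp C w y x (Cmp C w z y e d) c = Cmp C w z x e (Cmp C z y x d c)"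
    and Idn_closed: "x \<in> Obj C \<Longrightarrow> Idn C x \<in> carrier (Mor C x x)"
    and Idn_left: "\<lbrakk>x \<in> Obj C; y \<in> Obj C; c \<in> carrier (Mor C y x)\<rbrakk> \<Longrightarrow> Cmp C y y x (Idn C y) c = c"
    and Idn_right: "\<lbrakk>x \<in> Obj C; y \<in> Obj C; c \<in> carrier (Mor C y x)\<rbrakk> \<Longrightarrow> Cmp C y x x c (Idn C x) = c"

text \<open>\<open>Lact M z y x c m\<close> is \<open>cm\<close> for \<open>c \<in> \<^sub>z\<C>\<^sub>y\<close> and \<open>m \<in> \<^sub>y\<M>\<^sub>x\<close>; \<open>Ract M y x u m c\<close> is \<open>mc\<close> for
  \<open>m \<in> \<^sub>y\<M>\<^sub>x\<close> and \<open>c \<in> \<^sub>x\<C>\<^sub>u\<close>.\<close>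

record ('o, 'k, 'm, 'b) bimod =
  Bim :: "'o \<Rightarrow> 'o \<Rightarrow> ('k, 'b) module"
  Lact :: "'o \<Rightarrow> 'o \<Rightarrow> 'o \<Rightarrow> 'm \<Rightarrow> 'b \<Rightarrow> 'b"
  Ract :: "'o \<Rightarrow> 'o \<Rightarrow> 'o \<Rightarrow> 'b \<Rightarrow> 'm \<Rightarrow> 'b"

locale bimodule =
  fixes k :: "('k, 'r) ring_scheme" and C :: "('o, 'k, 'm) kcat" and M :: "('o, 'k, 'm, 'b) bimod"
  assumes Bim_vectorspace: "\<lbrakk>x \<in> Obj C; y \<in> Obj C\<rbrakk> \<Longrightarrow> vectorspace k (Bim M y x)"
    and Lact_bilinear: "\<lbrakk>x \<in> Obj C; y \<in> Obj C; z \<in> Obj C\<rbrakk> \<Longrightarrow>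
      bilinear_map k (Mor C z y) (Bim M y x) (Bim M z x) (Lact M z y x)"
    and Ract_bilinear: "\<lbrakk>y \<in> Obj C; x \<in> Obj C; u \<in> Obj C\<rbrakk> \<Longrightarrow>
      bilinear_map k (Bim M y x) (Mor C x u) (Bim M y u) (Ract M y x u)"
    and Lact_assoc: "\<lbrakk>x \<in> Obj C; y \<in> Obj C; z \<in> Obj C; w \<in> Obj C;
        m \<in> carrier (Bim M y x); c \<in> carrier (Mor C z y); d \<in> carrier (Mor C w z)\<rbrakk> \<Longrightarrow>
      Lact M w y x (Cmp C w z y d c) m = Lact M w z x d (Lact M z y x c m)"
    and Ract_assoc: "\<lbrakk>y \<in> Obj C; x \<in> Obj C; u \<in> Obj C; t \<in> Obj C;
        m \<in> carrier (Bim M y x); c \<in> carrier (Mor C x u); d \<in> carrier (Mor C u t)\<rbrakk> \<Longrightarrow>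
      Ract M y x t m (Cmp C x u t c d) = Ract M y u t (Ract M y x u m c) d"
    and Lact_Ract: "\<lbrakk>z \<in> Obj C; y \<in> Obj C; x \<in> Obj C; u \<in> Obj C;
        c \<in> carrier (Mor C z y); m \<in> carrier (Bim M y x); d \<in> carrier (Mor C x u)\<rbrakk> \<Longrightarrow>
      Ract M z x u (Lact M z y x c m) d = Lact M z y u c (Ract M y x u m d)"
    and Lact_Idn: "\<lbrakk>x \<in> Obj C; y \<in> Obj C; m \<in> carrier (Bim M y x)\<rbrakk> \<Longrightarrow> Lact M y y x (Idn C y) m = m"
    and Ract_Idn: "\<lbrakk>x \<in> Obj C; y \<in> Obj C; m \<in> carrier (Bim M y x)\<rbrakk> \<Longrightarrow> Ract M y x x m (Idn C x) = m"

definition locally_finite ::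
  "('k, 'r) ring_scheme \<Rightarrow> ('o, 'k, 'm) kcat \<Rightarrow> ('o, 'k, 'm, 'b) bimod \<Rightarrow> bool"
  where "locally_finite k C M \<longleftrightarrow> (\<forall>x \<in> Obj C. \<forall>y \<in> Obj C. vectorspace.fin_dim k (Bim M y x))"


section \<open>Hochschild-Mitchell cohomology\<close>

text \<open>A cell of degree \<open>n\<close> is a pair \<open>([x\<^sub>n\<^sub>+\<^sub>1, \<dots>, x\<^sub>1], [c\<^sub>n, \<dots>, c\<^sub>1])\<close> with \<open>c\<^sub>i\<close> a morphism from
  \<open>x\<^sub>i\<close> to \<open>x\<^sub>i\<^sub>+\<^sub>1\<close>. A linear map on \<open>c\<^sub>n \<otimes> \<dots> \<otimes> c\<^sub>1\<close> is the same as a multilinear map of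
  \<open>c\<^sub>n, \<dots>, c\<^sub>1\<close>, so an \<open>n\<close>-cochain is a function of such pairs that is linear in each \<open>c\<^sub>i\<close>. In degree
  \<open>0\<close> the pairs are \<open>([x], [])\<close> and the cochains are the families in \<open>\<Prod>\<^sub>x \<^sub>x\<M>\<^sub>x\<close>.\<close>

definition cells :: "('o, 'k, 'm) kcat \<Rightarrow> nat \<Rightarrow> ('o list \<times> 'm list) set"
  where "cells C n = {(xs, cs). length xs = Suc n \<and> length cs = n \<and> set xs \<subseteq> Obj C \<and>
    (\<forall>j < n. cs ! j \<in> carrier (Mor C (xs ! j) (xs ! Suc j)))}"

definition HM_cochains ::
  "('k, 'r) ring_scheme \<Rightarrow> ('o, 'k, 'm) kcat \<Rightarrow> ('o, 'k, 'm, 'b) bimod \<Rightarrow> nat \<Rightarrow>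
   ('k, 'o list \<times> 'm list \<Rightarrow> 'b) module"
  where "HM_cochains k C M n =
    (let P = product_module (cells C n) (\<lambda>(xs, cs). Bim M (hd xs) (last xs))
     in P\<lparr>carrier := {f \<in> carrier P. \<forall>(xs, cs) \<in> cells C n. \<forall>j < n.
          (\<lambda>c. f (xs, cs[j := c])) \<in>
            module_hom k (Mor C (xs ! j) (xs ! Suc j)) (Bim M (hd xs) (last xs))}\<rparr>)"

text \<open>Compose the morphisms at the list positions \<open>j\<close> and \<open>j + 1\<close>. In degree \<open>n + 1\<close> the morphism
  \<open>c\<^sub>i\<^sub>+\<^sub>1\<close> is at position \<open>n - i\<close>.\<close>

definition contract :: "('o, 'k, 'm) kcat \<Rightarrow> nat \<Rightarrow> 'o list \<times> 'm list \<Rightarrow> 'o list \<times> 'm list"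
  where "contract C j = (\<lambda>(xs, cs).
    (take (j + 1) xs @ drop (j + 2) xs,
     take j cs @ [Cmp C (xs ! j) (xs ! (j + 1)) (xs ! (j + 2)) (cs ! j) (cs ! (j + 1))]
       @ drop (j + 2) cs))"

definition HM_coboundary ::
  "('o, 'k, 'm) kcat \<Rightarrow> ('o, 'k, 'm, 'b) bimod \<Rightarrow> nat \<Rightarrow>
   ('o list \<times> 'm list \<Rightarrow> 'b) \<Rightarrow> ('o list \<times> 'm list \<Rightarrow> 'b)"
  where "HM_coboundary C M n f = (\<lambda>(xs, cs) \<in> cells C (Suc n).
    let V = Bim M (hd xs) (last xs) in
      alt_sign V (n + 1) (Lact M (xs ! 0) (xs ! 1) (last xs) (hd cs) (f (tl xs, tl cs)))
      \<oplus>\<^bsub>V\<^esub> (\<Oplus>\<^bsub>V\<^esub>i \<in> {1..n}. alt_sign V i (f (contract C (n - i) (xs, cs))))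
      \<oplus>\<^bsub>V\<^esub> Ract M (hd xs) (xs ! n) (xs ! (n + 1)) (f (butlast xs, butlast cs)) (last cs))"

definition HM_cohomology ::
  "('k, 'r) ring_scheme \<Rightarrow> ('o, 'k, 'm) kcat \<Rightarrow> ('o, 'k, 'm, 'b) bimod \<Rightarrow> nat \<Rightarrow>
   ('k, ('o list \<times> 'm list \<Rightarrow> 'b) set) module"
  where "HM_cohomology k C M = cohomology (HM_cochains k C M) (HM_coboundary C M)"


section \<open>Galois coverings\<close>

text \<open>\<open>\<phi> s x\<close> is \<open>sx\<close> for an object \<open>x\<close>, and \<open>\<psi> s y x c\<close> is \<open>sc\<close> for \<open>c \<in> \<^sub>y\<C>\<^sub>x\<close>.\<close>

locale free_action = k_category k C + group_action G "Obj C" \<phi>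
  for k :: "('k, 'r) ring_scheme" and C :: "('o, 'k, 'm) kcat"
    and G :: "('g, 'n) monoid_scheme" and \<phi> :: "'g \<Rightarrow> 'o \<Rightarrow> 'o" +
  fixes \<psi> :: "'g \<Rightarrow> 'o \<Rightarrow> 'o \<Rightarrow> 'm \<Rightarrow> 'm"
  assumes free: "\<lbrakk>s \<in> carrier G; x \<in> Obj C; \<phi> s x = x\<rbrakk> \<Longrightarrow> s = \<one>\<^bsub>G\<^esub>"
    and act_linear: "\<lbrakk>s \<in> carrier G; x \<in> Obj C; y \<in> Obj C\<rbrakk> \<Longrightarrow>
      \<psi> s y x \<in> module_hom k (Mor C y x) (Mor C (\<phi> s y) (\<phi> s x))"
    and act_one: "\<lbrakk>x \<in> Obj C; y \<in> Obj C; c \<in> carrier (Mor C y x)\<rbrakk> \<Longrightarrow> \<psi> \<one>\<^bsub>G\<^esub> y x c = c"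
    and act_act: "\<lbrakk>s \<in> carrier G; t \<in> carrier G; x \<in> Obj C; y \<in> Obj C; c \<in> carrier (Mor C y x)\<rbrakk> \<Longrightarrow>
      \<psi> s (\<phi> t y) (\<phi> t x) (\<psi> t y x c) = \<psi> (s \<otimes>\<^bsub>G\<^esub> t) y x c"
    and act_Cmp: "\<lbrakk>s \<in> carrier G; x \<in> Obj C; y \<in> Obj C; z \<in> Obj C;
        c \<in> carrier (Mor C y x); d \<in> carrier (Mor C z y)\<rbrakk> \<Longrightarrow>
      \<psi> s z x (Cmp C z y x d c) = Cmp C (\<phi> s z) (\<phi> s y) (\<phi> s x) (\<psi> s z y d) (\<psi> s y x c)"

definition orbit_sum :: "('o, 'k, 'm) kcat \<Rightarrow> 'o set \<Rightarrow> 'o set \<Rightarrow> ('k, 'o \<times> 'o \<Rightarrow> 'm) module"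
  where "orbit_sum C v u = direct_sum_module (v \<times> u) (\<lambda>(y, x). Mor C y x)"

definition orbit_single :: "('o, 'k, 'm) kcat \<Rightarrow> 'o set \<Rightarrow> 'o set \<Rightarrow> 'o \<Rightarrow> 'o \<Rightarrow> 'm \<Rightarrow> ('o \<times> 'o \<Rightarrow> 'm)"
  where "orbit_single C v u y x c = direct_sum_single (v \<times> u) (\<lambda>(y, x). Mor C y x) (y, x) c"

definition orbit_sum_action ::
  "('g, 'n) monoid_scheme \<Rightarrow> ('g \<Rightarrow> 'o \<Rightarrow> 'o) \<Rightarrow> ('g \<Rightarrow> 'o \<Rightarrow> 'o \<Rightarrow> 'm \<Rightarrow> 'm) \<Rightarrow> 'o set \<Rightarrow> 'o set \<Rightarrow>
   'g \<Rightarrow> ('o \<times> 'o \<Rightarrow> 'm) \<Rightarrow> ('o \<times> 'o \<Rightarrow> 'm)"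
  where "orbit_sum_action G \<phi> \<psi> v u s f = (\<lambda>(y, x) \<in> v \<times> u.
    let y' = \<phi> (inv\<^bsub>G\<^esub> s) y; x' = \<phi> (inv\<^bsub>G\<^esub> s) x in \<psi> s y' x' (f (y', x')))"

text \<open>\<open>orbit_class \<dots> v u f\<close> is the class of \<open>f\<close> in the coinvariants of \<open>orbit_sum C v u\<close>.\<close>

definition orbit_class ::
  "('k, 'r) ring_scheme \<Rightarrow> ('o, 'k, 'm) kcat \<Rightarrow> ('g, 'n) monoid_scheme \<Rightarrow> ('g \<Rightarrow> 'o \<Rightarrow> 'o) \<Rightarrow>
   ('g \<Rightarrow> 'o \<Rightarrow> 'o \<Rightarrow> 'm \<Rightarrow> 'm) \<Rightarrow> 'o set \<Rightarrow> 'o set \<Rightarrow> ('o \<times> 'o \<Rightarrow> 'm) \<Rightarrow> ('o \<times> 'o \<Rightarrow> 'm) set"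
  where "orbit_class k C G \<phi> \<psi> v u f =
    augmentation_submodule k G (orbit_sum C v u) (orbit_sum_action G \<phi> \<psi> v u)
      +>\<^bsub>orbit_sum C v u\<^esub> f"

text \<open>The bilinear map \<open>(d, c) \<mapsto> (sd)c\<close> on homogeneous elements \<open>d \<in> \<^sub>z\<C>\<^sub>y\<^sub>'\<close> and \<open>c \<in> \<^sub>y\<C>\<^sub>x\<close>, where
  \<open>sy' = y\<close>, extended to the direct sums.\<close>

definition orbit_sum_comp ::
  "('o, 'k, 'm) kcat \<Rightarrow> ('g, 'n) monoid_scheme \<Rightarrow> ('g \<Rightarrow> 'o \<Rightarrow> 'o) \<Rightarrow>
   ('g \<Rightarrow> 'o \<Rightarrow> 'o \<Rightarrow> 'm \<Rightarrow> 'm) \<Rightarrow> 'o set \<Rightarrow> 'o set \<Rightarrow> 'o set \<Rightarrow>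
   ('o \<times> 'o \<Rightarrow> 'm) \<Rightarrow> ('o \<times> 'o \<Rightarrow> 'm) \<Rightarrow> ('o \<times> 'o \<Rightarrow> 'm)"
  where "orbit_sum_comp C G \<phi> \<psi> w v u f g =
    finsum (orbit_sum C w u)
      (\<lambda>((z, y'), (y, x)). let s = (THE s. s \<in> carrier G \<and> \<phi> s y' = y) in
         orbit_single C w u (\<phi> s z) x (Cmp C (\<phi> s z) y x (\<psi> s z y' (f (z, y'))) (g (y, x))))
      ({(z, y') \<in> w \<times> v. f (z, y') \<noteq> \<zero>\<^bsub>Mor C z y'\<^esub>} \<times>
       {(y, x) \<in> v \<times> u. g (y, x) \<noteq> \<zero>\<^bsub>Mor C y x\<^esub>})"

text \<open>As for \<^const>\<open>rcoset_mult\<close>, operations on classes are unions over representatives.\<close>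

definition quotient_category ::
  "('k, 'r) ring_scheme \<Rightarrow> ('o, 'k, 'm) kcat \<Rightarrow> ('g, 'n) monoid_scheme \<Rightarrow> ('g \<Rightarrow> 'o \<Rightarrow> 'o) \<Rightarrow>
   ('g \<Rightarrow> 'o \<Rightarrow> 'o \<Rightarrow> 'm \<Rightarrow> 'm) \<Rightarrow> ('o set, 'k, ('o \<times> 'o \<Rightarrow> 'm) set) kcat"
  where "quotient_category k C G \<phi> \<psi> =
    \<lparr>Obj = orbits G (Obj C) \<phi>,
     Mor = (\<lambda>v u. coinvariants k G (orbit_sum C v u) (orbit_sum_action G \<phi> \<psi> v u)),
     Cmp = (\<lambda>w v u D E. \<Union>f \<in> D. \<Union>g \<in> E.
       orbit_class k C G \<phi> \<psi> w u (orbit_sum_comp C G \<phi> \<psi> w v u f g)),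
     Idn = (\<lambda>u. \<Union>x \<in> u. orbit_class k C G \<phi> \<psi> u u (orbit_single C u u x x (Idn C x)))\<rparr>"

definition morphism_class ::
  "('k, 'r) ring_scheme \<Rightarrow> ('o, 'k, 'm) kcat \<Rightarrow> ('g, 'n) monoid_scheme \<Rightarrow> ('g \<Rightarrow> 'o \<Rightarrow> 'o) \<Rightarrow>
   ('g \<Rightarrow> 'o \<Rightarrow> 'o \<Rightarrow> 'm \<Rightarrow> 'm) \<Rightarrow> 'o \<Rightarrow> 'o \<Rightarrow> 'm \<Rightarrow> ('o \<times> 'o \<Rightarrow> 'm) set"
  where "morphism_class k C G \<phi> \<psi> y x c =
    (let v = orbit G \<phi> y; u = orbit G \<phi> x in orbit_class k C G \<phi> \<psi> v u (orbit_single C v u y x c))"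

definition lifted_bimodule ::
  "('k, 'r) ring_scheme \<Rightarrow> ('o, 'k, 'm) kcat \<Rightarrow> ('g, 'n) monoid_scheme \<Rightarrow> ('g \<Rightarrow> 'o \<Rightarrow> 'o) \<Rightarrow>
   ('g \<Rightarrow> 'o \<Rightarrow> 'o \<Rightarrow> 'm \<Rightarrow> 'm) \<Rightarrow> ('o set, 'k, ('o \<times> 'o \<Rightarrow> 'm) set, 'b) bimod \<Rightarrow>
   ('o, 'k, 'm, 'b) bimod"
  where "lifted_bimodule k C G \<phi> \<psi> M =
    \<lparr>Bim = (\<lambda>y x. Bim M (orbit G \<phi> y) (orbit G \<phi> x)),
     Lact = (\<lambda>z y x c m. Lact M (orbit G \<phi> z) (orbit G \<phi> y) (orbit G \<phi> x)
                            (morphism_class k C G \<phi> \<psi> z y c) m),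
     Ract = (\<lambda>y x u m c. Ract M (orbit G \<phi> y) (orbit G \<phi> x) (orbit G \<phi> u)
                            m (morphism_class k C G \<phi> \<psi> x u c))\<rparr>"

definition cell_action ::
  "('g \<Rightarrow> 'o \<Rightarrow> 'o) \<Rightarrow> ('g \<Rightarrow> 'o \<Rightarrow> 'o \<Rightarrow> 'm \<Rightarrow> 'm) \<Rightarrow> 'g \<Rightarrow> 'o list \<times> 'm list \<Rightarrow> 'o list \<times> 'm list"
  where "cell_action \<phi> \<psi> s = (\<lambda>(xs, cs).
    (map (\<phi> s) xs, map (\<lambda>j. \<psi> s (xs ! j) (xs ! Suc j) (cs ! j)) [0..<length cs]))"

definition cochain_action ::
  "('o, 'k, 'm) kcat \<Rightarrow> ('g, 'n) monoid_scheme \<Rightarrow> ('g \<Rightarrow> 'o \<Rightarrow> 'o) \<Rightarrow>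
   ('g \<Rightarrow> 'o \<Rightarrow> 'o \<Rightarrow> 'm \<Rightarrow> 'm) \<Rightarrow> nat \<Rightarrow>
   'g \<Rightarrow> ('o list \<times> 'm list \<Rightarrow> 'b) \<Rightarrow> ('o list \<times> 'm list \<Rightarrow> 'b)"
  where "cochain_action C G \<phi> \<psi> n s f = (\<lambda>p \<in> cells C n. f (cell_action \<phi> \<psi> (inv\<^bsub>G\<^esub> s) p))"

text \<open>The action of \<open>s\<close> is an automorphism of the complex, so it sends a cohomology class, which is a
  coset of the coboundaries, to its image.\<close>

definition cohomology_action ::
  "('o, 'k, 'm) kcat \<Rightarrow> ('g, 'n) monoid_scheme \<Rightarrow> ('g \<Rightarrow> 'o \<Rightarrow> 'o) \<Rightarrow>
   ('g \<Rightarrow> 'o \<Rightarrow> 'o \<Rightarrow> 'm \<Rightarrow> 'm) \<Rightarrow> nat \<Rightarrow>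
   'g \<Rightarrow> ('o list \<times> 'm list \<Rightarrow> 'b) set \<Rightarrow> ('o list \<times> 'm list \<Rightarrow> 'b) set"
  where "cohomology_action C G \<phi> \<psi> n s X = cochain_action C G \<phi> \<psi> n s ` X"


section \<open>Spectral sequences\<close>

text \<open>First quadrant spectral sequences of cohomological type, starting at level \<open>2\<close>.\<close>

locale first_quadrant_spectral_sequence =
  fixes k :: "('k, 'r) ring_scheme"
    and E :: "nat \<Rightarrow> int \<Rightarrow> int \<Rightarrow> ('k, 'e) module"
    and d :: "nat \<Rightarrow> int \<Rightarrow> int \<Rightarrow> 'e \<Rightarrow> 'e"
  assumes page_vectorspace: "2 \<le> r \<Longrightarrow> vectorspace k (E r p q)"
    and first_quadrant: "\<lbrakk>2 \<le> r; p < 0 \<or> q < 0\<rbrakk> \<Longrightarrow> carrier (E r p q) = {\<zero>\<^bsub>E r p q\<^esub>}"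
    and differential_linear: "2 \<le> r \<Longrightarrow>
      d r p q \<in> module_hom k (E r p q) (E r (p + int r) (q - int r + 1))"
    and differential_square: "\<lbrakk>2 \<le> r; x \<in> carrier (E r p q)\<rbrakk> \<Longrightarrow>
      d r (p + int r) (q - int r + 1) (d r p q x)
        = \<zero>\<^bsub>E r (p + 2 * int r) (q - 2 * int r + 2)\<^esub>"
    and next_page: "2 \<le> r \<Longrightarrow> module_isomorphic k (E (Suc r) p q)
      (quotient_module
        ((E r p q)\<lparr>carrier := {x \<in> carrier (E r p q).
                       d r p q x = \<zero>\<^bsub>E r (p + int r) (q - int r + 1)\<^esub>}\<rparr>)
        (d r (p - int r) (q + int r - 1) ` carrier (E r (p - int r) (q + int r - 1))))"

text \<open>For \<open>r > max p (q + 1)\<close> the differentials into and out of \<open>E\<^sub>r\<^sup>p\<^sup>q\<close> vanish, so this term is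
  \<open>E\<^sub>\<infinity>\<^sup>p\<^sup>q\<close>.\<close>

definition converges_to ::
  "('k, 'r) ring_scheme \<Rightarrow> (nat \<Rightarrow> int \<Rightarrow> int \<Rightarrow> ('k, 'e) module) \<Rightarrow> (nat \<Rightarrow> ('k, 'h) module) \<Rightarrow> bool"
  where "converges_to k E H \<longleftrightarrow> (\<forall>n. \<exists>F :: nat \<Rightarrow> 'h set.
    F 0 = carrier (H n) \<and> F (Suc n) = {\<zero>\<^bsub>H n\<^esub>} \<and>
    (\<forall>p \<le> Suc n. subspace k (F p) (H n)) \<and>
    (\<forall>p \<le> n. F (Suc p) \<subseteq> F p \<and>
      (\<forall>r > max p (n - p + 1). module_isomorphic k
        (quotient_module ((H n)\<lparr>carrier := F p\<rparr>) (F (Suc p))) (E r (int p) (int (n - p))))))"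

end

(*
  The spectral sequence is that of the double complex K p q = C^p(G, C^q(C, LM)), filtered by p. Taking
  first the cohomology in the direction q gives the E_2 term. In the direction p the complex is exact in
  positive degrees: G acts freely on the objects of C, so after choosing a base point in every orbit a
  cochain of C is a function of the position in its orbit of the first object of a cell, and C^q(C, LM)
  is a coinduced kG-module. Hence the total cohomology is that of the complex of invariants, which
  pulling back along C -> C/G identifies with the cochains of C/G: for fixed y in v, the space of
  morphisms u -> v of C/G is the direct sum of the spaces of morphisms x -> y of C with x in u, so an
  invariant cochain extends to C/G by summing over lifted paths.
*)
theory Submission
  imports Defs
begin

section \<open>Subquotients of modules\<close>

text \<open>Maps out of cohomology or out of a page involve choices of representatives and of
  correction terms. They are therefore obtained from linear relations: linearity is checked on
  related pairs, and independence of the choices becomes the question of what is related to zero.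

  The pages of the filtered total complex consist of cosets in that complex, whereas
  \<open>E\<close> has to live in the type of group cohomology with values in cohomology classes. A
  page embeds into the preceding one by choosing representatives, and page 2 embeds into the
  required type because it is isomorphic to group cohomology; the spectral sequence is carried along
  these embeddings.

  Orbits may be infinite, so the sum over lifted paths has to be cut down to a finite one. A
  morphism of the quotient has finitely many nonzero coordinates once its target is lifted, and the
  sources of these coordinates are the lifted targets for the next slot. This is why paths are
  lifted from the final target, the head of the list. The position of a cell in its orbit is read
  off the same object.\<close>

abbreviation subquotient :: "('k, 'a) module \<Rightarrow> 'a set \<Rightarrow> 'a set \<Rightarrow> ('k, 'a set) module"
  where "subquotient M Z W \<equiv> quotient_module (M\<lparr>carrier := Z\<rparr>) W"

lemma module_homI:
  assumes "\<And>x. x \<in> carrier V \<Longrightarrow> f x \<in> carrier W"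
    and "\<And>x y. \<lbrakk>x \<in> carrier V; y \<in> carrier V\<rbrakk> \<Longrightarrow> f (x \<oplus>\<^bsub>V\<^esub> y) = f x \<oplus>\<^bsub>W\<^esub> f y"
    and "\<And>a x. \<lbrakk>a \<in> carrier R; x \<in> carrier V\<rbrakk> \<Longrightarrow> f (a \<odot>\<^bsub>V\<^esub> x) = a \<odot>\<^bsub>W\<^esub> f x"
  shows "f \<in> module_hom R V W"
  using assms by (auto simp: module_hom_def)

lemma module_homD:
  assumes "f \<in> module_hom R V W"
  shows "x \<in> carrier V \<Longrightarrow> f x \<in> carrier W"
    and "\<lbrakk>x \<in> carrier V; y \<in> carrier V\<rbrakk> \<Longrightarrow> f (x \<oplus>\<^bsub>V\<^esub> y) = f x \<oplus>\<^bsub>W\<^esub> f y"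
    and "\<lbrakk>a \<in> carrier R; x \<in> carrier V\<rbrakk> \<Longrightarrow> f (a \<odot>\<^bsub>V\<^esub> x) = a \<odot>\<^bsub>W\<^esub> f x"
  using assms by (auto simp: module_hom_def)

lemma module_hom_zero:
  assumes "module R V" "module R W" "f \<in> module_hom R V W"
  shows "f \<zero>\<^bsub>V\<^esub> = \<zero>\<^bsub>W\<^esub>"
proof -
  interpret mod_hom R V W f using assms by (simp add: mod_hom_def mod_hom_axioms_def)
  show ?thesis by simp
qed

lemma module_hom_uminus:
  assumes "module R V" "module R W" "f \<in> module_hom R V W" "x \<in> carrier V"
  shows "f (\<ominus>\<^bsub>V\<^esub> x) = \<ominus>\<^bsub>W\<^esub> f x"
proof -
  interpret mod_hom R V W f using assms by (simp add: mod_hom_def mod_hom_axioms_def)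
  show ?thesis using assms(4)
    by (metis M.smult_minus_1 N.smult_minus_1 M.R.add.inv_closed M.R.one_closed f_smult assms(3) module_homD(1))
qed

lemma module_hom_minus:
  assumes "module R V" "module R W" "f \<in> module_hom R V W" "x \<in> carrier V" "y \<in> carrier V"
  shows "f (x \<ominus>\<^bsub>V\<^esub> y) = f x \<ominus>\<^bsub>W\<^esub> f y"
proof -
  interpret V: module R V by fact
  show ?thesis using assms
    by (simp add: a_minus_def module_homD(2) module_hom_uminus)
qed

lemma module_hom_compose:
  assumes "f \<in> module_hom R U V" "g \<in> module_hom R V W"
  shows "(\<lambda>x. g (f x)) \<in> module_hom R U W"
  using assms by (auto simp: module_hom_def Pi_iff)

text \<open>The constructions of subquotients and products take and return records without further
  fields, so the record is fixed to the unextended type; this keeps the types of all modules below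
  uniform.\<close>

locale plain_module = module R M for R :: "('k, 'r) ring_scheme" and M :: "('k, 'a) module" (structure)

context plain_module
begin

lemma subset_submodule: "submodule R W M \<Longrightarrow> W \<subseteq> carrier M"
  by (rule submodule.subset)

lemma submodule_uminus: "\<lbrakk>submodule R W M; x \<in> W\<rbrakk> \<Longrightarrow> \<ominus> x \<in> W"
  by (metis R.add.inv_closed R.one_closed smult_minus_1 submodule.smult_closed submodule.subset subsetD)

lemma submodule_minus: "\<lbrakk>submodule R W M; x \<in> W; y \<in> W\<rbrakk> \<Longrightarrow> x \<ominus> y \<in> W"
  by (simp add: a_minus_def submodule_uminus submodule.m_closed)

lemma submoduleI':
  assumes "W \<subseteq> carrier M" "\<zero> \<in> W"
    and "\<And>v w. \<lbrakk>v \<in> W; w \<in> W\<rbrakk> \<Longrightarrow> v \<oplus> w \<in> W"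
    and "\<And>c v. \<lbrakk>c \<in> carrier R; v \<in> W\<rbrakk> \<Longrightarrow> c \<odot> v \<in> W"
  shows "submodule R W M"
  using assms module_axioms by unfold_locales auto

lemma submodule_carrier: "submodule R (carrier M) M"
  by (rule submoduleI') auto

lemma submodule_zero: "submodule R {\<zero>} M"
  by (rule submoduleI') auto

lemma minus_self [simp]: "x \<in> carrier M \<Longrightarrow> x \<ominus> x = \<zero>"
  by simp

lemma minus_zero_right [simp]: "x \<in> carrier M \<Longrightarrow> x \<ominus> \<zero> = x"
  using M.add.inv_one by (simp add: a_minus_def a_inv_def)

lemma add_minus_add:
  assumes "a \<in> carrier M" "b \<in> carrier M" "c \<in> carrier M" "d \<in> carrier M"
  shows "(a \<oplus> b) \<ominus> (c \<oplus> d) = (a \<ominus> c) \<oplus> (b \<ominus> d)"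
  using assms by (simp add: a_minus_def M.minus_add M.a_ac)

lemma smult_minus:
  assumes "a \<in> carrier R" "x \<in> carrier M" "y \<in> carrier M"
  shows "a \<odot> (x \<ominus> y) = a \<odot> x \<ominus> a \<odot> y"
  using assms by (simp add: a_minus_def smult_r_distr smult_r_minus)

lemma minus_add_cancel: "\<lbrakk>x \<in> carrier M; y \<in> carrier M\<rbrakk> \<Longrightarrow> (x \<ominus> y) \<oplus> y = x"
  by (simp add: a_minus_def M.a_ac M.l_neg M.r_neg)

lemma add_minus_cancel: "\<lbrakk>x \<in> carrier M; y \<in> carrier M\<rbrakk> \<Longrightarrow> (x \<oplus> y) \<ominus> y = x"
  by (simp add: a_minus_def M.a_ac M.l_neg M.r_neg)

lemma minus_minus_minus:
  assumes "x \<in> carrier M" "y \<in> carrier M" "z \<in> carrier M"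
  shows "(x \<ominus> z) \<ominus> (y \<ominus> z) = x \<ominus> y"
proof -
  have "(x \<ominus> z) \<ominus> (y \<ominus> z) = (x \<ominus> y) \<oplus> ((\<ominus> z) \<ominus> (\<ominus> z))"
    using assms add_minus_add[of x "\<ominus> z" y "\<ominus> z"] by (simp add: a_minus_def)
  then show ?thesis using assms by (simp add: a_minus_def M.l_neg M.r_neg)
qed

section \<open>Cosets and subquotients\<close>

lemma coset_def: "W +> x = {w \<oplus> x | w. w \<in> W}"
  by (auto simp: a_r_coset_def')

lemma mem_coset_iff:
  assumes "submodule R W M" "x \<in> carrier M"
  shows "y \<in> W +> x \<longleftrightarrow> y \<in> carrier M \<and> y \<ominus> x \<in> W"
  using assms subset_submodule[OF assms(1)]
  by (auto simp: coset_def add_minus_cancel subset_iff) (metis minus_add_cancel)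

lemma coset_eq_iff:
  assumes W: "submodule R W M" and x: "x \<in> carrier M" "y \<in> carrier M"
  shows "W +> x = W +> y \<longleftrightarrow> x \<ominus> y \<in> W"
proof
  assume "W +> x = W +> y"
  moreover have "x \<in> W +> x"
    using assms by (simp add: mem_coset_iff submodule.zero_closed)
  ultimately show "x \<ominus> y \<in> W" using assms by (simp add: mem_coset_iff)
next
  assume h: "x \<ominus> y \<in> W"
  have "z \<ominus> x \<in> W \<longleftrightarrow> z \<ominus> y \<in> W" if z: "z \<in> carrier M" for z
  proof -
    have "z \<ominus> x = (z \<ominus> y) \<ominus> (x \<ominus> y)"
      using x z by (simp add: minus_minus_minus)
    moreover have "z \<ominus> y = (z \<ominus> x) \<oplus> (x \<ominus> y)"
      using x z by (metis M.minus_closed calculation minus_add_cancel)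
    ultimately show ?thesis using h W by (metis submodule_minus submodule.m_closed)
  qed
  then show "W +> x = W +> y"
    using assms by (auto simp: mem_coset_iff)
qed

lemma coset_self: "\<lbrakk>submodule R W M; x \<in> carrier M\<rbrakk> \<Longrightarrow> x \<in> W +> x"
  by (simp add: mem_coset_iff submodule.zero_closed)

lemma coset_zero: "submodule R W M \<Longrightarrow> W +> \<zero> = W"
  using subset_submodule by (auto simp: mem_coset_iff)

lemma coset_eq_self_iff:
  assumes "submodule R W M" "x \<in> carrier M"
  shows "W +> x = W \<longleftrightarrow> x \<in> W"
  using coset_eq_iff[OF assms, of "\<zero>"] assms by (simp add: coset_zero)

lemma coset_of_mem:
  assumes "submodule R W M" "x \<in> carrier M" "y \<in> W +> x"
  shows "W +> x = W +> y"
  using assms by (metis coset_eq_iff mem_coset_iff)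

end

text \<open>A coset depends on the addition alone. Subquotients can thus be treated with cosets of
  the ambient module, whatever the carrier of the submodule.\<close>

lemma r_coset_update: "W +>\<^bsub>M\<lparr>carrier := Z\<rparr>\<^esub> x = W +>\<^bsub>M\<^esub> x"
  by (simp add: a_r_coset_def')

lemma subquotient_simps:
  shows "carrier (subquotient M Z W) = (\<lambda>x. W +>\<^bsub>M\<^esub> x) ` Z"
    and "\<zero>\<^bsub>subquotient M Z W\<^esub> = W"
  by (auto simp: quotient_module_def A_RCOSETS_def' r_coset_update)

lemma (in plain_module) subquotient_add:
  assumes W: "submodule R W M" and x: "x \<in> carrier M" "y \<in> carrier M"
  shows "(W +> x) \<oplus>\<^bsub>subquotient M Z W\<^esub> (W +> y) = W +> (x \<oplus> y)"
proof -
  have c: "\<And>w. w \<in> W \<Longrightarrow> w \<in> carrier M" using W by (meson subsetD subset_submodule)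
  have "(W +> x) <+>\<^bsub>M\<^esub> (W +> y) = W +> (x \<oplus> y)"
  proof (intro subset_antisym subsetI)
    fix z assume "z \<in> (W +> x) <+>\<^bsub>M\<^esub> (W +> y)"
    then obtain v w where vw: "v \<in> W" "w \<in> W" "z = (v \<oplus> x) \<oplus> (w \<oplus> y)"
      by (auto simp: set_add_def' coset_def)
    then have "z = (v \<oplus> w) \<oplus> (x \<oplus> y)" using x c by (simp add: M.a_ac)
    then show "z \<in> W +> (x \<oplus> y)" using vw W by (auto simp: coset_def submodule.m_closed)
  next
    fix z assume "z \<in> W +> (x \<oplus> y)"
    then obtain w where w: "w \<in> W" "z = w \<oplus> (x \<oplus> y)" by (auto simp: coset_def)
    then have "z = (w \<oplus> x) \<oplus> (\<zero> \<oplus> y)" using x c by (simp add: M.a_ac)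
    then show "z \<in> (W +> x) <+>\<^bsub>M\<^esub> (W +> y)"
      using w submodule.zero_closed[OF W] unfolding set_add_def' coset_def by blast
  qed
  then show ?thesis by (simp add: quotient_module_def set_add_def')
qed

lemma (in plain_module) subquotient_smult:
  assumes W: "submodule R W M" and a: "a \<in> carrier R" and x: "x \<in> carrier M"
  shows "a \<odot>\<^bsub>subquotient M Z W\<^esub> (W +> x) = W +> (a \<odot> x)"
proof -
  have "W +> (a \<odot> y) = W +> (a \<odot> x)" if y: "y \<in> W +> x" for y
  proof -
    have "y \<in> carrier M" "y \<ominus> x \<in> W" using y W x by (auto simp: mem_coset_iff)
    then show ?thesis using W a x
      by (simp add: coset_eq_iff smult_minus[symmetric] submodule.smult_closed)
  qed
  moreover have "x \<in> W +> x" using W x by (rule coset_self)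
  ultimately have "(\<Union>y\<in>W +> x. W +> (a \<odot> y)) = W +> (a \<odot> x)"
    by blast
  then show ?thesis by (simp add: quotient_module_def r_coset_update)
qed

text \<open>\<open>N\<close> is a bare record whose operations are known only on values of
  \<open>f\<close>; since \<open>f\<close> is onto, every module axiom is the image of the same
  axiom in \<open>Z\<close>. As \<open>f\<close> may identify elements, this covers quotients as
  well as transport along an injection.\<close>

lemma (in plain_module) module_image:
  assumes f: "\<And>x y. \<lbrakk>x \<in> Z; y \<in> Z\<rbrakk> \<Longrightarrow> f x \<oplus>\<^bsub>N\<^esub> f y = f (x \<oplus> y)"
      "\<And>a x. \<lbrakk>a \<in> carrier R; x \<in> Z\<rbrakk> \<Longrightarrow> a \<odot>\<^bsub>N\<^esub> f x = f (a \<odot> x)"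
    and zero: "f \<zero> = \<zero>\<^bsub>N\<^esub>" and onto: "f ` Z = carrier N" and Z: "submodule R Z M"
  shows "module R N"
proof -
  note [simp] = f zero onto[symmetric] submodule.m_closed[OF Z] submodule.smult_closed[OF Z]
    submodule.zero_closed[OF Z] subsetD[OF subset_submodule[OF Z]]
  show ?thesis
  proof (rule moduleI)
    show "cring R" by (rule R.cring_axioms)
    show "abelian_group N"
    proof (rule abelian_groupI)
      show "\<zero>\<^bsub>N\<^esub> \<in> carrier N" unfolding onto[symmetric] zero[symmetric] by (intro imageI) simp
      fix X assume "X \<in> carrier N"
      then obtain x where x: "x \<in> Z" "X = f x" by auto
      show "\<zero>\<^bsub>N\<^esub> \<oplus>\<^bsub>N\<^esub> X = X" using x f(1)[of \<zero> x] by simp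
      have "f (\<ominus> x) \<oplus>\<^bsub>N\<^esub> X = \<zero>\<^bsub>N\<^esub>" using x submodule_uminus[OF Z] by (simp add: M.l_neg)
      then show "\<exists>Y \<in> carrier N. Y \<oplus>\<^bsub>N\<^esub> X = \<zero>\<^bsub>N\<^esub>" using submodule_uminus[OF Z x(1)] by auto
    qed (auto simp: M.a_ac)
  qed (auto simp: smult_l_distr smult_r_distr smult_assoc1)
qed

lemma (in plain_module) subquotient_module:
  assumes Z: "submodule R Z M" and W: "submodule R W M" and WZ: "W \<subseteq> Z"
  shows "module R (subquotient M Z W)"
  using subset_submodule[OF Z] W Z
  by (intro module_image[where Z=Z and f="a_r_coset M W"]) (auto simp: subquotient_simps subquotient_add subquotient_smult coset_zero subset_iff)

lemma (in plain_module) coset_hom: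
  assumes Z: "submodule R Z M" and W: "submodule R W M"
  shows "(\<lambda>x. W +> x) \<in> module_hom R (M\<lparr>carrier := Z\<rparr>) (subquotient M Z W)"
  using subset_submodule[OF Z] W
  by (intro module_homI) (auto simp: subquotient_simps subquotient_add subquotient_smult subset_iff)

lemma (in plain_module) submodule_image:
  fixes N :: "('k, 'b) module"
  assumes N: "module R N" and f: "f \<in> module_hom R (N\<lparr>carrier := Z\<rparr>) M" and Z: "submodule R Z N"
  shows "submodule R (f ` Z) M"
proof -
  interpret N: plain_module R N using N by (simp add: plain_module_def)
  have m: "module R (N\<lparr>carrier := Z\<rparr>)" using Z by (rule N.submodule_is_module)
  have z: "f \<zero>\<^bsub>N\<^esub> = \<zero>" using module_hom_zero[OF m module_axioms f] by simp
  have h1: "\<And>x. x \<in> Z \<Longrightarrow> f x \<in> carrier M"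
    and h2: "\<And>x y. \<lbrakk>x \<in> Z; y \<in> Z\<rbrakk> \<Longrightarrow> f x \<oplus> f y = f (x \<oplus>\<^bsub>N\<^esub> y)"
    and h3: "\<And>a x. \<lbrakk>a \<in> carrier R; x \<in> Z\<rbrakk> \<Longrightarrow> a \<odot> f x = f (a \<odot>\<^bsub>N\<^esub> x)"
    using f by (auto simp: module_hom_def)
  show ?thesis
  proof (rule submoduleI')
    show "f ` Z \<subseteq> carrier M" using h1 by blast
    have "f \<zero>\<^bsub>N\<^esub> \<in> f ` Z" using Z by (intro imageI) (rule submodule.zero_closed)
    then show "\<zero> \<in> f ` Z" by (simp only: z)
  next
    fix v w assume "v \<in> f ` Z" "w \<in> f ` Z"
    then obtain x y where "x \<in> Z" "y \<in> Z" "v = f x" "w = f y" by blast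
    then show "v \<oplus> w \<in> f ` Z" using Z by (simp add: h2 submodule.m_closed)
  next
    fix c v assume "c \<in> carrier R" "v \<in> f ` Z"
    then show "c \<odot> v \<in> f ` Z" using Z by (auto simp: h3 submodule.smult_closed)
  qed
qed

section \<open>Isomorphisms and linear relations\<close>

lemma module_isomorphic_sym:
  assumes "module_isomorphic R V W" and V: "module R V"
  shows "module_isomorphic R W V"
proof -
  interpret V: module R V by fact
  obtain h where h: "h \<in> module_hom R V W" "bij_betw h (carrier V) (carrier W)"
    using assms by (auto simp: module_isomorphic_def)
  let ?g = "inv_into (carrier V) h"
  have g: "bij_betw ?g (carrier W) (carrier V)" using h(2) by (rule bij_betw_inv_into)
  have e: "\<And>w. w \<in> carrier W \<Longrightarrow> ?g w \<in> carrier V \<and> h (?g w) = w"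
    using g h(2) by (simp add: bij_betw_apply bij_betw_inv_into_right)
  have u: "?g w = v" if "v \<in> carrier V" "h v = w" for v w
    using that h(2) by (auto simp: bij_betw_inv_into_left)
  have "?g \<in> module_hom R W V"
    using e by (intro module_homI) (auto intro!: u simp: module_homD[OF h(1)])
  then show ?thesis using g unfolding module_isomorphic_def by blast
qed

lemma module_isomorphic_trans:
  assumes "module_isomorphic R U V" "module_isomorphic R V W"
  shows "module_isomorphic R U W"
proof -
  obtain f g where "f \<in> module_hom R U V" "bij_betw f (carrier U) (carrier V)"
    "g \<in> module_hom R V W" "bij_betw g (carrier V) (carrier W)"
    using assms by (auto simp: module_isomorphic_def)
  then have "(\<lambda>x. g (f x)) \<in> module_hom R U W \<and> bij_betw (\<lambda>x. g (f x)) (carrier U) (carrier W)"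
    using bij_betw_trans[of f "carrier U" "carrier V" g "carrier W"] module_hom_compose[of f R U V g W]
    by (simp add: comp_def)
  then show ?thesis unfolding module_isomorphic_def by blast
qed

text \<open>An additive relation between \<open>A\<close> and \<open>Z\<close>: the graph of a map
  that is defined only up to choices. It is total on \<open>A\<close>, but several \<open>z\<close>
  may be related to the same \<open>x\<close>; the ambiguity is measured by the elements related to
  zero.\<close>

locale linear_relation =
  X: plain_module R X + V: plain_module R V
  for R and X :: "('k, 'x) module" and V :: "('k, 'v) module" +
  fixes P :: "'x \<Rightarrow> 'v \<Rightarrow> bool" and A :: "'x set" and Z :: "'v set"
  assumes A_sub: "submodule R A X" and Z_sub: "submodule R Z V"
    and P_dom: "P x z \<Longrightarrow> x \<in> A \<and> z \<in> Z"
    and P_total: "x \<in> A \<Longrightarrow> \<exists>z. P x z"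
    and P_add: "\<lbrakk>P x z; P x' z'\<rbrakk> \<Longrightarrow> P (x \<oplus>\<^bsub>X\<^esub> x') (z \<oplus>\<^bsub>V\<^esub> z')"
    and P_smult: "\<lbrakk>a \<in> carrier R; P x z\<rbrakk> \<Longrightarrow> P (a \<odot>\<^bsub>X\<^esub> x) (a \<odot>\<^bsub>V\<^esub> z)"
begin

lemma P_minus: "\<lbrakk>P x z; P x' z'\<rbrakk> \<Longrightarrow> P (x \<ominus>\<^bsub>X\<^esub> x') (z \<ominus>\<^bsub>V\<^esub> z')"
proof -
  assume h: "P x z" "P x' z'"
  have "x' \<in> carrier X" "z' \<in> carrier V"
    using P_dom[OF h(2)] A_sub Z_sub by (meson subsetD X.subset_submodule V.subset_submodule)+
  then have "P (\<ominus>\<^bsub>X\<^esub> x') (\<ominus>\<^bsub>V\<^esub> z')"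
    using P_smult[OF _ h(2), of "\<ominus>\<^bsub>R\<^esub> \<one>\<^bsub>R\<^esub>"] by (simp add: X.smult_minus_1 V.smult_minus_1)
  then show ?thesis using P_add[OF h(1)] by (simp add: a_minus_def)
qed

text \<open>Two elements related to the same \<open>x\<close> differ by an element related to zero,
  hence by an element of \<open>W\<close>; so the coset of any of them is a well defined
  value.\<close>

lemma ex_hom:
  assumes W: "submodule R W V" "W \<subseteq> Z" and zero: "\<And>z. P \<zero>\<^bsub>X\<^esub> z \<Longrightarrow> z \<in> W"
  obtains c where "c \<in> module_hom R (X\<lparr>carrier := A\<rparr>) (subquotient V Z W)"
    "\<And>x z. P x z \<Longrightarrow> c x = W +>\<^bsub>V\<^esub> z"
proof -
  have zc: "P x z \<Longrightarrow> x \<in> carrier X \<and> z \<in> carrier V" for x z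
    using P_dom A_sub Z_sub by (meson subsetD X.subset_submodule V.subset_submodule)
  define c where "c x = W +>\<^bsub>V\<^esub> (SOME z. P x z)" for x
  have c: "c x = W +>\<^bsub>V\<^esub> z" if "P x z" for x z
  proof -
    have s: "P x (SOME z. P x z)" using that by (rule someI)
    have "P \<zero>\<^bsub>X\<^esub> ((SOME z. P x z) \<ominus>\<^bsub>V\<^esub> z)"
      using P_minus[OF s that] zc[OF that] by simp
    then show ?thesis using zero W zc[OF that] zc[OF s] by (simp add: c_def V.coset_eq_iff)
  qed
  have "c \<in> module_hom R (X\<lparr>carrier := A\<rparr>) (subquotient V Z W)"
  proof (rule module_homI; simp)
    fix x assume "x \<in> A"
    then obtain z where z: "P x z" using P_total by blast
    then show "c x \<in> carrier (subquotient V Z W)" using P_dom by (auto simp: subquotient_simps c)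
    show "c (a \<odot>\<^bsub>X\<^esub> x) = a \<odot>\<^bsub>subquotient V Z W\<^esub> c x" if "a \<in> carrier R" for a
      using c[OF z] c[OF P_smult[OF that z]] that z zc[OF z] W by (simp add: V.subquotient_smult)
    fix y assume "y \<in> A"
    then obtain z' where z': "P y z'" using P_total by blast
    show "c (x \<oplus>\<^bsub>X\<^esub> y) = c x \<oplus>\<^bsub>subquotient V Z W\<^esub> c y"
      using c[OF z] c[OF z'] c[OF P_add[OF z z']] zc[OF z] zc[OF z'] W
      by (simp add: V.subquotient_add)
  qed
  then show ?thesis using c that by blast
qed

text \<open>Differences of related pairs are again related, so \<open>eq\<close> turns congruence
  modulo \<open>B\<close> into congruence modulo \<open>W\<close> and back: one direction makes the
  map on cosets well defined, the other makes it injective. Surjectivity is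
  \<open>onto\<close>.\<close>

lemma subquotients_isomorphic:
  assumes onto: "\<And>z. z \<in> Z \<Longrightarrow> \<exists>x. P x z"
    and W: "submodule R W V" "W \<subseteq> Z" and B: "submodule R B X" "B \<subseteq> A"
    and eq: "\<And>x z. P x z \<Longrightarrow> x \<in> B \<longleftrightarrow> z \<in> W"
  shows "module_isomorphic R (subquotient X A B) (subquotient V Z W)"
proof -
  have zc: "P x z \<Longrightarrow> x \<in> carrier X \<and> z \<in> carrier V" for x z
    using P_dom A_sub Z_sub by (meson subsetD X.subset_submodule V.subset_submodule)
  have B0: "\<zero>\<^bsub>X\<^esub> \<in> B" using B by (simp add: submodule.zero_closed)
  obtain c where c: "c \<in> module_hom R (X\<lparr>carrier := A\<rparr>) (subquotient V Z W)"
    "\<And>x z. P x z \<Longrightarrow> c x = W +>\<^bsub>V\<^esub> z"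
    using ex_hom[OF W] eq B0 by metis
  \<comment> \<open>A coset is a bare set, so the map is described through its members;
    \<open>same\<close> shows that they all give one value.\<close>
  define h where "h C = (THE Y. \<exists>x z. x \<in> C \<and> P x z \<and> Y = W +>\<^bsub>V\<^esub> z)" for C
  have same: "B +>\<^bsub>X\<^esub> x = B +>\<^bsub>X\<^esub> x' \<longleftrightarrow> W +>\<^bsub>V\<^esub> z = W +>\<^bsub>V\<^esub> z'" if "P x z" "P x' z'" for x x' z z'
    using that eq[OF P_minus[OF that]] zc[OF that(1)] zc[OF that(2)] B W
    by (simp add: X.coset_eq_iff V.coset_eq_iff)
  have h: "h (B +>\<^bsub>X\<^esub> x) = W +>\<^bsub>V\<^esub> z" if p: "P x z" for x z
    unfolding h_def
  proof (rule the_equality)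
    show "\<exists>x' z'. x' \<in> B +>\<^bsub>X\<^esub> x \<and> P x' z' \<and> W +>\<^bsub>V\<^esub> z = W +>\<^bsub>V\<^esub> z'"
      using p zc[OF p] B X.coset_self by blast
  next
    fix Y assume "\<exists>x' z'. x' \<in> B +>\<^bsub>X\<^esub> x \<and> P x' z' \<and> Y = W +>\<^bsub>V\<^esub> z'"
    then obtain x' z' where x': "x' \<in> B +>\<^bsub>X\<^esub> x" "P x' z'" "Y = W +>\<^bsub>V\<^esub> z'" by blast
    then have "B +>\<^bsub>X\<^esub> x = B +>\<^bsub>X\<^esub> x'" using X.coset_of_mem B zc[OF p] by blast
    then show "Y = W +>\<^bsub>V\<^esub> z" using same[OF p x'(2)] x'(3) by simp
  qed
  have hh: "h \<in> module_hom R (subquotient X A B) (subquotient V Z W)"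
  proof (rule module_homI)
    fix C assume "C \<in> carrier (subquotient X A B)"
    then obtain x z where x: "C = B +>\<^bsub>X\<^esub> x" "P x z" using P_total unfolding subquotient_simps by blast
    then show "h C \<in> carrier (subquotient V Z W)" using P_dom[OF x(2)] h[OF x(2)] by (auto simp: subquotient_simps)
    show "h (a \<odot>\<^bsub>subquotient X A B\<^esub> C) = a \<odot>\<^bsub>subquotient V Z W\<^esub> h C" if "a \<in> carrier R" for a
      using x that zc[OF x(2)] B W h[OF x(2)] h[OF P_smult[OF that x(2)]]
      by (simp add: X.subquotient_smult V.subquotient_smult)
    fix C' assume "C' \<in> carrier (subquotient X A B)"
    then obtain x' z' where x': "C' = B +>\<^bsub>X\<^esub> x'" "P x' z'" using P_total unfolding subquotient_simps by blast
    show "h (C \<oplus>\<^bsub>subquotient X A B\<^esub> C') = h C \<oplus>\<^bsub>subquotient V Z W\<^esub> h C'"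
      using x x' zc[OF x(2)] zc[OF x'(2)] B W h[OF x(2)] h[OF x'(2)] h[OF P_add[OF x(2) x'(2)]]
      by (simp add: X.subquotient_add V.subquotient_add)
  qed
  have "bij_betw h (carrier (subquotient X A B)) (carrier (subquotient V Z W))"
    unfolding bij_betw_def
  proof
    show "inj_on h (carrier (subquotient X A B))"
    proof (rule inj_onI)
      fix C C' assume CC: "C \<in> carrier (subquotient X A B)" "C' \<in> carrier (subquotient X A B)" "h C = h C'"
      obtain x z where x: "C = B +>\<^bsub>X\<^esub> x" "P x z" using CC(1) P_total unfolding subquotient_simps by blast
      obtain x' z' where x': "C' = B +>\<^bsub>X\<^esub> x'" "P x' z'" using CC(2) P_total unfolding subquotient_simps by blast
      show "C = C'" using same[OF x(2) x'(2)] CC(3) h[OF x(2)] h[OF x'(2)] x(1) x'(1) by simp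
    qed
    show "h ` carrier (subquotient X A B) = carrier (subquotient V Z W)"
    proof (intro subset_antisym subsetI)
      fix Y assume "Y \<in> h ` carrier (subquotient X A B)"
      then show "Y \<in> carrier (subquotient V Z W)"
        using module_homD(1)[OF hh] by blast
    next
      fix Y assume "Y \<in> carrier (subquotient V Z W)"
      then obtain z where z: "z \<in> Z" "Y = W +>\<^bsub>V\<^esub> z" unfolding subquotient_simps by blast
      with onto obtain x where x: "P x z" by blast
      have "Y = h (B +>\<^bsub>X\<^esub> x)" "x \<in> A" using z h[OF x] P_dom[OF x] by simp_all
      then show "Y \<in> h ` carrier (subquotient X A B)"
        unfolding subquotient_simps by blast
    qed
  qed
  with hh show ?thesis unfolding module_isomorphic_def by blast
qed

end

section \<open>The spectral sequence of a filtered complex\<close>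

lemma (in plain_module) minus_eq_iff:
  assumes "x \<in> carrier M" "y \<in> carrier M" "d \<in> carrier M"
  shows "x \<ominus> y = d \<longleftrightarrow> x = y \<oplus> d"
  using assms minus_add_cancel[of x y] add_minus_cancel[of d y] M.a_comm[of d y] by auto

lemma (in plain_module) add_minus_self: "\<lbrakk>x \<in> carrier M; y \<in> carrier M\<rbrakk> \<Longrightarrow> x \<oplus> (y \<ominus> x) = y"
  using minus_add_cancel[of y x] M.a_comm[of x "y \<ominus> x"] by simp

lemma (in plain_module) kernel_submodule:
  fixes N :: "('k, 'b) module"
  assumes N: "module R N" and Z: "submodule R Z M" and f: "f \<in> module_hom R (M\<lparr>carrier := Z\<rparr>) N"
  shows "submodule R {x \<in> Z. f x = \<zero>\<^bsub>N\<^esub>} M"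
proof (rule submoduleI')
  interpret N: plain_module R N using N by (simp add: plain_module_def)
  have m: "module R (M\<lparr>carrier := Z\<rparr>)" using Z by (rule submodule_is_module)
  have z: "f \<zero> = \<zero>\<^bsub>N\<^esub>" using module_hom_zero[OF m N f] by simp
  show "{x \<in> Z. f x = \<zero>\<^bsub>N\<^esub>} \<subseteq> carrier M" using subset_submodule[OF Z] by blast
  show "\<zero> \<in> {x \<in> Z. f x = \<zero>\<^bsub>N\<^esub>}" using z submodule.zero_closed[OF Z] by simp
  show "\<And>v w. \<lbrakk>v \<in> {x \<in> Z. f x = \<zero>\<^bsub>N\<^esub>}; w \<in> {x \<in> Z. f x = \<zero>\<^bsub>N\<^esub>}\<rbrakk> \<Longrightarrow> v \<oplus> w \<in> {x \<in> Z. f x = \<zero>\<^bsub>N\<^esub>}"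
    using module_homD(2)[OF f] submodule.m_closed[OF Z] by simp
  show "\<And>c v. \<lbrakk>c \<in> carrier R; v \<in> {x \<in> Z. f x = \<zero>\<^bsub>N\<^esub>}\<rbrakk> \<Longrightarrow> c \<odot> v \<in> {x \<in> Z. f x = \<zero>\<^bsub>N\<^esub>}"
    using module_homD(3)[OF f] submodule.smult_closed[OF Z] by simp
qed

lemma module_hom_restrict:
  assumes "f \<in> module_hom R V W" "Z \<subseteq> carrier V"
  shows "f \<in> module_hom R (V\<lparr>carrier := Z\<rparr>) W"
  using assms(2) by (intro module_homI) (simp_all add: subset_iff module_homD[OF assms(1)])

text \<open>\<open>T\<close> carries no grading: \<open>F p n\<close> is step \<open>p\<close> of
  the filtration of the part of degree \<open>n\<close>, and \<open>F 0 n\<close> is that whole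
  part. Indices are integers so that \<open>p - r + 1\<close> makes sense; \<open>F_low\<close> and
  \<open>F_high\<close> say that the filtration of each degree is finite, running from
  \<open>0\<close> to \<open>n\<close>.\<close>

locale filtered_complex = plain_module R T for R :: "('k, 'r) ring_scheme" and T :: "('k, 'a) module" (structure) +
  fixes D :: "'a \<Rightarrow> 'a" and F :: "int \<Rightarrow> int \<Rightarrow> 'a set"
  assumes D_hom: "D \<in> module_hom R T T"
    and D_sq: "x \<in> carrier T \<Longrightarrow> D (D x) = \<zero>"
    and F_sub: "submodule R (F p n) T"
    and F_Suc: "F (p + 1) n \<subseteq> F p n"
    and F_D: "x \<in> F p n \<Longrightarrow> D x \<in> F p (n + 1)"
    and F_low: "p \<le> 0 \<Longrightarrow> F p n = F 0 n"
    and F_high: "n < p \<Longrightarrow> F p n = {\<zero>}"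
begin

lemma T_module: "module R T" by (rule module_axioms)

lemma F_carrier: "x \<in> F p n \<Longrightarrow> x \<in> carrier T"
  using subset_submodule[OF F_sub] by blast

lemma F_antimono: "p \<le> q \<Longrightarrow> F q n \<subseteq> F p n"
  by (induction q rule: int_ge_induct) (use F_Suc in blast)+

lemma F_antimonoD: "\<lbrakk>x \<in> F q n; p \<le> q\<rbrakk> \<Longrightarrow> x \<in> F p n"
  using F_antimono by blast

lemma F_SucD: "x \<in> F (p + 1) n \<Longrightarrow> x \<in> F p n"
  using F_Suc by blast

lemmas F_add = submodule.m_closed[OF F_sub]
  and F_zero = submodule.zero_closed[OF F_sub]
  and F_smult = submodule.smult_closed[OF F_sub]
  and F_uminus = submodule_uminus[OF F_sub]
  and F_minus = submodule_minus[OF F_sub]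

lemmas D_closed = module_homD(1)[OF D_hom]
  and D_add = module_homD(2)[OF D_hom]
  and D_smult = module_homD(3)[OF D_hom]
  and D_zero = module_hom_zero[OF T_module T_module D_hom]
  and D_uminus = module_hom_uminus[OF T_module T_module D_hom]
  and D_minus = module_hom_minus[OF T_module T_module D_hom]

text \<open>In the usual notation this is \<open>Z_r + F (p + 1) n\<close>, with \<open>Z_r\<close>
  the elements of \<open>F p n\<close> whose differential lies in \<open>F (p + r) (n + 1)\<close>.
  Similarly \<open>bnd r p n\<close> is \<open>F (p + 1) n\<close> plus the part of
  \<open>D (F (p - r + 1) (n - 1))\<close> inside \<open>F p n\<close>. Adding
  \<open>F (p + 1) n\<close> to numerator and denominator leaves the quotient unchanged up to
  isomorphism.\<close>

definition cyc :: "int \<Rightarrow> int \<Rightarrow> int \<Rightarrow> 'a set"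
  where "cyc r p n = {x \<in> F p n. \<exists>f \<in> F (p + 1) n. D (x \<oplus> f) \<in> F (p + r) (n + 1)}"

definition bnd :: "int \<Rightarrow> int \<Rightarrow> int \<Rightarrow> 'a set"
  where "bnd r p n = {x \<in> F p n. \<exists>w \<in> F (p - r + 1) (n - 1). x \<oplus> D w \<in> F (p + 1) n}"

text \<open>Since both \<open>cyc r p n\<close> and \<open>bnd r p n\<close> contain \<open>F (p + 1) n\<close>, the pages are subquotients of \<open>T\<close>
  for nested chains of submodules, decreasing for \<open>cyc\<close> and increasing for \<open>bnd\<close>.\<close>

definition pg :: "int \<Rightarrow> int \<Rightarrow> int \<Rightarrow> ('k, 'a set) module"
  where "pg r p n = subquotient T (cyc r p n) (bnd r p n)"

lemma cycI: "\<lbrakk>x \<in> F p n; f \<in> F (p + 1) n; D (x \<oplus> f) \<in> F (p + r) (n + 1)\<rbrakk> \<Longrightarrow> x \<in> cyc r p n"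
  by (auto simp: cyc_def)

lemma cycE:
  assumes "x \<in> cyc r p n"
  obtains f where "x \<in> F p n" "f \<in> F (p + 1) n" "D (x \<oplus> f) \<in> F (p + r) (n + 1)"
  using assms by (auto simp: cyc_def)

lemma bndI: "\<lbrakk>x \<in> F p n; w \<in> F (p - r + 1) (n - 1); x \<oplus> D w \<in> F (p + 1) n\<rbrakk> \<Longrightarrow> x \<in> bnd r p n"
  by (auto simp: bnd_def)

lemma bndE:
  assumes "x \<in> bnd r p n"
  obtains w where "x \<in> F p n" "w \<in> F (p - r + 1) (n - 1)" "x \<oplus> D w \<in> F (p + 1) n"
  using assms by (auto simp: bnd_def)

lemma add4: "\<lbrakk>x \<in> carrier T; y \<in> carrier T; u \<in> carrier T; v \<in> carrier T\<rbrakk> \<Longrightarrow>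
    (x \<oplus> y) \<oplus> (u \<oplus> v) = (x \<oplus> u) \<oplus> (y \<oplus> v)"
  by (simp add: M.a_ac)

lemma cyc_sub: "submodule R (cyc r p n) T"
proof (rule submoduleI')
  show "cyc r p n \<subseteq> carrier T" by (auto simp: cyc_def F_carrier)
  show "\<zero> \<in> cyc r p n" by (rule cycI[of _ _ _ \<zero>]) (simp_all add: F_zero D_zero)
next
  fix v w assume "v \<in> cyc r p n" "w \<in> cyc r p n"
  then obtain f g where h: "v \<in> F p n" "w \<in> F p n" "f \<in> F (p+1) n" "g \<in> F (p+1) n"
    "D (v \<oplus> f) \<in> F (p+r) (n+1)" "D (w \<oplus> g) \<in> F (p+r) (n+1)" by (auto simp: cyc_def)
  have "D ((v \<oplus> w) \<oplus> (f \<oplus> g)) = D (v \<oplus> f) \<oplus> D (w \<oplus> g)"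
    using h by (simp add: add4 F_carrier D_add)
  then show "v \<oplus> w \<in> cyc r p n" using h by (intro cycI[of _ _ _ "f \<oplus> g"]) (simp_all add: F_add)
next
  fix c v assume "c \<in> carrier R" "v \<in> cyc r p n"
  then obtain f where h: "c \<in> carrier R" "v \<in> F p n" "f \<in> F (p+1) n" "D (v \<oplus> f) \<in> F (p+r) (n+1)"
    by (auto simp: cyc_def)
  have "D (c \<odot> v \<oplus> c \<odot> f) = c \<odot> D (v \<oplus> f)"
    using h by (simp add: smult_r_distr[symmetric] D_smult F_carrier)
  then show "c \<odot> v \<in> cyc r p n"
    using h by (intro cycI[of _ _ _ "c \<odot> f"]) (simp_all add: F_smult)
qed

lemma bnd_sub: "submodule R (bnd r p n) T"
proof (rule submoduleI')
  show "bnd r p n \<subseteq> carrier T" by (auto simp: bnd_def F_carrier)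
  show "\<zero> \<in> bnd r p n" by (rule bndI[of _ _ _ \<zero>]) (simp_all add: F_zero D_zero)
next
  fix v w assume "v \<in> bnd r p n" "w \<in> bnd r p n"
  then obtain f g where h: "v \<in> F p n" "w \<in> F p n" "f \<in> F (p-r+1) (n-1)" "g \<in> F (p-r+1) (n-1)"
    "v \<oplus> D f \<in> F (p+1) n" "w \<oplus> D g \<in> F (p+1) n" by (auto simp: bnd_def)
  have "(v \<oplus> w) \<oplus> D (f \<oplus> g) = (v \<oplus> D f) \<oplus> (w \<oplus> D g)"
    using h by (simp add: add4 F_carrier D_add D_closed)
  then show "v \<oplus> w \<in> bnd r p n" using h by (intro bndI[of _ _ _ "f \<oplus> g"]) (simp_all add: F_add)
next
  fix c v assume "c \<in> carrier R" "v \<in> bnd r p n"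
  then obtain f where h: "c \<in> carrier R" "v \<in> F p n" "f \<in> F (p-r+1) (n-1)" "v \<oplus> D f \<in> F (p+1) n"
    by (auto simp: bnd_def)
  have "c \<odot> v \<oplus> D (c \<odot> f) = c \<odot> (v \<oplus> D f)"
    using h by (simp add: smult_r_distr D_smult F_carrier D_closed)
  then show "c \<odot> v \<in> bnd r p n"
    using h by (intro bndI[of _ _ _ "c \<odot> f"]) (simp_all add: F_smult)
qed

lemma F_bnd: "x \<in> F (p + 1) n \<Longrightarrow> x \<in> bnd r p n"
  using F_Suc by (intro bndI[of _ _ _ \<zero>]) (auto simp: D_zero F_carrier F_zero)

text \<open>Modulo \<open>F (p + 1) n\<close> an element of \<open>bnd\<close> equals
  \<open>- D w\<close>, which \<open>D\<close> annihilates. The correction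
  \<open>- (x + D w)\<close> therefore works for every \<open>s\<close>.\<close>

lemma bnd_cyc: "bnd r p n \<subseteq> cyc s p n"
proof
  fix x assume "x \<in> bnd r p n"
  then obtain w where w: "x \<in> F p n" "w \<in> F (p-r+1) (n-1)" "x \<oplus> D w \<in> F (p+1) n" by (auto simp: bnd_def)
  have c: "x \<in> carrier T" "w \<in> carrier T" "D w \<in> carrier T" using w by (auto simp: F_carrier D_closed)
  have "x \<oplus> (\<ominus> (x \<oplus> D w)) = \<ominus> D w" using c by (simp add: M.minus_add M.r_neg2)
  then have "D (x \<oplus> (\<ominus> (x \<oplus> D w))) = \<zero>" using c by (simp add: D_uminus D_sq)
  then show "x \<in> cyc s p n" using w(1) F_uminus[OF w(3)] by (intro cycI) (auto simp: F_zero)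
qed

lemma pg_module: "module R (pg r p n)"
  unfolding pg_def by (rule subquotient_module[OF cyc_sub bnd_sub bnd_cyc])

lemma pg_zero: "\<zero>\<^bsub>pg r p n\<^esub> = bnd r p n"
  by (simp add: pg_def subquotient_simps)

lemmas cosets = coset_eq_iff[OF bnd_sub] coset_eq_self_iff[OF bnd_sub]

text \<open>The correction term of \<open>cyc\<close> lies in \<open>F (p + 1) n\<close>, hence in
  \<open>bnd\<close>, and can be absorbed into the representative. Every class thus has a
  representative to which \<open>D\<close> can be applied directly.\<close>

lemma pg_rep:
  assumes "C \<in> carrier (pg r p n)"
  obtains x where "x \<in> F p n" "D x \<in> F (p + r) (n + 1)" "C = bnd r p n +> x"
proof -
  obtain y where y: "y \<in> cyc r p n" "C = bnd r p n +> y"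
    using assms unfolding pg_def subquotient_simps by blast
  then obtain f where f: "y \<in> F p n" "f \<in> F (p+1) n" "D (y \<oplus> f) \<in> F (p+r) (n+1)" by (auto simp: cyc_def)
  have c: "y \<in> carrier T" "f \<in> carrier T" using f by (auto simp: F_carrier)
  have "(y \<oplus> f) \<ominus> y = f" using c by (simp add: minus_eq_iff)
  then have "bnd r p n +> (y \<oplus> f) = C" using c F_bnd[OF f(2)] y(2) by (simp add: cosets)
  moreover have "y \<oplus> f \<in> F p n" using f F_Suc F_add by blast
  ultimately show ?thesis using f(3) that by blast
qed

lemma pg_coset:
  assumes "x \<in> F p n" "D x \<in> F (p + r) (n + 1)"
  shows "x \<in> cyc r p n" "bnd r p n +> x \<in> carrier (pg r p n)"
proof -
  show "x \<in> cyc r p n" using assms by (intro cycI[of _ _ _ \<zero>]) (simp_all add: F_carrier F_zero)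
  then show "bnd r p n +> x \<in> carrier (pg r p n)" by (auto simp: pg_def subquotient_simps)
qed

text \<open>\<open>D\<close> induces the map, and independence of the representative comes down to
  \<open>x\<close> in \<open>bnd\<close>. If \<open>x + D w\<close> lies in
  \<open>F (p + 1) n\<close>, then \<open>D x = D (x + D w)\<close> is a boundary at position
  \<open>p + r\<close> on the same page, because \<open>p + 1 = (p + r) - r + 1\<close>.\<close>

lemma ex_pg_diff:
  "\<exists>c. c \<in> module_hom R (pg r p n) (pg r (p + r) (n + 1)) \<and>
    (\<forall>x \<in> F p n. D x \<in> F (p + r) (n + 1) \<longrightarrow> c (bnd r p n +> x) = bnd r (p + r) (n + 1) +> D x)"
proof -
  define P where "P C z \<longleftrightarrow> (\<exists>x \<in> F p n. D x = z \<and> z \<in> F (p + r) (n + 1) \<and> C = bnd r p n +> x)" for C z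
  have m: "plain_module R (pg r p n)" using pg_module by (simp add: plain_module_def)
  interpret E: plain_module R "pg r p n" by (rule m)
  interpret linear_relation R "pg r p n" T P "carrier (pg r p n)" "cyc r (p + r) (n + 1)"
  proof (intro linear_relation.intro linear_relation_axioms.intro)
    show "plain_module R (pg r p n)" by (rule m)
    show "plain_module R T" by (rule plain_module_axioms)
    show "submodule R (carrier (pg r p n)) (pg r p n)" by (rule E.submodule_carrier)
    show "submodule R (cyc r (p + r) (n + 1)) T" by (rule cyc_sub)
    show "C \<in> carrier (pg r p n) \<and> z \<in> cyc r (p + r) (n + 1)" if "P C z" for C z
      using that pg_coset F_zero unfolding P_def by (auto intro!: pg_coset(1) simp: D_sq F_carrier)
    show "\<exists>z. P C z" if "C \<in> carrier (pg r p n)" for C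
      using pg_rep[OF that] unfolding P_def by metis
  next
    fix C z C' z' assume "P C z" "P C' z'"
    then obtain x x' where x: "x \<in> F p n" "D x = z" "z \<in> F (p + r) (n + 1)" "C = bnd r p n +> x"
      "x' \<in> F p n" "D x' = z'" "z' \<in> F (p + r) (n + 1)" "C' = bnd r p n +> x'" by (auto simp: P_def)
    have "C \<oplus>\<^bsub>pg r p n\<^esub> C' = bnd r p n +> (x \<oplus> x')"
      using x F_carrier unfolding pg_def by (simp add: subquotient_add[OF bnd_sub])
    moreover have "D (x \<oplus> x') = z \<oplus> z'" using x by (simp add: D_add F_carrier)
    ultimately show "P (C \<oplus>\<^bsub>pg r p n\<^esub> C') (z \<oplus> z')"
      using x F_add unfolding P_def by metis
  next
    fix a C z assume a: "a \<in> carrier R" and "P C z"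
    then obtain x where x: "x \<in> F p n" "D x = z" "z \<in> F (p + r) (n + 1)" "C = bnd r p n +> x"
      by (auto simp: P_def)
    have "a \<odot>\<^bsub>pg r p n\<^esub> C = bnd r p n +> (a \<odot> x)"
      using a x F_carrier unfolding pg_def by (simp add: subquotient_smult[OF bnd_sub])
    moreover have "D (a \<odot> x) = a \<odot> z" using a x by (simp add: D_smult F_carrier)
    ultimately show "P (a \<odot>\<^bsub>pg r p n\<^esub> C) (a \<odot> z)"
      using a x F_smult unfolding P_def by metis
  qed
  have zero: "z \<in> bnd r (p + r) (n + 1)" if Pz: "P \<zero>\<^bsub>pg r p n\<^esub> z" for z
  proof -
    obtain x where x: "x \<in> F p n" "D x = z" "z \<in> F (p + r) (n + 1)" "\<zero>\<^bsub>pg r p n\<^esub> = bnd r p n +> x"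
      using Pz unfolding P_def by blast
    then have "bnd r p n +> x = bnd r p n" by (simp add: pg_zero)
    then have "x \<in> bnd r p n" using F_carrier[OF x(1)] by (simp add: cosets)
    then obtain w where w: "w \<in> F (p - r + 1) (n - 1)" "x \<oplus> D w \<in> F (p + 1) n" by (auto simp: bnd_def)
    have c: "x \<in> carrier T" "w \<in> carrier T" "D w \<in> carrier T" "D x \<in> carrier T"
      using x w by (auto simp: F_carrier D_closed)
    have "z \<oplus> D (\<ominus> (x \<oplus> D w)) = \<zero>"
      using c x(2) by (simp add: D_uminus D_add D_sq M.r_neg)
    then show ?thesis using F_uminus[OF w(2)] x(3)
      by (intro bndI[of _ _ _ "\<ominus> (x \<oplus> D w)"]) (simp_all add: F_zero)
  qed
  obtain c where c: "c \<in> module_hom R (pg r p n\<lparr>carrier := carrier (pg r p n)\<rparr>) (subquotient T (cyc r (p + r) (n + 1)) (bnd r (p + r) (n + 1)))"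
    "\<And>x z. P x z \<Longrightarrow> c x = bnd r (p + r) (n + 1) +> z"
    using ex_hom[OF bnd_sub bnd_cyc zero] by blast
  have "c \<in> module_hom R (pg r p n) (pg r (p + r) (n + 1))" using c(1) by (simp add: pg_def)
  moreover have "c (bnd r p n +> x) = bnd r (p + r) (n + 1) +> D x"
    if "x \<in> F p n" "D x \<in> F (p + r) (n + 1)" for x
    using that by (intro c(2)) (auto simp: P_def)
  ultimately show ?thesis by blast
qed

definition pg_diff :: "int \<Rightarrow> int \<Rightarrow> int \<Rightarrow> 'a set \<Rightarrow> 'a set"
  where "pg_diff r p n = (SOME c. c \<in> module_hom R (pg r p n) (pg r (p + r) (n + 1)) \<and>
    (\<forall>x \<in> F p n. D x \<in> F (p + r) (n + 1) \<longrightarrow> c (bnd r p n +> x) = bnd r (p + r) (n + 1) +> D x))"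

lemma pg_diff_hom: "pg_diff r p n \<in> module_hom R (pg r p n) (pg r (p + r) (n + 1))"
  and pg_diff_coset: "\<lbrakk>x \<in> F p n; D x \<in> F (p + r) (n + 1)\<rbrakk> \<Longrightarrow>
    pg_diff r p n (bnd r p n +> x) = bnd r (p + r) (n + 1) +> D x"
  using someI_ex[OF ex_pg_diff, of r p n] unfolding pg_diff_def by blast+

lemma pg_diff_sq:
  assumes "C \<in> carrier (pg r p n)"
  shows "pg_diff r (p + r) (n + 1) (pg_diff r p n C) = \<zero>\<^bsub>pg r (p + r + r) (n + 1 + 1)\<^esub>"
proof -
  obtain x where x: "x \<in> F p n" "D x \<in> F (p + r) (n + 1)" "C = bnd r p n +> x" using pg_rep[OF assms] .
  have "D (D x) = \<zero>" using x F_carrier D_sq by blast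
  then show ?thesis using x F_zero
    by (simp add: pg_diff_coset pg_zero coset_zero[OF bnd_sub])
qed

text \<open>An element of \<open>cyc (r + 1)\<close> is sent to its class on page \<open>r\<close>.
  Every class in the kernel of \<open>pg_diff\<close> is reached because the \<open>w\<close>
  witnessing that \<open>D y\<close> lies in \<open>bnd\<close> is itself the correction that puts
  \<open>y\<close> into \<open>cyc (r + 1)\<close>. The image of \<open>pg_diff\<close> pulls back
  to \<open>bnd (r + 1)\<close>, where \<open>w\<close> may lie one step lower in the filtration
  than for \<open>bnd r\<close>.\<close>

lemma pg_next:
  "module_isomorphic R (pg (r + 1) p n)
     (subquotient (pg r p n) {C \<in> carrier (pg r p n). pg_diff r p n C = \<zero>\<^bsub>pg r (p + r) (n + 1)\<^esub>}
        (pg_diff r (p - r) (n - 1) ` carrier (pg r (p - r) (n - 1))))"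
proof -
  let ?Z = "{C \<in> carrier (pg r p n). pg_diff r p n C = \<zero>\<^bsub>pg r (p + r) (n + 1)\<^esub>}"
  let ?W = "pg_diff r (p - r) (n - 1) ` carrier (pg r (p - r) (n - 1))"
  define P where "P x C \<longleftrightarrow> x \<in> cyc (r + 1) p n \<and> C = bnd r p n +> x" for x C
  have m: "plain_module R (pg r p n)" for r p n using pg_module by (simp add: plain_module_def)
  interpret E: plain_module R "pg r p n" by (rule m)
  interpret E': plain_module R "pg r (p - r) (n - 1)" by (rule m)
  have h: "pg_diff r (p - r) (n - 1) \<in> module_hom R (pg r (p - r) (n - 1)) (pg r p n)"
    using pg_diff_hom[of r "p - r" "n - 1"] by simp
  have Z: "submodule R ?Z (pg r p n)"
    using E.kernel_submodule[OF pg_module E.submodule_carrier, of "pg_diff r p n"] pg_diff_hom by simp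
  have W: "submodule R ?W (pg r p n)"
    using E.submodule_image[OF pg_module _ E'.submodule_carrier, of "pg_diff r (p - r) (n - 1)"] h by simp
  have WZ: "?W \<subseteq> ?Z"
  proof
    fix C assume "C \<in> ?W"
    then obtain C' where C': "C' \<in> carrier (pg r (p - r) (n - 1))" "C = pg_diff r (p - r) (n - 1) C'" by blast
    show "C \<in> ?Z" using C' module_homD(1)[OF h C'(1)] pg_diff_sq[OF C'(1)] by simp
  qed
  have cls: "bnd r p n +> x = bnd r p n +> (x \<oplus> f)" if "x \<in> F p n" "f \<in> F (p + 1) n" for x f
  proof -
    have c: "x \<in> carrier T" "f \<in> carrier T" using that F_carrier by auto
    have "x \<ominus> (x \<oplus> f) = \<ominus> f" using c by (simp add: a_minus_def M.minus_add M.r_neg2)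
    then show ?thesis using c F_bnd[OF F_uminus[OF that(2)]] by (simp add: cosets)
  qed
  interpret linear_relation R T "pg r p n" P "cyc (r + 1) p n" ?Z
  proof (intro linear_relation.intro linear_relation_axioms.intro)
    show "plain_module R (pg r p n)" by (rule m)
    show "plain_module R T" by (rule plain_module_axioms)
    show "submodule R ?Z (pg r p n)" by (rule Z)
    show "submodule R (cyc (r + 1) p n) T" by (rule cyc_sub)
    show "\<exists>C. P x C" if "x \<in> cyc (r + 1) p n" for x using that by (auto simp: P_def)
    have "C \<in> ?Z" if "P x C" for x C
    proof -
      obtain f where f: "x \<in> F p n" "f \<in> F (p + 1) n" "D (x \<oplus> f) \<in> F (p + (r + 1)) (n + 1)"
        using \<open>P x C\<close> by (auto simp: P_def cyc_def)
      have xf: "x \<oplus> f \<in> F p n" using f F_Suc F_add by blast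
      have Dxf: "D (x \<oplus> f) \<in> F (p + r) (n + 1)" using f(3) by (rule F_antimonoD) simp
      have C: "C = bnd r p n +> (x \<oplus> f)" using \<open>P x C\<close> cls f by (simp add: P_def)
      have "D (x \<oplus> f) \<in> bnd r (p + r) (n + 1)" using f(3) by (intro F_bnd) (simp add: algebra_simps)
      then have "pg_diff r p n C = bnd r (p + r) (n + 1)"
        using C pg_diff_coset[OF xf Dxf] cosets(2) F_carrier[OF Dxf] by simp
      then show ?thesis using pg_coset(2)[OF xf Dxf] C by (simp add: pg_zero)
    qed
    then show "x \<in> cyc (r + 1) p n \<and> C \<in> ?Z" if "P x C" for x C using that by (simp add: P_def)
  next
    fix x C x' C' assume "P x C" "P x' C'"
    then show "P (x \<oplus> x') (C \<oplus>\<^bsub>pg r p n\<^esub> C')"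
      using subset_submodule[OF cyc_sub, of "r + 1" p n] submodule.m_closed[OF cyc_sub]
      unfolding P_def pg_def by (auto simp: subquotient_add[OF bnd_sub] subset_iff)
  next
    fix a x C assume "a \<in> carrier R" "P x C"
    then show "P (a \<odot> x) (a \<odot>\<^bsub>pg r p n\<^esub> C)"
      using subset_submodule[OF cyc_sub, of "r + 1" p n] submodule.smult_closed[OF cyc_sub]
      unfolding P_def pg_def by (auto simp: subquotient_smult[OF bnd_sub] subset_iff)
  qed
  show ?thesis unfolding pg_def[of "r + 1"]
  proof (rule subquotients_isomorphic[OF _ W WZ bnd_sub bnd_cyc])
    fix C assume C: "C \<in> ?Z"
    then obtain y where y: "y \<in> F p n" "D y \<in> F (p + r) (n + 1)" "C = bnd r p n +> y" using pg_rep by blast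
    have "D y \<in> bnd r (p + r) (n + 1)"
      using C y pg_diff_coset[OF y(1,2)] cosets(2) F_carrier[OF y(2)] by (simp add: pg_zero)
    then obtain w where w: "w \<in> F (p + 1) n" "D y \<oplus> D w \<in> F (p + r + 1) (n + 1)" by (auto simp: bnd_def)
    then have "y \<in> cyc (r + 1) p n" using y
      by (intro cycI[of _ _ _ w]) (simp_all add: D_add F_carrier add.assoc)
    then show "\<exists>x. P x C" using y(3) by (auto simp: P_def)
  next
    fix x C assume "P x C"
    then have x: "x \<in> cyc (r + 1) p n" "x \<in> F p n" "C = bnd r p n +> x" by (auto simp: P_def cyc_def)
    have xc: "x \<in> carrier T" using x F_carrier by blast
    show "x \<in> bnd (r + 1) p n \<longleftrightarrow> C \<in> ?W"
    proof
      assume "x \<in> bnd (r + 1) p n"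
      then obtain w where w: "w \<in> F (p - r) (n - 1)" "x \<oplus> D w \<in> F (p + 1) n" by (auto simp: bnd_def)
      have c: "w \<in> carrier T" "D w \<in> carrier T" using w F_carrier D_closed by auto
      have "(x \<oplus> D w) \<ominus> x = D w" using xc c by (simp add: minus_eq_iff)
      then have "D w \<in> F p n" using F_minus[OF _ x(2), of "x \<oplus> D w"] w(2) F_Suc by auto
      then have u: "\<ominus> w \<in> F (p - r) (n - 1)" "D (\<ominus> w) \<in> F (p - r + r) (n - 1 + 1)"
        using w c by (simp_all add: F_uminus D_uminus)
      have "x \<ominus> D (\<ominus> w) = x \<oplus> D w" using xc c by (simp add: D_uminus a_minus_def)
      then have "x \<ominus> D (\<ominus> w) \<in> bnd r p n" using F_bnd[OF w(2)] by simp
      then have "C = bnd r p n +> D (\<ominus> w)" using x(3) xc c by (simp add: cosets D_uminus)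
      then have "C = pg_diff r (p - r) (n - 1) (bnd r (p - r) (n - 1) +> (\<ominus> w))"
        using pg_diff_coset[OF u] by simp
      then show "C \<in> ?W" using pg_coset(2)[OF u] by blast
    next
      assume "C \<in> ?W"
      then obtain U where U: "U \<in> carrier (pg r (p - r) (n - 1))" "C = pg_diff r (p - r) (n - 1) U" by blast
      obtain u where u: "u \<in> F (p - r) (n - 1)" "D u \<in> F (p - r + r) (n - 1 + 1)"
        "U = bnd r (p - r) (n - 1) +> u" using pg_rep[OF U(1)] .
      have c: "u \<in> carrier T" "D u \<in> carrier T" using u F_carrier D_closed by auto
      have "C = bnd r p n +> D u" using U u pg_diff_coset[OF u(1,2)] by simp
      then have "x \<ominus> D u \<in> bnd r p n" using x(3) xc c by (simp add: cosets)
      then obtain w where w: "w \<in> F (p - r + 1) (n - 1)" "(x \<ominus> D u) \<oplus> D w \<in> F (p + 1) n" by (auto simp: bnd_def)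
      have wc: "w \<in> carrier T" "D w \<in> carrier T" using w F_carrier D_closed by auto
      \<comment> \<open>\<open>u\<close> lies in the larger step \<open>F (p - r)\<close>, which
        absorbs \<open>w\<close>; this is the step allowed for \<open>bnd (r + 1)\<close>.\<close>
      have "x \<oplus> D (w \<ominus> u) = (x \<ominus> D u) \<oplus> D w"
        using xc c wc by (simp add: D_minus) (simp add: a_minus_def M.a_ac)
      moreover have "w \<ominus> u \<in> F (p - r) (n - 1)" using w u F_Suc[of "p - r"] F_minus by blast
      ultimately show "x \<in> bnd (r + 1) p n" using w(2) x(2)
        by (intro bndI[of _ _ _ "w \<ominus> u"]) simp_all
    qed
  qed
qed

text \<open>For \<open>p < 0\<close> the filtration does not move between \<open>p\<close> and
  \<open>p + 1\<close>, and for \<open>n < p\<close> it is zero; either way \<open>F p n\<close>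
  lies in \<open>bnd\<close>.\<close>

lemma pg_first_quadrant:
  assumes "p < 0 \<or> n < p"
  shows "carrier (pg r p n) = {\<zero>\<^bsub>pg r p n\<^esub>}"
proof -
  have "F p n \<subseteq> bnd r p n"
  proof (cases "p < 0")
    case True
    then have "F p n = F (p + 1) n" using F_low[of p n] F_low[of "p + 1" n] by simp
    then show ?thesis using F_bnd by blast
  next
    case False
    then show ?thesis using assms F_high submodule.zero_closed[OF bnd_sub] by auto
  qed
  then have "cyc r p n \<subseteq> bnd r p n" by (auto simp: cyc_def)
  moreover have "carrier (pg r p n) = (\<lambda>x. bnd r p n +> x) ` cyc r p n" by (simp add: pg_def subquotient_simps)
  moreover have "(\<lambda>x. bnd r p n +> x) ` cyc r p n = (\<lambda>x. bnd r p n) ` cyc r p n"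
  proof (rule image_cong[OF refl])
    fix x assume "x \<in> cyc r p n"
    then have "x \<in> bnd r p n" "x \<in> carrier T" using calculation(1) subset_submodule[OF bnd_sub] by blast+
    then show "bnd r p n +> x = bnd r p n" by (simp add: cosets)
  qed
  moreover have "(\<lambda>x. bnd r p n) ` cyc r p n = {bnd r p n}"
    using submodule.zero_closed[OF cyc_sub] by blast
  ultimately show ?thesis by (simp add: pg_zero)
qed

section \<open>The spectral sequence and its limit\<close>

definition page :: "nat \<Rightarrow> int \<Rightarrow> int \<Rightarrow> ('k, 'a set) module"
  where "page r p q = pg (int r) p (p + q)"

definition page_diff :: "nat \<Rightarrow> int \<Rightarrow> int \<Rightarrow> 'a set \<Rightarrow> 'a set"
  where "page_diff r p q = pg_diff (int r) p (p + q)"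

lemma page_spectral_sequence:
  assumes "field R"
  shows "first_quadrant_spectral_sequence R page page_diff"
proof (rule first_quadrant_spectral_sequence.intro)
  fix r p q
  show "vectorspace R (page r p q)"
    using pg_module assms by (simp add: page_def vectorspace_def)
  show "carrier (page r p q) = {\<zero>\<^bsub>page r p q\<^esub>}" if "p < 0 \<or> q < 0"
    using that pg_first_quadrant by (simp add: page_def)
  show "page_diff r p q \<in> module_hom R (page r p q) (page r (p + int r) (q - int r + 1))"
    using pg_diff_hom[of "int r" p "p + q"] by (simp add: page_def page_diff_def algebra_simps)
  show "page_diff r (p + int r) (q - int r + 1) (page_diff r p q x) = \<zero>\<^bsub>page r (p + 2 * int r) (q - 2 * int r + 2)\<^esub>"
    if "x \<in> carrier (page r p q)" for x
    using pg_diff_sq[of x "int r" p "p + q"] that by (simp add: page_def page_diff_def algebra_simps)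
  show "module_isomorphic R (page (Suc r) p q)
      (subquotient (page r p q) {x \<in> carrier (page r p q). page_diff r p q x = \<zero>\<^bsub>page r (p + int r) (q - int r + 1)\<^esub>}
        (page_diff r (p - int r) (q + int r - 1) ` carrier (page r (p - int r) (q + int r - 1))))"
    using pg_next[of "int r" p "p + q"] by (simp add: page_def page_diff_def algebra_simps)
qed

text \<open>The cohomology of \<open>T\<close> enters through surjections \<open>c n\<close> from
  the cocycles with the coboundaries as kernel, so the limit may be any model of it. Its filtration
  consists of the classes of cocycles in \<open>F p\<close>, and an element of \<open>cyc\<close> is
  related to the classes of those corrections of it that are cocycles.\<close>

lemma page_converges:
  fixes H :: "nat \<Rightarrow> ('k, 'h) module"
  assumes "field R" and H: "\<And>n. module R (H n)"
    and c_hom: "\<And>n. c n \<in> module_hom R (T\<lparr>carrier := {x \<in> F 0 (int n). D x = \<zero>}\<rparr>) (H n)"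
    and c_surj: "\<And>n. c n ` {x \<in> F 0 (int n). D x = \<zero>} = carrier (H n)"
    and c_ker: "\<And>n x. \<lbrakk>x \<in> F 0 (int n); D x = \<zero>\<rbrakk> \<Longrightarrow> c n x = \<zero>\<^bsub>H n\<^esub> \<longleftrightarrow> x \<in> D ` F 0 (int n - 1)"
  shows "converges_to R page H"
  unfolding converges_to_def
proof
  fix n :: nat
  interpret H: plain_module R "H n" using H by (simp add: plain_module_def)
  let ?n = "int n"
  define K where "K p = {x \<in> F p ?n. D x = \<zero>}" for p
  define Fil where "Fil p = c n ` K (int p)" for p
  have Ksub: "submodule R (K p) T" for p
    unfolding K_def
    by (rule kernel_submodule[OF T_module F_sub module_hom_restrict[OF D_hom subset_submodule[OF F_sub]]])
  have KT: "K p \<subseteq> carrier T" for p using F_carrier by (auto simp: K_def)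
  have K0: "K p \<subseteq> K 0" for p
  proof (cases "p \<ge> 0")
    case True then show ?thesis using F_antimono[of 0 p ?n] by (auto simp: K_def)
  next
    case False then show ?thesis using F_low[of p ?n] by (auto simp: K_def)
  qed
  have hom: "c n \<in> module_hom R (T\<lparr>carrier := K 0\<rparr>) (H n)" using c_hom by (simp add: K_def)
  have hom': "c n \<in> module_hom R (T\<lparr>carrier := K p\<rparr>) (H n)" for p
    using module_hom_restrict[OF hom, of "K p"] K0[of p] by simp
  note cadd = module_homD(2)[OF hom, simplified] and csm = module_homD(3)[OF hom, simplified]
  have mK: "module R (T\<lparr>carrier := K 0\<rparr>)" using Ksub by (rule submodule_is_module)
  have Fsub: "submodule R (Fil p) (H n)" for p
    unfolding Fil_def by (rule H.submodule_image[OF T_module hom' Ksub])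
  have c0: "c n x = \<zero>\<^bsub>H n\<^esub> \<longleftrightarrow> x \<in> D ` F 0 (?n - 1)" if "x \<in> K 0" for x using that c_ker by (simp add: K_def)
  have cD: "c n x = c n y \<longleftrightarrow> (\<exists>w \<in> F 0 (?n - 1). x = y \<oplus> D w)" if "x \<in> K 0" "y \<in> K 0" for x y
  proof -
    have k: "x \<ominus> y \<in> K 0" using submodule_minus[OF Ksub] that by blast
    have xy: "x \<in> carrier T" "y \<in> carrier T" using that KT by auto
    have "c n x = c n ((x \<ominus> y) \<oplus> y)" using xy by (simp add: minus_add_cancel)
    also have "\<dots> = c n (x \<ominus> y) \<oplus>\<^bsub>H n\<^esub> c n y" using cadd k that by blast
    finally have "c n x = c n y \<longleftrightarrow> c n (x \<ominus> y) = \<zero>\<^bsub>H n\<^esub>"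
      using module_homD(1)[OF hom, simplified] that k by simp
    also have "\<dots> \<longleftrightarrow> (\<exists>w \<in> F 0 (?n - 1). x \<ominus> y = D w)" using c0[OF k] by auto
    also have "\<dots> \<longleftrightarrow> (\<exists>w \<in> F 0 (?n - 1). x = y \<oplus> D w)"
    proof (rule bex_cong[OF refl])
      fix w assume "w \<in> F 0 (?n - 1)"
      then have dw: "D w \<in> carrier T" using F_carrier D_closed by blast
      show "(x \<ominus> y = D w) = (x = y \<oplus> D w)" by (rule minus_eq_iff[OF xy dw])
    qed
    finally show ?thesis .
  qed
  show "\<exists>F. F 0 = carrier (H n) \<and> F (Suc n) = {\<zero>\<^bsub>H n\<^esub>} \<and> (\<forall>p \<le> Suc n. subspace R (F p) (H n)) \<and>
      (\<forall>p \<le> n. F (Suc p) \<subseteq> F p \<and> (\<forall>r > max p (n - p + 1). module_isomorphic R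
        (subquotient (H n) (F p) (F (Suc p))) (page r (int p) (int (n - p)))))"
  proof (intro exI[of _ Fil] conjI allI impI)
    show "Fil 0 = carrier (H n)" using c_surj by (simp add: Fil_def K_def)
    have "K (int (Suc n)) = {\<zero>}" using F_high[of ?n "int (Suc n)"] D_zero by (auto simp: K_def)
    moreover have "c n \<zero> = \<zero>\<^bsub>H n\<^esub>" using module_hom_zero[OF mK H hom] by simp
    ultimately show "Fil (Suc n) = {\<zero>\<^bsub>H n\<^esub>}" by (simp add: Fil_def)
    show "subspace R (Fil p) (H n)" for p
      using Fsub H assms(1) by (simp add: subspace_def vectorspace_def)
    fix p assume p: "p \<le> n"
    show sub: "Fil (Suc p) \<subseteq> Fil p" using F_Suc[of "int p"] by (auto simp: Fil_def K_def add.commute)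
    fix r assume r: "max p (n - p + 1) < r"
    let ?p = "int p" and ?r = "int r"
    \<comment> \<open>With this bound on \<open>r\<close> the condition in \<open>cyc\<close> reads
      \<open>D (x + f) = 0\<close>, and the \<open>w\<close> in \<open>bnd\<close> ranges over the
      whole of degree \<open>n - 1\<close>.\<close>
    have Fr: "F (?p + ?r) (?n + 1) = {\<zero>}" using r p by (intro F_high) auto
    have Fl: "F (?p - ?r + 1) (?n - 1) = F 0 (?n - 1)" using r p by (intro F_low) auto
    define P where "P h x \<longleftrightarrow> x \<in> F ?p ?n \<and> (\<exists>f \<in> F (?p + 1) ?n. D (x \<oplus> f) = \<zero> \<and> h = c n (x \<oplus> f))" for h x
    have Pk: "x \<oplus> f \<in> K ?p" if "x \<in> F ?p ?n" "f \<in> F (?p + 1) ?n" "D (x \<oplus> f) = \<zero>" for x f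
      using F_add[OF that(1) F_SucD[OF that(2)]] that(3) by (simp add: K_def)
    interpret linear_relation R "H n" T P "Fil p" "cyc ?r ?p ?n"
    proof (intro linear_relation.intro linear_relation_axioms.intro)
      show "plain_module R (H n)" by unfold_locales
      show "plain_module R T" by (rule plain_module_axioms)
      show "submodule R (Fil p) (H n)" by (rule Fsub)
      show "submodule R (cyc ?r ?p ?n) T" by (rule cyc_sub)
      show "h \<in> Fil p \<and> x \<in> cyc ?r ?p ?n" if "P h x" for h x
        using that Pk by (auto simp: P_def Fil_def cyc_def Fr)
      show "\<exists>x. P h x" if "h \<in> Fil p" for h
      proof -
        obtain x where x: "x \<in> F ?p ?n" "D x = \<zero>" "h = c n x" using \<open>h \<in> Fil p\<close> by (auto simp: Fil_def K_def)
        then have "P h x" unfolding P_def using F_zero F_carrier by (auto intro!: bexI[of _ \<zero>])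
        then show ?thesis by blast
      qed
    next
      fix h x h' x' assume "P h x" "P h' x'"
      then obtain f f' where f: "x \<in> F ?p ?n" "f \<in> F (?p + 1) ?n" "D (x \<oplus> f) = \<zero>" "h = c n (x \<oplus> f)"
        "x' \<in> F ?p ?n" "f' \<in> F (?p + 1) ?n" "D (x' \<oplus> f') = \<zero>" "h' = c n (x' \<oplus> f')" by (auto simp: P_def)
      have e: "(x \<oplus> x') \<oplus> (f \<oplus> f') = (x \<oplus> f) \<oplus> (x' \<oplus> f')" using f by (simp add: add4 F_carrier)
      have k: "x \<oplus> f \<in> K 0" "x' \<oplus> f' \<in> K 0" using f Pk K0 by blast+
      then have "D ((x \<oplus> f) \<oplus> (x' \<oplus> f')) = \<zero>" using submodule.m_closed[OF Ksub] by (fastforce simp: K_def)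
      moreover have "h \<oplus>\<^bsub>H n\<^esub> h' = c n ((x \<oplus> f) \<oplus> (x' \<oplus> f'))" using cadd[OF k] f by simp
      ultimately show "P (h \<oplus>\<^bsub>H n\<^esub> h') (x \<oplus> x')"
        using f e F_add unfolding P_def by (auto intro!: bexI[of _ "f \<oplus> f'"])
    next
      fix a h x assume a: "a \<in> carrier R" and "P h x"
      then obtain f where f: "x \<in> F ?p ?n" "f \<in> F (?p + 1) ?n" "D (x \<oplus> f) = \<zero>" "h = c n (x \<oplus> f)" by (auto simp: P_def)
      have e: "a \<odot> x \<oplus> a \<odot> f = a \<odot> (x \<oplus> f)" using f a by (simp add: smult_r_distr F_carrier)
      have k: "x \<oplus> f \<in> K 0" using f Pk K0 by blast
      then have "D (a \<odot> (x \<oplus> f)) = \<zero>" using submodule.smult_closed[OF Ksub a] by (fastforce simp: K_def)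
      moreover have "a \<odot>\<^bsub>H n\<^esub> h = c n (a \<odot> (x \<oplus> f))" using csm[OF a k] f by simp
      ultimately show "P (a \<odot>\<^bsub>H n\<^esub> h) (a \<odot> x)"
        using f e a F_smult unfolding P_def by (auto intro!: bexI[of _ "a \<odot> f"])
    qed
    have "module_isomorphic R (subquotient (H n) (Fil p) (Fil (Suc p))) (subquotient T (cyc ?r ?p ?n) (bnd ?r ?p ?n))"
    proof (rule subquotients_isomorphic[OF _ bnd_sub bnd_cyc Fsub sub])
      show "\<exists>h. P h x" if "x \<in> cyc ?r ?p ?n" for x
        using that unfolding P_def cyc_def Fr by blast
      fix h x assume "P h x"
      then obtain f where f: "x \<in> F ?p ?n" "f \<in> F (?p + 1) ?n" "D (x \<oplus> f) = \<zero>" "h = c n (x \<oplus> f)" by (auto simp: P_def)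
      have c: "x \<in> carrier T" "f \<in> carrier T" using f F_carrier by auto
      have k: "x \<oplus> f \<in> K 0" using f Pk K0 by blast
      show "h \<in> Fil (Suc p) \<longleftrightarrow> x \<in> bnd ?r ?p ?n"
      proof
        assume "h \<in> Fil (Suc p)"
        then obtain x' where x': "x' \<in> K (?p + 1)" "h = c n x'" by (auto simp: Fil_def add.commute)
        \<comment> \<open>Equal classes differ by a coboundary of the whole complex; moving the two
          members of \<open>F (p + 1)\<close> to one side leaves \<open>x + D w\<close>.\<close>
        then obtain w where w: "w \<in> F 0 (?n - 1)" "x' = (x \<oplus> f) \<oplus> D w" using cD[OF _ k, of x'] f(4) K0 by auto
        have wc: "D w \<in> carrier T" using w F_carrier D_closed by blast
        have "x \<oplus> D w = x' \<ominus> f" using w(2) c wc by (subst eq_commute) (simp add: minus_eq_iff M.a_ac)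
        moreover have "x' \<ominus> f \<in> F (?p + 1) ?n" using x' f F_minus by (auto simp: K_def)
        ultimately have "x \<oplus> D w \<in> F (?p + 1) ?n" by (simp only:)
        then show "x \<in> bnd ?r ?p ?n" using w(1) f(1) by (intro bndI[of _ _ _ w]) (simp_all add: Fl)
      next
        assume "x \<in> bnd ?r ?p ?n"
        then obtain w where w: "w \<in> F 0 (?n - 1)" "x \<oplus> D w \<in> F (?p + 1) ?n" by (auto simp: bnd_def Fl)
        have wc: "w \<in> carrier T" "D w \<in> carrier T" using w F_carrier D_closed by auto
        have e: "(x \<oplus> f) \<oplus> D w = (x \<oplus> D w) \<oplus> f" using c wc by (simp add: M.a_ac)
        have "(x \<oplus> f) \<oplus> D w \<in> F (?p + 1) ?n" unfolding e using w f F_add by blast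
        moreover have "D ((x \<oplus> f) \<oplus> D w) = \<zero>" using c wc f(3) D_add[of "x \<oplus> f" "D w"] by (simp add: D_sq)
        ultimately have k': "(x \<oplus> f) \<oplus> D w \<in> K (?p + 1)" by (simp add: K_def)
        then have "c n ((x \<oplus> f) \<oplus> D w) = h" using cD[OF _ k] w(1) f(4) K0 by blast
        then show "h \<in> Fil (Suc p)" using k' unfolding Fil_def by (force simp: add.commute)
      qed
    qed
    then show "module_isomorphic R (subquotient (H n) (Fil p) (Fil (Suc p))) (page r (int p) (int (n - p)))"
      using p by (simp add: page_def pg_def)
  qed
qed

end

section \<open>Double complexes\<close>

lemma product_module_simps:
  shows "carrier (product_module I V) = (\<Pi>\<^sub>E i\<in>I. carrier (V i))"
    and "\<zero>\<^bsub>product_module I V\<^esub> = (\<lambda>i\<in>I. \<zero>\<^bsub>V i\<^esub>)"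
    and "f \<oplus>\<^bsub>product_module I V\<^esub> g = (\<lambda>i\<in>I. f i \<oplus>\<^bsub>V i\<^esub> g i)"
    and "a \<odot>\<^bsub>product_module I V\<^esub> f = (\<lambda>i\<in>I. a \<odot>\<^bsub>V i\<^esub> f i)"
  by (simp_all add: product_module_def)

lemma product_module_module:
  assumes R: "cring R" and V: "\<And>i. i \<in> I \<Longrightarrow> module R (V i)"
  shows "module R (product_module I V)"
proof (rule moduleI)
  let ?P = "product_module I V"
  note [simp] = product_module_simps
  have ag: "i \<in> I \<Longrightarrow> abelian_group (V i)" for i using V by (simp add: module_def)
  then have am: "i \<in> I \<Longrightarrow> abelian_monoid (V i)" for i by (simp add: abelian_group.axioms(1))
  have mem: "\<And>f i. \<lbrakk>f \<in> carrier ?P; i \<in> I\<rbrakk> \<Longrightarrow> f i \<in> carrier (V i)" by auto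
  show "cring R" by (rule R)
  show "abelian_group ?P"
  proof (rule abelian_groupI)
    fix f g h assume fgh: "f \<in> carrier ?P" "g \<in> carrier ?P" "h \<in> carrier ?P"
    have "f i \<oplus>\<^bsub>V i\<^esub> g i \<oplus>\<^bsub>V i\<^esub> h i = f i \<oplus>\<^bsub>V i\<^esub> (g i \<oplus>\<^bsub>V i\<^esub> h i)" if "i \<in> I" for i
      by (rule abelian_monoid.a_assoc[OF am[OF that] mem[OF fgh(1) that] mem[OF fgh(2) that] mem[OF fgh(3) that]])
    then show "f \<oplus>\<^bsub>?P\<^esub> g \<oplus>\<^bsub>?P\<^esub> h = f \<oplus>\<^bsub>?P\<^esub> (g \<oplus>\<^bsub>?P\<^esub> h)"
      by (simp cong: restrict_cong)
  next
    fix f g assume fg: "f \<in> carrier ?P" "g \<in> carrier ?P"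
    have "f i \<oplus>\<^bsub>V i\<^esub> g i \<in> carrier (V i)" if "i \<in> I" for i
      by (rule abelian_monoid.a_closed[OF am[OF that] mem[OF fg(1) that] mem[OF fg(2) that]])
    then show "f \<oplus>\<^bsub>?P\<^esub> g \<in> carrier ?P" by simp
    have "f i \<oplus>\<^bsub>V i\<^esub> g i = g i \<oplus>\<^bsub>V i\<^esub> f i" if "i \<in> I" for i
      by (rule abelian_monoid.a_comm[OF am[OF that] mem[OF fg(1) that] mem[OF fg(2) that]])
    then show "f \<oplus>\<^bsub>?P\<^esub> g = g \<oplus>\<^bsub>?P\<^esub> f" by (simp cong: restrict_cong)
  next
    show "\<zero>\<^bsub>?P\<^esub> \<in> carrier ?P" using abelian_monoid.zero_closed[OF am] by simp
    fix f assume f: "f \<in> carrier ?P"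
    have "\<zero>\<^bsub>V i\<^esub> \<oplus>\<^bsub>V i\<^esub> f i = f i" if "i \<in> I" for i
      by (rule abelian_monoid.l_zero[OF am[OF that] mem[OF f that]])
    then have "\<zero>\<^bsub>?P\<^esub> \<oplus>\<^bsub>?P\<^esub> f = restrict f I" by (simp cong: restrict_cong)
    then show "\<zero>\<^bsub>?P\<^esub> \<oplus>\<^bsub>?P\<^esub> f = f" using f by (simp add: PiE_restrict)
    have "(\<lambda>i\<in>I. \<ominus>\<^bsub>V i\<^esub> f i) \<in> carrier ?P" using abelian_group.a_inv_closed[OF ag mem[OF f]] by simp
    moreover have "\<ominus>\<^bsub>V i\<^esub> f i \<oplus>\<^bsub>V i\<^esub> f i = \<zero>\<^bsub>V i\<^esub>" if "i \<in> I" for i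
      by (rule abelian_group.l_neg[OF ag[OF that] mem[OF f that]])
    then have "(\<lambda>i\<in>I. \<ominus>\<^bsub>V i\<^esub> f i) \<oplus>\<^bsub>?P\<^esub> f = \<zero>\<^bsub>?P\<^esub>" by (simp cong: restrict_cong)
    ultimately show "\<exists>g \<in> carrier ?P. g \<oplus>\<^bsub>?P\<^esub> f = \<zero>\<^bsub>?P\<^esub>" by blast
  qed
next
  let ?P = "product_module I V"
  note [simp] = product_module_simps
  have mem: "\<And>f i. \<lbrakk>f \<in> carrier ?P; i \<in> I\<rbrakk> \<Longrightarrow> f i \<in> carrier (V i)" by auto
  fix a f assume a: "a \<in> carrier R" and f: "f \<in> carrier ?P"
  show "a \<odot>\<^bsub>?P\<^esub> f \<in> carrier ?P" using module.smult_closed[OF V a mem[OF f]] by simp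
  fix b assume b: "b \<in> carrier R"
  have "(a \<oplus>\<^bsub>R\<^esub> b) \<odot>\<^bsub>V i\<^esub> f i = a \<odot>\<^bsub>V i\<^esub> f i \<oplus>\<^bsub>V i\<^esub> b \<odot>\<^bsub>V i\<^esub> f i"
    "(a \<otimes>\<^bsub>R\<^esub> b) \<odot>\<^bsub>V i\<^esub> f i = a \<odot>\<^bsub>V i\<^esub> (b \<odot>\<^bsub>V i\<^esub> f i)" if "i \<in> I" for i
    using module.smult_l_distr[OF V[OF that] a b mem[OF f that]] module.smult_assoc1[OF V[OF that] a b mem[OF f that]]
    by simp_all
  then show "(a \<oplus>\<^bsub>R\<^esub> b) \<odot>\<^bsub>?P\<^esub> f = a \<odot>\<^bsub>?P\<^esub> f \<oplus>\<^bsub>?P\<^esub> b \<odot>\<^bsub>?P\<^esub> f"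
    "(a \<otimes>\<^bsub>R\<^esub> b) \<odot>\<^bsub>?P\<^esub> f = a \<odot>\<^bsub>?P\<^esub> (b \<odot>\<^bsub>?P\<^esub> f)"
    by (simp_all cong: restrict_cong)
next
  let ?P = "product_module I V"
  note [simp] = product_module_simps
  have mem: "\<And>f i. \<lbrakk>f \<in> carrier ?P; i \<in> I\<rbrakk> \<Longrightarrow> f i \<in> carrier (V i)" by auto
  fix f assume f: "f \<in> carrier ?P"
  have "\<one>\<^bsub>R\<^esub> \<odot>\<^bsub>V i\<^esub> f i = f i" if "i \<in> I" for i
    by (rule module.smult_one[OF V[OF that] mem[OF f that]])
  then have "\<one>\<^bsub>R\<^esub> \<odot>\<^bsub>?P\<^esub> f = restrict f I" by (simp cong: restrict_cong)
  then show "\<one>\<^bsub>R\<^esub> \<odot>\<^bsub>?P\<^esub> f = f" using f by (simp add: PiE_restrict)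
next
  let ?P = "product_module I V"
  note [simp] = product_module_simps
  have mem: "\<And>f i. \<lbrakk>f \<in> carrier ?P; i \<in> I\<rbrakk> \<Longrightarrow> f i \<in> carrier (V i)" by auto
  fix a f g assume a: "a \<in> carrier R" and fg: "f \<in> carrier ?P" "g \<in> carrier ?P"
  have "a \<odot>\<^bsub>V i\<^esub> (f i \<oplus>\<^bsub>V i\<^esub> g i) = a \<odot>\<^bsub>V i\<^esub> f i \<oplus>\<^bsub>V i\<^esub> a \<odot>\<^bsub>V i\<^esub> g i" if "i \<in> I" for i
    by (rule module.smult_r_distr[OF V[OF that] a mem[OF fg(1) that] mem[OF fg(2) that]])
  then show "a \<odot>\<^bsub>?P\<^esub> (f \<oplus>\<^bsub>?P\<^esub> g) = a \<odot>\<^bsub>?P\<^esub> f \<oplus>\<^bsub>?P\<^esub> a \<odot>\<^bsub>?P\<^esub> g"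
    by (simp cong: restrict_cong)
qed

context plain_module
begin

lemma alt_sign_hom: "alt_sign M i \<in> module_hom R M M"
  by (rule module_homI) (auto simp: alt_sign_def M.minus_add smult_r_minus)

lemma alt_sign_closed [simp]: "x \<in> carrier M \<Longrightarrow> alt_sign M i x \<in> carrier M"
  by (simp add: alt_sign_def)

lemma alt_sign_zero [simp]: "alt_sign M i \<zero> = \<zero>"
  using M.add.inv_one by (simp add: alt_sign_def a_inv_def)

lemma alt_sign_eq_zero_iff [simp]: "x \<in> carrier M \<Longrightarrow> alt_sign M i x = \<zero> \<longleftrightarrow> x = \<zero>"
  using M.add.inv_eq_1_iff by (simp add: alt_sign_def a_inv_def)

lemma alt_sign_alt_sign [simp]: "x \<in> carrier M \<Longrightarrow> alt_sign M i (alt_sign M j x) = alt_sign M (i + j) x"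
  by (auto simp: alt_sign_def)

lemma alt_sign_even: "even i \<Longrightarrow> alt_sign M i x = x"
  by (simp add: alt_sign_def)

lemma alt_sign_cancel: "x \<in> carrier M \<Longrightarrow> alt_sign M i x \<oplus> alt_sign M (Suc i) x = \<zero>"
  by (simp add: alt_sign_def M.r_neg M.l_neg)

end

lemma module_hom_alt_sign:
  assumes "module R V" "module R W" "f \<in> module_hom R V W" "x \<in> carrier V"
  shows "f (alt_sign V i x) = alt_sign W i (f x)"
  using assms by (simp add: alt_sign_def module_hom_uminus)

text \<open>The two differentials commute; the sign that makes the total differential square to zero
  is put into \<open>D\<close>. Group cochains with coefficients in a complex have this form without
  further signs.\<close>

locale double_complex =
  fixes R :: "('k, 'r) ring_scheme" and K :: "nat \<Rightarrow> nat \<Rightarrow> ('k, 'c) module"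
    and dh dv :: "nat \<Rightarrow> nat \<Rightarrow> 'c \<Rightarrow> 'c"
  assumes ring: "cring R"
    and K_module: "module R (K p q)"
    and dh_hom: "dh p q \<in> module_hom R (K p q) (K (Suc p) q)"
    and dv_hom: "dv p q \<in> module_hom R (K p q) (K p (Suc q))"
    and dh_sq: "x \<in> carrier (K p q) \<Longrightarrow> dh (Suc p) q (dh p q x) = \<zero>\<^bsub>K (Suc (Suc p)) q\<^esub>"
    and dv_sq: "x \<in> carrier (K p q) \<Longrightarrow> dv p (Suc q) (dv p q x) = \<zero>\<^bsub>K p (Suc (Suc q))\<^esub>"
    and dh_dv: "x \<in> carrier (K p q) \<Longrightarrow> dh p (Suc q) (dv p q x) = dv (Suc p) q (dh p q x)"
begin

sublocale K: plain_module R "K p q" for p q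
  using K_module by (simp add: plain_module_def)

text \<open>The product over all bidegrees serves for every total degree at once. In one total
  degree only finitely many bidegrees occur, so there the product is the usual direct sum.\<close>

definition T :: "('k, nat \<times> nat \<Rightarrow> 'c) module"
  where "T = product_module UNIV (\<lambda>(p, q). K p q)"

definition hpart :: "(nat \<times> nat \<Rightarrow> 'c) \<Rightarrow> nat \<Rightarrow> nat \<Rightarrow> 'c"
  where "hpart x p q = (case p of 0 \<Rightarrow> \<zero>\<^bsub>K p q\<^esub> | Suc p' \<Rightarrow> dh p' q (x (p', q)))"

definition vpart :: "(nat \<times> nat \<Rightarrow> 'c) \<Rightarrow> nat \<Rightarrow> nat \<Rightarrow> 'c"
  where "vpart x p q = (case q of 0 \<Rightarrow> \<zero>\<^bsub>K p q\<^esub> | Suc q' \<Rightarrow> dv p q' (x (p, q')))"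

definition D :: "(nat \<times> nat \<Rightarrow> 'c) \<Rightarrow> (nat \<times> nat \<Rightarrow> 'c)"
  where "D x = (\<lambda>(p, q). hpart x p q \<oplus>\<^bsub>K p q\<^esub> alt_sign (K p q) p (vpart x p q))"

definition F :: "int \<Rightarrow> int \<Rightarrow> (nat \<times> nat \<Rightarrow> 'c) set"
  where "F p n = {x \<in> carrier T. \<forall>i j. x (i, j) \<noteq> \<zero>\<^bsub>K i j\<^esub> \<longrightarrow> p \<le> int i \<and> int i + int j = n}"

lemma T_simps:
  shows "x \<in> carrier T \<longleftrightarrow> (\<forall>i j. x (i, j) \<in> carrier (K i j))"
    and "\<zero>\<^bsub>T\<^esub> = (\<lambda>(i, j). \<zero>\<^bsub>K i j\<^esub>)"
    and "x \<oplus>\<^bsub>T\<^esub> y = (\<lambda>(i, j). x (i, j) \<oplus>\<^bsub>K i j\<^esub> y (i, j))"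
    and "a \<odot>\<^bsub>T\<^esub> x = (\<lambda>(i, j). a \<odot>\<^bsub>K i j\<^esub> x (i, j))"
  by (auto simp: T_def product_module_simps PiE_def Pi_def split: prod.splits)

lemma T_module: "module R T"
  unfolding T_def by (rule product_module_module[OF ring]) (auto simp: K_module)

sublocale T: plain_module R T
  using T_module by (simp add: plain_module_def)

lemma T_uminus: "x \<in> carrier T \<Longrightarrow> \<ominus>\<^bsub>T\<^esub> x = (\<lambda>(i, j). \<ominus>\<^bsub>K i j\<^esub> x (i, j))"
  by (rule T.M.minus_equality) (auto simp: T_simps K.M.l_neg K.M.r_neg)

lemma T_minus: "\<lbrakk>x \<in> carrier T; y \<in> carrier T\<rbrakk> \<Longrightarrow> x \<ominus>\<^bsub>T\<^esub> y = (\<lambda>(i, j). x (i, j) \<ominus>\<^bsub>K i j\<^esub> y (i, j))"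
  by (auto simp: a_minus_def T_uminus T_simps)

lemma dh_closed [simp]: "x \<in> carrier (K p q) \<Longrightarrow> dh p q x \<in> carrier (K (Suc p) q)"
  using module_homD(1)[OF dh_hom] .

lemma dv_closed [simp]: "x \<in> carrier (K p q) \<Longrightarrow> dv p q x \<in> carrier (K p (Suc q))"
  using module_homD(1)[OF dv_hom] .

lemmas dh_add = module_homD(2)[OF dh_hom] and dh_smult = module_homD(3)[OF dh_hom]
  and dv_add = module_homD(2)[OF dv_hom] and dv_smult = module_homD(3)[OF dv_hom]
  and dh_zero [simp] = module_hom_zero[OF K_module K_module dh_hom]
  and dv_zero [simp] = module_hom_zero[OF K_module K_module dv_hom]
  and dh_sign = module_hom_alt_sign[OF K_module K_module dh_hom]
  and dv_sign = module_hom_alt_sign[OF K_module K_module dv_hom]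

lemma hpart_closed [simp]: "x \<in> carrier T \<Longrightarrow> hpart x p q \<in> carrier (K p q)"
  by (auto simp: hpart_def T_simps split: nat.splits)

lemma vpart_closed [simp]: "x \<in> carrier T \<Longrightarrow> vpart x p q \<in> carrier (K p q)"
  by (auto simp: vpart_def T_simps split: nat.splits)

lemma hpart_add: "\<lbrakk>x \<in> carrier T; y \<in> carrier T\<rbrakk> \<Longrightarrow> hpart (x \<oplus>\<^bsub>T\<^esub> y) p q = hpart x p q \<oplus>\<^bsub>K p q\<^esub> hpart y p q"
  by (auto simp: hpart_def T_simps dh_add split: nat.splits)

lemma vpart_add: "\<lbrakk>x \<in> carrier T; y \<in> carrier T\<rbrakk> \<Longrightarrow> vpart (x \<oplus>\<^bsub>T\<^esub> y) p q = vpart x p q \<oplus>\<^bsub>K p q\<^esub> vpart y p q"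
  by (auto simp: vpart_def T_simps dv_add split: nat.splits)

lemma hpart_smult: "\<lbrakk>a \<in> carrier R; x \<in> carrier T\<rbrakk> \<Longrightarrow> hpart (a \<odot>\<^bsub>T\<^esub> x) p q = a \<odot>\<^bsub>K p q\<^esub> hpart x p q"
  by (auto simp: hpart_def T_simps dh_smult split: nat.splits)

lemma vpart_smult: "\<lbrakk>a \<in> carrier R; x \<in> carrier T\<rbrakk> \<Longrightarrow> vpart (a \<odot>\<^bsub>T\<^esub> x) p q = a \<odot>\<^bsub>K p q\<^esub> vpart x p q"
  by (auto simp: vpart_def T_simps dv_smult split: nat.splits)

lemma D_apply: "D x (p, q) = hpart x p q \<oplus>\<^bsub>K p q\<^esub> alt_sign (K p q) p (vpart x p q)"
  by (simp add: D_def)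

lemma D_T [simp]: "x \<in> carrier T \<Longrightarrow> D x \<in> carrier T"
  by (simp add: T_simps(1)[of "D x"] D_apply)

lemma D_module_hom: "D \<in> module_hom R T T"
proof (rule module_homI)
  fix x y assume xy: "x \<in> carrier T" "y \<in> carrier T"
  show "D x \<in> carrier T" using xy by simp
  show "D (x \<oplus>\<^bsub>T\<^esub> y) = D x \<oplus>\<^bsub>T\<^esub> D y"
  proof
    fix i :: "nat \<times> nat" obtain p q where i: "i = (p, q)" by (cases i)
    have "alt_sign (K p q) p (vpart x p q \<oplus>\<^bsub>K p q\<^esub> vpart y p q) =
        alt_sign (K p q) p (vpart x p q) \<oplus>\<^bsub>K p q\<^esub> alt_sign (K p q) p (vpart y p q)"
      using xy module_homD(2)[OF K.alt_sign_hom] by simp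
    then show "D (x \<oplus>\<^bsub>T\<^esub> y) i = (D x \<oplus>\<^bsub>T\<^esub> D y) i"
      using xy i by (simp add: D_apply hpart_add vpart_add T_simps(3)[of "D x" "D y"] K.M.a_ac)
  qed
next
  fix a x assume ax: "a \<in> carrier R" "x \<in> carrier T"
  show "D (a \<odot>\<^bsub>T\<^esub> x) = a \<odot>\<^bsub>T\<^esub> D x"
  proof
    fix i :: "nat \<times> nat" obtain p q where i: "i = (p, q)" by (cases i)
    have "alt_sign (K p q) p (a \<odot>\<^bsub>K p q\<^esub> vpart x p q) = a \<odot>\<^bsub>K p q\<^esub> alt_sign (K p q) p (vpart x p q)"
      using ax module_homD(3)[OF K.alt_sign_hom] by simp
    then show "D (a \<odot>\<^bsub>T\<^esub> x) i = (a \<odot>\<^bsub>T\<^esub> D x) i"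
      using ax i by (simp add: D_apply hpart_smult vpart_smult T_simps(4)[of a "D x"] K.smult_r_distr)
  qed
qed

text \<open>Going horizontally and then vertically carries the sign of column \<open>p\<close>,
  going vertically and then horizontally the sign of column \<open>p - 1\<close>; since
  \<open>dh\<close> and \<open>dv\<close> commute, the two contributions cancel. On the edges both
  are absent.\<close>

lemma D_D:
  assumes x: "x \<in> carrier T"
  shows "D (D x) = \<zero>\<^bsub>T\<^esub>"
proof
  fix i :: "nat \<times> nat" obtain p q where i: "i = (p, q)" by (cases i)
  have h: "hpart (D x) p q = (case p of 0 \<Rightarrow> \<zero>\<^bsub>K p q\<^esub> | Suc p' \<Rightarrow> alt_sign (K p q) p' (dh p' q (vpart x p' q)))"
  proof (cases p)
    case (Suc p')
    have "dh p' q (hpart x p' q) = \<zero>\<^bsub>K (Suc p') q\<^esub>"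
      using x by (auto simp: hpart_def T_simps dh_sq split: nat.splits)
    then show ?thesis using x Suc by (simp add: hpart_def[of "D x"] D_apply dh_add dh_sign)
  qed (simp add: hpart_def)
  have v: "vpart (D x) p q = (case q of 0 \<Rightarrow> \<zero>\<^bsub>K p q\<^esub> | Suc q' \<Rightarrow> dv p q' (hpart x p q'))"
  proof (cases q)
    case (Suc q')
    have "dv p q' (vpart x p q') = \<zero>\<^bsub>K p (Suc q')\<^esub>"
      using x by (auto simp: vpart_def T_simps dv_sq split: nat.splits)
    then show ?thesis using x Suc by (simp add: vpart_def[of "D x"] D_apply dv_add dv_sign)
  qed (simp add: vpart_def)
  have "D (D x) (p, q) = \<zero>\<^bsub>K p q\<^esub>"
  proof (cases "p = 0 \<or> q = 0")
    case True
    then show ?thesis unfolding D_apply[of "D x"] h v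
      using x by (auto simp: hpart_def vpart_def split: nat.splits)
  next
    case False
    then obtain p' q' where pq: "p = Suc p'" "q = Suc q'" by (metis not0_implies_Suc)
    have "x (p', q') \<in> carrier (K p' q')" using x by (simp add: T_simps)
    then show ?thesis unfolding D_apply[of "D x"] h v
      using pq by (simp add: hpart_def vpart_def dh_dv K.alt_sign_cancel)
  qed
  then show "D (D x) i = \<zero>\<^bsub>T\<^esub> i" using i by (simp add: T_simps)
qed

lemma F_iff: "x \<in> F p n \<longleftrightarrow> x \<in> carrier T \<and> (\<forall>i j. (int i < p \<or> int i + int j \<noteq> n) \<longrightarrow> x (i, j) = \<zero>\<^bsub>K i j\<^esub>)"
  unfolding F_def by force

lemma hpart_eq_zero: "(\<And>p'. p = Suc p' \<Longrightarrow> x (p', q) = \<zero>\<^bsub>K p' q\<^esub>) \<Longrightarrow> hpart x p q = \<zero>\<^bsub>K p q\<^esub>"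
  by (auto simp: hpart_def split: nat.splits)

lemma vpart_eq_zero: "(\<And>q'. q = Suc q' \<Longrightarrow> x (p, q') = \<zero>\<^bsub>K p q'\<^esub>) \<Longrightarrow> vpart x p q = \<zero>\<^bsub>K p q\<^esub>"
  by (auto simp: vpart_def split: nat.splits)

sublocale filtered_complex R T D F
proof (intro filtered_complex.intro filtered_complex_axioms.intro)
  show "plain_module R T" by (rule T.plain_module_axioms)
  show "D \<in> module_hom R T T" by (rule D_module_hom)
  show "\<And>x. x \<in> carrier T \<Longrightarrow> D (D x) = \<zero>\<^bsub>T\<^esub>" by (rule D_D)
  show "submodule R (F p n) T" for p n
    by (rule T.submoduleI') (auto simp: F_iff T_simps)
  show "F (p + 1) n \<subseteq> F p n" for p n by (auto simp: F_iff)
  show "F p n = F 0 n" if "p \<le> 0" for p n using that by (auto simp: F_iff)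
  show "F p n = {\<zero>\<^bsub>T\<^esub>}" if "n < p" for p n
  proof -
    have "x = \<zero>\<^bsub>T\<^esub>" if "x \<in> F p n" for x
    proof
      fix i :: "nat \<times> nat"
      obtain a b where i: "i = (a, b)" by (cases i)
      have "int a < p \<or> int a + int b \<noteq> n" using \<open>n < p\<close> by linarith
      then show "x i = \<zero>\<^bsub>T\<^esub> i" using that unfolding i F_iff by (auto simp: T_simps)
    qed
    moreover have "\<zero>\<^bsub>T\<^esub> \<in> F p n" by (simp add: F_iff) (simp add: T_simps)
    ultimately show ?thesis by blast
  qed
  show "D x \<in> F p (n + 1)" if "x \<in> F p n" for x p n
    unfolding F_iff
  proof (intro conjI allI impI)
    show "D x \<in> carrier T" using that by (simp add: F_iff)
    fix i j assume h: "int i < p \<or> int i + int j \<noteq> n + 1"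
    have "hpart x i j = \<zero>\<^bsub>K i j\<^esub>" using that h by (intro hpart_eq_zero) (auto simp: F_iff)
    moreover have "vpart x i j = \<zero>\<^bsub>K i j\<^esub>" using that h by (intro vpart_eq_zero) (auto simp: F_iff)
    ultimately show "D x (i, j) = \<zero>\<^bsub>K i j\<^esub>" by (simp add: D_apply)
  qed
qed

text \<open>In total degree \<open>p + q\<close> the column \<open>p\<close> contributes the single
  entry \<open>(p, q)\<close>, the only one that distinguishes step \<open>p\<close> from step
  \<open>p + 1\<close>.\<close>

lemma F_next: "\<lbrakk>x \<in> F (int p) (int p + int q); x (p, q) = \<zero>\<^bsub>K p q\<^esub>\<rbrakk> \<Longrightarrow> x \<in> F (int p + 1) (int p + int q)"
  unfolding F_iff by (metis add_left_imp_eq of_nat_eq_iff order_less_le zless_imp_add1_zle linorder_not_less)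

definition single :: "nat \<Rightarrow> nat \<Rightarrow> 'c \<Rightarrow> (nat \<times> nat \<Rightarrow> 'c)"
  where "single p q u = (\<lambda>(i, j). if i = p \<and> j = q then u else \<zero>\<^bsub>K i j\<^esub>)"

lemma single_F: "u \<in> carrier (K p q) \<Longrightarrow> r \<le> int p \<Longrightarrow> int p + int q = n \<Longrightarrow> single p q u \<in> F r n"
  by (auto simp: F_iff T_simps single_def)

lemma single_apply: "single p q u (p, q) = u" "(i, j) \<noteq> (p, q) \<Longrightarrow> single p q u (i, j) = \<zero>\<^bsub>K i j\<^esub>"
  by (auto simp: single_def)

end

section \<open>Cochain complexes and their cohomology\<close>

lemma coboundaries_0: "coboundaries A d 0 = {\<zero>\<^bsub>A 0\<^esub>}"
  and coboundaries_Suc: "coboundaries A d (Suc n) = d n ` carrier (A n)"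
  by (simp_all add: coboundaries_def)

locale cochain_complex =
  fixes R :: "('k, 'r) ring_scheme" and A :: "nat \<Rightarrow> ('k, 'a) module" and d :: "nat \<Rightarrow> 'a \<Rightarrow> 'a"
  assumes A_module: "module R (A n)"
    and d_hom: "d n \<in> module_hom R (A n) (A (Suc n))"
    and d_sq: "x \<in> carrier (A n) \<Longrightarrow> d (Suc n) (d n x) = \<zero>\<^bsub>A (Suc (Suc n))\<^esub>"
begin

sublocale A: plain_module R "A n" for n
  using A_module by (simp add: plain_module_def)

lemmas d_closed [simp] = module_homD(1)[OF d_hom]
  and d_add = module_homD(2)[OF d_hom] and d_smult = module_homD(3)[OF d_hom]
  and d_zero [simp] = module_hom_zero[OF A_module A_module d_hom]

lemma cocycles_sub: "submodule R (cocycles A d n) (A n)"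
  unfolding cocycles_def
  using A.kernel_submodule[OF A_module A.submodule_carrier, of "d n" n] d_hom by simp

lemma coboundaries_sub: "submodule R (coboundaries A d n) (A n)"
proof (cases n)
  case (Suc m)
  then show ?thesis
    using A.submodule_image[OF A_module _ A.submodule_carrier, of "d m" m n] d_hom by (simp add: coboundaries_Suc)
qed (simp add: coboundaries_0 A.submodule_zero)

lemma coboundaries_cocycles: "coboundaries A d n \<subseteq> cocycles A d n"
  by (cases n) (auto simp: coboundaries_0 coboundaries_Suc cocycles_def d_sq)

lemma cohomology_module: "module R (cohomology A d n)"
  unfolding cohomology_def by (rule A.subquotient_module[OF cocycles_sub coboundaries_sub coboundaries_cocycles])

end

section \<open>The second page of a double complex\<close>

context double_complex
begin

lemma column: "cochain_complex R (K p) (dv p)"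
  by unfold_locales (simp_all add: K_module dv_hom dv_sq)

sublocale col: cochain_complex R "K p" "dv p" for p
  by (rule column)

lemma vpart_coboundary: "x \<in> carrier T \<Longrightarrow> vpart x p q \<in> coboundaries (K p) (dv p) q"
  by (cases q) (auto simp: vpart_def T_simps coboundaries_0 coboundaries_Suc)

text \<open>Nothing arrives horizontally in column \<open>p\<close>, because \<open>x\<close>
  vanishes in column \<open>p - 1\<close>.\<close>

lemma D_edge:
  assumes "x \<in> F (int p) (int p + int q)"
  shows "D x (p, Suc q) = alt_sign (K p (Suc q)) p (dv p q (x (p, q)))"
proof -
  have "hpart x p (Suc q) = \<zero>\<^bsub>K p (Suc q)\<^esub>" using assms by (intro hpart_eq_zero) (simp add: F_iff)
  moreover have "x (p, q) \<in> carrier (K p q)" using assms by (simp add: F_iff T_simps)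
  ultimately show ?thesis by (simp add: D_apply vpart_def)
qed

text \<open>Each step of the filtration costs the vanishing of one entry; in total degree
  \<open>p + q + 1\<close> these are \<open>(p, q + 1)\<close> and
  \<open>(p + 1, q)\<close>.\<close>

lemma F_next2:
  assumes "x \<in> F (int p) (int p + int q)" "D x (p, Suc q) = \<zero>\<^bsub>K p (Suc q)\<^esub>" "D x (Suc p, q) = \<zero>\<^bsub>K (Suc p) q\<^esub>"
  shows "D x \<in> F (int p + 2) (int p + int q + 1)"
proof -
  have "D x \<in> F (int p) (int p + int (Suc q))" using F_D[OF assms(1)] by (simp add: algebra_simps)
  then have "D x \<in> F (int p + 1) (int p + int (Suc q))" using assms(2) by (rule F_next)
  then have "D x \<in> F (int (Suc p)) (int (Suc p) + int q)" by (simp add: algebra_simps)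
  then have "D x \<in> F (int (Suc p) + 1) (int (Suc p) + int q)" using assms(3) by (rule F_next)
  then show ?thesis by (simp add: algebra_simps)
qed

text \<open>\<open>w\<close> has an entry \<open>y\<close> at \<open>(p - 1, q)\<close> producing
  \<open>v\<close> horizontally and an entry \<open>z\<close> at \<open>(p, q - 1)\<close> producing
  \<open>u\<close> vertically. Choosing \<open>y\<close> among the vertical cocycles prevents
  \<open>D w\<close> from having a component in column \<open>p - 1\<close>. If \<open>p\<close> or
  \<open>q\<close> is zero, the corresponding entry does not exist, and the hypotheses force the
  part to be zero.\<close>

lemma ex_parts:
  assumes v: "v \<in> carrier (K p q)" "p = 0 \<Longrightarrow> v = \<zero>\<^bsub>K p q\<^esub>"
      "\<And>p'. p = Suc p' \<Longrightarrow> \<exists>y \<in> cocycles (K p') (dv p') q. v = dh p' q y"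
    and u: "u \<in> coboundaries (K p) (dv p) q"
  obtains w where "w \<in> F (int p - 1) (int p + int q - 1)" "hpart w p q = v" "vpart w p q = u"
    "D w \<in> F (int p) (int p + int q)"
proof -
  obtain y where y: "p = Suc p' \<Longrightarrow> y \<in> carrier (K p' q) \<and> dv p' q y = \<zero>\<^bsub>K p' (Suc q)\<^esub> \<and> v = dh p' q y" for p'
  proof (cases p)
    case 0 then show ?thesis using that by auto
  next
    case (Suc p')
    then show ?thesis using v(3)[OF Suc] that by (auto simp: cocycles_def)
  qed
  obtain z where z: "q = Suc q' \<Longrightarrow> z \<in> carrier (K p q') \<and> u = dv p q' z" for q'
  proof (cases q)
    case 0 then show ?thesis using that by auto
  next
    case (Suc q')
    then show ?thesis using u that by (auto simp: coboundaries_Suc)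
  qed
  define w where "w = (\<lambda>(i, j). if Suc i = p \<and> j = q then y else if i = p \<and> Suc j = q then z else \<zero>\<^bsub>K i j\<^esub>)"
  have wF: "w \<in> F (int p - 1) (int p + int q - 1)"
    using y z by (auto simp: F_iff T_simps w_def)
  have h: "hpart w p q = v" using y v(2) by (auto simp: hpart_def w_def split: nat.splits)
  have vp: "vpart w p q = u" using z u by (auto simp: vpart_def w_def coboundaries_0 split: nat.splits)
  have "D w \<in> F (int p) (int p + int q)"
  proof (cases p)
    case 0
    then have "w \<in> F 0 (int p + int q - 1)" using wF F_low[of "-1"] by simp
    then show ?thesis using F_D[of w 0 "int p + int q - 1"] 0 by simp
  next
    case (Suc p')
    have wF': "w \<in> F (int p') (int p' + int q)" using wF Suc by simp
    have "D w (p', Suc q) = \<zero>\<^bsub>K p' (Suc q)\<^esub>" using y[OF Suc] unfolding D_edge[OF wF'] by (simp add: w_def Suc)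
    moreover have "D w \<in> F (int p') (int p' + int (Suc q))" using F_D[OF wF'] by (simp add: algebra_simps)
    ultimately have "D w \<in> F (int p' + 1) (int p' + int (Suc q))" using F_next by blast
    then show ?thesis using Suc by (simp add: algebra_simps)
  qed
  with wF h vp that show ?thesis by blast
qed

text \<open>An element of \<open>cyc 2\<close> is seen only through its entry at
  \<open>(p, q)\<close>. That \<open>D (x + f)\<close> vanishes at \<open>(p, q + 1)\<close> makes
  the entry a vertical cocycle, and that it vanishes at \<open>(p + 1, q)\<close> makes the
  horizontal differential of the entry a vertical coboundary, so that its class is a cocycle for
  \<open>\<delta>\<close>. The vertical cohomology is given by surjections \<open>c p\<close> with
  the coboundaries as kernel, so that for group cochains it can be the module of cochains with
  values in classes.\<close>

theorem page_two:
  fixes Y :: "nat \<Rightarrow> ('k, 'y) module" and \<delta> :: "nat \<Rightarrow> 'y \<Rightarrow> 'y" and c :: "nat \<Rightarrow> 'c \<Rightarrow> 'y"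
  assumes Y_module: "\<And>p. module R (Y p)" and Y_hom: "\<And>p. \<delta> p \<in> module_hom R (Y p) (Y (Suc p))"
    and c_hom: "\<And>p. c p \<in> module_hom R ((K p q)\<lparr>carrier := cocycles (K p) (dv p) q\<rparr>) (Y p)"
    and c_surj: "\<And>p. c p ` cocycles (K p) (dv p) q = carrier (Y p)"
    and c_ker: "\<And>p x. x \<in> cocycles (K p) (dv p) q \<Longrightarrow> c p x = \<zero>\<^bsub>Y p\<^esub> \<longleftrightarrow> x \<in> coboundaries (K p) (dv p) q"
    and c_dh: "\<And>p x. x \<in> cocycles (K p) (dv p) q \<Longrightarrow> c (Suc p) (dh p q x) = \<delta> p (c p x)"
  shows "module_isomorphic R (page 2 (int p) (int q)) (cohomology Y \<delta> p)"
proof -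
  let ?Zv = "\<lambda>p. cocycles (K p) (dv p) q" and ?Bv = "\<lambda>p. coboundaries (K p) (dv p) q"
  let ?n = "int p + int q"
  have dhZ: "dh p q x \<in> ?Zv (Suc p)" if "x \<in> ?Zv p" for p x
    using that by (auto simp: cocycles_def dh_dv[symmetric])
  have Zc: "x \<in> ?Zv p \<Longrightarrow> x \<in> carrier (K p q)" for p x by (simp add: cocycles_def)
  \<comment> \<open>\<open>\<delta>\<close> squares to zero because \<open>dh\<close> does and
    \<open>c\<close> is onto.\<close>
  interpret Y: cochain_complex R Y \<delta>
  proof (rule cochain_complex.intro)
    fix p y assume "y \<in> carrier (Y p)"
    then obtain x where x: "x \<in> ?Zv p" "y = c p x" using c_surj by blast
    have "\<zero>\<^bsub>K (Suc (Suc p)) q\<^esub> \<in> ?Bv (Suc (Suc p))" "\<zero>\<^bsub>K (Suc (Suc p)) q\<^esub> \<in> ?Zv (Suc (Suc p))"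
      using submodule.zero_closed[OF col.coboundaries_sub] submodule.zero_closed[OF col.cocycles_sub] by blast+
    then have "c (Suc (Suc p)) (dh (Suc p) q (dh p q x)) = \<zero>\<^bsub>Y (Suc (Suc p))\<^esub>"
      using c_ker Zc[OF x(1)] by (simp add: dh_sq)
    then show "\<delta> (Suc p) (\<delta> p y) = \<zero>\<^bsub>Y (Suc (Suc p))\<^esub>"
      using x(2) c_dh[OF x(1)] c_dh[OF dhZ[OF x(1)]] by simp
  qed (rule Y_module Y_hom)+
  note cadd = module_homD(2)[OF c_hom, simplified] and csm = module_homD(3)[OF c_hom, simplified]
    and ccl = module_homD(1)[OF c_hom, simplified]
  \<comment> \<open>\<open>c p\<close> is linear on a record with restricted carrier, whose additive
    inverse is defined through that carrier; writing negation as a scalar multiple avoids comparing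
    it with the inverse of \<open>K p q\<close>.\<close>
  have cmin: "c p (x \<ominus>\<^bsub>K p q\<^esub> y) = c p x \<ominus>\<^bsub>Y p\<^esub> c p y" if "x \<in> ?Zv p" "y \<in> ?Zv p" for p x y
  proof -
    have e: "\<ominus>\<^bsub>K p q\<^esub> y = (\<ominus>\<^bsub>R\<^esub> \<one>\<^bsub>R\<^esub>) \<odot>\<^bsub>K p q\<^esub> y" using Zc[OF that(2)] by (simp add: K.smult_minus_1)
    have m: "\<ominus>\<^bsub>R\<^esub> \<one>\<^bsub>R\<^esub> \<in> carrier R" using ring by (simp add: cring_def ring.ring_simprules)
    have "\<ominus>\<^bsub>K p q\<^esub> y \<in> ?Zv p" using K.submodule_uminus[OF col.cocycles_sub that(2)] .
    then show ?thesis using cadd[OF that(1)] csm[OF m that(2)] ccl[OF that(2)]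
      by (simp add: a_minus_def e Y.A.smult_minus_1)
  qed
  define P where "P x y \<longleftrightarrow> x \<in> cyc 2 (int p) ?n \<and> y = c p (x (p, q))" for x y
  have cycZ: "x (p, q) \<in> ?Zv p \<and> c p (x (p, q)) \<in> cocycles Y \<delta> p" if x: "x \<in> cyc 2 (int p) ?n" for x
  proof -
    obtain f where f: "x \<in> F (int p) ?n" "f \<in> F (int p + 1) ?n" "D (x \<oplus>\<^bsub>T\<^esub> f) \<in> F (int p + 2) (?n + 1)"
      using cycE[OF x] .
    have xc: "x \<in> carrier T" "f \<in> carrier T" using f F_carrier by auto
    have xf: "x \<oplus>\<^bsub>T\<^esub> f \<in> F (int p) ?n" using f F_SucD F_add by blast
    have fp: "f (p, q) = \<zero>\<^bsub>K p q\<^esub>" using f(2) by (simp add: F_iff)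
    have e: "(x \<oplus>\<^bsub>T\<^esub> f) (p, q) = x (p, q)" using fp xc by (simp add: T_simps)
    have xpq: "x (p, q) \<in> carrier (K p q)" using xc by (simp add: T_simps)
    have "D (x \<oplus>\<^bsub>T\<^esub> f) (p, Suc q) = \<zero>\<^bsub>K p (Suc q)\<^esub>" using f(3) by (simp add: F_iff)
    then have z: "x (p, q) \<in> ?Zv p" using D_edge[OF xf] e xpq by (simp add: cocycles_def)
    have "D (x \<oplus>\<^bsub>T\<^esub> f) (Suc p, q) = \<zero>\<^bsub>K (Suc p) q\<^esub>" using f(3) by (simp add: F_iff)
    then have "dh p q (x (p, q)) \<oplus>\<^bsub>K (Suc p) q\<^esub> alt_sign (K (Suc p) q) (Suc p) (vpart (x \<oplus>\<^bsub>T\<^esub> f) (Suc p) q) = \<zero>\<^bsub>K (Suc p) q\<^esub>"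
      using e by (simp add: D_apply hpart_def)
    moreover have b: "alt_sign (K (Suc p) q) (Suc p) (vpart (x \<oplus>\<^bsub>T\<^esub> f) (Suc p) q) \<in> ?Bv (Suc p)"
      using vpart_coboundary[of "x \<oplus>\<^bsub>T\<^esub> f" "Suc p" q] xc K.submodule_uminus[OF col.coboundaries_sub]
      by (auto simp: alt_sign_def)
    ultimately have "dh p q (x (p, q)) = \<ominus>\<^bsub>K (Suc p) q\<^esub> (alt_sign (K (Suc p) q) (Suc p) (vpart (x \<oplus>\<^bsub>T\<^esub> f) (Suc p) q))"
      using xpq xc by (intro K.M.minus_equality[symmetric]) auto
    then have "dh p q (x (p, q)) \<in> ?Bv (Suc p)" using K.submodule_uminus[OF col.coboundaries_sub b] by simp
    then have "\<delta> p (c p (x (p, q))) = \<zero>\<^bsub>Y (Suc p)\<^esub>" using c_ker[OF dhZ[OF z]] c_dh[OF z] by simp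
    then show ?thesis using z ccl[OF z] by (simp add: cocycles_def)
  qed
  interpret linear_relation R T "Y p" P "cyc 2 (int p) ?n" "cocycles Y \<delta> p"
  proof (intro linear_relation.intro linear_relation_axioms.intro)
    show "plain_module R T" by (rule T.plain_module_axioms)
    show "plain_module R (Y p)" by (rule Y.A.plain_module_axioms)
    show "submodule R (cyc 2 (int p) ?n) T" by (rule cyc_sub)
    show "submodule R (cocycles Y \<delta> p) (Y p)" by (rule Y.cocycles_sub)
    show "x \<in> cyc 2 (int p) ?n \<and> y \<in> cocycles Y \<delta> p" if "P x y" for x y
      using that cycZ by (simp add: P_def)
    show "\<exists>y. P x y" if "x \<in> cyc 2 (int p) ?n" for x using that by (simp add: P_def)
    show "P (x \<oplus>\<^bsub>T\<^esub> x') (y \<oplus>\<^bsub>Y p\<^esub> y')" if "P x y" "P x' y'" for x y x' y'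
      using that cycZ submodule.m_closed[OF cyc_sub] cadd by (simp add: P_def T_simps(3))
    show "P (a \<odot>\<^bsub>T\<^esub> x) (a \<odot>\<^bsub>Y p\<^esub> y)" if "a \<in> carrier R" "P x y" for a x y
      using that cycZ submodule.smult_closed[OF cyc_sub] csm by (simp add: P_def T_simps(4))
  qed
  have "module_isomorphic R (subquotient T (cyc 2 (int p) ?n) (bnd 2 (int p) ?n)) (cohomology Y \<delta> p)"
    unfolding cohomology_def
  proof (rule subquotients_isomorphic[OF _ Y.coboundaries_sub Y.coboundaries_cocycles bnd_sub bnd_cyc])
    fix y assume "y \<in> cocycles Y \<delta> p"
    then have y: "y \<in> carrier (Y p)" "\<delta> p y = \<zero>\<^bsub>Y (Suc p)\<^esub>" by (auto simp: cocycles_def)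
    then obtain x0 where x0: "x0 \<in> ?Zv p" "y = c p x0" using c_surj by blast
    have x0c: "x0 \<in> carrier (K p q)" "dv p q x0 = \<zero>\<^bsub>K p (Suc q)\<^esub>" using x0 by (auto simp: cocycles_def)
    have "dh p q x0 \<in> ?Bv (Suc p)" using c_ker[OF dhZ[OF x0(1)]] c_dh[OF x0(1)] x0(2) y by simp
    then have b: "\<ominus>\<^bsub>K (Suc p) q\<^esub> alt_sign (K (Suc p) q) (Suc p) (dh p q x0) \<in> ?Bv (Suc p)"
      using K.submodule_uminus[OF col.coboundaries_sub] dh_closed[OF x0c(1)] by (auto simp: alt_sign_def)
    \<comment> \<open>A correction in column \<open>p + 1\<close> has to cancel
      \<open>dh p q x0\<close>. It sits at \<open>(p + 1, q - 1)\<close>; for \<open>q = 0\<close>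
      there is no such place, but then vertical coboundaries are zero and so is
      \<open>dh p q x0\<close>.\<close>
    obtain f where f: "f \<in> F (int p + 1) ?n"
      "vpart f (Suc p) q = \<ominus>\<^bsub>K (Suc p) q\<^esub> alt_sign (K (Suc p) q) (Suc p) (dh p q x0)"
    proof (cases q)
      case 0
      have "\<zero>\<^bsub>T\<^esub> \<in> F (int p + 1) ?n" by (rule F_zero)
      moreover have "vpart \<zero>\<^bsub>T\<^esub> (Suc p) q = \<ominus>\<^bsub>K (Suc p) q\<^esub> alt_sign (K (Suc p) q) (Suc p) (dh p q x0)"
        using b 0 by (simp add: vpart_def coboundaries_0)
      ultimately show ?thesis using that by blast
    next
      case (Suc q')
      then obtain f0 where f0: "f0 \<in> carrier (K (Suc p) q')"
        "\<ominus>\<^bsub>K (Suc p) q\<^esub> alt_sign (K (Suc p) q) (Suc p) (dh p q x0) = dv (Suc p) q' f0"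
        using b by (auto simp: coboundaries_Suc)
      then show ?thesis using Suc
        by (intro that[of "single (Suc p) q' f0"]) (auto intro!: single_F simp: vpart_def single_apply)
    qed
    let ?x = "single p q x0"
    have xF: "?x \<in> F (int p) ?n" using x0c by (auto intro!: single_F)
    have xc: "?x \<in> carrier T" "f \<in> carrier T" using xF f F_carrier by auto
    have xf: "?x \<oplus>\<^bsub>T\<^esub> f \<in> F (int p) ?n" using xF f F_SucD F_add by blast
    have "f (p, q) = \<zero>\<^bsub>K p q\<^esub>" using f(1) by (simp add: F_iff)
    then have e: "(?x \<oplus>\<^bsub>T\<^esub> f) (p, q) = x0" using x0c by (simp add: T_simps single_apply)
    have "vpart ?x (Suc p) q = \<zero>\<^bsub>K (Suc p) q\<^esub>" by (intro vpart_eq_zero) (simp add: single_apply)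
    then have "vpart (?x \<oplus>\<^bsub>T\<^esub> f) (Suc p) q = vpart f (Suc p) q" using xc by (simp add: vpart_add)
    then have "D (?x \<oplus>\<^bsub>T\<^esub> f) (Suc p, q) = \<zero>\<^bsub>K (Suc p) q\<^esub>"
      using e f(2) x0c module_hom_uminus[OF K_module K_module K.alt_sign_hom]
      by (simp add: D_apply hpart_def K.alt_sign_even K.M.r_neg)
    moreover have "D (?x \<oplus>\<^bsub>T\<^esub> f) (p, Suc q) = \<zero>\<^bsub>K p (Suc q)\<^esub>" using D_edge[OF xf] e x0c by simp
    ultimately have "D (?x \<oplus>\<^bsub>T\<^esub> f) \<in> F (int p + 2) (?n + 1)" using F_next2[OF xf] by simp
    then have "?x \<in> cyc 2 (int p) ?n" using xF f by (intro cycI)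
    then have "P ?x y" using x0 by (simp add: P_def single_apply)
    then show "\<exists>x. P x y" by blast
  next
    fix x y assume "P x y"
    then have x: "x \<in> cyc 2 (int p) ?n" "y = c p (x (p, q))" by (auto simp: P_def)
    have xF: "x \<in> F (int p) ?n" using x(1) by (auto elim: cycE)
    then have xc: "x \<in> carrier T" "x (p, q) \<in> carrier (K p q)" using F_carrier by (auto simp: T_simps)
    have xZ: "x (p, q) \<in> ?Zv p" using cycZ[OF x(1)] by simp
    show "x \<in> bnd 2 (int p) ?n \<longleftrightarrow> y \<in> coboundaries Y \<delta> p"
    proof
      assume "x \<in> bnd 2 (int p) ?n"
      then obtain w where w: "w \<in> F (int p - 1) (?n - 1)" "x \<oplus>\<^bsub>T\<^esub> D w \<in> F (int p + 1) ?n" by (auto elim: bndE)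
      have wc: "w \<in> carrier T" using w F_carrier by blast
      \<comment> \<open>\<open>D w\<close> has no component in column \<open>p - 1\<close>, because
        neither \<open>x\<close> nor \<open>x + D w\<close> has one; so the entry of
        \<open>w\<close> there is a vertical cocycle and has a class.\<close>
      have h0: "(\<exists>v \<in> ?Zv p'. hpart w p q = dh p' q v)" if "p = Suc p'" for p'
      proof -
        have wF: "w \<in> F (int p') (int p' + int q)" using w(1) that by simp
        have "D w = (x \<oplus>\<^bsub>T\<^esub> D w) \<ominus>\<^bsub>T\<^esub> x" using xc wc by (subst eq_commute) (simp add: T.minus_eq_iff)
        then have "D w \<in> F (int p) ?n" using F_minus[OF F_SucD[OF w(2)] xF] by simp
        then have "D w (p', Suc q) = \<zero>\<^bsub>K p' (Suc q)\<^esub>" using that by (simp add: F_iff)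
        then have "w (p', q) \<in> ?Zv p'" using D_edge[OF wF] wc by (simp add: cocycles_def T_simps)
        then show ?thesis using that by (auto simp: hpart_def)
      qed
      let ?u = "alt_sign (K p q) p (vpart w p q)"
      have uB: "?u \<in> ?Bv p"
        using vpart_coboundary[OF wc, of p q] K.submodule_uminus[OF col.coboundaries_sub] by (auto simp: alt_sign_def)
      have uZ: "?u \<in> ?Zv p" using uB col.coboundaries_cocycles by blast
      have hZ: "hpart w p q \<in> ?Zv p"
        using h0 dhZ submodule.zero_closed[OF col.cocycles_sub] by (cases p) (auto simp: hpart_def)
      have "(x \<oplus>\<^bsub>T\<^esub> D w) (p, q) = \<zero>\<^bsub>K p q\<^esub>" using w(2) by (simp add: F_iff)
      then have "x (p, q) \<oplus>\<^bsub>K p q\<^esub> (hpart w p q \<oplus>\<^bsub>K p q\<^esub> ?u) = \<zero>\<^bsub>K p q\<^esub>" by (simp add: T_simps D_apply)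
      then have "c p (x (p, q) \<oplus>\<^bsub>K p q\<^esub> (hpart w p q \<oplus>\<^bsub>K p q\<^esub> ?u)) = \<zero>\<^bsub>Y p\<^esub>"
        using c_ker[of "\<zero>\<^bsub>K p q\<^esub>"] submodule.zero_closed[OF col.cocycles_sub] submodule.zero_closed[OF col.coboundaries_sub] by simp
      moreover have "c p ?u = \<zero>\<^bsub>Y p\<^esub>" using c_ker[OF uZ] uB by simp
      ultimately have "c p (x (p, q)) \<oplus>\<^bsub>Y p\<^esub> c p (hpart w p q) = \<zero>\<^bsub>Y p\<^esub>"
        using cadd[OF xZ submodule.m_closed[OF col.cocycles_sub hZ uZ]] cadd[OF hZ uZ] ccl[OF hZ] ccl[OF xZ] by simp
      then have y: "y = \<ominus>\<^bsub>Y p\<^esub> c p (hpart w p q)"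
        using x(2) ccl[OF hZ] ccl[OF xZ] by (intro Y.A.M.minus_equality[symmetric]) auto
      have "c p (hpart w p q) \<in> coboundaries Y \<delta> p"
      proof (cases p)
        case 0
        then show ?thesis using c_ker[OF hZ] submodule.zero_closed[OF col.coboundaries_sub]
          by (simp add: hpart_def coboundaries_0)
      next
        case (Suc p')
        then obtain v where "v \<in> ?Zv p'" "hpart w p q = dh p' q v" using h0 by blast
        then show ?thesis using Suc c_dh ccl by (auto simp: coboundaries_Suc)
      qed
      then show "y \<in> coboundaries Y \<delta> p" using y Y.A.submodule_uminus[OF Y.coboundaries_sub] by simp
    next
      assume y: "y \<in> coboundaries Y \<delta> p"
      \<comment> \<open>\<open>v\<close> represents the class \<open>y\<close> and comes by
        \<open>dh\<close> from a vertical cocycle, or is zero if \<open>p = 0\<close>; the rest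
        \<open>x (p, q) - v\<close> is then a vertical coboundary.\<close>
      obtain v where v: "v \<in> ?Zv p" "p = 0 \<Longrightarrow> v = \<zero>\<^bsub>K p q\<^esub>" "\<And>p'. p = Suc p' \<Longrightarrow> \<exists>y \<in> ?Zv p'. v = dh p' q y" "c p v = y"
      proof (cases p)
        case 0
        then show ?thesis using y that[of "\<zero>\<^bsub>K p q\<^esub>"] c_ker[of "\<zero>\<^bsub>K p q\<^esub>" p] submodule.zero_closed[OF col.coboundaries_sub]
          submodule.zero_closed[OF col.cocycles_sub] by (auto simp: coboundaries_0)
      next
        case (Suc p')
        then obtain y' where "y' \<in> carrier (Y p')" "y = \<delta> p' y'" using y by (auto simp: coboundaries_Suc)
        moreover then obtain v' where v': "v' \<in> ?Zv p'" "y' = c p' v'" using c_surj by blast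
        ultimately show ?thesis using that[of "dh p' q v'"] Suc dhZ[OF v'(1)] c_dh[OF v'(1)] by auto
      qed
      have vc: "v \<in> carrier (K p q)" using v(1) Zc by blast
      let ?u = "x (p, q) \<ominus>\<^bsub>K p q\<^esub> v"
      have "?u \<in> ?Zv p" using K.submodule_minus[OF col.cocycles_sub xZ v(1)] .
      moreover have "c p ?u = \<zero>\<^bsub>Y p\<^esub>" using cmin[OF xZ v(1)] v(4) x(2) ccl[OF xZ] by simp
      ultimately have uB: "?u \<in> ?Bv p" using c_ker by blast
      \<comment> \<open>The sign is inserted here because \<open>D\<close> multiplies the vertical
        part by it once more.\<close>
      have suB: "alt_sign (K p q) p ?u \<in> ?Bv p"
        using uB K.submodule_uminus[OF col.coboundaries_sub] by (auto simp: alt_sign_def)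
      obtain w where w: "w \<in> F (int p - 1) (?n - 1)" "hpart w p q = v" "vpart w p q = alt_sign (K p q) p ?u" "D w \<in> F (int p) ?n"
        using ex_parts[OF vc v(2,3) suB] by blast
      have wc: "w \<in> carrier T" using w F_carrier by blast
      have "D w (p, q) = x (p, q)" using w xc vc
        by (simp add: D_apply K.alt_sign_even K.add_minus_self)
      then have wpq: "(x \<oplus>\<^bsub>T\<^esub> D (\<ominus>\<^bsub>T\<^esub> w)) (p, q) = \<zero>\<^bsub>K p q\<^esub>"
        using wc xc by (simp add: D_uminus[OF wc] T_uminus[of "D w"] T_simps(3) K.M.r_neg)
      have "x \<oplus>\<^bsub>T\<^esub> D (\<ominus>\<^bsub>T\<^esub> w) \<in> F (int p) ?n" using xF w(4) wc F_uminus F_add by (simp add: D_uminus)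
      then have "x \<oplus>\<^bsub>T\<^esub> D (\<ominus>\<^bsub>T\<^esub> w) \<in> F (int p + 1) ?n" using wpq by (rule F_next)
      then show "x \<in> bnd 2 (int p) ?n" using xF F_uminus[OF w(1)] by (intro bndI[of _ _ _ "\<ominus>\<^bsub>T\<^esub> w"]) simp_all
    qed
  qed
  then show ?thesis by (simp add: page_def pg_def)
qed

end

text \<open>Every row \<open>K 0 q\<close>, \<open>K 1 q\<close>, ... is a resolution of
  \<open>B q\<close>: exact in positive degrees, with \<open>B q\<close> as its kernel in degree
  zero. The embedding of \<open>B\<close> into column zero then induces an isomorphism from the
  cohomology of \<open>B\<close> to that of the total complex.\<close>

locale augmented_double_complex = double_complex R K dh dv
  for R :: "('k, 'r) ring_scheme" and K :: "nat \<Rightarrow> nat \<Rightarrow> ('k, 'c) module" and dh dv +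
  fixes B :: "nat \<Rightarrow> ('k, 'e) module" and dB :: "nat \<Rightarrow> 'e \<Rightarrow> 'e" and \<epsilon> :: "nat \<Rightarrow> 'e \<Rightarrow> 'c"
  assumes B_module: "module R (B n)"
    and dB_hom: "dB n \<in> module_hom R (B n) (B (Suc n))"
    and \<epsilon>_hom: "\<epsilon> n \<in> module_hom R (B n) (K 0 n)"
    and \<epsilon>_inj: "inj_on (\<epsilon> n) (carrier (B n))"
    and \<epsilon>_image: "\<epsilon> n ` carrier (B n) = {u \<in> carrier (K 0 n). dh 0 n u = \<zero>\<^bsub>K 1 n\<^esub>}"
    and dv_\<epsilon>: "b \<in> carrier (B n) \<Longrightarrow> dv 0 n (\<epsilon> n b) = \<epsilon> (Suc n) (dB n b)"
    and rows_exact: "\<lbrakk>u \<in> carrier (K (Suc p) q); dh (Suc p) q u = \<zero>\<^bsub>K (Suc (Suc p)) q\<^esub>\<rbrakk> \<Longrightarrow>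
      \<exists>v \<in> carrier (K p q). dh p q v = u"
begin

lemma \<epsilon>_closed [simp]: "b \<in> carrier (B n) \<Longrightarrow> \<epsilon> n b \<in> carrier (K 0 n)"
  by (rule module_homD(1)[OF \<epsilon>_hom])

lemma \<epsilon>_zero [simp]: "\<epsilon> n \<zero>\<^bsub>B n\<^esub> = \<zero>\<^bsub>K 0 n\<^esub>"
  by (rule module_hom_zero[OF B_module K_module \<epsilon>_hom])

lemma dh_\<epsilon>: "b \<in> carrier (B n) \<Longrightarrow> dh 0 n (\<epsilon> n b) = \<zero>\<^bsub>K 1 n\<^esub>"
  using \<epsilon>_image by blast

text \<open>\<open>\<epsilon>\<close> is injective and takes \<open>dB\<close> to \<open>dv\<close>,
  so \<open>dB\<close> squares to zero because \<open>dv\<close> does.\<close>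

sublocale B: cochain_complex R B dB
proof (rule cochain_complex.intro)
  fix b n assume b: "b \<in> carrier (B n)"
  interpret Bn: module R "B (Suc (Suc n))" by (rule B_module)
  have c: "dB n b \<in> carrier (B (Suc n))" "dB (Suc n) (dB n b) \<in> carrier (B (Suc (Suc n)))"
    using b module_homD(1)[OF dB_hom] by auto
  have "\<epsilon> (Suc (Suc n)) (dB (Suc n) (dB n b)) = \<epsilon> (Suc (Suc n)) \<zero>\<^bsub>B (Suc (Suc n))\<^esub>"
    using dv_\<epsilon>[OF c(1)] dv_\<epsilon>[OF b] dv_sq[OF \<epsilon>_closed[OF b]] by simp
  then show "dB (Suc n) (dB n b) = \<zero>\<^bsub>B (Suc (Suc n))\<^esub>"
    using inj_onD[OF \<epsilon>_inj] c(2) by blast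
qed (rule B_module dB_hom)+

definition emb :: "nat \<Rightarrow> 'e \<Rightarrow> (nat \<times> nat \<Rightarrow> 'c)"
  where "emb n b = single 0 n (\<epsilon> n b)"

lemma emb_F: "b \<in> carrier (B n) \<Longrightarrow> emb n b \<in> F 0 (int n)"
  by (auto simp: emb_def intro!: single_F)

lemma emb_T: "b \<in> carrier (B n) \<Longrightarrow> emb n b \<in> carrier T"
  using emb_F F_carrier by blast

lemma emb_add: "\<lbrakk>b \<in> carrier (B n); b' \<in> carrier (B n)\<rbrakk> \<Longrightarrow> emb n (b \<oplus>\<^bsub>B n\<^esub> b') = emb n b \<oplus>\<^bsub>T\<^esub> emb n b'"
  by (auto simp: emb_def single_def T_simps(3) module_homD(2)[OF \<epsilon>_hom])

lemma emb_smult: "\<lbrakk>a \<in> carrier R; b \<in> carrier (B n)\<rbrakk> \<Longrightarrow> emb n (a \<odot>\<^bsub>B n\<^esub> b) = a \<odot>\<^bsub>T\<^esub> emb n b"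
  by (auto simp: emb_def single_def T_simps(4) module_homD(3)[OF \<epsilon>_hom])

lemma emb_zero: "emb n \<zero>\<^bsub>B n\<^esub> = \<zero>\<^bsub>T\<^esub>"
  by (auto simp: emb_def single_def T_simps(2))

lemma emb_inj: "\<lbrakk>b \<in> carrier (B n); b' \<in> carrier (B n); emb n b = emb n b'\<rbrakk> \<Longrightarrow> b = b'"
  unfolding emb_def by (metis single_apply(1) inj_onD \<epsilon>_inj)

lemma D_emb:
  assumes b: "b \<in> carrier (B n)"
  shows "D (emb n b) = emb (Suc n) (dB n b)"
proof
  fix i :: "nat \<times> nat"
  obtain p q where i: "i = (p, q)" by (cases i)
  have h: "hpart (emb n b) p q = \<zero>\<^bsub>K p q\<^esub>"
    using dh_\<epsilon>[OF b] by (auto simp: hpart_def emb_def single_def split: nat.splits)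
  show "D (emb n b) i = emb (Suc n) (dB n b) i"
  proof (cases "p = 0 \<and> q = Suc n")
    case True
    then show ?thesis using b h dv_\<epsilon>[OF b] i dv_closed[of "\<epsilon> n b" 0 n]
      by (simp add: D_apply vpart_def emb_def single_def K.alt_sign_even)
  next
    case False
    then have "vpart (emb n b) p q = \<zero>\<^bsub>K p q\<^esub>"
      by (intro vpart_eq_zero) (auto simp: emb_def single_def)
    then show ?thesis using False h i by (auto simp: D_apply emb_def single_def)
  qed
qed

text \<open>Induction on the last column that may be nonzero. Its entry is killed by
  \<open>dh\<close>, as \<open>D x\<close> vanishes one column further and nothing arrives there
  vertically; exactness of the row gives a preimage, and subtracting the total differential of that
  preimage clears the column. \<open>D x\<close> has to vanish off column zero only: this holds for
  cocycles, and also for a \<open>w\<close> whose differential lies in column zero.\<close>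

lemma push_to_column_zero:
  assumes "x \<in> F 0 (int n)" "\<And>i j. i > m \<Longrightarrow> x (i, j) = \<zero>\<^bsub>K i j\<^esub>" "\<And>i j. i > 0 \<Longrightarrow> D x (i, j) = \<zero>\<^bsub>K i j\<^esub>"
  shows "\<exists>y \<in> F 0 (int n - 1). \<exists>x' \<in> F 0 (int n). x = x' \<oplus>\<^bsub>T\<^esub> D y \<and> (\<forall>i j. i > 0 \<longrightarrow> x' (i, j) = \<zero>\<^bsub>K i j\<^esub>)"
  using assms
proof (induction m arbitrary: x)
  case 0
  then show ?case
    by (intro bexI[of _ "\<zero>\<^bsub>T\<^esub>"] bexI[of _ x]) (auto simp: D_zero F_zero F_carrier)
next
  case (Suc m)
  have xc: "x \<in> carrier T" using Suc.prems(1) F_carrier by blast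
  show ?case
  proof (cases "Suc m \<le> n")
    case False
    \<comment> \<open>Beyond column \<open>n\<close> there is no entry of total degree
      \<open>n\<close>, so the column is already empty.\<close>
    have "x (i, j) = \<zero>\<^bsub>K i j\<^esub>" if "i > m" for i j
    proof -
      have "int i + int j \<noteq> int n" using that False by linarith
      then show ?thesis using Suc.prems(1) by (auto simp: F_iff)
    qed
    then show ?thesis using Suc.IH[OF Suc.prems(1) _ Suc.prems(3)] by blast
  next
    case True
    define j where "j = n - Suc m"
    have j: "Suc m + j = n" using True by (simp add: j_def)
    let ?u = "x (Suc m, j)"
    have u: "?u \<in> carrier (K (Suc m) j)" using xc by (simp add: T_simps)
    have "vpart x (Suc (Suc m)) j = \<zero>\<^bsub>K (Suc (Suc m)) j\<^esub>"
      using Suc.prems(2) by (intro vpart_eq_zero) simp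
    then have "D x (Suc (Suc m), j) = dh (Suc m) j ?u" using u by (simp add: D_apply hpart_def)
    then have "dh (Suc m) j ?u = \<zero>\<^bsub>K (Suc (Suc m)) j\<^esub>" using Suc.prems(3)[of "Suc (Suc m)" j] by simp
    then obtain v where v: "v \<in> carrier (K m j)" "dh m j v = ?u" using rows_exact[OF u] by blast
    define y where "y = single m j v"
    have yF: "y \<in> F 0 (int n - 1)" using v(1) j by (auto simp: y_def intro!: single_F)
    have yc: "y \<in> carrier T" "D y \<in> carrier T" using yF F_carrier D_T by auto
    define z where "z = x \<ominus>\<^bsub>T\<^esub> D y"
    have DyF: "D y \<in> F 0 (int n)" using F_D[OF yF] by simp
    have zF: "z \<in> F 0 (int n)" unfolding z_def using Suc.prems(1) DyF by (rule F_minus)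
    have Dy: "D y (Suc m, j) = ?u"
    proof -
      have "vpart y (Suc m) j = \<zero>\<^bsub>K (Suc m) j\<^esub>" by (intro vpart_eq_zero) (simp add: y_def single_def)
      then show ?thesis using v u by (simp add: D_apply hpart_def y_def single_apply)
    qed
    \<comment> \<open>\<open>D y\<close> has entries in columns \<open>m\<close> and
      \<open>m + 1\<close> only. The latter cancel; whatever appears in column \<open>m\<close> is
      left to the induction hypothesis.\<close>
    have "z (i, k) = \<zero>\<^bsub>K i k\<^esub>" if i: "i > m" for i k
    proof (cases "i = Suc m")
      case True
      show ?thesis
      proof (cases "k = j")
        case kj: True
        show ?thesis using True kj Dy u xc yc unfolding z_def by (simp add: T_minus)
      next
        case False
        then have "int i + int k \<noteq> int n" using True j by linarith
        then show ?thesis using zF by (auto simp: F_iff)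
      qed
    next
      case False
      then have i: "i > Suc m" using i by simp
      have "hpart y i k = \<zero>\<^bsub>K i k\<^esub>" using i by (intro hpart_eq_zero) (auto simp: y_def single_def)
      moreover have "vpart y i k = \<zero>\<^bsub>K i k\<^esub>" using i by (intro vpart_eq_zero) (auto simp: y_def single_def)
      ultimately have "D y (i, k) = \<zero>\<^bsub>K i k\<^esub>" by (simp add: D_apply)
      then show ?thesis using Suc.prems(2)[OF i, of k] xc yc unfolding z_def by (simp add: T_minus)
    qed
    moreover have Dz: "D z = D x" using xc yc by (simp add: z_def D_minus D_sq)
    ultimately obtain y' x' where h: "y' \<in> F 0 (int n - 1)" "x' \<in> F 0 (int n)" "z = x' \<oplus>\<^bsub>T\<^esub> D y'"
      "\<forall>i j. i > 0 \<longrightarrow> x' (i, j) = \<zero>\<^bsub>K i j\<^esub>"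
      using Suc.IH[OF zF] Suc.prems(3) by metis
    have hc: "x' \<in> carrier T" "y' \<in> carrier T" "D y' \<in> carrier T" using h F_carrier D_T by auto
    have "x = z \<oplus>\<^bsub>T\<^esub> D y" using xc yc by (simp add: z_def T.minus_add_cancel)
    also have "\<dots> = x' \<oplus>\<^bsub>T\<^esub> D (y' \<oplus>\<^bsub>T\<^esub> y)" using h(3) hc yc by (simp add: D_add T.M.a_assoc)
    finally have "x = x' \<oplus>\<^bsub>T\<^esub> D (y' \<oplus>\<^bsub>T\<^esub> y)" .
    moreover have "y' \<oplus>\<^bsub>T\<^esub> y \<in> F 0 (int n - 1)" using h(1) yF by (rule F_add)
    ultimately show ?thesis using h(2,4) by blast
  qed
qed

text \<open>Once pushed into column zero, the element is killed by \<open>dh\<close>, because its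
  differential has no entry in column one; such elements are the values of
  \<open>\<epsilon>\<close>.\<close>

lemma reduce_to_emb:
  assumes x: "x \<in> F 0 (int n)" "\<And>i j. i > 0 \<Longrightarrow> D x (i, j) = \<zero>\<^bsub>K i j\<^esub>"
  shows "\<exists>b \<in> carrier (B n). \<exists>y \<in> F 0 (int n - 1). x = emb n b \<oplus>\<^bsub>T\<^esub> D y"
proof -
  have "x (i, j) = \<zero>\<^bsub>K i j\<^esub>" if "i > n" for i j
  proof -
    have "int i + int j \<noteq> int n" using that by linarith
    then show ?thesis using x(1) by (auto simp: F_iff)
  qed
  then obtain y x' where h: "y \<in> F 0 (int n - 1)" "x' \<in> F 0 (int n)" "x = x' \<oplus>\<^bsub>T\<^esub> D y"
    "\<forall>i j. i > 0 \<longrightarrow> x' (i, j) = \<zero>\<^bsub>K i j\<^esub>"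
    using push_to_column_zero[OF x(1) _ x(2), of n] by blast
  have c: "x' \<in> carrier T" "y \<in> carrier T" "D y \<in> carrier T" using h F_carrier D_T by auto
  have Dx': "D x' = D x" using h(3) c by (simp add: D_add D_sq)
  have u: "x' (0, n) \<in> carrier (K 0 n)" using c by (simp add: T_simps)
  have "vpart x' 1 n = \<zero>\<^bsub>K 1 n\<^esub>" using h(4) by (intro vpart_eq_zero) simp
  then have "D x' (1, n) = dh 0 n (x' (0, n))" using u by (simp add: D_apply hpart_def)
  then have "dh 0 n (x' (0, n)) = \<zero>\<^bsub>K 1 n\<^esub>" using x(2)[of 1 n] Dx' by simp
  then have "x' (0, n) \<in> \<epsilon> n ` carrier (B n)" using u \<epsilon>_image by blast
  then obtain b where b: "b \<in> carrier (B n)" "x' (0, n) = \<epsilon> n b" by blast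
  have "x' = emb n b"
  proof
    fix i :: "nat \<times> nat"
    obtain p q where i: "i = (p, q)" by (cases i)
    show "x' i = emb n b i"
    proof (cases "p = 0 \<and> q = n")
      case True then show ?thesis using i b by (simp add: emb_def single_def)
    next
      case False
      then have "p > 0 \<or> int p + int q \<noteq> int n" by auto
      then have "x' (p, q) = \<zero>\<^bsub>K p q\<^esub>" using h(2,4) by (auto simp: F_iff)
      then show ?thesis using i False by (auto simp: emb_def single_def)
    qed
  qed
  then show ?thesis using b h by blast
qed

text \<open>\<open>P x b\<close> says that \<open>x\<close> is cohomologous to the image of
  \<open>b\<close> in column zero. That some \<open>b\<close> exists is
  \<open>reduce_to_emb\<close>; the same lemma, applied one degree lower, shows that the class of
  \<open>b\<close> is determined by \<open>x\<close>.\<close>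

lemma ex_to_cohomology:
  "\<exists>c. c \<in> module_hom R (T\<lparr>carrier := {x \<in> F 0 (int n). D x = \<zero>\<^bsub>T\<^esub>}\<rparr>) (cohomology B dB n) \<and>
    c ` {x \<in> F 0 (int n). D x = \<zero>\<^bsub>T\<^esub>} = carrier (cohomology B dB n) \<and>
    (\<forall>x \<in> F 0 (int n). D x = \<zero>\<^bsub>T\<^esub> \<longrightarrow> (c x = \<zero>\<^bsub>cohomology B dB n\<^esub> \<longleftrightarrow> x \<in> D ` F 0 (int n - 1)))"
proof -
  let ?Z = "{x \<in> F 0 (int n). D x = \<zero>\<^bsub>T\<^esub>}"
  define P where "P x b \<longleftrightarrow> x \<in> ?Z \<and> b \<in> cocycles B dB n \<and> (\<exists>y \<in> F 0 (int n - 1). x = emb n b \<oplus>\<^bsub>T\<^esub> D y)" for x b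
  have Zsub: "submodule R ?Z T"
    by (rule T.kernel_submodule[OF T_module F_sub module_hom_restrict[OF D_hom T.subset_submodule[OF F_sub]]])
  have bc: "b \<in> cocycles B dB n \<Longrightarrow> b \<in> carrier (B n)" for b by (simp add: cocycles_def)
  have D0: "i > 0 \<Longrightarrow> D x (i, j) = \<zero>\<^bsub>K i j\<^esub>" if "D x = \<zero>\<^bsub>T\<^esub>" for x i j using that by (simp add: T_simps(2))
  have tot: "\<exists>b. P x b" if x: "x \<in> ?Z" for x
  proof -
    obtain b y where h: "b \<in> carrier (B n)" "y \<in> F 0 (int n - 1)" "x = emb n b \<oplus>\<^bsub>T\<^esub> D y"
      using reduce_to_emb[of x n] D0 x by blast
    have yc: "y \<in> carrier T" "D y \<in> carrier T" using h(2) F_carrier D_T by auto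
    have "D (emb n b) = \<zero>\<^bsub>T\<^esub>" using x h yc emb_T[OF h(1)] by (simp add: D_add D_sq)
    then have "emb (Suc n) (dB n b) = emb (Suc n) \<zero>\<^bsub>B (Suc n)\<^esub>" using D_emb[OF h(1)] emb_zero by simp
    then have "dB n b = \<zero>\<^bsub>B (Suc n)\<^esub>"
      by (rule emb_inj[rotated 2]) (simp_all add: h(1))
    then have "P x b" unfolding P_def cocycles_def using x h by blast
    then show ?thesis by blast
  qed
  interpret linear_relation R T "B n" P ?Z "cocycles B dB n"
  proof (intro linear_relation.intro linear_relation_axioms.intro)
    show "plain_module R T" by (rule T.plain_module_axioms)
    show "plain_module R (B n)" by (rule B.A.plain_module_axioms)
    show "submodule R ?Z T" by (rule Zsub)
    show "submodule R (cocycles B dB n) (B n)" by (rule B.cocycles_sub)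
    show "x \<in> ?Z \<and> b \<in> cocycles B dB n" if "P x b" for x b using that by (simp add: P_def)
    show "\<exists>b. P x b" if "x \<in> ?Z" for x using that by (rule tot)
  next
    fix x b x' b' assume p: "P x b" "P x' b'"
    then obtain y y' where y: "y \<in> F 0 (int n - 1)" "x = emb n b \<oplus>\<^bsub>T\<^esub> D y" "y' \<in> F 0 (int n - 1)" "x' = emb n b' \<oplus>\<^bsub>T\<^esub> D y'"
      by (auto simp: P_def)
    have b: "b \<in> cocycles B dB n" "b' \<in> cocycles B dB n" "x \<in> ?Z" "x' \<in> ?Z" using p by (simp_all add: P_def)
    have "y \<in> carrier T" "y' \<in> carrier T" "D y \<in> carrier T" "D y' \<in> carrier T" using y F_carrier D_T by auto
    then have "x \<oplus>\<^bsub>T\<^esub> x' = emb n (b \<oplus>\<^bsub>B n\<^esub> b') \<oplus>\<^bsub>T\<^esub> D (y \<oplus>\<^bsub>T\<^esub> y')"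
      using y b bc emb_T by (simp add: emb_add D_add add4)
    moreover have "y \<oplus>\<^bsub>T\<^esub> y' \<in> F 0 (int n - 1)" using y by (simp add: F_add)
    ultimately show "P (x \<oplus>\<^bsub>T\<^esub> x') (b \<oplus>\<^bsub>B n\<^esub> b')"
      unfolding P_def using submodule.m_closed[OF Zsub b(3,4)] submodule.m_closed[OF B.cocycles_sub b(1,2)] by blast
  next
    fix a x b assume a: "a \<in> carrier R" and p: "P x b"
    then obtain y where y: "y \<in> F 0 (int n - 1)" "x = emb n b \<oplus>\<^bsub>T\<^esub> D y" by (auto simp: P_def)
    have b: "b \<in> cocycles B dB n" "x \<in> ?Z" using p by (simp_all add: P_def)
    have "y \<in> carrier T" "D y \<in> carrier T" using y F_carrier D_T by auto
    then have "a \<odot>\<^bsub>T\<^esub> x = emb n (a \<odot>\<^bsub>B n\<^esub> b) \<oplus>\<^bsub>T\<^esub> D (a \<odot>\<^bsub>T\<^esub> y)"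
      using y b bc emb_T a by (simp add: emb_smult D_smult T.smult_r_distr)
    moreover have "a \<odot>\<^bsub>T\<^esub> y \<in> F 0 (int n - 1)" using y a by (simp add: F_smult)
    ultimately show "P (a \<odot>\<^bsub>T\<^esub> x) (a \<odot>\<^bsub>B n\<^esub> b)"
      unfolding P_def using submodule.smult_closed[OF Zsub a b(2)] submodule.smult_closed[OF B.cocycles_sub a b(1)] by blast
  qed
  \<comment> \<open>If \<open>emb n b = D w\<close>, then \<open>w\<close> is some
    \<open>emb m b'\<close> up to a coboundary, so \<open>emb n b = emb n (dB m b')\<close> and
    \<open>b = dB m b'\<close> by injectivity.\<close>
  have cob: "b \<in> coboundaries B dB n" if b: "b \<in> carrier (B n)" and w: "w \<in> F 0 (int n - 1)" "emb n b = D w" for b w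
  proof (cases n)
    case 0
    then have "w = \<zero>\<^bsub>T\<^esub>" using w(1) F_high[of "-1" 0] by simp
    then have "emb n b = emb n \<zero>\<^bsub>B n\<^esub>" using w(2) D_zero emb_zero by simp
    then have "b = \<zero>\<^bsub>B n\<^esub>" by (rule emb_inj[rotated 2]) (simp_all add: b)
    then show ?thesis using 0 by (simp add: coboundaries_0)
  next
    case (Suc m)
    then have wF: "w \<in> F 0 (int m)" using w(1) by simp
    have "D w (i, j) = \<zero>\<^bsub>K i j\<^esub>" if "i > 0" for i j using that w(2)[symmetric] by (simp add: emb_def single_def)
    then obtain b' y where h: "b' \<in> carrier (B m)" "y \<in> F 0 (int m - 1)" "w = emb m b' \<oplus>\<^bsub>T\<^esub> D y"
      using reduce_to_emb[OF wF] by blast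
    have yc: "y \<in> carrier T" "D y \<in> carrier T" using h(2) F_carrier D_T by auto
    have "D w = D (emb m b')" using h yc emb_T[OF h(1)] by (simp add: D_add D_sq)
    then have "emb n b = emb n (dB m b')" using w(2) D_emb[OF h(1)] Suc by simp
    then have "b = dB m b'" by (rule emb_inj[rotated 2]) (use b h(1) Suc in simp_all)
    then show ?thesis using h(1) Suc by (simp add: coboundaries_Suc)
  qed
  have zero: "b \<in> coboundaries B dB n" if pz: "P \<zero>\<^bsub>T\<^esub> b" for b
  proof -
    obtain y where y: "y \<in> F 0 (int n - 1)" "\<zero>\<^bsub>T\<^esub> = emb n b \<oplus>\<^bsub>T\<^esub> D y" using pz by (auto simp: P_def)
    have b: "b \<in> carrier (B n)" using pz bc by (simp add: P_def)
    have yc: "y \<in> carrier T" "D y \<in> carrier T" using y F_carrier D_T by auto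
    have "emb n b = \<ominus>\<^bsub>T\<^esub> D y" using y(2) yc emb_T[OF b] by (intro T.M.minus_equality[symmetric]) auto
    then have "emb n b = D (\<ominus>\<^bsub>T\<^esub> y)" using yc by (simp add: D_uminus)
    then show ?thesis using cob[OF b F_uminus[OF y(1)]] by simp
  qed
  obtain c where c: "c \<in> module_hom R (T\<lparr>carrier := ?Z\<rparr>) (subquotient (B n) (cocycles B dB n) (coboundaries B dB n))"
    "\<And>x b. P x b \<Longrightarrow> c x = coboundaries B dB n +>\<^bsub>B n\<^esub> b"
    using ex_hom[OF B.coboundaries_sub B.coboundaries_cocycles zero] by blast
  have car: "carrier (cohomology B dB n) = (\<lambda>b. coboundaries B dB n +>\<^bsub>B n\<^esub> b) ` cocycles B dB n"
    and zer: "\<zero>\<^bsub>cohomology B dB n\<^esub> = coboundaries B dB n"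
    by (simp_all add: cohomology_def subquotient_simps)
  have surj: "c ` ?Z = carrier (cohomology B dB n)"
  proof (intro subset_antisym subsetI)
    fix X assume "X \<in> c ` ?Z"
    then obtain x where "x \<in> ?Z" "X = c x" by blast
    then show "X \<in> carrier (cohomology B dB n)" using tot c(2) P_dom unfolding car by blast
  next
    fix X assume "X \<in> carrier (cohomology B dB n)"
    then obtain b where b: "b \<in> cocycles B dB n" "X = coboundaries B dB n +>\<^bsub>B n\<^esub> b" using car by blast
    have bB: "b \<in> carrier (B n)" using b bc by blast
    have "D (emb n b) = \<zero>\<^bsub>T\<^esub>" using D_emb[OF bB] b(1) by (simp add: cocycles_def emb_zero)
    moreover have "emb n b = emb n b \<oplus>\<^bsub>T\<^esub> D \<zero>\<^bsub>T\<^esub>" using emb_T[OF bB] by (simp add: D_zero)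
    ultimately have "P (emb n b) b" unfolding P_def using b(1) emb_F[OF bB] F_zero by blast
    then show "X \<in> c ` ?Z" using b(2) c(2) P_dom by blast
  qed
  have ker: "c x = \<zero>\<^bsub>cohomology B dB n\<^esub> \<longleftrightarrow> x \<in> D ` F 0 (int n - 1)" if x: "x \<in> ?Z" for x
  proof
    assume cx: "c x = \<zero>\<^bsub>cohomology B dB n\<^esub>"
    obtain b where p: "P x b" using tot[OF x] by blast
    then obtain y where y: "y \<in> F 0 (int n - 1)" "x = emb n b \<oplus>\<^bsub>T\<^esub> D y" by (auto simp: P_def)
    have yc: "y \<in> carrier T" "D y \<in> carrier T" using y F_carrier D_T by auto
    have b: "b \<in> carrier (B n)" using P_dom[OF p] bc by blast
    have bb: "b \<in> coboundaries B dB n" using cx c(2)[OF p] zer B.A.coset_eq_self_iff[OF B.coboundaries_sub b] by simp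
    have "\<exists>w \<in> F 0 (int n - 1). emb n b = D w"
    proof (cases n)
      case 0
      then show ?thesis using bb emb_zero D_zero F_zero by (auto simp: coboundaries_0 intro!: bexI[of _ "\<zero>\<^bsub>T\<^esub>"])
    next
      case (Suc m)
      then obtain b' where "b' \<in> carrier (B m)" "b = dB m b'" using bb by (auto simp: coboundaries_Suc)
      then show ?thesis using Suc D_emb emb_F by (auto intro!: bexI[of _ "emb m b'"])
    qed
    then obtain w where w: "w \<in> F 0 (int n - 1)" "emb n b = D w" by blast
    then have "x = D (w \<oplus>\<^bsub>T\<^esub> y)" using y(2) yc F_carrier by (simp add: D_add)
    then show "x \<in> D ` F 0 (int n - 1)" using F_add[OF w(1) y(1)] by blast
  next
    assume "x \<in> D ` F 0 (int n - 1)"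
    then obtain w where w: "w \<in> F 0 (int n - 1)" "x = D w" by blast
    have "x = emb n \<zero>\<^bsub>B n\<^esub> \<oplus>\<^bsub>T\<^esub> D w" using w F_carrier D_T by (simp add: emb_zero)
    then have "P x \<zero>\<^bsub>B n\<^esub>" unfolding P_def using x w submodule.zero_closed[OF B.cocycles_sub] by blast
    then show "c x = \<zero>\<^bsub>cohomology B dB n\<^esub>" using c(2) zer B.A.coset_zero[OF B.coboundaries_sub] by simp
  qed
  have "c \<in> module_hom R (T\<lparr>carrier := ?Z\<rparr>) (cohomology B dB n)" using c(1) by (simp add: cohomology_def)
  then show ?thesis using surj ker by blast
qed

theorem page_converges_to_cohomology:
  assumes "field R"
  shows "converges_to R page (cohomology B dB)"
proof -
  define Q where "Q n c \<longleftrightarrow> c \<in> module_hom R (T\<lparr>carrier := {x \<in> F 0 (int n). D x = \<zero>\<^bsub>T\<^esub>}\<rparr>) (cohomology B dB n) \<and>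
    c ` {x \<in> F 0 (int n). D x = \<zero>\<^bsub>T\<^esub>} = carrier (cohomology B dB n) \<and>
    (\<forall>x \<in> F 0 (int n). D x = \<zero>\<^bsub>T\<^esub> \<longrightarrow> (c x = \<zero>\<^bsub>cohomology B dB n\<^esub> \<longleftrightarrow> x \<in> D ` F 0 (int n - 1)))" for n c
  have "\<forall>n. \<exists>c. Q n c" unfolding Q_def using ex_to_cohomology by (intro allI)
  then obtain c where "\<forall>n. Q n (c n)" using choice[of Q] by blast
  then have c: "Q n (c n)" for n by simp
  show ?thesis
  proof (rule page_converges[OF assms B.cohomology_module])
    fix n
    show "c n \<in> module_hom R (T\<lparr>carrier := {x \<in> F 0 (int n). D x = \<zero>\<^bsub>T\<^esub>}\<rparr>) (cohomology B dB n)"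
      "c n ` {x \<in> F 0 (int n). D x = \<zero>\<^bsub>T\<^esub>} = carrier (cohomology B dB n)"
      using c[of n] unfolding Q_def by simp_all
    show "c n x = \<zero>\<^bsub>cohomology B dB n\<^esub> \<longleftrightarrow> x \<in> D ` F 0 (int n - 1)"
      if "x \<in> F 0 (int n)" "D x = \<zero>\<^bsub>T\<^esub>" for x
      using c[of n] that unfolding Q_def by simp
  qed
qed

end

section \<open>Transport of spectral sequences\<close>

definition transport_module :: "('k, 'a) module \<Rightarrow> ('a \<Rightarrow> 'b) \<Rightarrow> ('k, 'b) module"
  where "transport_module V j = (let g = inv_into (carrier V) j in
    \<lparr>carrier = j ` carrier V, mult = undefined, one = undefined, zero = j \<zero>\<^bsub>V\<^esub>,
     add = (\<lambda>x y. j (g x \<oplus>\<^bsub>V\<^esub> g y)), smult = (\<lambda>a x. j (a \<odot>\<^bsub>V\<^esub> g x))\<rparr>)"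

lemma transport_simps:
  assumes "inj_on j (carrier V)"
  shows "carrier (transport_module V j) = j ` carrier V"
    and "\<zero>\<^bsub>transport_module V j\<^esub> = j \<zero>\<^bsub>V\<^esub>"
    and "\<lbrakk>x \<in> carrier V; y \<in> carrier V\<rbrakk> \<Longrightarrow> j x \<oplus>\<^bsub>transport_module V j\<^esub> j y = j (x \<oplus>\<^bsub>V\<^esub> y)"
    and "x \<in> carrier V \<Longrightarrow> a \<odot>\<^bsub>transport_module V j\<^esub> j x = j (a \<odot>\<^bsub>V\<^esub> x)"
  using assms by (simp_all add: transport_module_def Let_def)

lemma transport_module:
  assumes V: "module R V" and j: "inj_on j (carrier V)"
  shows "module R (transport_module V j)"
proof -
  interpret V: plain_module R V using V by (simp add: plain_module_def)
  show ?thesis using V.submodule_carrier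
    by (intro V.module_image[where Z="carrier V" and f=j]) (simp_all add: transport_simps[OF j])
qed

lemma transport_hom: "inj_on j (carrier V) \<Longrightarrow> j \<in> module_hom R V (transport_module V j)"
  by (rule module_homI) (simp_all add: transport_simps)

lemma transport_inv_hom:
  assumes V: "module R V" and j: "inj_on j (carrier V)"
  shows "inv_into (carrier V) j \<in> module_hom R (transport_module V j) V"
proof -
  interpret V: module R V by fact
  note [simp] = transport_simps[OF j]
  show ?thesis by (rule module_homI) (auto simp: j)
qed

lemma transport_isomorphic: "inj_on j (carrier V) \<Longrightarrow> module_isomorphic R V (transport_module V j)"
  unfolding module_isomorphic_def
  by (intro bexI[OF _ transport_hom]) (auto simp: bij_betw_def transport_simps)

text \<open>A coset is recovered from any of its members, so choosing one member from each coset
  embeds the subquotient into the module it was formed from.\<close>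

lemma inj_on_cosets:
  assumes "module R V" "submodule R W V" "Z \<subseteq> carrier V"
  shows "\<exists>j. inj_on j (carrier (subquotient V Z W)) \<and> j ` carrier (subquotient V Z W) \<subseteq> carrier V"
proof -
  interpret V: plain_module R V using assms by (simp add: plain_module_def)
  have rep: "(SOME x. x \<in> C) \<in> carrier V \<and> C = W +>\<^bsub>V\<^esub> (SOME x. x \<in> C)" if C: "C \<in> carrier (subquotient V Z W)" for C
  proof -
    obtain z where z: "z \<in> carrier V" "C = W +>\<^bsub>V\<^esub> z" using C assms(3) unfolding subquotient_simps by blast
    have "z \<in> C" using z assms(2) by (simp add: V.coset_self)
    then have s: "(SOME x. x \<in> C) \<in> W +>\<^bsub>V\<^esub> z" using z(2) someI[of "\<lambda>x. x \<in> C"] by blast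
    then show ?thesis using V.coset_of_mem[OF assms(2) z(1) s] V.mem_coset_iff[OF assms(2) z(1)] z(2) by blast
  qed
  have "inj_on (\<lambda>C. SOME x. x \<in> C) (carrier (subquotient V Z W))"
  proof (rule inj_onI)
    fix C C' assume "C \<in> carrier (subquotient V Z W)" "C' \<in> carrier (subquotient V Z W)" "(SOME x. x \<in> C) = (SOME x. x \<in> C')"
    then show "C = C'" using rep[of C] rep[of C'] by simp
  qed
  moreover have "(\<lambda>C. SOME x. x \<in> C) ` carrier (subquotient V Z W) \<subseteq> carrier V"
    using rep by (intro image_subsetI) simp
  ultimately show ?thesis by (intro exI[of _ "\<lambda>C. SOME x. x \<in> C"]) simp
qed

text \<open>Each page is a subquotient of the one before, and choosing representatives embeds it
  there; an embedding of page 2 into the new type therefore yields embeddings of all later pages.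
  Modules and differentials are then moved along these injections onto their images.\<close>

theorem (in first_quadrant_spectral_sequence) transport:
  assumes base: "\<And>p q. \<exists>j :: 'e \<Rightarrow> 'f. inj_on j (carrier (E 2 p q))"
  obtains E' :: "nat \<Rightarrow> int \<Rightarrow> int \<Rightarrow> ('k, 'f) module" and d'
  where "first_quadrant_spectral_sequence k E' d'"
    and "\<And>r p q. 2 \<le> r \<Longrightarrow> module_isomorphic k (E r p q) (E' r p q)"
proof -
  have modE: "module k (E r p q)" if "2 \<le> r" for r p q
    using page_vectorspace[OF that] by (simp add: vectorspace_def)
  have "\<exists>j :: 'e \<Rightarrow> 'f. inj_on j (carrier (E r p q))" if r: "2 \<le> r" for r p q
    using r
  proof (induction r arbitrary: p q rule: dec_induct)
    case base
    show ?case by (rule assms)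
  next
    case (step r)
    let ?Z = "{x \<in> carrier (E r p q). d r p q x = \<zero>\<^bsub>E r (p + int r) (q - int r + 1)\<^esub>}"
    let ?W = "d r (p - int r) (q + int r - 1) ` carrier (E r (p - int r) (q + int r - 1))"
    interpret P: plain_module k "E r p q" using modE[OF step(1)] by (simp add: plain_module_def)
    interpret P': plain_module k "E r (p - int r) (q + int r - 1)" using modE[OF step(1)] by (simp add: plain_module_def)
    have h: "d r (p - int r) (q + int r - 1) \<in> module_hom k (E r (p - int r) (q + int r - 1)) (E r p q)"
      using differential_linear[OF step(1), of "p - int r" "q + int r - 1"] by simp
    have W: "submodule k ?W (E r p q)"
      using P.submodule_image[OF P'.module_axioms _ P'.submodule_carrier, of "d r (p - int r) (q + int r - 1)"] h by simp
    obtain i where i: "inj_on i (carrier (subquotient (E r p q) ?Z ?W))" "i ` carrier (subquotient (E r p q) ?Z ?W) \<subseteq> carrier (E r p q)"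
      using inj_on_cosets[OF P.module_axioms W, of ?Z] by blast
    obtain h where h: "bij_betw h (carrier (E (Suc r) p q)) (carrier (subquotient (E r p q) ?Z ?W))"
      using next_page[OF step(1), of p q] unfolding module_isomorphic_def by blast
    obtain j :: "'e \<Rightarrow> 'f" where j: "inj_on j (carrier (E r p q))" using step by blast
    \<comment> \<open>\<open>h\<close> leads from the next page to the subquotient of page
      \<open>r\<close>, and \<open>i\<close> from there to representatives on page \<open>r\<close>,
      where \<open>j\<close> applies.\<close>
    have ih: "inj_on (i \<circ> h) (carrier (E (Suc r) p q))"
      using h i(1) by (intro comp_inj_on) (auto simp: bij_betw_def)
    have "(i \<circ> h) ` carrier (E (Suc r) p q) \<subseteq> carrier (E r p q)"
      using h i(2) unfolding bij_betw_def image_comp[symmetric] by simp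
    then have "inj_on (j \<circ> (i \<circ> h)) (carrier (E (Suc r) p q))"
      by (rule comp_inj_on[OF ih inj_on_subset[OF j]])
    then show ?case by blast
  qed
  note ex_j = this
  define j :: "nat \<Rightarrow> int \<Rightarrow> int \<Rightarrow> 'e \<Rightarrow> 'f" where "j r p q = (SOME j. inj_on j (carrier (E r p q)))" for r p q
  have j: "inj_on (j r p q) (carrier (E r p q))" if "2 \<le> r" for r p q
    unfolding j_def by (rule someI_ex[OF ex_j[OF that]])
  define E' where "E' r p q = transport_module (E r p q) (j r p q)" for r p q
  define g where "g r p q = inv_into (carrier (E r p q)) (j r p q)" for r p q
  define d' where "d' r p q x = j r (p + int r) (q - int r + 1) (d r p q (g r p q x))" for r p q x
  have jh: "j r p q \<in> module_hom k (E r p q) (E' r p q)" if "2 \<le> r" for r p q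
    unfolding E'_def by (rule transport_hom[OF j[OF that]])
  have gh: "g r p q \<in> module_hom k (E' r p q) (E r p q)" if "2 \<le> r" for r p q
    unfolding E'_def g_def by (rule transport_inv_hom[OF modE[OF that] j[OF that]])
  have gj: "g r p q (j r p q x) = x" if "2 \<le> r" "x \<in> carrier (E r p q)" for r p q x
    unfolding g_def using j[OF that(1)] that(2) by simp
  have car: "carrier (E' r p q) = j r p q ` carrier (E r p q)" and zer: "\<zero>\<^bsub>E' r p q\<^esub> = j r p q \<zero>\<^bsub>E r p q\<^esub>" if "2 \<le> r" for r p q
    unfolding E'_def by (simp_all add: transport_simps[OF j[OF that]])
  have modE': "module k (E' r p q)" if "2 \<le> r" for r p q
    unfolding E'_def by (rule transport_module[OF modE[OF that] j[OF that]])
  have iso: "module_isomorphic k (E r p q) (E' r p q)" if "2 \<le> r" for r p q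
    unfolding E'_def by (rule transport_isomorphic[OF j[OF that]])
  have dj: "d' r p q (j r p q x) = j r (p + int r) (q - int r + 1) (d r p q x)" if "2 \<le> r" "x \<in> carrier (E r p q)" for r p q x
    using gj[OF that] by (simp add: d'_def)
  have dcl: "d r p q x \<in> carrier (E r (p + int r) (q - int r + 1))" if "2 \<le> r" "x \<in> carrier (E r p q)" for r p q x
    using module_homD(1)[OF differential_linear[OF that(1)] that(2)] .
  have "first_quadrant_spectral_sequence k E' d'"
  proof (rule first_quadrant_spectral_sequence.intro)
    fix r :: nat and p q :: int assume r: "2 \<le> r"
    show "vectorspace k (E' r p q)" using page_vectorspace[OF r, of p q] modE'[OF r] by (simp add: vectorspace_def)
    show "d' r p q \<in> module_hom k (E' r p q) (E' r (p + int r) (q - int r + 1))"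
      unfolding d'_def
      by (rule module_hom_compose[OF module_hom_compose[OF gh[OF r] differential_linear[OF r]] jh[OF r]])
    show "carrier (E' r p q) = {\<zero>\<^bsub>E' r p q\<^esub>}" if "p < 0 \<or> q < 0"
      using first_quadrant[OF r that] by (simp add: car[OF r] zer[OF r])
    show "d' r (p + int r) (q - int r + 1) (d' r p q x) = \<zero>\<^bsub>E' r (p + 2 * int r) (q - 2 * int r + 2)\<^esub>"
      if x: "x \<in> carrier (E' r p q)" for x
    proof -
      obtain y where y: "y \<in> carrier (E r p q)" "x = j r p q y" using x car[OF r] by blast
      have i: "p + int r + int r = p + 2 * int r" "q - int r + 1 - int r + 1 = q - 2 * int r + 2" by simp_all
      show ?thesis
        by (simp only: y(2) dj[OF r y(1)] dj[OF r dcl[OF r y(1)]] differential_square[OF r y(1)] zer[OF r] i)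
    qed
    let ?Z = "{x \<in> carrier (E r p q). d r p q x = \<zero>\<^bsub>E r (p + int r) (q - int r + 1)\<^esub>}"
    let ?W = "d r (p - int r) (q + int r - 1) ` carrier (E r (p - int r) (q + int r - 1))"
    let ?Z' = "{x \<in> carrier (E' r p q). d' r p q x = \<zero>\<^bsub>E' r (p + int r) (q - int r + 1)\<^esub>}"
    let ?W' = "d' r (p - int r) (q + int r - 1) ` carrier (E' r (p - int r) (q + int r - 1))"
    interpret P: plain_module k "E r p q" using modE[OF r] by (simp add: plain_module_def)
    interpret P': plain_module k "E' r p q" using modE'[OF r] by (simp add: plain_module_def)
    interpret P0: plain_module k "E r (p - int r) (q + int r - 1)" using modE[OF r] by (simp add: plain_module_def)
    have dl: "d r (p - int r) (q + int r - 1) \<in> module_hom k (E r (p - int r) (q + int r - 1)) (E r p q)"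
      using differential_linear[OF r, of "p - int r" "q + int r - 1"] by simp
    have sq: "d r p q (d r (p - int r) (q + int r - 1) y) = \<zero>\<^bsub>E r (p + int r) (q - int r + 1)\<^esub>"
      if "y \<in> carrier (E r (p - int r) (q + int r - 1))" for y
    proof -
      have i: "p - int r + 2 * int r = p + int r" "q + int r - 1 - 2 * int r + 2 = q - int r + 1" by simp_all
      show ?thesis using differential_square[OF r that] unfolding i by simp
    qed
    have Zs: "submodule k ?Z (E r p q)"
      using P.kernel_submodule[OF modE[OF r] P.submodule_carrier, of "d r p q"] differential_linear[OF r] by simp
    have Ws: "submodule k ?W (E r p q)"
      using P.submodule_image[OF P0.module_axioms _ P0.submodule_carrier, of "d r (p - int r) (q + int r - 1)"] dl by simp
    have WZ: "?W \<subseteq> ?Z" using sq module_homD(1)[OF dl] by blast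
    have Z': "?Z' = j r p q ` ?Z"
    proof -
      have "j r (p + int r) (q - int r + 1) (d r p q x) = j r (p + int r) (q - int r + 1) \<zero>\<^bsub>E r (p + int r) (q - int r + 1)\<^esub> \<longleftrightarrow>
          d r p q x = \<zero>\<^bsub>E r (p + int r) (q - int r + 1)\<^esub>" if "x \<in> carrier (E r p q)" for x
      proof -
        interpret Q: plain_module k "E r (p + int r) (q - int r + 1)" using modE[OF r] by (simp add: plain_module_def)
        show ?thesis using inj_on_eq_iff[OF j[OF r] dcl[OF r that] Q.M.zero_closed] .
      qed
      then show ?thesis using dj[OF r] by (auto simp: car[OF r] zer[OF r])
    qed
    have W': "?W' = j r p q ` ?W"
    proof -
      have "d' r (p - int r) (q + int r - 1) (j r (p - int r) (q + int r - 1) x) = j r p q (d r (p - int r) (q + int r - 1) x)"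
        if "x \<in> carrier (E r (p - int r) (q + int r - 1))" for x
        using dj[OF r that] by simp
      then show ?thesis by (force simp: car[OF r] image_image)
    qed
    have hj: "j r p q \<in> module_hom k ((E r p q)\<lparr>carrier := X\<rparr>) (E' r p q)" if "X \<subseteq> carrier (E r p q)" for X
      by (rule module_hom_restrict[OF jh[OF r] that])
    have Zc: "?Z \<subseteq> carrier (E r p q)" by blast
    interpret linear_relation k "E r p q" "E' r p q" "\<lambda>x y. x \<in> ?Z \<and> y = j r p q x" ?Z ?Z'
    proof (intro linear_relation.intro linear_relation_axioms.intro)
      show "plain_module k (E r p q)" "plain_module k (E' r p q)" by unfold_locales
      show "submodule k ?Z (E r p q)" by (rule Zs)
      show "submodule k ?Z' (E' r p q)" unfolding Z' by (rule P'.submodule_image[OF modE[OF r] hj[OF Zc] Zs])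
    next
      fix x y x' y' assume "x \<in> ?Z \<and> y = j r p q x" "x' \<in> ?Z \<and> y' = j r p q x'"
      then show "x \<oplus>\<^bsub>E r p q\<^esub> x' \<in> ?Z \<and> y \<oplus>\<^bsub>E' r p q\<^esub> y' = j r p q (x \<oplus>\<^bsub>E r p q\<^esub> x')"
        using submodule.m_closed[OF Zs, of x x'] module_homD(2)[OF jh[OF r], of x p q x'] by simp
    next
      fix a x y assume "a \<in> carrier k" "x \<in> ?Z \<and> y = j r p q x"
      then show "a \<odot>\<^bsub>E r p q\<^esub> x \<in> ?Z \<and> a \<odot>\<^bsub>E' r p q\<^esub> y = j r p q (a \<odot>\<^bsub>E r p q\<^esub> x)"
        using submodule.smult_closed[OF Zs, of a x] module_homD(3)[OF jh[OF r], of a x p q] by simp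
    qed (use Z' in blast)+
    have "module_isomorphic k (subquotient (E r p q) ?Z ?W) (subquotient (E' r p q) ?Z' ?W')"
    proof (rule subquotients_isomorphic[OF _ _ _ Ws WZ])
      show "submodule k ?W' (E' r p q)" unfolding W' using WZ by (intro P'.submodule_image[OF modE[OF r] hj Ws]) blast
      show "?W' \<subseteq> ?Z'" unfolding W' Z' using WZ by (rule image_mono)
      show "\<exists>x. x \<in> ?Z \<and> y = j r p q x" if "y \<in> ?Z'" for y using that Z' by blast
      fix x y assume xy: "x \<in> ?Z \<and> y = j r p q x"
      have "?W \<subseteq> carrier (E r p q)" using WZ by blast
      then show "x \<in> ?W \<longleftrightarrow> y \<in> ?W'" unfolding W' using xy inj_on_image_mem_iff[OF j[OF r, of p q], of x ?W] by simp
    qed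
    note i3 = this
    have r': "2 \<le> Suc r" using r by simp
    note i1 = module_isomorphic_sym[OF iso[OF r'] modE[OF r'], of p q]
    show "module_isomorphic k (E' (Suc r) p q) (subquotient (E' r p q) ?Z' ?W')"
      by (rule module_isomorphic_trans[OF module_isomorphic_trans[OF i1 next_page[OF r]] i3])
  qed
  then show ?thesis using iso that by blast
qed

lemma converges_to_isomorphic:
  assumes "converges_to k E H" and iso: "\<And>r p q. 2 \<le> r \<Longrightarrow> module_isomorphic k (E r p q) (E' r p q)"
  shows "converges_to k E' H"
  unfolding converges_to_def
proof
  fix n
  obtain F where F: "F 0 = carrier (H n)" "F (Suc n) = {\<zero>\<^bsub>H n\<^esub>}" "\<forall>p \<le> Suc n. subspace k (F p) (H n)"
    "\<forall>p \<le> n. F (Suc p) \<subseteq> F p \<and> (\<forall>r > max p (n - p + 1). module_isomorphic k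
        (subquotient (H n) (F p) (F (Suc p))) (E r (int p) (int (n - p))))"
    using assms(1)[unfolded converges_to_def, THEN spec, of n] by (elim exE conjE) (rule that)
  have i: "module_isomorphic k (subquotient (H n) (F p) (F (Suc p))) (E' r (int p) (int (n - p)))"
    if p: "p \<le> n" and r: "max p (n - p + 1) < r" for p r
  proof (rule module_isomorphic_trans)
    show "module_isomorphic k (subquotient (H n) (F p) (F (Suc p))) (E r (int p) (int (n - p)))"
      using F(4) p r by blast
    \<comment> \<open>\<open>n - p + 1\<close> is at least 1, so \<open>r\<close> is at least
      2.\<close>
    show "module_isomorphic k (E r (int p) (int (n - p))) (E' r (int p) (int (n - p)))"
      using r by (intro iso) simp
  qed
  then show "\<exists>F. F 0 = carrier (H n) \<and> F (Suc n) = {\<zero>\<^bsub>H n\<^esub>} \<and> (\<forall>p \<le> Suc n. subspace k (F p) (H n)) \<and>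
      (\<forall>p \<le> n. F (Suc p) \<subseteq> F p \<and> (\<forall>r > max p (n - p + 1). module_isomorphic k
        (subquotient (H n) (F p) (F (Suc p))) (E' r (int p) (int (n - p)))))"
  proof (intro exI[of _ F] conjI allI impI)
    show "F 0 = carrier (H n)" "F (Suc n) = {\<zero>\<^bsub>H n\<^esub>}" by (rule F)+
    show "subspace k (F p) (H n)" if "p \<le> Suc n" for p using F(3) that by blast
    fix p assume p: "p \<le> n"
    show "F (Suc p) \<subseteq> F p" using F(4) p by blast
    fix r assume "max p (n - p + 1) < r"
    with p show "module_isomorphic k (subquotient (H n) (F p) (F (Suc p))) (E' r (int p) (int (n - p)))" by (rule i)
  qed
qed

section \<open>Alternating sums\<close>

text \<open>For infinite \<open>I\<close> both sums are zero by convention, which is why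
  \<open>I\<close> is arbitrary.\<close>

lemma module_hom_finsum:
  assumes V: "module R V" and W: "module R W" and f: "f \<in> module_hom R V W" and g: "\<And>i. i \<in> I \<Longrightarrow> g i \<in> carrier V"
  shows "f (\<Oplus>\<^bsub>V\<^esub>i\<in>I. g i) = (\<Oplus>\<^bsub>W\<^esub>i\<in>I. f (g i))"
proof -
  interpret V: module R V by fact
  interpret W: module R W by fact
  note fc = module_homD(1)[OF f] and f0 = module_hom_zero[OF V W f]
  show ?thesis using g
  proof (induction I rule: infinite_finite_induct)
    case (insert i I)
    then have g: "g \<in> I \<rightarrow> carrier V" "g i \<in> carrier V" by auto
    then have "(\<lambda>i. f (g i)) \<in> I \<rightarrow> carrier W" "f (g i) \<in> carrier W" using fc by auto
    then show ?case using insert g by (simp add: module_homD(2)[OF f])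
  qed (use f0 in simp_all)
qed

context plain_module
begin

lemma finsum_hom:
  fixes V :: "('k, 'v) module"
  assumes V: "module R V" and f: "\<And>i. i \<in> I \<Longrightarrow> f i \<in> module_hom R V M"
  shows "(\<lambda>x. \<Oplus>i\<in>I. f i x) \<in> module_hom R V M"
  using f
proof (induction I rule: infinite_finite_induct)
  case (insert i I)
  have h: "f i \<in> module_hom R V M" by (rule insert.prems) simp
  have h': "(\<lambda>x. \<Oplus>i\<in>I. f i x) \<in> module_hom R V M" by (rule insert.IH) (rule insert.prems, simp)
  interpret V: module R V by fact
  have c: "\<And>j x. \<lbrakk>j \<in> insert i I; x \<in> carrier V\<rbrakk> \<Longrightarrow> f j x \<in> carrier M" by (rule module_homD(1)[OF insert.prems])
  have e: "(\<Oplus>j\<in>insert i I. f j x) = f i x \<oplus> (\<Oplus>j\<in>I. f j x)" if "x \<in> carrier V" for x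
    using insert(1,2) c[OF _ that] by (intro M.finsum_insert) auto
  show ?case
  proof (rule module_homI)
    fix x y assume xy: "x \<in> carrier V" "y \<in> carrier V"
    show "(\<Oplus>j\<in>insert i I. f j x) \<in> carrier M" using c[OF _ xy(1)] by (intro M.finsum_closed) auto
    have "(\<Oplus>j\<in>insert i I. f j (x \<oplus>\<^bsub>V\<^esub> y)) = (f i x \<oplus> f i y) \<oplus> ((\<Oplus>j\<in>I. f j x) \<oplus> (\<Oplus>j\<in>I. f j y))"
      using xy e[of "x \<oplus>\<^bsub>V\<^esub> y"] module_homD(2)[OF h xy] module_homD(2)[OF h' xy] by simp
    then show "(\<Oplus>j\<in>insert i I. f j (x \<oplus>\<^bsub>V\<^esub> y)) = (\<Oplus>j\<in>insert i I. f j x) \<oplus> (\<Oplus>j\<in>insert i I. f j y)"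
      using xy e module_homD(1)[OF h] module_homD(1)[OF h'] by (simp add: M.a_ac)
  next
    fix a x assume ax: "a \<in> carrier R" "x \<in> carrier V"
    have "(\<Oplus>j\<in>insert i I. f j (a \<odot>\<^bsub>V\<^esub> x)) = a \<odot> f i x \<oplus> a \<odot> (\<Oplus>j\<in>I. f j x)"
      using ax e[of "a \<odot>\<^bsub>V\<^esub> x"] module_homD(3)[OF h ax] module_homD(3)[OF h' ax] by simp
    then show "(\<Oplus>j\<in>insert i I. f j (a \<odot>\<^bsub>V\<^esub> x)) = a \<odot> (\<Oplus>j\<in>insert i I. f j x)"
      using ax e module_homD(1)[OF h] module_homD(1)[OF h'] by (simp add: smult_r_distr)
  qed
qed (simp_all add: module_hom_def)

lemma finsum_Sigma:
  assumes A: "finite A" "\<And>a. a \<in> A \<Longrightarrow> finite (B a)" and f: "\<And>a b. \<lbrakk>a \<in> A; b \<in> B a\<rbrakk> \<Longrightarrow> f a b \<in> carrier M"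
  shows "(\<Oplus>a\<in>A. \<Oplus>b\<in>B a. f a b) = (\<Oplus>p\<in>Sigma A B. f (fst p) (snd p))"
  using assms
proof (induction A rule: finite_induct)
  case (insert x A)
  have e: "Sigma (insert x A) B = Pair x ` B x \<union> Sigma A B" by auto
  have "(\<Oplus>p\<in>Sigma (insert x A) B. f (fst p) (snd p)) =
      (\<Oplus>p\<in>Pair x ` B x. f (fst p) (snd p)) \<oplus> (\<Oplus>p\<in>Sigma A B. f (fst p) (snd p))"
    unfolding e using insert by (intro M.finsum_Un_disjoint) auto
  also have "(\<Oplus>p\<in>Pair x ` B x. f (fst p) (snd p)) = (\<Oplus>b\<in>B x. f x b)"
    using insert.prems by (subst M.finsum_reindex) (auto simp: inj_on_def)
  also have "(\<Oplus>p\<in>Sigma A B. f (fst p) (snd p)) = (\<Oplus>a\<in>A. \<Oplus>b\<in>B a. f a b)"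
    using insert by simp
  also have "(\<Oplus>b\<in>B x. f x b) \<oplus> (\<Oplus>a\<in>A. \<Oplus>b\<in>B a. f a b) = (\<Oplus>a\<in>insert x A. \<Oplus>b\<in>B a. f a b)"
    using insert by (subst M.finsum_insert) (auto intro!: M.finsum_closed)
  finally show ?case by simp
qed simp

text \<open>The pairs with \<open>a \<le> b\<close> are matched with the pairs
  \<open>(b + 1, a)\<close>, which run through all pairs whose first entry exceeds the second.
  Matched terms are equal by \<open>sym\<close>, and the parities of the index sums differ. With
  \<open>t\<close> the iterated faces of a cochain, the double sum is the square of a
  coboundary.\<close>

lemma alternating_double_sum_zero:
  assumes t: "\<And>a b. \<lbrakk>a \<le> Suc n; b \<le> n\<rbrakk> \<Longrightarrow> t a b \<in> carrier M"
    and sym: "\<And>a b. \<lbrakk>a \<le> b; b \<le> n\<rbrakk> \<Longrightarrow> t (Suc b) a = t a b"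
  shows "(\<Oplus>a\<in>{..Suc n}. alt_sign M a (\<Oplus>b\<in>{..n}. alt_sign M b (t a b))) = \<zero>"
proof -
  let ?P = "{..Suc n} \<times> {..n}"
  let ?U = "{p \<in> ?P. fst p \<le> snd p}" and ?L = "{p \<in> ?P. snd p < fst p}"
  let ?g = "\<lambda>p. alt_sign M (fst p + snd p) (t (fst p) (snd p))"
  let ?h = "\<lambda>p::nat \<times> nat. (Suc (snd p), fst p)"
  have g: "?g p \<in> carrier M" if "p \<in> ?P" for p using that t by auto
  have "alt_sign M a (\<Oplus>b\<in>{..n}. alt_sign M b (t a b)) = (\<Oplus>b\<in>{..n}. ?g (a, b))" if "a \<le> Suc n" for a
  proof -
    have c: "t a b \<in> carrier M" if "b \<in> {..n}" for b using t \<open>a \<le> Suc n\<close> that by simp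
    have "alt_sign M a (\<Oplus>b\<in>{..n}. alt_sign M b (t a b)) = (\<Oplus>b\<in>{..n}. alt_sign M a (alt_sign M b (t a b)))"
      using c by (intro module_hom_finsum[OF module_axioms module_axioms alt_sign_hom]) simp
    also have "\<dots> = (\<Oplus>b\<in>{..n}. ?g (a, b))" using c by (intro M.finsum_cong') auto
    finally show ?thesis .
  qed
  then have "(\<Oplus>a\<in>{..Suc n}. alt_sign M a (\<Oplus>b\<in>{..n}. alt_sign M b (t a b))) = (\<Oplus>a\<in>{..Suc n}. \<Oplus>b\<in>{..n}. ?g (a, b))"
    using g by (intro M.finsum_cong') (auto intro!: M.finsum_closed)
  also have "\<dots> = (\<Oplus>p\<in>?P. ?g p)" using t by (subst finsum_Sigma) auto
  also have "?P = ?U \<union> ?L" by auto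
  also have "(\<Oplus>p\<in>?U \<union> ?L. ?g p) = (\<Oplus>p\<in>?U. ?g p) \<oplus> (\<Oplus>p\<in>?L. ?g p)"
    using g by (intro M.finsum_Un_disjoint) auto
  also have "?L = ?h ` ?U"
  proof (intro subset_antisym subsetI)
    fix p assume "p \<in> ?L"
    then obtain a b where p: "p = (a, b)" "a \<le> Suc n" "b < a" by (cases p) auto
    then obtain a' where "a = Suc a'" by (cases a) auto
    then show "p \<in> ?h ` ?U" using p by (intro image_eqI[of _ _ "(b, a')"]) auto
  qed auto
  also have "(\<Oplus>p\<in>?h ` ?U. ?g p) = (\<Oplus>p\<in>?U. ?g (?h p))"
    using t by (intro M.finsum_reindex) (auto simp: inj_on_def)
  also have "(\<Oplus>p\<in>?U. ?g p) \<oplus> (\<Oplus>p\<in>?U. ?g (?h p)) = (\<Oplus>p\<in>?U. ?g p \<oplus> ?g (?h p))"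
    using t by (intro M.finsum_addf[symmetric]) auto
  also have "\<dots> = (\<Oplus>p\<in>?U. \<zero>)"
  proof (rule M.finsum_cong'[OF refl])
    fix p assume p: "p \<in> ?U"
    then have "t (Suc (snd p)) (fst p) = t (fst p) (snd p)" using sym by auto
    then show "?g p \<oplus> ?g (?h p) = \<zero>" using p t alt_sign_cancel[of "t (fst p) (snd p)" "fst p + snd p"]
      by (auto simp: add.commute)
  qed simp
  finally show ?thesis by simp
qed

lemma finsum_ends:
  assumes "\<And>i. i \<le> Suc n \<Longrightarrow> g i \<in> carrier M"
  shows "(\<Oplus>i\<in>{..Suc n}. g i) = g (Suc n) \<oplus> (\<Oplus>i\<in>{1..n}. g i) \<oplus> g 0"
proof -
  have e: "{..n} = insert 0 {1..n}" by auto
  have "(\<Oplus>i\<in>{..n}. g i) = g 0 \<oplus> (\<Oplus>i\<in>{1..n}. g i)"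
    unfolding e using assms by (intro M.finsum_insert) auto
  moreover have "(\<Oplus>i\<in>{..Suc n}. g i) = g (Suc n) \<oplus> (\<Oplus>i\<in>{..n}. g i)"
    using assms by (intro M.finsum_Suc) auto
  moreover have "(\<Oplus>i\<in>{1..n}. g i) \<in> carrier M" using assms by (intro M.finsum_closed) auto
  ultimately show ?thesis using assms by (simp add: M.a_ac)
qed

end

section \<open>Hochschild-Mitchell cochains\<close>

text \<open>Everything about cochains apart from the square of the coboundary depends on linearity
  alone. The quotient category enters at this level: that its coboundary squares to zero will follow
  from the injectivity of pulling back to \<open>C\<close>.\<close>

locale linear_precategory =
  fixes k :: "('k, 'r) ring_scheme" and C :: "('o, 'k, 'm) kcat" and M :: "('o, 'k, 'm, 'b) bimod"
  assumes ring: "cring k"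
    and Mor_module: "\<lbrakk>x \<in> Obj C; y \<in> Obj C\<rbrakk> \<Longrightarrow> module k (Mor C y x)"
    and Cmp_bil: "\<lbrakk>x \<in> Obj C; y \<in> Obj C; z \<in> Obj C\<rbrakk> \<Longrightarrow>
      bilinear_map k (Mor C z y) (Mor C y x) (Mor C z x) (Cmp C z y x)"
    and Bim_module: "\<lbrakk>x \<in> Obj C; y \<in> Obj C\<rbrakk> \<Longrightarrow> module k (Bim M y x)"
    and Lact_bil: "\<lbrakk>x \<in> Obj C; y \<in> Obj C; z \<in> Obj C\<rbrakk> \<Longrightarrow>
      bilinear_map k (Mor C z y) (Bim M y x) (Bim M z x) (Lact M z y x)"
    and Ract_bil: "\<lbrakk>y \<in> Obj C; x \<in> Obj C; u \<in> Obj C\<rbrakk> \<Longrightarrow>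
      bilinear_map k (Bim M y x) (Mor C x u) (Bim M y u) (Ract M y x u)"

lemma bilinear_mapD:
  assumes "bilinear_map k U V W f"
  shows "u \<in> carrier U \<Longrightarrow> (\<lambda>v. f u v) \<in> module_hom k V W"
    and "v \<in> carrier V \<Longrightarrow> (\<lambda>u. f u v) \<in> module_hom k U W"
    and "\<lbrakk>u \<in> carrier U; v \<in> carrier V\<rbrakk> \<Longrightarrow> f u v \<in> carrier W"
proof -
  show 1: "(\<lambda>v. f u v) \<in> module_hom k V W" if "u \<in> carrier U" for u
    using assms that unfolding bilinear_map_def by blast
  show "(\<lambda>u. f u v) \<in> module_hom k U W" if "v \<in> carrier V"
    using assms that unfolding bilinear_map_def by blast
  show "f u v \<in> carrier W" if "u \<in> carrier U" "v \<in> carrier V"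
    using module_homD(1)[OF 1[OF that(1)] that(2)] .
qed

section \<open>Cells, contractions and faces\<close>

lemma cellsI:
  assumes "length xs = Suc n" "length cs = n" "\<And>i. i \<le> n \<Longrightarrow> xs ! i \<in> Obj C"
    "\<And>j. j < n \<Longrightarrow> cs ! j \<in> carrier (Mor C (xs ! j) (xs ! Suc j))"
  shows "(xs, cs) \<in> cells C n"
  using assms by (auto simp: cells_def in_set_conv_nth less_Suc_eq_le)

lemma cellsD:
  assumes "(xs, cs) \<in> cells C n"
  shows "length xs = Suc n" "length cs = n" "i \<le> n \<Longrightarrow> xs ! i \<in> Obj C"
    "j < n \<Longrightarrow> cs ! j \<in> carrier (Mor C (xs ! j) (xs ! Suc j))"
  using assms by (auto simp: cells_def subset_iff less_Suc_eq_le)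

lemma cells_hd_last:
  assumes "(xs, cs) \<in> cells C n"
  shows "hd xs = xs ! 0" "last xs = xs ! n" "hd xs \<in> Obj C" "last xs \<in> Obj C"
proof -
  have "xs \<noteq> []" using cellsD(1)[OF assms] by auto
  then show "hd xs = xs ! 0" "last xs = xs ! n" using cellsD(1)[OF assms] by (auto simp: hd_conv_nth last_conv_nth)
  then show "hd xs \<in> Obj C" "last xs \<in> Obj C" using cellsD(3)[OF assms] by auto
qed

text \<open>The increasing map that omits \<open>Suc j\<close>, the index of the middle object in
  the composite formed at position \<open>j\<close>.\<close>

definition skip :: "nat \<Rightarrow> nat \<Rightarrow> nat"
  where "skip j i = (if i \<le> j then i else Suc i)"

lemma contract_simps:
  assumes "length xs = Suc (Suc n)" "length cs = Suc n" "j < n"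
  shows "length (fst (contract C j (xs, cs))) = Suc n" "length (snd (contract C j (xs, cs))) = n"
    and "i \<le> n \<Longrightarrow> fst (contract C j (xs, cs)) ! i = xs ! skip j i"
    and "i < n \<Longrightarrow> snd (contract C j (xs, cs)) ! i =
      (if i < j then cs ! i else if i = j then Cmp C (xs ! j) (xs ! Suc j) (xs ! Suc (Suc j)) (cs ! j) (cs ! Suc j) else cs ! Suc i)"
  using assms by (auto simp: contract_def skip_def nth_append min_def nth_Cons' Suc_diff_le)

lemma contract_cell:
  assumes "linear_precategory k C M" and c: "(xs, cs) \<in> cells C (Suc n)" and j: "j < n"
  shows "contract C j (xs, cs) \<in> cells C n"
proof -
  interpret linear_precategory k C M by fact
  note l = cellsD(1,2)[OF c]
  have o: "xs ! i \<in> Obj C" if "i \<le> Suc n" for i using cellsD(3)[OF c] that by blast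
  have m: "cs ! i \<in> carrier (Mor C (xs ! i) (xs ! Suc i))" if "i < Suc n" for i using cellsD(4)[OF c] that by blast
  have "(fst (contract C j (xs, cs)), snd (contract C j (xs, cs))) \<in> cells C n"
  proof (rule cellsI)
    show "length (fst (contract C j (xs, cs))) = Suc n" "length (snd (contract C j (xs, cs))) = n"
      using contract_simps[where C=C, OF l j] by auto
    show "fst (contract C j (xs, cs)) ! i \<in> Obj C" if "i \<le> n" for i
      using contract_simps(3)[where C=C, OF l j that] o that by (auto simp: skip_def)
    fix i assume i: "i < n"
    have "Cmp C (xs ! j) (xs ! Suc j) (xs ! Suc (Suc j)) (cs ! j) (cs ! Suc j) \<in> carrier (Mor C (xs ! j) (xs ! Suc (Suc j)))"
      using j by (intro bilinear_mapD(3)[OF Cmp_bil] o m) auto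
    then show "snd (contract C j (xs, cs)) ! i \<in>
        carrier (Mor C (fst (contract C j (xs, cs)) ! i) (fst (contract C j (xs, cs)) ! Suc i))"
      using contract_simps(3)[where C=C, OF l j, of i] contract_simps(3)[where C=C, OF l j, of "Suc i"] contract_simps(4)[where C=C, OF l j i] i j m
      by (auto simp: skip_def)
  qed
  then show ?thesis by simp
qed

lemma tl_cell:
  assumes c: "(xs, cs) \<in> cells C (Suc n)"
  shows "(tl xs, tl cs) \<in> cells C n" "hd (tl xs) = xs ! 1" "last (tl xs) = last xs" "hd cs = cs ! 0"
proof -
  note l = cellsD(1,2)[OF c]
  show t: "(tl xs, tl cs) \<in> cells C n"
    using l cellsD(3)[OF c] cellsD(4)[OF c] by (intro cellsI) (simp_all add: nth_tl)
  show "hd (tl xs) = xs ! 1" "last (tl xs) = last xs"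
    using cells_hd_last(1,2)[OF t] cells_hd_last(2)[OF c] l by (simp_all add: nth_tl)
  have "cs \<noteq> []" using l by auto
  then show "hd cs = cs ! 0" by (rule hd_conv_nth)
qed

lemma butlast_cell:
  assumes c: "(xs, cs) \<in> cells C (Suc n)"
  shows "(butlast xs, butlast cs) \<in> cells C n" "hd (butlast xs) = hd xs" "last (butlast xs) = xs ! n" "last cs = cs ! n"
proof -
  note l = cellsD(1,2)[OF c]
  show b: "(butlast xs, butlast cs) \<in> cells C n"
    using l cellsD(3)[OF c] cellsD(4)[OF c] by (intro cellsI) (simp_all add: nth_butlast)
  show "hd (butlast xs) = hd xs" "last (butlast xs) = xs ! n"
    using l cells_hd_last(1,2)[OF b] cells_hd_last(1)[OF c] by (simp_all add: nth_butlast)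
  have "cs \<noteq> []" using l by auto
  then show "last cs = cs ! n" using l by (simp add: last_conv_nth)
qed

text \<open>The term of the coboundary that carries the sign \<open>(-1)^i\<close>. The index
  \<open>i\<close> counts from the source end of the chain while list positions count from the
  target end, which accounts for \<open>n - i\<close>; face \<open>0\<close> is the right action and
  face \<open>n + 1\<close> the left one.\<close>

definition HM_face ::
  "('o, 'k, 'm) kcat \<Rightarrow> ('o, 'k, 'm, 'b) bimod \<Rightarrow> nat \<Rightarrow> ('o list \<times> 'm list \<Rightarrow> 'b) \<Rightarrow> nat \<Rightarrow> 'o list \<times> 'm list \<Rightarrow> 'b"
  where "HM_face C M n f i = (\<lambda>(xs, cs).
    if i = 0 then Ract M (hd xs) (xs ! n) (xs ! (n + 1)) (f (butlast xs, butlast cs)) (last cs)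
    else if i \<le> n then f (contract C (n - i) (xs, cs))
    else Lact M (xs ! 0) (xs ! 1) (last xs) (hd cs) (f (tl xs, tl cs)))"

lemma HM_cochainsD:
  assumes f: "f \<in> carrier (HM_cochains k C M n)" and c: "(xs, cs) \<in> cells C n"
  shows "f (xs, cs) \<in> carrier (Bim M (hd xs) (last xs))"
    and "j < n \<Longrightarrow> (\<lambda>c. f (xs, cs[j := c])) \<in> module_hom k (Mor C (xs ! j) (xs ! Suc j)) (Bim M (hd xs) (last xs))"
  using f c by (auto simp: HM_cochains_def Let_def product_module_simps PiE_def Pi_def)

lemma HM_cochainsI:
  assumes "f \<in> extensional (cells C n)"
    and "\<And>xs cs. (xs, cs) \<in> cells C n \<Longrightarrow> f (xs, cs) \<in> carrier (Bim M (hd xs) (last xs))"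
    and "\<And>xs cs j. \<lbrakk>(xs, cs) \<in> cells C n; j < n\<rbrakk> \<Longrightarrow>
      (\<lambda>c. f (xs, cs[j := c])) \<in> module_hom k (Mor C (xs ! j) (xs ! Suc j)) (Bim M (hd xs) (last xs))"
  shows "f \<in> carrier (HM_cochains k C M n)"
  using assms by (auto simp: HM_cochains_def Let_def product_module_simps PiE_def)

lemma HM_cochains_simps:
  shows "\<zero>\<^bsub>HM_cochains k C M n\<^esub> = (\<lambda>(xs, cs)\<in>cells C n. \<zero>\<^bsub>Bim M (hd xs) (last xs)\<^esub>)"
    and "f \<oplus>\<^bsub>HM_cochains k C M n\<^esub> g = (\<lambda>(xs, cs)\<in>cells C n. f (xs, cs) \<oplus>\<^bsub>Bim M (hd xs) (last xs)\<^esub> g (xs, cs))"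
    and "a \<odot>\<^bsub>HM_cochains k C M n\<^esub> f = (\<lambda>(xs, cs)\<in>cells C n. a \<odot>\<^bsub>Bim M (hd xs) (last xs)\<^esub> f (xs, cs))"
  by (auto simp: HM_cochains_def Let_def product_module_simps intro!: restrict_ext)

lemma HM_cochains_ext:
  assumes "f \<in> extensional (cells C n)" "g \<in> extensional (cells C n)"
    and "\<And>xs cs. (xs, cs) \<in> cells C n \<Longrightarrow> f (xs, cs) = g (xs, cs)"
  shows "f = g"
  using assms by (intro extensionalityI[of f "cells C n"]) auto

lemma HM_cochains_extensional: "f \<in> carrier (HM_cochains k C M n) \<Longrightarrow> f \<in> extensional (cells C n)"
  by (auto simp: HM_cochains_def Let_def product_module_simps PiE_def)

lemma module_hom_cong:
  assumes "module R V" "f \<in> module_hom R V W" "\<And>x. x \<in> carrier V \<Longrightarrow> g x = f x"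
  shows "g \<in> module_hom R V W"
proof -
  interpret V: module R V by fact
  show ?thesis by (rule module_homI) (simp_all add: assms(3) module_homD[OF assms(2)])
qed

lemma cells_update:
  assumes "(xs, cs) \<in> cells C n" "j < n" "c \<in> carrier (Mor C (xs ! j) (xs ! Suc j))"
  shows "(xs, cs[j := c]) \<in> cells C n"
  using cellsD[OF assms(1)] assms(2,3) by (intro cellsI) (auto simp: nth_list_update)

text \<open>Each slot of a cell influences exactly one slot of its contraction, through composition
  if it is one of the two composed slots. Linearity of the inner faces in every slot reduces to this
  and to bilinearity of composition.\<close>

lemma contract_update:
  assumes l: "length xs = Suc (Suc n)" "length cs = Suc n" and m: "m < n" and j: "j \<le> n"
  shows "contract C m (xs, cs[j := c]) = (fst (contract C m (xs, cs)),
    if j < m then (snd (contract C m (xs, cs)))[j := c]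
    else if j = m then (snd (contract C m (xs, cs)))[m := Cmp C (xs ! m) (xs ! Suc m) (xs ! Suc (Suc m)) c (cs ! Suc m)]
    else if j = Suc m then (snd (contract C m (xs, cs)))[m := Cmp C (xs ! m) (xs ! Suc m) (xs ! Suc (Suc m)) (cs ! m) c]
    else (snd (contract C m (xs, cs)))[j - 1 := c])"
proof -
  have l': "length (cs[j := c]) = Suc n" using l by simp
  note s = contract_simps[where C=C, OF l m] and s' = contract_simps[where C=C, OF l(1) l' m]
  show ?thesis
    apply (rule prod_eqI)
     apply (rule nth_equalityI)
      apply (simp add: s s')
     apply (simp add: s s')
    apply (rule nth_equalityI)
     apply (simp add: s s')
    apply (use l j m in \<open>auto simp: s s' nth_list_update\<close>)
    done
qed

lemma contract_ends:
  assumes l: "length xs = Suc (Suc n)" "length cs = Suc n" and m: "m < n"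
  shows "hd (fst (contract C m (xs, cs))) = hd xs" "last (fst (contract C m (xs, cs))) = last xs"
proof -
  note s = contract_simps[where C=C, OF l m]
  have ne: "xs \<noteq> []" "fst (contract C m (xs, cs)) \<noteq> []" using l s(1) by auto
  show "hd (fst (contract C m (xs, cs))) = hd xs" using ne s(3)[of 0] by (simp add: hd_conv_nth skip_def)
  show "last (fst (contract C m (xs, cs))) = last xs" using ne s(1) s(3)[of n] l m by (simp add: last_conv_nth skip_def)
qed

section \<open>Linearity of the coboundary\<close>

context linear_precategory
begin

lemma Bim_plain: "(xs, cs) \<in> cells C n \<Longrightarrow> plain_module k (Bim M (hd xs) (last xs))"
  unfolding plain_module_def by (intro Bim_module cells_hd_last(3,4))

lemma value_module: "p \<in> cells C n \<Longrightarrow> module k (case p of (xs, cs) \<Rightarrow> Bim M (hd xs) (last xs))"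
  using Bim_plain[of "fst p" "snd p" n] by (simp add: plain_module_def case_prod_beta)

lemma HM_cochains_submodule:
  "submodule k (carrier (HM_cochains k C M n)) (product_module (cells C n) (\<lambda>(xs, cs). Bim M (hd xs) (last xs)))"
  (is "submodule k _ ?P")
proof -
  interpret kR: cring k by (rule ring)
  have P: "module k ?P" by (rule product_module_module[OF ring value_module])
  interpret P: plain_module k ?P using P by (simp add: plain_module_def)
  have V: "module k (Bim M (hd xs) (last xs))" if "(xs, cs) \<in> cells C n" for xs cs
    using Bim_plain[OF that] by (simp add: plain_module_def)
  have U: "module k (Mor C (xs ! j) (xs ! Suc j))" if "(xs, cs) \<in> cells C n" "j < n" for xs cs j
    using that by (intro Mor_module cellsD(3)[OF that(1)]) auto
  note upd = cells_update
  show ?thesis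
  proof (rule P.submoduleI')
    show "carrier (HM_cochains k C M n) \<subseteq> carrier ?P" by (auto simp: HM_cochains_def Let_def)
    show "\<zero>\<^bsub>?P\<^esub> \<in> carrier (HM_cochains k C M n)"
    proof (rule HM_cochainsI)
      show "\<zero>\<^bsub>?P\<^esub> \<in> extensional (cells C n)" by (simp add: product_module_simps)
      fix xs cs assume c: "(xs, cs) \<in> cells C n"
      interpret V: module k "Bim M (hd xs) (last xs)" by (rule V[OF c])
      show "\<zero>\<^bsub>?P\<^esub> (xs, cs) \<in> carrier (Bim M (hd xs) (last xs))" using c by (simp add: product_module_simps)
      fix j assume j: "j < n"
      interpret U: module k "Mor C (xs ! j) (xs ! Suc j)" by (rule U[OF c j])
      show "(\<lambda>c. \<zero>\<^bsub>?P\<^esub> (xs, cs[j := c])) \<in> module_hom k (Mor C (xs ! j) (xs ! Suc j)) (Bim M (hd xs) (last xs))"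
        using upd[OF c j] by (intro module_homI) (simp_all add: product_module_simps)
    qed
  next
    fix f g assume f: "f \<in> carrier (HM_cochains k C M n)" and g: "g \<in> carrier (HM_cochains k C M n)"
    show "f \<oplus>\<^bsub>?P\<^esub> g \<in> carrier (HM_cochains k C M n)"
    proof (rule HM_cochainsI)
      show "f \<oplus>\<^bsub>?P\<^esub> g \<in> extensional (cells C n)" by (simp add: product_module_simps)
      fix xs cs assume c: "(xs, cs) \<in> cells C n"
      interpret V: module k "Bim M (hd xs) (last xs)" by (rule V[OF c])
      show "(f \<oplus>\<^bsub>?P\<^esub> g) (xs, cs) \<in> carrier (Bim M (hd xs) (last xs))"
        using c HM_cochainsD(1)[OF f c] HM_cochainsD(1)[OF g c] by (simp add: product_module_simps)
      fix j assume j: "j < n"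
      interpret U: module k "Mor C (xs ! j) (xs ! Suc j)" by (rule U[OF c j])
      note hf = HM_cochainsD(2)[OF f c j] and hg = HM_cochainsD(2)[OF g c j]
      show "(\<lambda>c. (f \<oplus>\<^bsub>?P\<^esub> g) (xs, cs[j := c])) \<in> module_hom k (Mor C (xs ! j) (xs ! Suc j)) (Bim M (hd xs) (last xs))"
        using upd[OF c j] by (intro module_homI)
          (simp_all add: product_module_simps module_homD[OF hf] module_homD[OF hg] V.M.a_ac V.smult_r_distr)
    qed
  next
    fix a f assume a: "a \<in> carrier k" and f: "f \<in> carrier (HM_cochains k C M n)"
    show "a \<odot>\<^bsub>?P\<^esub> f \<in> carrier (HM_cochains k C M n)"
    proof (rule HM_cochainsI)
      show "a \<odot>\<^bsub>?P\<^esub> f \<in> extensional (cells C n)" by (simp add: product_module_simps)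
      fix xs cs assume c: "(xs, cs) \<in> cells C n"
      interpret V: module k "Bim M (hd xs) (last xs)" by (rule V[OF c])
      show "(a \<odot>\<^bsub>?P\<^esub> f) (xs, cs) \<in> carrier (Bim M (hd xs) (last xs))"
        using c a HM_cochainsD(1)[OF f c] by (simp add: product_module_simps)
      fix j assume j: "j < n"
      interpret U: module k "Mor C (xs ! j) (xs ! Suc j)" by (rule U[OF c j])
      note hf = HM_cochainsD(2)[OF f c j]
      show "(\<lambda>c. (a \<odot>\<^bsub>?P\<^esub> f) (xs, cs[j := c])) \<in> module_hom k (Mor C (xs ! j) (xs ! Suc j)) (Bim M (hd xs) (last xs))"
        using upd[OF c j] a by (intro module_homI)
          (simp_all add: product_module_simps module_homD[OF hf] V.smult_r_distr V.smult_assoc1[symmetric] kR.m_comm)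
    qed
  qed
qed

lemma HM_cochains_module: "module k (HM_cochains k C M n)"
proof -
  let ?P = "product_module (cells C n) (\<lambda>(xs, cs). Bim M (hd xs) (last xs))"
  have P: "module k ?P" by (rule product_module_module[OF ring value_module])
  have "HM_cochains k C M n = ?P\<lparr>carrier := carrier (HM_cochains k C M n)\<rparr>" by (simp add: HM_cochains_def Let_def)
  then show ?thesis using module.submodule_is_module[OF P HM_cochains_submodule] by simp
qed

text \<open>Iterated faces are formed one at a time, and a single face is a function on all pairs of
  lists, not an extensional one, hence not a cochain in the strict sense. Only its values on cells
  are kept track of.\<close>

abbreviation vals :: "nat \<Rightarrow> ('o list \<times> 'm list \<Rightarrow> 'b) set"
  where "vals n \<equiv> Pi (cells C n) (\<lambda>p. carrier (Bim M (hd (fst p)) (last (fst p))))"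

lemma HM_face_closed:
  assumes f: "f \<in> vals n"
    and c: "(xs, cs) \<in> cells C (Suc n)" and i: "i \<le> Suc n"
  shows "HM_face C M n f i (xs, cs) \<in> carrier (Bim M (hd xs) (last xs))"
proof -
  note l = cellsD(1,2)[OF c] and hl = cells_hd_last[OF c] and t = tl_cell[OF c] and b = butlast_cell[OF c]
  have o: "i \<le> Suc n \<Longrightarrow> xs ! i \<in> Obj C" for i using cellsD(3)[OF c] by blast
  have m: "j < Suc n \<Longrightarrow> cs ! j \<in> carrier (Mor C (xs ! j) (xs ! Suc j))" for j using cellsD(4)[OF c] by blast
  consider "i = 0" | "0 < i" "i \<le> n" | "i = Suc n" using i by linarith
  then show ?thesis
  proof cases
    case 1
    have "Ract M (xs ! 0) (xs ! n) (xs ! Suc n) (f (butlast xs, butlast cs)) (cs ! n) \<in> carrier (Bim M (xs ! 0) (xs ! Suc n))"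
      by (rule bilinear_mapD(3)[OF Ract_bil]) (use o m Pi_mem[OF f b(1)] b(2,3) hl in auto)
    then show ?thesis using 1 hl b by (simp add: HM_face_def)
  next
    case 2
    have nm: "n - i < n" using 2 by simp
    have "contract C (n - i) (xs, cs) \<in> cells C n" by (rule contract_cell[OF linear_precategory_axioms c nm])
    then show ?thesis using 2 Pi_mem[OF f, of "contract C (n - i) (xs, cs)"] contract_ends[where C=C, OF l nm] by (simp add: HM_face_def)
  next
    case 3
    have "Lact M (xs ! 0) (xs ! 1) (xs ! Suc n) (cs ! 0) (f (tl xs, tl cs)) \<in> carrier (Bim M (xs ! 0) (xs ! Suc n))"
      by (rule bilinear_mapD(3)[OF Lact_bil]) (use o m[of 0] Pi_mem[OF f t(1)] t(2,3) hl in auto)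
    then show ?thesis using 3 hl t by (simp add: HM_face_def)
  qed
qed

text \<open>In an outer face the slot is either the acting morphism, where bilinearity of the action
  applies, or a slot of \<open>f\<close>. For an inner face \<open>contract_update\<close> tells
  which slot of the contraction varies, and how.\<close>

lemma HM_face_linear:
  assumes f: "f \<in> carrier (HM_cochains k C M n)" and c: "(xs, cs) \<in> cells C (Suc n)" and i: "i \<le> Suc n" and j: "j < Suc n"
  shows "(\<lambda>c. HM_face C M n f i (xs, cs[j := c])) \<in> module_hom k (Mor C (xs ! j) (xs ! Suc j)) (Bim M (hd xs) (last xs))"
proof -
  note l = cellsD(1,2)[OF c] and hl = cells_hd_last[OF c] and t = tl_cell[OF c] and b = butlast_cell[OF c]
  have o: "i \<le> Suc n \<Longrightarrow> xs ! i \<in> Obj C" for i using cellsD(3)[OF c] by blast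
  have m: "j < Suc n \<Longrightarrow> cs ! j \<in> carrier (Mor C (xs ! j) (xs ! Suc j))" for j using cellsD(4)[OF c] by blast
  have ne: "cs \<noteq> []" using l by auto
  have U: "module k (Mor C (xs ! j) (xs ! Suc j))" using o j by (intro Mor_module) auto
  consider "i = 0" | "0 < i" "i \<le> n" | "i = Suc n" using i by linarith
  then show ?thesis
  proof cases
    case 1
    show ?thesis
    proof (cases "j = n")
      case True
      have "(\<lambda>c. Ract M (xs ! 0) (xs ! n) (xs ! Suc n) (f (butlast xs, butlast cs)) c) \<in>
          module_hom k (Mor C (xs ! n) (xs ! Suc n)) (Bim M (xs ! 0) (xs ! Suc n))"
        by (rule bilinear_mapD(1)[OF Ract_bil]) (use o HM_cochainsD(1)[OF f b(1)] b(2,3) hl in auto)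
      then show ?thesis using True 1 hl l ne by (simp add: HM_face_def butlast_list_update last_list_update)
    next
      case False
      have "(\<lambda>c. f (butlast xs, (butlast cs)[j := c])) \<in> module_hom k (Mor C (xs ! j) (xs ! Suc j)) (Bim M (xs ! 0) (xs ! n))"
        using HM_cochainsD(2)[OF f b(1), of j] False j b(2,3) hl l by (simp add: nth_butlast)
      moreover have "(\<lambda>u. Ract M (xs ! 0) (xs ! n) (xs ! Suc n) u (cs ! n)) \<in>
          module_hom k (Bim M (xs ! 0) (xs ! n)) (Bim M (xs ! 0) (xs ! Suc n))"
        by (rule bilinear_mapD(2)[OF Ract_bil]) (use o m in auto)
      ultimately have "(\<lambda>c. Ract M (xs ! 0) (xs ! n) (xs ! Suc n) (f (butlast xs, (butlast cs)[j := c])) (cs ! n)) \<in>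
          module_hom k (Mor C (xs ! j) (xs ! Suc j)) (Bim M (xs ! 0) (xs ! Suc n))"
        by (rule module_hom_compose)
      then show ?thesis using False 1 hl l ne b(4) j by (simp add: HM_face_def butlast_list_update last_list_update)
    qed
  next
    case 2
    define p where "p = n - i"
    have p: "p < n" using 2 by (simp add: p_def)
    note s = contract_simps[where C=C, OF l p] and e = contract_ends[where C=C, OF l p]
    let ?ys = "fst (contract C p (xs, cs))" and ?ds = "snd (contract C p (xs, cs))"
    have pc: "(?ys, ?ds) \<in> cells C n" using contract_cell[OF linear_precategory_axioms c p] by simp
    have lin: "(\<lambda>c. f (?ys, ?ds[q := c])) \<in> module_hom k (Mor C (xs ! skip p q) (xs ! skip p (Suc q))) (Bim M (hd xs) (last xs))"
      if "q < n" for q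
      using HM_cochainsD(2)[OF f pc that] e s(3)[of q] s(3)[of "Suc q"] that by simp
    have "(\<lambda>c. f (contract C p (xs, cs[j := c]))) \<in> module_hom k (Mor C (xs ! j) (xs ! Suc j)) (Bim M (hd xs) (last xs))"
    proof -
      consider "j < p" | "j = p" | "j = Suc p" | "Suc p < j" by linarith
      then show ?thesis
      proof cases
        case 1
        then show ?thesis using lin[of j] j p contract_update[where C=C, OF l p, of j] by (simp add: skip_def)
      next
        case 2
        have "(\<lambda>c. Cmp C (xs ! p) (xs ! Suc p) (xs ! Suc (Suc p)) c (cs ! Suc p)) \<in>
            module_hom k (Mor C (xs ! p) (xs ! Suc p)) (Mor C (xs ! p) (xs ! Suc (Suc p)))"
          using p by (intro bilinear_mapD(2)[OF Cmp_bil] o m) auto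
        moreover have "(\<lambda>c. f (?ys, ?ds[p := c])) \<in> module_hom k (Mor C (xs ! p) (xs ! Suc (Suc p))) (Bim M (hd xs) (last xs))"
          using lin[OF p] by (simp add: skip_def)
        ultimately have "(\<lambda>c. f (?ys, ?ds[p := Cmp C (xs ! p) (xs ! Suc p) (xs ! Suc (Suc p)) c (cs ! Suc p)])) \<in>
            module_hom k (Mor C (xs ! p) (xs ! Suc p)) (Bim M (hd xs) (last xs))"
          by (rule module_hom_compose)
        then show ?thesis using 2 j contract_update[where C=C, OF l p, of j] by simp
      next
        case 3
        have "(\<lambda>c. Cmp C (xs ! p) (xs ! Suc p) (xs ! Suc (Suc p)) (cs ! p) c) \<in>
            module_hom k (Mor C (xs ! Suc p) (xs ! Suc (Suc p))) (Mor C (xs ! p) (xs ! Suc (Suc p)))"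
          using p by (intro bilinear_mapD(1)[OF Cmp_bil] o m) auto
        moreover have "(\<lambda>c. f (?ys, ?ds[p := c])) \<in> module_hom k (Mor C (xs ! p) (xs ! Suc (Suc p))) (Bim M (hd xs) (last xs))"
          using lin[OF p] by (simp add: skip_def)
        ultimately have "(\<lambda>c. f (?ys, ?ds[p := Cmp C (xs ! p) (xs ! Suc p) (xs ! Suc (Suc p)) (cs ! p) c])) \<in>
            module_hom k (Mor C (xs ! Suc p) (xs ! Suc (Suc p))) (Bim M (hd xs) (last xs))"
          by (rule module_hom_compose)
        then show ?thesis using 3 j contract_update[where C=C, OF l p, of j] by simp
      next
        case 4
        then obtain j' where j': "j = Suc j'" "p < j'" by (cases j) auto
        then show ?thesis using lin[of j'] j contract_update[where C=C, OF l p, of j] by (simp add: skip_def)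
      qed
    qed
    then show ?thesis using 2 by (simp add: HM_face_def p_def)
  next
    case 3
    show ?thesis
    proof (cases j)
      case 0
      have "(\<lambda>c. Lact M (xs ! 0) (xs ! 1) (xs ! Suc n) c (f (tl xs, tl cs))) \<in>
          module_hom k (Mor C (xs ! 0) (xs ! 1)) (Bim M (xs ! 0) (xs ! Suc n))"
        by (rule bilinear_mapD(2)[OF Lact_bil]) (use o HM_cochainsD(1)[OF f t(1)] t(2,3) hl in auto)
      moreover have "hd (cs[0 := c]) = c \<and> tl (cs[0 := c]) = tl cs" for c using ne by (cases cs) auto
      ultimately show ?thesis using 0 3 hl by (simp add: HM_face_def)
    next
      case (Suc j')
      have "(\<lambda>c. f (tl xs, (tl cs)[j' := c])) \<in> module_hom k (Mor C (xs ! j) (xs ! Suc j)) (Bim M (xs ! 1) (xs ! Suc n))"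
        using HM_cochainsD(2)[OF f t(1), of j'] Suc j t(2,3) hl l by (simp add: nth_tl)
      moreover have "(\<lambda>u. Lact M (xs ! 0) (xs ! 1) (xs ! Suc n) (cs ! 0) u) \<in>
          module_hom k (Bim M (xs ! 1) (xs ! Suc n)) (Bim M (xs ! 0) (xs ! Suc n))"
        by (rule bilinear_mapD(1)[OF Lact_bil]) (use o m[of 0] in auto)
      ultimately have "(\<lambda>c. Lact M (xs ! 0) (xs ! 1) (xs ! Suc n) (cs ! 0) (f (tl xs, (tl cs)[j' := c]))) \<in>
          module_hom k (Mor C (xs ! j) (xs ! Suc j)) (Bim M (xs ! 0) (xs ! Suc n))"
        by (rule module_hom_compose)
      moreover have "hd (cs[j := c]) = cs ! 0 \<and> tl (cs[j := c]) = (tl cs)[j' := c]" for c using ne Suc by (cases cs) auto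
      ultimately show ?thesis using 3 hl by (simp add: HM_face_def)
    qed
  qed
qed

lemma HM_coboundary_faces:
  assumes f: "f \<in> vals n" and c: "(xs, cs) \<in> cells C (Suc n)"
  shows "HM_coboundary C M n f (xs, cs) =
    (\<Oplus>\<^bsub>Bim M (hd xs) (last xs)\<^esub>i\<in>{..Suc n}. alt_sign (Bim M (hd xs) (last xs)) i (HM_face C M n f i (xs, cs)))"
proof -
  interpret V: plain_module k "Bim M (hd xs) (last xs)" by (rule Bim_plain[OF c])
  have fc: "HM_face C M n f i (xs, cs) \<in> carrier (Bim M (hd xs) (last xs))" if "i \<le> Suc n" for i
    by (rule HM_face_closed[OF f c that])
  have "(\<Oplus>\<^bsub>Bim M (hd xs) (last xs)\<^esub>i\<in>{1..n}. alt_sign (Bim M (hd xs) (last xs)) i (f (contract C (n - i) (xs, cs)))) =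
      (\<Oplus>\<^bsub>Bim M (hd xs) (last xs)\<^esub>i\<in>{1..n}. alt_sign (Bim M (hd xs) (last xs)) i (HM_face C M n f i (xs, cs)))"
  proof (rule V.M.finsum_cong'[OF refl])
    show "(\<lambda>i. alt_sign (Bim M (hd xs) (last xs)) i (HM_face C M n f i (xs, cs))) \<in> {1..n} \<rightarrow> carrier (Bim M (hd xs) (last xs))"
      using fc by auto
  qed (simp add: HM_face_def)
  then show ?thesis
    using c fc by (subst V.finsum_ends) (simp_all add: HM_coboundary_def Let_def HM_face_def V.alt_sign_even)
qed

lemma HM_cochain_values: "f \<in> carrier (HM_cochains k C M n) \<Longrightarrow> f \<in> vals n"
  using HM_cochainsD(1)[of f k C M n] by (intro Pi_I) (metis prod.collapse)

lemma HM_coboundary_closed: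
  assumes f: "f \<in> carrier (HM_cochains k C M n)"
  shows "HM_coboundary C M n f \<in> carrier (HM_cochains k C M (Suc n))"
proof (rule HM_cochainsI)
  show "HM_coboundary C M n f \<in> extensional (cells C (Suc n))" by (simp add: HM_coboundary_def)
  note fv = HM_cochain_values[OF f]
  fix xs cs assume c: "(xs, cs) \<in> cells C (Suc n)"
  interpret V: plain_module k "Bim M (hd xs) (last xs)" by (rule Bim_plain[OF c])
  show "HM_coboundary C M n f (xs, cs) \<in> carrier (Bim M (hd xs) (last xs))"
    unfolding HM_coboundary_faces[OF fv c] using HM_face_closed[OF fv c] by (intro V.M.finsum_closed) auto
  fix j assume j: "j < Suc n"
  have U: "module k (Mor C (xs ! j) (xs ! Suc j))" using j by (intro Mor_module cellsD(3)[OF c]) auto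
  have "(\<lambda>c. \<Oplus>\<^bsub>Bim M (hd xs) (last xs)\<^esub>i\<in>{..Suc n}. alt_sign (Bim M (hd xs) (last xs)) i (HM_face C M n f i (xs, cs[j := c])))
      \<in> module_hom k (Mor C (xs ! j) (xs ! Suc j)) (Bim M (hd xs) (last xs))"
    by (rule V.finsum_hom[OF U]) (rule module_hom_compose[OF HM_face_linear[OF f c _ j] V.alt_sign_hom], simp)
  then show "(\<lambda>c. HM_coboundary C M n f (xs, cs[j := c])) \<in> module_hom k (Mor C (xs ! j) (xs ! Suc j)) (Bim M (hd xs) (last xs))"
    by (rule module_hom_cong[OF U]) (rule HM_coboundary_faces[OF fv cells_update[OF c j]])
qed

text \<open>At a fixed cell a face is the evaluation at another cell followed by a linear map: the
  action of a fixed morphism, or the identity. Linearity in \<open>f\<close> and compatibility with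
  sums follow at once.\<close>

lemma HM_face_hom_pointwise:
  assumes c: "(xs, cs) \<in> cells C (Suc n)" and i: "i \<le> Suc n"
  obtains q h where "q \<in> cells C n" "h \<in> module_hom k (Bim M (hd (fst q)) (last (fst q))) (Bim M (hd xs) (last xs))"
    "\<And>f. HM_face C M n f i (xs, cs) = h (f q)"
proof -
  note l = cellsD(1,2)[OF c] and hl = cells_hd_last[OF c] and t = tl_cell[OF c] and b = butlast_cell[OF c]
  have o: "i \<le> Suc n \<Longrightarrow> xs ! i \<in> Obj C" for i using cellsD(3)[OF c] by blast
  have m: "j < Suc n \<Longrightarrow> cs ! j \<in> carrier (Mor C (xs ! j) (xs ! Suc j))" for j using cellsD(4)[OF c] by blast
  consider "i = 0" | "0 < i" "i \<le> n" | "i = Suc n" using i by linarith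
  then show ?thesis
  proof cases
    case 1
    have "(\<lambda>u. Ract M (xs ! 0) (xs ! n) (xs ! Suc n) u (cs ! n)) \<in> module_hom k (Bim M (xs ! 0) (xs ! n)) (Bim M (xs ! 0) (xs ! Suc n))"
      by (rule bilinear_mapD(2)[OF Ract_bil]) (use o m in auto)
    then show ?thesis using 1 hl b
      by (intro that[of "(butlast xs, butlast cs)" "\<lambda>u. Ract M (xs ! 0) (xs ! n) (xs ! Suc n) u (cs ! n)"]) (simp_all add: HM_face_def)
  next
    case 2
    have nm: "n - i < n" using 2 by simp
    have "contract C (n - i) (xs, cs) \<in> cells C n" by (rule contract_cell[OF linear_precategory_axioms c nm])
    then show ?thesis using 2 contract_ends[where C=C, OF l nm]
      by (intro that[of "contract C (n - i) (xs, cs)" "\<lambda>u. u"]) (simp_all add: HM_face_def module_hom_def)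
  next
    case 3
    have "(\<lambda>u. Lact M (xs ! 0) (xs ! 1) (xs ! Suc n) (cs ! 0) u) \<in> module_hom k (Bim M (xs ! 1) (xs ! Suc n)) (Bim M (xs ! 0) (xs ! Suc n))"
      by (rule bilinear_mapD(1)[OF Lact_bil]) (use o m[of 0] in auto)
    then show ?thesis using 3 hl t
      by (intro that[of "(tl xs, tl cs)" "\<lambda>u. Lact M (xs ! 0) (xs ! 1) (xs ! Suc n) (cs ! 0) u"]) (simp_all add: HM_face_def)
  qed
qed

lemma HM_cochains_homI:
  assumes V: "module k V" and h: "\<And>x. x \<in> carrier V \<Longrightarrow> h x \<in> carrier (HM_cochains k C M n)"
    and hom: "\<And>p. p \<in> cells C n \<Longrightarrow> (\<lambda>x. h x p) \<in> module_hom k V (Bim M (hd (fst p)) (last (fst p)))"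
  shows "h \<in> module_hom k V (HM_cochains k C M n)"
proof (rule module_homI)
  interpret V: module k V by fact
  note e = HM_cochains_extensional[OF h]
  show "h (x \<oplus>\<^bsub>V\<^esub> y) = h x \<oplus>\<^bsub>HM_cochains k C M n\<^esub> h y" if "x \<in> carrier V" "y \<in> carrier V" for x y
    using that module_homD(2)[OF hom that]
    by (intro extensionalityI[OF e]) (auto simp: HM_cochains_simps)
  show "h (a \<odot>\<^bsub>V\<^esub> x) = a \<odot>\<^bsub>HM_cochains k C M n\<^esub> h x" if "a \<in> carrier k" "x \<in> carrier V" for a x
    using that module_homD(3)[OF hom that]
    by (intro extensionalityI[OF e]) (auto simp: HM_cochains_simps)
qed (rule h)

lemma HM_cochains_eval:
  assumes "p \<in> cells C n"
  shows "(\<lambda>f. f p) \<in> module_hom k (HM_cochains k C M n) (Bim M (hd (fst p)) (last (fst p)))"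
  using assms Pi_mem[OF HM_cochain_values assms] by (intro module_homI) (simp_all add: HM_cochains_simps case_prod_beta)

lemma HM_coboundary_hom: "HM_coboundary C M n \<in> module_hom k (HM_cochains k C M n) (HM_cochains k C M (Suc n))"
proof (rule HM_cochains_homI[OF HM_cochains_module HM_coboundary_closed])
  fix p assume "p \<in> cells C (Suc n)"
  then obtain xs cs where p: "p = (xs, cs)" and c: "(xs, cs) \<in> cells C (Suc n)" by (cases p) auto
  interpret V: plain_module k "Bim M (hd xs) (last xs)" by (rule Bim_plain[OF c])
  have face: "(\<lambda>f. HM_face C M n f i (xs, cs)) \<in> module_hom k (HM_cochains k C M n) (Bim M (hd xs) (last xs))" if "i \<le> Suc n" for i
  proof (rule HM_face_hom_pointwise[OF c that])
    fix q h assume q: "q \<in> cells C n" and h: "h \<in> module_hom k (Bim M (hd (fst q)) (last (fst q))) (Bim M (hd xs) (last xs))"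
      and e: "\<And>f. HM_face C M n f i (xs, cs) = h (f q)"
    show ?thesis unfolding e by (rule module_hom_compose[OF HM_cochains_eval[OF q] h])
  qed
  have "(\<lambda>f. \<Oplus>\<^bsub>Bim M (hd xs) (last xs)\<^esub>i\<in>{..Suc n}. alt_sign (Bim M (hd xs) (last xs)) i (HM_face C M n f i (xs, cs)))
      \<in> module_hom k (HM_cochains k C M n) (Bim M (hd xs) (last xs))"
    by (rule V.finsum_hom[OF HM_cochains_module]) (rule module_hom_compose[OF face V.alt_sign_hom], simp)
  then show "(\<lambda>f. HM_coboundary C M n f p) \<in> module_hom k (HM_cochains k C M n) (Bim M (hd (fst p)) (last (fst p)))"
    unfolding p fst_conv by (rule module_hom_cong[OF HM_cochains_module]) (rule HM_coboundary_faces[OF HM_cochain_values c])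
qed

end

section \<open>The coboundary squares to zero\<close>

lemma contract_butlast:
  assumes l: "length xs = Suc (Suc (Suc n))" "length cs = Suc (Suc n)" and p: "p < n"
  shows "contract C p (butlast xs, butlast cs) = (butlast (fst (contract C p (xs, cs))), butlast (snd (contract C p (xs, cs))))"
proof -
  have l': "length (butlast xs) = Suc (Suc n)" "length (butlast cs) = Suc n" using l by simp_all
  have p': "p < Suc n" using p by simp
  note s = contract_simps[where C=C, OF l p'] and s' = contract_simps[where C=C, OF l' p]
  show ?thesis
    apply (rule prod_eqI)
     apply (rule nth_equalityI)
      apply (simp add: s s')
     apply (use p in \<open>simp add: s s' nth_butlast l skip_def\<close>)
    apply (rule nth_equalityI)
     apply (simp add: s s')
    apply (use p in \<open>auto simp: s s' nth_butlast l\<close>)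
    done
qed

lemma contract_tl:
  assumes l: "length xs = Suc (Suc (Suc n))" "length cs = Suc (Suc n)" and p: "p < n"
  shows "contract C p (tl xs, tl cs) = (tl (fst (contract C (Suc p) (xs, cs))), tl (snd (contract C (Suc p) (xs, cs))))"
proof -
  have l': "length (tl xs) = Suc (Suc n)" "length (tl cs) = Suc n" using l by simp_all
  have p': "Suc p < Suc n" using p by simp
  note s = contract_simps[where C=C, OF l p'] and s' = contract_simps[where C=C, OF l' p]
  show ?thesis
    apply (rule prod_eqI)
     apply (rule nth_equalityI)
      apply (simp add: s s')
     apply (use p in \<open>simp add: s s' nth_tl l skip_def\<close>)
    apply (rule nth_equalityI)
     apply (simp add: s s')
    apply (use p in \<open>auto simp: s s' nth_tl l\<close>)
    done
qed

lemma butlast_contract_last: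
  assumes l: "length xs = Suc (Suc (Suc n))" "length cs = Suc (Suc n)"
  shows "butlast (fst (contract C n (xs, cs))) = butlast (butlast xs)"
    and "butlast (snd (contract C n (xs, cs))) = butlast (butlast cs)"
proof -
  have p: "n < Suc n" by simp
  note s = contract_simps[where C=C, OF l p]
  show "butlast (fst (contract C n (xs, cs))) = butlast (butlast xs)"
    by (rule nth_equalityI) (simp_all add: s nth_butlast l skip_def)
  show "butlast (snd (contract C n (xs, cs))) = butlast (butlast cs)"
    by (rule nth_equalityI) (simp_all add: s nth_butlast l)
qed

lemma tl_contract_first:
  assumes l: "length xs = Suc (Suc (Suc n))" "length cs = Suc (Suc n)"
  shows "tl (fst (contract C 0 (xs, cs))) = tl (tl xs)" and "tl (snd (contract C 0 (xs, cs))) = tl (tl cs)"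
proof -
  have p: "0 < Suc n" by simp
  note s = contract_simps[where C=C, OF l p]
  show "tl (fst (contract C 0 (xs, cs))) = tl (tl xs)"
    by (rule nth_equalityI) (simp_all add: s nth_tl l skip_def)
  show "tl (snd (contract C 0 (xs, cs))) = tl (tl cs)"
    by (rule nth_equalityI) (simp_all add: s nth_tl l)
qed

locale linear_category = linear_precategory +
  assumes Cmp_assoc': "\<lbrakk>x \<in> Obj C; y \<in> Obj C; z \<in> Obj C; w \<in> Obj C;
        c \<in> carrier (Mor C y x); d \<in> carrier (Mor C z y); e \<in> carrier (Mor C w z)\<rbrakk> \<Longrightarrow>
      Cmp C w y x (Cmp C w z y e d) c = Cmp C w z x e (Cmp C z y x d c)"
    and Lact_assoc': "\<lbrakk>x \<in> Obj C; y \<in> Obj C; z \<in> Obj C; w \<in> Obj C;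
        m \<in> carrier (Bim M y x); c \<in> carrier (Mor C z y); d \<in> carrier (Mor C w z)\<rbrakk> \<Longrightarrow>
      Lact M w y x (Cmp C w z y d c) m = Lact M w z x d (Lact M z y x c m)"
    and Ract_assoc': "\<lbrakk>y \<in> Obj C; x \<in> Obj C; u \<in> Obj C; t \<in> Obj C;
        m \<in> carrier (Bim M y x); c \<in> carrier (Mor C x u); d \<in> carrier (Mor C u t)\<rbrakk> \<Longrightarrow>
      Ract M y x t m (Cmp C x u t c d) = Ract M y u t (Ract M y x u m c) d"
    and Lact_Ract': "\<lbrakk>z \<in> Obj C; y \<in> Obj C; x \<in> Obj C; u \<in> Obj C;
        c \<in> carrier (Mor C z y); m \<in> carrier (Bim M y x); d \<in> carrier (Mor C x u)\<rbrakk> \<Longrightarrow>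
      Ract M z x u (Lact M z y x c m) d = Lact M z y u c (Ract M y x u m d)"
begin

text \<open>The simplicial identity for inner faces. For \<open>p < q\<close> the two contractions
  compose disjoint pairs of slots; for \<open>p = q\<close> three consecutive morphisms are
  composed, and associativity is used.\<close>

lemma contract_contract:
  assumes c: "(xs, cs) \<in> cells C (Suc (Suc n))" and pq: "p \<le> q" "q < n"
  shows "contract C q (contract C p (xs, cs)) = contract C p (contract C (Suc q) (xs, cs))"
proof -
  note l = cellsD(1,2)[OF c]
  have o: "i \<le> Suc (Suc n) \<Longrightarrow> xs ! i \<in> Obj C" for i using cellsD(3)[OF c] by blast
  have m: "j < Suc (Suc n) \<Longrightarrow> cs ! j \<in> carrier (Mor C (xs ! j) (xs ! Suc j))" for j using cellsD(4)[OF c] by blast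
  have p: "p < Suc n" "p < n" and q: "Suc q < Suc n" using pq by auto
  let ?P = "contract C p (xs, cs)" and ?Q = "contract C (Suc q) (xs, cs)"
  note sp = contract_simps[where C=C, OF l p(1)] and sq = contract_simps[where C=C, OF l q]
  note sqp = contract_simps[where C=C, OF sp(1,2) pq(2), unfolded prod.collapse] and spq = contract_simps[where C=C, OF sq(1,2) p(2), unfolded prod.collapse]
  have assoc: "Cmp C (xs ! p) (xs ! Suc (Suc p)) (xs ! Suc (Suc (Suc p))) (Cmp C (xs ! p) (xs ! Suc p) (xs ! Suc (Suc p)) (cs ! p) (cs ! Suc p)) (cs ! Suc (Suc p))
     = Cmp C (xs ! p) (xs ! Suc p) (xs ! Suc (Suc (Suc p))) (cs ! p) (Cmp C (xs ! Suc p) (xs ! Suc (Suc p)) (xs ! Suc (Suc (Suc p))) (cs ! Suc p) (cs ! Suc (Suc p)))"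
    using p by (intro Cmp_assoc' o m) auto
  have "contract C q (fst ?P, snd ?P) = contract C p (fst ?Q, snd ?Q)"
  proof (rule prod_eqI)
    show "fst (contract C q (fst ?P, snd ?P)) = fst (contract C p (fst ?Q, snd ?Q))"
      by (rule nth_equalityI) (use pq in \<open>auto simp: sqp spq sp sq skip_def\<close>)
    show "snd (contract C q (fst ?P, snd ?P)) = snd (contract C p (fst ?Q, snd ?Q))"
    proof (rule nth_equalityI)
      show "length (snd (contract C q (fst ?P, snd ?P))) = length (snd (contract C p (fst ?Q, snd ?Q)))"
        by (simp add: sqp spq)
      fix i assume "i < length (snd (contract C q (fst ?P, snd ?P)))"
      then have i: "i < n" by (simp add: sqp)
      show "snd (contract C q (fst ?P, snd ?P)) ! i = snd (contract C p (fst ?Q, snd ?Q)) ! i"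
      proof (cases "p = q")
        case True
        note sqp' = sqp[unfolded True[symmetric]] and spq' = spq[unfolded True[symmetric]] and sq' = sq[unfolded True[symmetric]]
        show ?thesis using i assoc pq unfolding True[symmetric] by (simp add: sqp' spq' sp sq' skip_def)
      next
        case False
        then have "p < q" using pq by simp
        then show ?thesis using i pq by (auto simp: sqp spq sp sq skip_def)
      qed
    qed
  qed
  then show ?thesis by simp
qed

text \<open>The cosimplicial identity. Two faces at the source end meet by associativity of the
  right action, two at the target end by that of the left action, and one at each end by commutation
  of the two actions. In the remaining cases an end and an inner contraction do not interact, or two
  inner contractions meet as in \<open>contract_contract\<close>.\<close>

lemma HM_face_face:
  assumes f: "f \<in> vals n" and c: "(xs, cs) \<in> cells C (Suc (Suc n))" and ab: "a \<le> b" "b \<le> Suc n"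
  shows "HM_face C M (Suc n) (HM_face C M n f a) (Suc b) (xs, cs) = HM_face C M (Suc n) (HM_face C M n f b) a (xs, cs)"
proof -
  note l = cellsD(1,2)[OF c] and hl = cells_hd_last[OF c] and t = tl_cell[OF c] and b = butlast_cell[OF c]
  note tt = tl_cell[OF t(1)] and bb = butlast_cell[OF b(1)] and tb = tl_cell[OF b(1)]
  have o: "i \<le> Suc (Suc n) \<Longrightarrow> xs ! i \<in> Obj C" for i using cellsD(3)[OF c] by blast
  have m: "j < Suc (Suc n) \<Longrightarrow> cs ! j \<in> carrier (Mor C (xs ! j) (xs ! Suc j))" for j using cellsD(4)[OF c] by blast
  have nth: "\<And>i. i < Suc (Suc n) \<Longrightarrow> tl xs ! i = xs ! Suc i" "\<And>j. j < Suc n \<Longrightarrow> tl cs ! j = cs ! Suc j"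
    "\<And>i. i < Suc (Suc n) \<Longrightarrow> butlast xs ! i = xs ! i" "\<And>j. j < Suc n \<Longrightarrow> butlast cs ! j = cs ! j"
    using l by (simp_all add: nth_tl nth_butlast)
  have con: "contract C p (xs, cs) \<in> cells C (Suc n)" if "p < Suc n" for p
    by (rule contract_cell[OF linear_precategory_axioms c that])
  have conp: "(fst (contract C p (xs, cs)), snd (contract C p (xs, cs))) \<in> cells C (Suc n)" if "p < Suc n" for p
    using con[OF that] by simp
  have lastc: "last (snd (contract C p (xs, cs))) = (if p = n then Cmp C (xs ! n) (xs ! Suc n) (xs ! Suc (Suc n)) (cs ! n) (cs ! Suc n) else cs ! Suc n)"
    if "p < Suc n" for p
    using butlast_cell(4)[OF conp[OF that]] contract_simps(4)[where C=C, OF l that, of n] that by simp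
  have hdc: "hd (snd (contract C p (xs, cs))) = (if p = 0 then Cmp C (xs ! 0) (xs ! 1) (xs ! 2) (cs ! 0) (cs ! 1) else cs ! 0)"
    if "p < Suc n" for p
    using tl_cell(4)[OF conp[OF that]] contract_simps(4)[where C=C, OF l that, of 0] that by (simp add: numeral_2_eq_2)
  have xc: "fst (contract C p (xs, cs)) ! i = xs ! skip p i" if "p < Suc n" "i \<le> Suc n" for p i
    using contract_simps(3)[where C=C, OF l that] .
  have ec: "hd (fst (contract C p (xs, cs))) = hd xs" "last (fst (contract C p (xs, cs))) = last xs" if "p < Suc n" for p
    using contract_ends[where C=C, OF l that] by auto
  consider "a = 0" "b = 0" | "a = 0" "0 < b" "b \<le> n" | "a = 0" "b = Suc n" | "0 < a" "b \<le> n" | "0 < a" "a \<le> n" "b = Suc n" | "a = Suc n" "b = Suc n"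
    using ab by linarith
  then show ?thesis
  proof cases
    case 1
    let ?u = "f (butlast (butlast xs), butlast (butlast cs))"
    have "?u \<in> carrier (Bim M (xs ! 0) (xs ! n))" using Pi_mem[OF f bb(1)] bb(2,3) b(2) hl nth by simp
    then have "Ract M (xs ! 0) (xs ! n) (xs ! Suc (Suc n)) ?u (Cmp C (xs ! n) (xs ! Suc n) (xs ! Suc (Suc n)) (cs ! n) (cs ! Suc n)) =
        Ract M (xs ! 0) (xs ! Suc n) (xs ! Suc (Suc n)) (Ract M (xs ! 0) (xs ! n) (xs ! Suc n) ?u (cs ! n)) (cs ! Suc n)"
      by (intro Ract_assoc' o m) auto
    then show ?thesis
      using 1 hl b bb nth lastc[of n] butlast_contract_last[where C=C, OF l] xc[of n n] xc[of n "Suc n"] ec[of n]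
      by (simp add: HM_face_def case_prod_beta skip_def)
  next
    case 2
    then have p: "n - b < n" "n - b < Suc n" "n - b \<noteq> n" by auto
    show ?thesis
      using 2 hl b lastc[OF p(2)] contract_butlast[where C=C, OF l p(1)] xc[OF p(2), of n] xc[OF p(2), of "Suc n"] ec[OF p(2)] p
      by (simp add: HM_face_def case_prod_beta skip_def)
  next
    case 3
    let ?u = "f (tl (butlast xs), tl (butlast cs))"
    have "?u \<in> carrier (Bim M (xs ! 1) (xs ! Suc n))" using Pi_mem[OF f tb(1)] tb(2,3) b(3) nth by simp
    then have "Ract M (xs ! 0) (xs ! Suc n) (xs ! Suc (Suc n)) (Lact M (xs ! 0) (xs ! 1) (xs ! Suc n) (cs ! 0) ?u) (cs ! Suc n) =
        Lact M (xs ! 0) (xs ! 1) (xs ! Suc (Suc n)) (cs ! 0) (Ract M (xs ! 1) (xs ! Suc n) (xs ! Suc (Suc n)) ?u (cs ! Suc n))"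
      using m[of 0] by (intro Lact_Ract' o m) auto
    then show ?thesis
      using 3 hl b t tb butlast_cell(4)[OF t(1)] nth by (simp add: HM_face_def butlast_tl)
  next
    case 4
    have pq: "n - b \<le> n - a" "n - a < n" "Suc (n - a) = Suc n - a" using ab 4 by auto
    show ?thesis
      using 4 ab contract_contract[OF c pq(1,2)] pq(3) by (simp add: HM_face_def case_prod_beta)
  next
    case 5
    then have p: "n - a < n" "Suc (n - a) < Suc n" "Suc n - a = Suc (n - a)" by auto
    show ?thesis
      using 5 hl t hdc[OF p(2)] contract_tl[where C=C, OF l p(1)] xc[OF p(2), of 0] xc[OF p(2), of 1] ec[OF p(2)] p
      by (simp add: HM_face_def case_prod_beta skip_def)
  next
    case 6
    let ?u = "f (tl (tl xs), tl (tl cs))"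
    have p: "0 < Suc n" by simp
    have "?u \<in> carrier (Bim M (xs ! 2) (xs ! Suc (Suc n)))"
      using Pi_mem[OF f tt(1)] tt(2,3) t(3) hl nth by (simp add: numeral_2_eq_2)
    then have "Lact M (xs ! 0) (xs ! 2) (xs ! Suc (Suc n)) (Cmp C (xs ! 0) (xs ! 1) (xs ! 2) (cs ! 0) (cs ! 1)) ?u =
        Lact M (xs ! 0) (xs ! 1) (xs ! Suc (Suc n)) (cs ! 0) (Lact M (xs ! 1) (xs ! 2) (xs ! Suc (Suc n)) (cs ! 1) ?u)"
      using m[of 0] m[of 1] by (intro Lact_assoc' o m) (auto simp: numeral_2_eq_2)
    then show ?thesis
      using 6 hl t tt nth hdc[OF p] tl_contract_first[where C=C, OF l] xc[OF p, of 0] xc[OF p, of 1] ec[OF p]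
      by (simp add: HM_face_def case_prod_beta skip_def numeral_2_eq_2)
  qed
qed

lemma HM_coboundary_sq:
  assumes f: "f \<in> carrier (HM_cochains k C M n)"
  shows "HM_coboundary C M (Suc n) (HM_coboundary C M n f) = \<zero>\<^bsub>HM_cochains k C M (Suc (Suc n))\<^esub>"
proof (rule HM_cochains_ext[where C=C and n="Suc (Suc n)"])
  note fv = HM_cochain_values[OF f] and dv = HM_cochain_values[OF HM_coboundary_closed[OF f]]
  fix xs cs assume c: "(xs, cs) \<in> cells C (Suc (Suc n))"
  let ?V = "Bim M (hd xs) (last xs)"
  interpret V: plain_module k ?V by (rule Bim_plain[OF c])
  have ff: "HM_face C M n f b \<in> vals (Suc n)" if "b \<le> Suc n" for b
  proof (rule Pi_I)
    fix p assume "p \<in> cells C (Suc n)"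
    then show "HM_face C M n f b p \<in> carrier (Bim M (hd (fst p)) (last (fst p)))"
      using HM_face_closed[OF fv _ that, of "fst p" "snd p"] by simp
  qed
  let ?t = "\<lambda>a b. HM_face C M (Suc n) (HM_face C M n f b) a (xs, cs)"
  have t: "?t a b \<in> carrier ?V" if "a \<le> Suc (Suc n)" "b \<le> Suc n" for a b
    by (rule HM_face_closed[OF ff[OF that(2)] c that(1)])
  \<comment> \<open>A face at a cell is a linear map applied to a value, so it can be moved inside
    the sum that computes the inner coboundary.\<close>
  have e: "HM_face C M (Suc n) (HM_coboundary C M n f) a (xs, cs) = (\<Oplus>\<^bsub>?V\<^esub>b\<in>{..Suc n}. alt_sign ?V b (?t a b))"
    if a: "a \<le> Suc (Suc n)" for a
  proof -
    obtain q h where q: "q \<in> cells C (Suc n)" "h \<in> module_hom k (Bim M (hd (fst q)) (last (fst q))) ?V"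
      "\<And>g. HM_face C M (Suc n) g a (xs, cs) = h (g q)" using HM_face_hom_pointwise[OF c a] by metis
    let ?U = "Bim M (hd (fst q)) (last (fst q))"
    interpret U: plain_module k ?U using Bim_plain[of "fst q" "snd q"] q(1) by simp
    have fq: "HM_face C M n f b q \<in> carrier ?U" if "b \<le> Suc n" for b using Pi_mem[OF ff[OF that] q(1)] .
    have "HM_coboundary C M n f q = (\<Oplus>\<^bsub>?U\<^esub>b\<in>{..Suc n}. alt_sign ?U b (HM_face C M n f b q))"
      using HM_coboundary_faces[OF fv, of "fst q" "snd q"] q(1) by simp
    then have "h (HM_coboundary C M n f q) = h (\<Oplus>\<^bsub>?U\<^esub>b\<in>{..Suc n}. alt_sign ?U b (HM_face C M n f b q))"
      by (rule arg_cong)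
    also have "\<dots> = (\<Oplus>\<^bsub>?V\<^esub>b\<in>{..Suc n}. h (alt_sign ?U b (HM_face C M n f b q)))"
      using fq by (intro module_hom_finsum[OF U.module_axioms V.module_axioms q(2)]) simp
    also have "\<dots> = (\<Oplus>\<^bsub>?V\<^esub>b\<in>{..Suc n}. alt_sign ?V b (?t a b))"
    proof (rule V.M.finsum_cong'[OF refl])
      show "(\<lambda>b. alt_sign ?V b (?t a b)) \<in> {..Suc n} \<rightarrow> carrier ?V" using t[OF a] by auto
      fix b assume "b \<in> {..Suc n}"
      then have b: "b \<le> Suc n" by simp
      show "h (alt_sign ?U b (HM_face C M n f b q)) = alt_sign ?V b (?t a b)"
        by (simp add: q(3) module_hom_alt_sign[OF U.module_axioms V.module_axioms q(2) fq[OF b]])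
    qed
    finally show ?thesis by (simp add: q(3))
  qed
  have "HM_coboundary C M (Suc n) (HM_coboundary C M n f) (xs, cs) =
      (\<Oplus>\<^bsub>?V\<^esub>a\<in>{..Suc (Suc n)}. alt_sign ?V a (\<Oplus>\<^bsub>?V\<^esub>b\<in>{..Suc n}. alt_sign ?V b (?t a b)))"
    unfolding HM_coboundary_faces[OF dv c]
  proof (rule V.M.finsum_cong'[OF refl])
    show "(\<lambda>a. alt_sign ?V a (\<Oplus>\<^bsub>?V\<^esub>b\<in>{..Suc n}. alt_sign ?V b (?t a b))) \<in> {..Suc (Suc n)} \<rightarrow> carrier ?V"
      using t by (auto intro!: V.alt_sign_closed V.M.finsum_closed)
  qed (simp add: e)
  also have "\<dots> = \<zero>\<^bsub>?V\<^esub>"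
    by (rule V.alternating_double_sum_zero[OF t]) (simp_all add: HM_face_face[OF fv c])
  finally show "HM_coboundary C M (Suc n) (HM_coboundary C M n f) (xs, cs) = \<zero>\<^bsub>HM_cochains k C M (Suc (Suc n))\<^esub> (xs, cs)"
    using c by (simp add: HM_cochains_simps)
qed (simp_all add: HM_coboundary_def HM_cochains_simps)

lemma HM_cochain_complex: "cochain_complex k (HM_cochains k C M) (HM_coboundary C M)"
  by (rule cochain_complex.intro) (rule HM_cochains_module HM_coboundary_hom HM_coboundary_sq, assumption?)+

end

section \<open>Pulling back cochains along functors\<close>

text \<open>The formula of \<open>cell_action\<close> for an arbitrary functor, so that the
  projection to the quotient and the action of a group element are treated together.\<close>

definition functor_cell ::
  "('o \<Rightarrow> 'p) \<Rightarrow> ('o \<Rightarrow> 'o \<Rightarrow> 'm \<Rightarrow> 'l) \<Rightarrow> 'o list \<times> 'm list \<Rightarrow> 'p list \<times> 'l list"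
  where "functor_cell \<phi> \<psi> = (\<lambda>(xs, cs). (map \<phi> xs, map (\<lambda>j. \<psi> (xs ! j) (xs ! Suc j) (cs ! j)) [0..<length cs]))"

lemma functor_cell_simps:
  "length (fst (functor_cell \<phi> \<psi> p)) = length (fst p)" "length (snd (functor_cell \<phi> \<psi> p)) = length (snd p)"
  "i < length (fst p) \<Longrightarrow> fst (functor_cell \<phi> \<psi> p) ! i = \<phi> (fst p ! i)"
  "j < length (snd p) \<Longrightarrow> snd (functor_cell \<phi> \<psi> p) ! j = \<psi> (fst p ! j) (fst p ! Suc j) (snd p ! j)"
  by (simp_all add: functor_cell_def case_prod_beta)

lemma cell_action_functor_cell: "cell_action \<phi> \<psi> s = functor_cell (\<phi> s) (\<psi> s)"
  by (simp add: cell_action_def functor_cell_def)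

text \<open>\<open>M\<close> is the pullback of \<open>M'\<close> along the functor, with equal
  rather than isomorphic spaces, so a cochain is pulled back by composition alone. The two instances
  are the projection onto the quotient and the action of a group element on \<open>C\<close> with
  coefficients in the lifted bimodule.\<close>

locale coefficient_functor =
  src: linear_precategory k C M + tgt: linear_precategory k C' M'
  for k :: "('k, 'r) ring_scheme" and C :: "('o, 'k, 'm) kcat" and M :: "('o, 'k, 'm, 'b) bimod"
    and C' :: "('p, 'k, 'l) kcat" and M' :: "('p, 'k, 'l, 'b) bimod" +
  fixes \<phi> :: "'o \<Rightarrow> 'p" and \<psi> :: "'o \<Rightarrow> 'o \<Rightarrow> 'm \<Rightarrow> 'l"
  assumes \<phi>_Obj: "x \<in> Obj C \<Longrightarrow> \<phi> x \<in> Obj C'"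
    and \<psi>_hom: "\<lbrakk>x \<in> Obj C; y \<in> Obj C\<rbrakk> \<Longrightarrow> \<psi> y x \<in> module_hom k (Mor C y x) (Mor C' (\<phi> y) (\<phi> x))"
    and \<psi>_Cmp: "\<lbrakk>x \<in> Obj C; y \<in> Obj C; z \<in> Obj C; c \<in> carrier (Mor C y x); d \<in> carrier (Mor C z y)\<rbrakk> \<Longrightarrow>
      \<psi> z x (Cmp C z y x d c) = Cmp C' (\<phi> z) (\<phi> y) (\<phi> x) (\<psi> z y d) (\<psi> y x c)"
    and Bim_pull: "\<lbrakk>x \<in> Obj C; y \<in> Obj C\<rbrakk> \<Longrightarrow> Bim M y x = Bim M' (\<phi> y) (\<phi> x)"
    and Lact_pull: "\<lbrakk>x \<in> Obj C; y \<in> Obj C; z \<in> Obj C; c \<in> carrier (Mor C z y)\<rbrakk> \<Longrightarrow>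
      Lact M z y x c m = Lact M' (\<phi> z) (\<phi> y) (\<phi> x) (\<psi> z y c) m"
    and Ract_pull: "\<lbrakk>y \<in> Obj C; x \<in> Obj C; u \<in> Obj C; c \<in> carrier (Mor C x u)\<rbrakk> \<Longrightarrow>
      Ract M y x u m c = Ract M' (\<phi> y) (\<phi> x) (\<phi> u) m (\<psi> x u c)"
begin

abbreviation act :: "'o list \<times> 'm list \<Rightarrow> 'p list \<times> 'l list"
  where "act \<equiv> functor_cell \<phi> \<psi>"

lemma act_cell:
  assumes c: "(xs, cs) \<in> cells C n"
  shows "act (xs, cs) \<in> cells C' n"
proof -
  note l = cellsD(1,2)[OF c]
  have "(fst (act (xs, cs)), snd (act (xs, cs))) \<in> cells C' n"
  proof (rule cellsI)
    show "fst (act (xs, cs)) ! i \<in> Obj C'" if "i \<le> n" for i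
      using that l \<phi>_Obj[OF cellsD(3)[OF c that]] by (simp add: functor_cell_simps)
    show "snd (act (xs, cs)) ! j \<in> carrier (Mor C' (fst (act (xs, cs)) ! j) (fst (act (xs, cs)) ! Suc j))" if "j < n" for j
      using that l module_homD(1)[OF \<psi>_hom cellsD(4)[OF c that]] cellsD(3)[OF c] by (simp add: functor_cell_simps)
  qed (simp_all add: functor_cell_simps l)
  then show ?thesis by simp
qed

lemma act_cell': "p \<in> cells C n \<Longrightarrow> act p \<in> cells C' n"
  using act_cell[of "fst p" "snd p"] by simp

lemma Bim_act:
  assumes c: "(xs, cs) \<in> cells C n"
  shows "Bim M' (hd (fst (act (xs, cs)))) (last (fst (act (xs, cs)))) = Bim M (hd xs) (last xs)"
proof -
  have "(fst (act (xs, cs)), snd (act (xs, cs))) \<in> cells C' n" using act_cell[OF c] by simp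
  note hl = cells_hd_last[OF this] cells_hd_last[OF c]
  show ?thesis using hl Bim_pull[of "last xs" "hd xs"] cellsD(1)[OF c] by (simp add: functor_cell_simps)
qed

lemma act_update:
  assumes c: "(xs, cs) \<in> cells C n" and j: "j < n"
  shows "act (xs, cs[j := d]) = (fst (act (xs, cs)), (snd (act (xs, cs)))[j := \<psi> (xs ! j) (xs ! Suc j) d])"
proof (rule prod_eqI)
  note l = cellsD(1,2)[OF c]
  show "fst (act (xs, cs[j := d])) = fst (fst (act (xs, cs)), (snd (act (xs, cs)))[j := \<psi> (xs ! j) (xs ! Suc j) d])"
    by (simp add: functor_cell_def)
  show "snd (act (xs, cs[j := d])) = snd (fst (act (xs, cs)), (snd (act (xs, cs)))[j := \<psi> (xs ! j) (xs ! Suc j) d])"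
    by (rule nth_equalityI) (use j in \<open>auto simp: functor_cell_simps nth_list_update l\<close>)
qed

lemma act_tl:
  assumes c: "(xs, cs) \<in> cells C (Suc n)"
  shows "act (tl xs, tl cs) = (tl (fst (act (xs, cs))), tl (snd (act (xs, cs))))"
proof (rule prod_eqI)
  note l = cellsD(1,2)[OF c]
  show "fst (act (tl xs, tl cs)) = fst (tl (fst (act (xs, cs))), tl (snd (act (xs, cs))))"
    by (simp add: functor_cell_def map_tl)
  show "snd (act (tl xs, tl cs)) = snd (tl (fst (act (xs, cs))), tl (snd (act (xs, cs))))"
    by (rule nth_equalityI) (auto simp: functor_cell_simps nth_tl l)
qed

lemma act_butlast:
  assumes c: "(xs, cs) \<in> cells C (Suc n)"
  shows "act (butlast xs, butlast cs) = (butlast (fst (act (xs, cs))), butlast (snd (act (xs, cs))))"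
proof (rule prod_eqI)
  note l = cellsD(1,2)[OF c]
  show "fst (act (butlast xs, butlast cs)) = fst (butlast (fst (act (xs, cs))), butlast (snd (act (xs, cs))))"
    by (simp add: functor_cell_def map_butlast)
  show "snd (act (butlast xs, butlast cs)) = snd (butlast (fst (act (xs, cs))), butlast (snd (act (xs, cs))))"
    by (rule nth_equalityI) (auto simp: functor_cell_simps nth_butlast l)
qed

lemma act_contract:
  assumes c: "(xs, cs) \<in> cells C (Suc n)" and j: "j < n"
  shows "act (contract C j (xs, cs)) = contract C' j (act (xs, cs))"
proof -
  note l = cellsD(1,2)[OF c]
  note s = contract_simps[where C=C, OF l j]
  have l': "length (fst (act (xs, cs))) = Suc (Suc n)" "length (snd (act (xs, cs))) = Suc n"
    by (simp_all add: functor_cell_simps l)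
  note s' = contract_simps[where C=C', OF l' j, unfolded prod.collapse]
  have o: "i \<le> Suc n \<Longrightarrow> xs ! i \<in> Obj C" for i using cellsD(3)[OF c] by blast
  have m: "j < Suc n \<Longrightarrow> cs ! j \<in> carrier (Mor C (xs ! j) (xs ! Suc j))" for j using cellsD(4)[OF c] by blast
  have cmp: "\<psi> (xs ! j) (xs ! Suc (Suc j)) (Cmp C (xs ! j) (xs ! Suc j) (xs ! Suc (Suc j)) (cs ! j) (cs ! Suc j)) =
      Cmp C' (\<phi> (xs ! j)) (\<phi> (xs ! Suc j)) (\<phi> (xs ! Suc (Suc j))) (\<psi> (xs ! j) (xs ! Suc j) (cs ! j)) (\<psi> (xs ! Suc j) (xs ! Suc (Suc j)) (cs ! Suc j))"
  proof -
    have jj: "Suc (Suc j) \<le> Suc n" "Suc j \<le> Suc n" "j \<le> Suc n" "Suc j < Suc n" "j < Suc n" using j by simp_all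
    show ?thesis by (rule \<psi>_Cmp[OF o[OF jj(1)] o[OF jj(2)] o[OF jj(3)] m[OF jj(4)] m[OF jj(5)]])
  qed
  have "act (fst (contract C j (xs, cs)), snd (contract C j (xs, cs))) = contract C' j (fst (act (xs, cs)), snd (act (xs, cs)))"
  proof (rule prod_eqI)
    show "fst (act (fst (contract C j (xs, cs)), snd (contract C j (xs, cs)))) = fst (contract C' j (fst (act (xs, cs)), snd (act (xs, cs))))"
      by (rule nth_equalityI) (auto simp: functor_cell_simps s s' l skip_def)
    show "snd (act (fst (contract C j (xs, cs)), snd (contract C j (xs, cs)))) = snd (contract C' j (fst (act (xs, cs)), snd (act (xs, cs))))"
      by (rule nth_equalityI) (use j in \<open>auto simp: functor_cell_simps s s' l skip_def cmp\<close>)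
  qed
  then show ?thesis by simp
qed

definition pull :: "nat \<Rightarrow> ('p list \<times> 'l list \<Rightarrow> 'b) \<Rightarrow> ('o list \<times> 'm list \<Rightarrow> 'b)"
  where "pull n f = (\<lambda>p\<in>cells C n. f (act p))"

lemma pull_closed:
  assumes f: "f \<in> carrier (HM_cochains k C' M' n)"
  shows "pull n f \<in> carrier (HM_cochains k C M n)"
proof (rule HM_cochainsI)
  show "pull n f \<in> extensional (cells C n)" by (simp add: pull_def)
  fix xs cs assume c: "(xs, cs) \<in> cells C n"
  have ac: "(fst (act (xs, cs)), snd (act (xs, cs))) \<in> cells C' n" using act_cell[OF c] by simp
  show "pull n f (xs, cs) \<in> carrier (Bim M (hd xs) (last xs))"
    using HM_cochainsD(1)[OF f ac] Bim_act[OF c] c by (simp add: pull_def)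
  fix j assume j: "j < n"
  have o: "xs ! j \<in> Obj C" "xs ! Suc j \<in> Obj C" using cellsD(3)[OF c] j by auto
  have "(\<lambda>c. f (fst (act (xs, cs)), (snd (act (xs, cs)))[j := c])) \<in>
      module_hom k (Mor C' (\<phi> (xs ! j)) (\<phi> (xs ! Suc j))) (Bim M (hd xs) (last xs))"
    using HM_cochainsD(2)[OF f ac j] Bim_act[OF c] cellsD(1)[OF c] j by (simp add: functor_cell_simps)
  then have "(\<lambda>c. f (fst (act (xs, cs)), (snd (act (xs, cs)))[j := \<psi> (xs ! j) (xs ! Suc j) c])) \<in>
      module_hom k (Mor C (xs ! j) (xs ! Suc j)) (Bim M (hd xs) (last xs))"
    by (rule module_hom_compose[OF \<psi>_hom[OF o(2,1)]])
  then show "(\<lambda>c. pull n f (xs, cs[j := c])) \<in> module_hom k (Mor C (xs ! j) (xs ! Suc j)) (Bim M (hd xs) (last xs))"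
    by (rule module_hom_cong[OF src.Mor_module[OF o(2,1)]]) (simp add: pull_def act_update[OF c j] cells_update[OF c j])
qed

lemma pull_hom: "pull n \<in> module_hom k (HM_cochains k C' M' n) (HM_cochains k C M n)"
proof (rule src.HM_cochains_homI[OF tgt.HM_cochains_module pull_closed])
  fix p assume p: "p \<in> cells C n"
  have "Bim M' (hd (fst (act p))) (last (fst (act p))) = Bim M (hd (fst p)) (last (fst p))"
    using Bim_act[of "fst p" "snd p"] p by simp
  then show "(\<lambda>f. pull n f p) \<in> module_hom k (HM_cochains k C' M' n) (Bim M (hd (fst p)) (last (fst p)))"
    using tgt.HM_cochains_eval[OF act_cell'[OF p]] p by (simp add: pull_def)
qed

lemma pull_face:
  assumes c: "(xs, cs) \<in> cells C (Suc n)" and i: "i \<le> Suc n"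
  shows "HM_face C M n (pull n f) i (xs, cs) = HM_face C' M' n f i (act (xs, cs))"
proof -
  note l = cellsD(1,2)[OF c] and hl = cells_hd_last[OF c] and t = tl_cell[OF c] and b = butlast_cell[OF c]
  have ac: "(fst (act (xs, cs)), snd (act (xs, cs))) \<in> cells C' (Suc n)" using act_cell[OF c] by simp
  note hl' = cells_hd_last[OF ac] and t' = tl_cell[OF ac] and b' = butlast_cell[OF ac]
  have o: "i \<le> Suc n \<Longrightarrow> xs ! i \<in> Obj C" for i using cellsD(3)[OF c] by blast
  have m: "j < Suc n \<Longrightarrow> cs ! j \<in> carrier (Mor C (xs ! j) (xs ! Suc j))" for j using cellsD(4)[OF c] by blast
  consider "i = 0" | "0 < i" "i \<le> n" | "i = Suc n" using i by linarith
  then show ?thesis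
  proof cases
    case 1
    then show ?thesis
      using hl hl' b b' l act_butlast[OF c] o m[of n] Ract_pull[of "xs ! 0" "xs ! n" "xs ! Suc n" "cs ! n"]
      by (simp add: HM_face_def pull_def case_prod_beta functor_cell_simps)
  next
    case 2
    then have "n - i < n" by simp
    then show ?thesis
      using 2 act_contract[OF c] contract_cell[OF src.linear_precategory_axioms c] by (simp add: HM_face_def pull_def case_prod_beta)
  next
    case 3
    then show ?thesis
      using hl hl' t t' l act_tl[OF c] o m[of 0] Lact_pull[of "xs ! Suc n" "xs ! 1" "xs ! 0" "cs ! 0"]
      by (simp add: HM_face_def pull_def case_prod_beta functor_cell_simps)
  qed
qed

text \<open>The functor carries contractions to contractions and the actions to the actions, so
  every single face commutes with the pullback.\<close>

lemma pull_coboundary: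
  assumes f: "f \<in> carrier (HM_cochains k C' M' n)"
  shows "pull (Suc n) (HM_coboundary C' M' n f) = HM_coboundary C M n (pull n f)"
proof (rule HM_cochains_ext[where C=C and n="Suc n"])
  fix xs cs assume c: "(xs, cs) \<in> cells C (Suc n)"
  let ?V = "Bim M (hd xs) (last xs)"
  interpret V: plain_module k ?V by (rule src.Bim_plain[OF c])
  have ac: "(fst (act (xs, cs)), snd (act (xs, cs))) \<in> cells C' (Suc n)" using act_cell[OF c] by simp
  have "HM_coboundary C M n (pull n f) (xs, cs) = (\<Oplus>\<^bsub>?V\<^esub>i\<in>{..Suc n}. alt_sign ?V i (HM_face C M n (pull n f) i (xs, cs)))"
    by (rule src.HM_coboundary_faces[OF src.HM_cochain_values[OF pull_closed[OF f]] c])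
  also have "\<dots> = (\<Oplus>\<^bsub>?V\<^esub>i\<in>{..Suc n}. alt_sign ?V i (HM_face C' M' n f i (act (xs, cs))))"
  proof (rule V.M.finsum_cong'[OF refl])
    show "(\<lambda>i. alt_sign ?V i (HM_face C' M' n f i (act (xs, cs)))) \<in> {..Suc n} \<rightarrow> carrier ?V"
      using tgt.HM_face_closed[OF tgt.HM_cochain_values[OF f] ac] Bim_act[OF c] by auto
  qed (simp add: pull_face[OF c])
  also have "\<dots> = HM_coboundary C' M' n f (act (xs, cs))"
    using tgt.HM_coboundary_faces[OF tgt.HM_cochain_values[OF f] ac] Bim_act[OF c] by simp
  finally show "pull (Suc n) (HM_coboundary C' M' n f) (xs, cs) = HM_coboundary C M n (pull n f) (xs, cs)"
    using c by (simp add: pull_def)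
qed (simp_all add: pull_def HM_coboundary_def)

end

section \<open>Group cochains\<close>

definition gcontract :: "('g, 'n) monoid_scheme \<Rightarrow> nat \<Rightarrow> 'g list \<Rightarrow> 'g list"
  where "gcontract G m gs = take m gs @ [gs ! m \<otimes>\<^bsub>G\<^esub> gs ! Suc m] @ drop (Suc (Suc m)) gs"

lemma gcontract_simps:
  assumes "length gs = Suc n" "m < n"
  shows "length (gcontract G m gs) = n"
    and "i < n \<Longrightarrow> gcontract G m gs ! i = (if i < m then gs ! i else if i = m then gs ! m \<otimes>\<^bsub>G\<^esub> gs ! Suc m else gs ! Suc i)"
  using assms by (auto simp: gcontract_def nth_append min_def nth_Cons' Suc_diff_le)

lemma group_tuplesI: "\<lbrakk>length gs = p; \<And>i. i < p \<Longrightarrow> gs ! i \<in> carrier G\<rbrakk> \<Longrightarrow> gs \<in> group_tuples G p"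
  by (auto simp: group_tuples_def in_set_conv_nth)

lemma group_tuplesD:
  assumes "gs \<in> group_tuples G p"
  shows "length gs = p" "i < p \<Longrightarrow> gs ! i \<in> carrier G"
  using assms by (auto simp: group_tuples_def subset_iff)

definition group_face ::
  "('g, 'n) monoid_scheme \<Rightarrow> ('g \<Rightarrow> 'a \<Rightarrow> 'a) \<Rightarrow> nat \<Rightarrow> ('g list \<Rightarrow> 'a) \<Rightarrow> nat \<Rightarrow> 'g list \<Rightarrow> 'a"
  where "group_face G \<rho> p f i gs =
    (if i = 0 then \<rho> (hd gs) (f (tl gs)) else if i \<le> p then f (gcontract G (i - 1) gs) else f (butlast gs))"

context group
begin

lemma tl_tuple:
  assumes "gs \<in> group_tuples G (Suc p)"
  shows "tl gs \<in> group_tuples G p"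
  using group_tuplesD(1)[OF assms] group_tuplesD(2)[OF assms] by (intro group_tuplesI) (simp_all add: nth_tl)

lemma butlast_tuple:
  assumes "gs \<in> group_tuples G (Suc p)"
  shows "butlast gs \<in> group_tuples G p"
  using group_tuplesD(1)[OF assms] group_tuplesD(2)[OF assms] by (intro group_tuplesI) (simp_all add: nth_butlast)

lemma gcontract_tuple:
  assumes "gs \<in> group_tuples G (Suc p)" "m < p"
  shows "gcontract G m gs \<in> group_tuples G p"
  using gcontract_simps[where G=G, OF group_tuplesD(1)[OF assms(1)] assms(2)] group_tuplesD(2)[OF assms(1)] assms(2)
  by (intro group_tuplesI) auto

lemma hd_tuple:
  assumes "gs \<in> group_tuples G (Suc p)"
  shows "hd gs \<in> carrier G" "hd gs = gs ! 0"
proof -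
  have "gs \<noteq> []" using group_tuplesD(1)[OF assms] by auto
  then show "hd gs \<in> carrier G" "hd gs = gs ! 0" using group_tuplesD(2)[OF assms, of 0] by (simp_all add: hd_conv_nth)
qed

lemma gcontract_gcontract:
  assumes gs: "gs \<in> group_tuples G (Suc (Suc n))" and pq: "p \<le> q" "q < n"
  shows "gcontract G q (gcontract G p gs) = gcontract G p (gcontract G (Suc q) gs)"
proof -
  note l = group_tuplesD(1)[OF gs]
  have p: "p < Suc n" "p < n" and q: "Suc q < Suc n" using pq by auto
  note sp = gcontract_simps[where G=G, OF l p(1)] and sq = gcontract_simps[where G=G, OF l q]
  note sqp = gcontract_simps[where G=G, OF sp(1) pq(2)] and spq = gcontract_simps[where G=G, OF sq(1) p(2)]
  have assoc: "gs ! p \<otimes> gs ! Suc p \<otimes> gs ! Suc (Suc p) = gs ! p \<otimes> (gs ! Suc p \<otimes> gs ! Suc (Suc p))"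
    using group_tuplesD(2)[OF gs] p by (intro m_assoc) auto
  show ?thesis
  proof (rule nth_equalityI)
    show "length (gcontract G q (gcontract G p gs)) = length (gcontract G p (gcontract G (Suc q) gs))" by (simp add: sqp spq)
    fix i assume "i < length (gcontract G q (gcontract G p gs))"
    then have i: "i < n" by (simp add: sqp)
    show "gcontract G q (gcontract G p gs) ! i = gcontract G p (gcontract G (Suc q) gs) ! i"
    proof (cases "p = q")
      case True
      note sqp' = sqp[unfolded True[symmetric]] and spq' = spq[unfolded True[symmetric]] and sq' = sq[unfolded True[symmetric]]
      show ?thesis using i assoc pq unfolding True[symmetric] by (simp add: sqp' spq' sp sq')
    next
      case False
      then have "p < q" using pq by simp
      then show ?thesis using i pq by (auto simp: sqp spq sp sq)
    qed
  qed
qed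

lemma gcontract_tl:
  assumes "gs \<in> group_tuples G (Suc (Suc n))" "m < n"
  shows "gcontract G m (tl gs) = tl (gcontract G (Suc m) gs)" "hd (gcontract G (Suc m) gs) = hd gs"
proof -
  note l = group_tuplesD(1)[OF assms(1)]
  have l': "length (tl gs) = Suc n" using l by simp
  have m: "Suc m < Suc n" using assms by simp
  note s = gcontract_simps[where G=G, OF l m] and s' = gcontract_simps[where G=G, OF l' assms(2)]
  show "gcontract G m (tl gs) = tl (gcontract G (Suc m) gs)"
    by (rule nth_equalityI) (use assms(2) in \<open>auto simp: s s' nth_tl l\<close>)
  have "gcontract G (Suc m) gs \<noteq> []" "gs \<noteq> []" using s(1) l by auto
  then show "hd (gcontract G (Suc m) gs) = hd gs" using s(2)[of 0] by (simp add: hd_conv_nth)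
qed

lemma gcontract_butlast:
  assumes "gs \<in> group_tuples G (Suc (Suc n))" "m < n"
  shows "gcontract G m (butlast gs) = butlast (gcontract G m gs)"
proof -
  note l = group_tuplesD(1)[OF assms(1)]
  have l': "length (butlast gs) = Suc n" using l by simp
  have m: "m < Suc n" using assms by simp
  note s = gcontract_simps[where G=G, OF l m] and s' = gcontract_simps[where G=G, OF l' assms(2)]
  show ?thesis by (rule nth_equalityI) (use assms(2) in \<open>auto simp: s s' nth_butlast l\<close>)
qed

lemma gcontract_first_last:
  assumes "gs \<in> group_tuples G (Suc (Suc n))"
  shows "tl (gcontract G 0 gs) = tl (tl gs)" "hd (gcontract G 0 gs) = gs ! 0 \<otimes> gs ! 1"
    "butlast (gcontract G n gs) = butlast (butlast gs)"
proof -
  note l = group_tuplesD(1)[OF assms]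
  have m: "0 < Suc n" "n < Suc n" by auto
  note s = gcontract_simps[where G=G, OF l m(1)] and s' = gcontract_simps[where G=G, OF l m(2)]
  show "tl (gcontract G 0 gs) = tl (tl gs)" by (rule nth_equalityI) (auto simp: s nth_tl l)
  have "gcontract G 0 gs \<noteq> []" using s(1) by auto
  then show "hd (gcontract G 0 gs) = gs ! 0 \<otimes> gs ! 1" using s(2)[of 0] by (simp add: hd_conv_nth)
  show "butlast (gcontract G n gs) = butlast (butlast gs)" by (rule nth_equalityI) (auto simp: s' nth_butlast l)
qed

end

text \<open>The sum is formed in \<open>M\<close> while \<open>h\<close> is linear on
  \<open>Z\<close> only, so membership in \<open>Z\<close> is carried through the induction together
  with the equation.\<close>

lemma (in plain_module) hom_finsum_on:
  fixes N :: "('k, 'b) module"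
  assumes N: "module R N" and Z: "submodule R Z M" and h: "h \<in> module_hom R (M\<lparr>carrier := Z\<rparr>) N"
    and g: "\<And>i. i \<in> I \<Longrightarrow> g i \<in> Z"
  shows "(\<Oplus>i\<in>I. g i) \<in> Z \<and> h (\<Oplus>i\<in>I. g i) = (\<Oplus>\<^bsub>N\<^esub>i\<in>I. h (g i))"
proof -
  interpret N: module R N by fact
  have m: "module R (M\<lparr>carrier := Z\<rparr>)" using Z by (rule submodule_is_module)
  have h0: "h \<zero> = \<zero>\<^bsub>N\<^esub>" using module_hom_zero[OF m N h] by simp
  have hc: "\<And>x. x \<in> Z \<Longrightarrow> h x \<in> carrier N" and ha: "\<And>x y. \<lbrakk>x \<in> Z; y \<in> Z\<rbrakk> \<Longrightarrow> h (x \<oplus> y) = h x \<oplus>\<^bsub>N\<^esub> h y"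
    using module_homD(1)[OF h] module_homD(2)[OF h] by simp_all
  have Zc: "\<And>x. x \<in> Z \<Longrightarrow> x \<in> carrier M" using subset_submodule[OF Z] by blast
  show ?thesis using g
  proof (induction I rule: infinite_finite_induct)
    case (insert i I)
    have IH: "(\<Oplus>i\<in>I. g i) \<in> Z" "h (\<Oplus>i\<in>I. g i) = (\<Oplus>\<^bsub>N\<^esub>i\<in>I. h (g i))" using insert by auto
    have gi: "g i \<in> Z" "\<And>j. j \<in> I \<Longrightarrow> g j \<in> Z" using insert.prems by auto
    have e: "(\<Oplus>j\<in>insert i I. g j) = g i \<oplus> (\<Oplus>j\<in>I. g j)"
      using insert(1,2) gi Zc by (intro M.finsum_insert) auto
    have e': "(\<Oplus>\<^bsub>N\<^esub>j\<in>insert i I. h (g j)) = h (g i) \<oplus>\<^bsub>N\<^esub> (\<Oplus>\<^bsub>N\<^esub>j\<in>I. h (g j))"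
      using insert(1,2) gi hc by (intro N.M.finsum_insert) auto
    show ?case using submodule.m_closed[OF Z gi(1) IH(1)] ha[OF gi(1) IH(1)] IH(2) by (simp only: e e')
  qed (use h0 submodule.zero_closed[OF Z] in simp_all)
qed

lemma module_hom_product:
  assumes V: "module R V" and ext: "\<And>x. f x \<in> extensional I"
    and hom: "\<And>i. i \<in> I \<Longrightarrow> (\<lambda>x. f x i) \<in> module_hom R V (W i)"
  shows "f \<in> module_hom R V (product_module I W)"
proof (rule module_homI)
  show "f x \<in> carrier (product_module I W)" if "x \<in> carrier V" for x
    using ext module_homD(1)[OF hom that] by (auto simp: product_module_simps PiE_def)
  show "f (x \<oplus>\<^bsub>V\<^esub> y) = f x \<oplus>\<^bsub>product_module I W\<^esub> f y" if "x \<in> carrier V" "y \<in> carrier V" for x y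
    using module_homD(2)[OF hom that] by (intro extensionalityI[OF ext]) (auto simp: product_module_simps)
  show "f (a \<odot>\<^bsub>V\<^esub> x) = a \<odot>\<^bsub>product_module I W\<^esub> f x" if "a \<in> carrier R" "x \<in> carrier V" for a x
    using module_homD(3)[OF hom that] by (intro extensionalityI[OF ext]) (auto simp: product_module_simps)
qed

text \<open>The locale asks for linearity of each operator; the group law of the action is passed
  separately to the statements that use it, such as \<open>group_coboundary_sq\<close>.\<close>

locale group_module = group G + plain_module k X
  for k :: "('k, 'r) ring_scheme" and G :: "('g, 'n) monoid_scheme" and X :: "('k, 'a) module" +
  fixes \<rho> :: "'g \<Rightarrow> 'a \<Rightarrow> 'a"
  assumes \<rho>_hom: "s \<in> carrier G \<Longrightarrow> \<rho> s \<in> module_hom k X X"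
begin

lemma group_cochains_module: "module k (group_cochains G X p)"
  unfolding group_cochains_def by (rule product_module_module[OF R.cring_axioms module_axioms])

lemma group_cochains_carrier: "f \<in> carrier (group_cochains G X p) \<longleftrightarrow> f \<in> group_tuples G p \<rightarrow>\<^sub>E carrier X"
  by (simp add: group_cochains_def product_module_simps)

lemma group_face_closed:
  assumes f: "f \<in> group_tuples G p \<rightarrow> carrier X" and gs: "gs \<in> group_tuples G (Suc p)"
  shows "group_face G \<rho> p f i gs \<in> carrier X"
proof (cases "i = 0")
  case True
  then show ?thesis using Pi_mem[OF f tl_tuple[OF gs]] module_homD(1)[OF \<rho>_hom[OF hd_tuple(1)[OF gs]]] by (simp add: group_face_def)
next
  case False
  show ?thesis
  proof (cases "i \<le> p")
    case True
    then have "i - 1 < p" using False by simp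
    then show ?thesis using Pi_mem[OF f gcontract_tuple[OF gs]] True False by (simp add: group_face_def)
  next
    case f': False
    then show ?thesis using False Pi_mem[OF f butlast_tuple[OF gs]] by (simp add: group_face_def)
  qed
qed

lemma group_coboundary_faces:
  assumes f: "f \<in> group_tuples G p \<rightarrow> carrier X" and gs: "gs \<in> group_tuples G (Suc p)"
  shows "group_coboundary G X \<rho> p f gs = (\<Oplus>\<^bsub>X\<^esub>i\<in>{..Suc p}. alt_sign X i (group_face G \<rho> p f i gs))"
proof -
  note fc = group_face_closed[OF f gs]
  have "(\<Oplus>\<^bsub>X\<^esub>i\<in>{1..p}. alt_sign X i (f (take (i - 1) gs @ [gs ! (i - 1) \<otimes>\<^bsub>G\<^esub> gs ! i] @ drop (i + 1) gs))) =
      (\<Oplus>\<^bsub>X\<^esub>i\<in>{1..p}. alt_sign X i (group_face G \<rho> p f i gs))"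
  proof (rule M.finsum_cong'[OF refl])
    show "(\<lambda>i. alt_sign X i (group_face G \<rho> p f i gs)) \<in> {1..p} \<rightarrow> carrier X" using fc by auto
    fix i assume i: "i \<in> {1..p}"
    then have "gcontract G (i - 1) gs = take (i - 1) gs @ [gs ! (i - 1) \<otimes>\<^bsub>G\<^esub> gs ! i] @ drop (i + 1) gs"
      by (simp add: gcontract_def)
    then show "alt_sign X i (f (take (i - 1) gs @ [gs ! (i - 1) \<otimes>\<^bsub>G\<^esub> gs ! i] @ drop (i + 1) gs)) = alt_sign X i (group_face G \<rho> p f i gs)"
      using i by (simp add: group_face_def)
  qed
  then have "group_coboundary G X \<rho> p f gs = group_face G \<rho> p f 0 gs \<oplus>\<^bsub>X\<^esub>
      (\<Oplus>\<^bsub>X\<^esub>i\<in>{1..p}. alt_sign X i (group_face G \<rho> p f i gs)) \<oplus>\<^bsub>X\<^esub> alt_sign X (Suc p) (group_face G \<rho> p f (Suc p) gs)"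
    using gs by (simp add: group_coboundary_def group_face_def)
  moreover have "(\<Oplus>\<^bsub>X\<^esub>i\<in>{1..p}. alt_sign X i (group_face G \<rho> p f i gs)) \<in> carrier X"
    using fc by (intro M.finsum_closed) auto
  ultimately show ?thesis using fc by (subst finsum_ends) (simp_all add: alt_sign_even M.a_ac)
qed

lemma group_coboundary_closed:
  assumes f: "f \<in> group_tuples G p \<rightarrow> carrier X"
  shows "group_coboundary G X \<rho> p f \<in> carrier (group_cochains G X (Suc p))"
  unfolding group_cochains_carrier
proof (rule PiE_I)
  fix gs assume gs: "gs \<in> group_tuples G (Suc p)"
  show "group_coboundary G X \<rho> p f gs \<in> carrier X"
    unfolding group_coboundary_faces[OF f gs] using group_face_closed[OF f gs] by (intro M.finsum_closed) auto
qed (simp add: group_coboundary_def)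

text \<open>The same pattern as for Hochschild cochains, with the trivial action at the right end.
  \<open>mult\<close> enters where two faces of index zero meet, and associativity in
  \<open>G\<close> where two inner contractions overlap.\<close>

lemma group_face_face:
  assumes f: "f \<in> group_tuples G p \<rightarrow> carrier X" and gs: "gs \<in> group_tuples G (Suc (Suc p))"
    and mult: "\<And>s t x. \<lbrakk>s \<in> carrier G; t \<in> carrier G; x \<in> carrier X\<rbrakk> \<Longrightarrow> \<rho> (s \<otimes>\<^bsub>G\<^esub> t) x = \<rho> s (\<rho> t x)"
    and ab: "a \<le> b" "b \<le> Suc p"
  shows "group_face G \<rho> (Suc p) (group_face G \<rho> p f a) (Suc b) gs = group_face G \<rho> (Suc p) (group_face G \<rho> p f b) a gs"
proof -
  note l = group_tuplesD(1)[OF gs] and t = tl_tuple[OF gs] and b = butlast_tuple[OF gs]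
  note h = hd_tuple[OF gs] and ht = hd_tuple[OF t] and hb = hd_tuple[OF b]
  have n: "tl gs ! 0 = gs ! 1" "butlast gs ! 0 = gs ! 0" using l by (simp_all add: nth_tl nth_butlast)
  consider "a = 0" "b = 0" | "a = 0" "0 < b" "b \<le> p" | "a = 0" "b = Suc p" | "0 < a" "b \<le> p" | "0 < a" "a \<le> p" "b = Suc p" | "a = Suc p" "b = Suc p"
    using ab by linarith
  then show ?thesis
  proof cases
    case 1
    have "\<rho> (gs ! 0 \<otimes>\<^bsub>G\<^esub> gs ! 1) (f (tl (tl gs))) = \<rho> (gs ! 0) (\<rho> (gs ! 1) (f (tl (tl gs))))"
      using group_tuplesD(2)[OF gs] Pi_mem[OF f tl_tuple[OF t]] by (intro mult) auto
    then show ?thesis using 1 h ht n gcontract_first_last[OF gs] by (simp add: group_face_def)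
  next
    case 2
    then obtain b' where b': "b = Suc b'" "b' < p" by (cases b) auto
    show ?thesis using 2 b' gcontract_tl[OF gs b'(2)] by (simp add: group_face_def)
  next
    case 3
    then show ?thesis using h hb n by (simp add: group_face_def butlast_tl)
  next
    case 4
    then have pq: "a - 1 \<le> b - 1" "b - 1 < p" "Suc (b - 1) = b" "Suc (a - 1) = a" using ab by auto
    show ?thesis using 4 ab gcontract_gcontract[OF gs pq(1,2)] pq(3,4) by (simp add: group_face_def)
  next
    case 5
    then have p: "a - 1 < p" by simp
    show ?thesis using 5 gcontract_butlast[OF gs p] by (simp add: group_face_def)
  next
    case 6
    then show ?thesis using gcontract_first_last(3)[OF gs] by (simp add: group_face_def)
  qed
qed

text \<open>The submodule \<open>Z\<close> is needed for the passage to cohomology classes, which is only defined on cocycles.\<close>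

lemma group_coboundary_natural:
  fixes Y :: "('k, 'b) module"
  assumes Y: "group_module k G Y \<sigma>" and Z: "submodule k Z X" and h: "h \<in> module_hom k (X\<lparr>carrier := Z\<rparr>) Y"
    and eq: "\<And>s x. \<lbrakk>s \<in> carrier G; x \<in> Z\<rbrakk> \<Longrightarrow> \<rho> s x \<in> Z \<and> h (\<rho> s x) = \<sigma> s (h x)"
    and f: "f \<in> group_tuples G p \<rightarrow> Z"
  shows "group_coboundary G Y \<sigma> p (\<lambda>gs\<in>group_tuples G p. h (f gs)) =
      (\<lambda>gs\<in>group_tuples G (Suc p). h (group_coboundary G X \<rho> p f gs))"
    and "group_coboundary G X \<rho> p f \<in> group_tuples G (Suc p) \<rightarrow> Z"
proof -
  interpret Y: group_module k G Y \<sigma> by fact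
  have m: "module k (X\<lparr>carrier := Z\<rparr>)" using Z by (rule submodule_is_module)
  have hc: "\<And>x. x \<in> Z \<Longrightarrow> h x \<in> carrier Y" using module_homD(1)[OF h] by simp
  have hm: "h (\<ominus>\<^bsub>X\<^esub> x) = \<ominus>\<^bsub>Y\<^esub> h x" if x: "x \<in> Z" for x
  proof -
    have c: "x \<in> carrier X" "h x \<in> carrier Y" using subset_submodule[OF Z] x hc by auto
    have "h ((\<ominus>\<^bsub>k\<^esub> \<one>\<^bsub>k\<^esub>) \<odot>\<^bsub>X\<^esub> x) = (\<ominus>\<^bsub>k\<^esub> \<one>\<^bsub>k\<^esub>) \<odot>\<^bsub>Y\<^esub> h x"
      using module_homD(3)[OF h, of "\<ominus>\<^bsub>k\<^esub> \<one>\<^bsub>k\<^esub>" x] x by simp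
    then show ?thesis using c by (simp add: smult_minus_1 Y.smult_minus_1)
  qed
  have Zc: "\<And>x. x \<in> Z \<Longrightarrow> x \<in> carrier X" using subset_submodule[OF Z] by blast
  have fX: "f \<in> group_tuples G p \<rightarrow> carrier X" using f Zc by auto
  let ?hf = "\<lambda>gs\<in>group_tuples G p. h (f gs)"
  have hf: "?hf \<in> group_tuples G p \<rightarrow> carrier Y" using f hc by auto
  have face: "group_face G \<rho> p f i gs \<in> Z \<and> group_face G \<sigma> p ?hf i gs = h (group_face G \<rho> p f i gs)"
    if gs: "gs \<in> group_tuples G (Suc p)" for i gs
  proof -
    consider "i = 0" | "0 < i" "i - 1 < p" "i \<le> p" | "0 < i" "p < i" by linarith
    then show ?thesis
    proof cases
      case 1
      then show ?thesis using tl_tuple[OF gs] Pi_mem[OF f tl_tuple[OF gs]] eq[OF hd_tuple(1)[OF gs]] by (simp add: group_face_def)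
    next
      case 2
      then show ?thesis using gcontract_tuple[OF gs 2(2)] Pi_mem[OF f gcontract_tuple[OF gs 2(2)]] by (simp add: group_face_def)
    next
      case 3
      then show ?thesis using butlast_tuple[OF gs] Pi_mem[OF f butlast_tuple[OF gs]] by (simp add: group_face_def)
    qed
  qed
  have sgn: "alt_sign X i x \<in> Z \<and> h (alt_sign X i x) = alt_sign Y i (h x)" if "x \<in> Z" for i x
    using that hm submodule_uminus[OF Z that] by (simp add: alt_sign_def)
  have main: "group_coboundary G X \<rho> p f gs \<in> Z \<and> group_coboundary G Y \<sigma> p ?hf gs = h (group_coboundary G X \<rho> p f gs)"
    if gs: "gs \<in> group_tuples G (Suc p)" for gs
  proof -
    have "(\<Oplus>\<^bsub>X\<^esub>i\<in>{..Suc p}. alt_sign X i (group_face G \<rho> p f i gs)) \<in> Z \<and>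
        h (\<Oplus>\<^bsub>X\<^esub>i\<in>{..Suc p}. alt_sign X i (group_face G \<rho> p f i gs)) = (\<Oplus>\<^bsub>Y\<^esub>i\<in>{..Suc p}. h (alt_sign X i (group_face G \<rho> p f i gs)))"
      using face[OF gs] sgn by (intro hom_finsum_on[OF Y.module_axioms Z h]) blast
    moreover have "(\<Oplus>\<^bsub>Y\<^esub>i\<in>{..Suc p}. h (alt_sign X i (group_face G \<rho> p f i gs))) =
        (\<Oplus>\<^bsub>Y\<^esub>i\<in>{..Suc p}. alt_sign Y i (group_face G \<sigma> p ?hf i gs))"
    proof (rule Y.M.finsum_cong'[OF refl])
      show "(\<lambda>i. alt_sign Y i (group_face G \<sigma> p ?hf i gs)) \<in> {..Suc p} \<rightarrow> carrier Y"
        using Y.group_face_closed[OF hf gs] by auto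
    qed (use face[OF gs] sgn in simp)
    ultimately show ?thesis by (simp only: group_coboundary_faces[OF fX gs] Y.group_coboundary_faces[OF hf gs])
  qed
  then show "group_coboundary G X \<rho> p f \<in> group_tuples G (Suc p) \<rightarrow> Z" by blast
  show "group_coboundary G Y \<sigma> p ?hf = (\<lambda>gs\<in>group_tuples G (Suc p). h (group_coboundary G X \<rho> p f gs))"
  proof
    fix gs show "group_coboundary G Y \<sigma> p ?hf gs = (\<lambda>gs\<in>group_tuples G (Suc p). h (group_coboundary G X \<rho> p f gs)) gs"
      using main by (cases "gs \<in> group_tuples G (Suc p)") (auto simp: group_coboundary_def)
  qed
qed

lemma group_coboundary_hom: "group_coboundary G X \<rho> p \<in> module_hom k (group_cochains G X p) (group_cochains G X (Suc p))"
proof -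
  let ?K = "group_cochains G X p"
  have ev: "(\<lambda>f. f q) \<in> module_hom k ?K X" if "q \<in> group_tuples G p" for q
    using that by (intro module_homI) (auto simp: group_cochains_def product_module_simps)
  have face: "(\<lambda>f. group_face G \<rho> p f i gs) \<in> module_hom k ?K X" if gs: "gs \<in> group_tuples G (Suc p)" for i gs
  proof -
    consider "i = 0" | "0 < i" "i - 1 < p" "i \<le> p" | "0 < i" "p < i" by linarith
    then show ?thesis
    proof cases
      case 1
      then show ?thesis using module_hom_compose[OF ev[OF tl_tuple[OF gs]] \<rho>_hom[OF hd_tuple(1)[OF gs]]] by (simp add: group_face_def)
    next
      case 2
      then show ?thesis using ev[OF gcontract_tuple[OF gs 2(2)]] by (simp add: group_face_def)
    next
      case 3
      then show ?thesis using ev[OF butlast_tuple[OF gs]] by (simp add: group_face_def)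
    qed
  qed
  show ?thesis unfolding group_cochains_def[of _ _ "Suc p"]
  proof (rule module_hom_product[OF group_cochains_module])
    fix gs assume gs: "gs \<in> group_tuples G (Suc p)"
    have "(\<lambda>f. \<Oplus>\<^bsub>X\<^esub>i\<in>{..Suc p}. alt_sign X i (group_face G \<rho> p f i gs)) \<in> module_hom k ?K X"
      by (rule finsum_hom[OF group_cochains_module module_hom_compose[OF face[OF gs] alt_sign_hom]])
    then show "(\<lambda>f. group_coboundary G X \<rho> p f gs) \<in> module_hom k ?K X"
    proof (rule module_hom_cong[OF group_cochains_module])
      fix f assume "f \<in> carrier ?K"
      then have "f \<in> group_tuples G p \<rightarrow> carrier X" by (auto simp: group_cochains_carrier)
      then show "group_coboundary G X \<rho> p f gs = (\<Oplus>\<^bsub>X\<^esub>i\<in>{..Suc p}. alt_sign X i (group_face G \<rho> p f i gs))"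
        by (rule group_coboundary_faces[OF _ gs])
    qed
  qed (simp add: group_coboundary_def)
qed

lemma group_coboundary_sq:
  assumes f: "f \<in> group_tuples G p \<rightarrow> carrier X"
    and mult: "\<And>s t x. \<lbrakk>s \<in> carrier G; t \<in> carrier G; x \<in> carrier X\<rbrakk> \<Longrightarrow> \<rho> (s \<otimes>\<^bsub>G\<^esub> t) x = \<rho> s (\<rho> t x)"
  shows "group_coboundary G X \<rho> (Suc p) (group_coboundary G X \<rho> p f) = \<zero>\<^bsub>group_cochains G X (Suc (Suc p))\<^esub>"
proof
  fix gs
  show "group_coboundary G X \<rho> (Suc p) (group_coboundary G X \<rho> p f) gs = \<zero>\<^bsub>group_cochains G X (Suc (Suc p))\<^esub> gs"
  proof (cases "gs \<in> group_tuples G (Suc (Suc p))")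
    case gs: True
    let ?df = "group_coboundary G X \<rho> p f"
    have df: "?df \<in> group_tuples G (Suc p) \<rightarrow> carrier X"
      using group_coboundary_closed[OF f] unfolding group_cochains_carrier by auto
    let ?t = "\<lambda>a b. group_face G \<rho> (Suc p) (group_face G \<rho> p f b) a gs"
    have ff: "group_face G \<rho> p f b \<in> group_tuples G (Suc p) \<rightarrow> carrier X" for b using group_face_closed[OF f] by blast
    have t: "?t a b \<in> carrier X" for a b by (rule group_face_closed[OF ff gs])
    have sum: "h (?df q) = (\<Oplus>\<^bsub>X\<^esub>b\<in>{..Suc p}. alt_sign X b (h (group_face G \<rho> p f b q)))"
      if q: "q \<in> group_tuples G (Suc p)" and h: "h \<in> module_hom k X X" for q h
    proof -
      have fq: "group_face G \<rho> p f b q \<in> carrier X" for b using group_face_closed[OF f q] .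
      have "h (?df q) = h (\<Oplus>\<^bsub>X\<^esub>b\<in>{..Suc p}. alt_sign X b (group_face G \<rho> p f b q))" unfolding group_coboundary_faces[OF f q] ..
      also have "\<dots> = (\<Oplus>\<^bsub>X\<^esub>b\<in>{..Suc p}. h (alt_sign X b (group_face G \<rho> p f b q)))"
        using fq by (intro module_hom_finsum[OF module_axioms module_axioms h]) simp
      also have "\<dots> = (\<Oplus>\<^bsub>X\<^esub>b\<in>{..Suc p}. alt_sign X b (h (group_face G \<rho> p f b q)))"
        using fq module_homD(1)[OF h fq] module_hom_alt_sign[OF module_axioms module_axioms h fq]
        by (intro M.finsum_cong') auto
      finally show ?thesis .
    qed
    have id: "(\<lambda>x. x) \<in> module_hom k X X" by (auto simp: module_hom_def)
    have e: "group_face G \<rho> (Suc p) ?df a gs = (\<Oplus>\<^bsub>X\<^esub>b\<in>{..Suc p}. alt_sign X b (?t a b))" for a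
    proof -
      consider "a = 0" | "0 < a" "a - 1 < Suc p" "a \<le> Suc p" | "0 < a" "Suc p < a" by linarith
      then show ?thesis
      proof cases
        case 1
        have "hd gs \<in> carrier G" by (rule hd_tuple(1)[OF gs])
        then show ?thesis using 1 sum[OF tl_tuple[OF gs] \<rho>_hom] by (simp add: group_face_def[of _ _ "Suc p"])
      next
        case 2
        then show ?thesis using sum[OF gcontract_tuple[OF gs 2(2)] id] by (simp add: group_face_def[of _ _ "Suc p"])
      next
        case 3
        then show ?thesis using sum[OF butlast_tuple[OF gs] id] by (simp add: group_face_def[of _ _ "Suc p"])
      qed
    qed
    have "group_coboundary G X \<rho> (Suc p) ?df gs = (\<Oplus>\<^bsub>X\<^esub>a\<in>{..Suc (Suc p)}. alt_sign X a (\<Oplus>\<^bsub>X\<^esub>b\<in>{..Suc p}. alt_sign X b (?t a b)))"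
      unfolding group_coboundary_faces[OF df gs] e ..
    also have "\<dots> = \<zero>\<^bsub>X\<^esub>"
      by (rule alternating_double_sum_zero[OF t]) (simp add: group_face_face[OF f gs mult])
    finally show ?thesis using gs by (simp add: group_cochains_def product_module_simps)
  qed (simp add: group_coboundary_def group_cochains_def product_module_simps)
qed

end

subsection \<open>Acyclicity of coinduced modules\<close>

text \<open>A module of functions on a free \<open>G\<close>-set: \<open>ev i\<close> is the evaluation at \<open>i\<close>, and \<open>\<tau> i\<close> measures the
  position of \<open>i\<close> in its orbit.\<close>

locale coinduced_module = group_module k G X \<rho>
  for k :: "('k, 'r) ring_scheme" and G :: "('g, 'n) monoid_scheme" and X :: "('k, 'a) module" and \<rho> +
  fixes I :: "'i set" and V :: "'i \<Rightarrow> ('k, 'v) module" and ev :: "'i \<Rightarrow> 'a \<Rightarrow> 'v" and \<tau> :: "'i \<Rightarrow> 'g"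
  assumes \<rho>_mult: "\<lbrakk>s \<in> carrier G; t \<in> carrier G; x \<in> carrier X\<rbrakk> \<Longrightarrow> \<rho> (s \<otimes>\<^bsub>G\<^esub> t) x = \<rho> s (\<rho> t x)"
    and \<rho>_one: "x \<in> carrier X \<Longrightarrow> \<rho> \<one>\<^bsub>G\<^esub> x = x"
    and V_module: "i \<in> I \<Longrightarrow> module k (V i)"
    and ev_hom: "i \<in> I \<Longrightarrow> ev i \<in> module_hom k X (V i)"
    and ev_inj: "\<lbrakk>x \<in> carrier X; y \<in> carrier X; \<And>i. i \<in> I \<Longrightarrow> ev i x = ev i y\<rbrakk> \<Longrightarrow> x = y"
    and \<tau>_closed: "i \<in> I \<Longrightarrow> \<tau> i \<in> carrier G"
    and glue: "w \<in> carrier G \<rightarrow> carrier X \<Longrightarrow> \<exists>x \<in> carrier X. \<forall>i \<in> I. ev i x = ev i (w (\<tau> i))"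
    and shift: "\<lbrakk>i \<in> I; g \<in> carrier G\<rbrakk> \<Longrightarrow>
      \<exists>j \<in> I. \<tau> j = inv\<^bsub>G\<^esub> g \<otimes>\<^bsub>G\<^esub> \<tau> i \<and> (\<forall>x \<in> carrier X. ev j x = ev i (\<rho> g x))"
begin

lemmas G_m_closed = monoid.m_closed[OF group.is_monoid[OF group_axioms]]
  and G_m_assoc = monoid.m_assoc[OF group.is_monoid[OF group_axioms]]
  and G_inv_closed = group.inv_closed[OF group_axioms]
  and G_inv_mult = group.inv_mult_group[OF group_axioms]
  and G_inv_inv = group.inv_inv[OF group_axioms]
  and G_r_inv = group.r_inv[OF group_axioms]

text \<open>The contracting homotopy is \<open>(h u)(gs) = (i \<mapsto> (\<rho> (\<tau> i) (u (inv (\<tau> i) # gs))) i)\<close>, the homogeneous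
  homotopy \<open>F \<mapsto> F (\<tau> i, \<dots>)\<close> written in inhomogeneous cochains.\<close>

theorem group_coboundary_exact:
  assumes "u \<in> carrier (group_cochains G X (Suc p))"
    and du: "group_coboundary G X \<rho> (Suc p) u = \<zero>\<^bsub>group_cochains G X (Suc (Suc p))\<^esub>"
  shows "\<exists>v \<in> carrier (group_cochains G X p). group_coboundary G X \<rho> p v = u"
proof -
  have u: "u \<in> group_tuples G (Suc p) \<rightarrow> carrier X" and ue: "u \<in> extensional (group_tuples G (Suc p))"
    using assms(1) by (auto simp: group_cochains_carrier PiE_def)
  have cons: "t # gs \<in> group_tuples G (Suc q)" if "t \<in> carrier G" "gs \<in> group_tuples G q" for t gs q
    using that by (auto simp: group_tuples_def)
  \<comment> \<open>The module \<open>X\<close> is abstract, so a value of the homotopy is described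
    by its evaluations; for different positions \<open>\<tau> i\<close> these come from different
    elements of \<open>X\<close>, and \<open>glue\<close> provides one element having all of
    them.\<close>
  define P where "P gs x \<longleftrightarrow> x \<in> carrier X \<and> (\<forall>i \<in> I. ev i x = ev i (\<rho> (\<tau> i) (u (inv\<^bsub>G\<^esub> (\<tau> i) # gs))))" for gs x
  have exP: "\<exists>x. P gs x" if gs: "gs \<in> group_tuples G p" for gs
  proof -
    have "(\<lambda>t. \<rho> t (u (inv\<^bsub>G\<^esub> t # gs))) \<in> carrier G \<rightarrow> carrier X"
    proof (rule Pi_I)
      fix t assume t: "t \<in> carrier G"
      show "\<rho> t (u (inv\<^bsub>G\<^esub> t # gs)) \<in> carrier X"
        by (rule module_homD(1)[OF \<rho>_hom[OF t] Pi_mem[OF u cons[OF G_inv_closed[OF t] gs]]])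
    qed
    from glue[OF this] show ?thesis unfolding P_def by blast
  qed
  define v where "v = (\<lambda>gs\<in>group_tuples G p. SOME x. P gs x)"
  have v: "P gs (v gs)" if "gs \<in> group_tuples G p" for gs
    using someI_ex[OF exP[OF that]] that by (simp add: v_def)
  have vX: "v \<in> group_tuples G p \<rightarrow> carrier X" using v by (auto simp: P_def)
  have vc: "v \<in> carrier (group_cochains G X p)" using vX by (auto simp: group_cochains_carrier PiE_def v_def)
  have dvX: "group_coboundary G X \<rho> p v \<in> group_tuples G (Suc p) \<rightarrow> carrier X"
    using group_coboundary_closed[OF vX] unfolding group_cochains_carrier by auto
  have main: "group_coboundary G X \<rho> p v gs = u gs" if gs: "gs \<in> group_tuples G (Suc p)" for gs
  proof (rule ev_inj[OF Pi_mem[OF dvX gs] Pi_mem[OF u gs]])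
    fix i assume i: "i \<in> I"
    interpret V: plain_module k "V i" using V_module[OF i] by (simp add: plain_module_def)
    let ?t = "inv\<^bsub>G\<^esub> (\<tau> i)"
    have t: "?t \<in> carrier G" "\<tau> i \<in> carrier G" using \<tau>_closed[OF i] G_inv_closed by auto
    note tgs = cons[OF t(1) gs]
    let ?h = "\<lambda>x. ev i (\<rho> (\<tau> i) x)"
    have h: "?h \<in> module_hom k X (V i)" by (rule module_hom_compose[OF \<rho>_hom[OF t(2)] ev_hom[OF i]])
    have ne: "gs \<noteq> []" using group_tuplesD(1)[OF gs] by auto
    have uc: "group_face G \<rho> (Suc p) u a (?t # gs) \<in> carrier X" for a by (rule group_face_closed[OF u tgs])
    have vcl: "group_face G \<rho> p v a gs \<in> carrier X" for a by (rule group_face_closed[OF vX gs])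
    have face: "?h (group_face G \<rho> (Suc p) u (Suc a) (?t # gs)) = ev i (group_face G \<rho> p v a gs)" if a: "a \<le> Suc p" for a
    proof -
      consider "a = 0" | "0 < a" "a - 1 < p" "a \<le> p" | "a = Suc p" using a by linarith
      then show ?thesis
      proof cases
        \<comment> \<open>Face zero of \<open>v\<close> acts by \<open>?g\<close>, which
          \<open>shift\<close> trades for a change of index from \<open>i\<close> to
          \<open>j\<close>. By the formula for \<open>\<tau> j\<close>, the tuple in the definition
          of \<open>v\<close> becomes the first contraction of \<open>?t # gs\<close>, and the two
          operators combine to that of \<open>\<tau> i\<close> again.\<close>
        case 1
        let ?g = "hd gs"
        have g: "?g \<in> carrier G" by (rule hd_tuple(1)[OF gs])
        obtain j where j: "j \<in> I" "\<tau> j = inv\<^bsub>G\<^esub> ?g \<otimes>\<^bsub>G\<^esub> \<tau> i" "\<forall>x \<in> carrier X. ev j x = ev i (\<rho> ?g x)"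
          using shift[OF i g] by blast
        note tl = tl_tuple[OF gs]
        have it: "inv\<^bsub>G\<^esub> (\<tau> j) = ?t \<otimes>\<^bsub>G\<^esub> ?g" using g t j(2) by (simp add: G_inv_mult G_inv_inv G_inv_closed)
        have c: "u ((?t \<otimes>\<^bsub>G\<^esub> ?g) # tl gs) \<in> carrier X" using Pi_mem[OF u cons[OF G_m_closed[OF t(1) g] tl]] .
        have tj: "\<tau> j \<in> carrier G" using \<tau>_closed[OF j(1)] .
        have vt: "v (tl gs) \<in> carrier X" using Pi_mem[OF vX tl] .
        have "ev i (group_face G \<rho> p v a gs) = ev j (v (tl gs))" using 1 j(3) vt by (simp add: group_face_def)
        also have "\<dots> = ev j (\<rho> (\<tau> j) (u ((?t \<otimes>\<^bsub>G\<^esub> ?g) # tl gs)))" using v[OF tl] j(1) it by (simp add: P_def)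
        also have "\<dots> = ev i (\<rho> ?g (\<rho> (\<tau> j) (u ((?t \<otimes>\<^bsub>G\<^esub> ?g) # tl gs))))"
          using j(3) module_homD(1)[OF \<rho>_hom[OF tj] c] by blast
        also have "\<dots> = ev i (\<rho> (?g \<otimes>\<^bsub>G\<^esub> \<tau> j) (u ((?t \<otimes>\<^bsub>G\<^esub> ?g) # tl gs)))" by (simp add: \<rho>_mult[OF g tj c])
        also have "?g \<otimes>\<^bsub>G\<^esub> \<tau> j = \<tau> i" using g t by (simp add: j(2) G_m_assoc[symmetric] G_inv_closed G_r_inv)
        finally show ?thesis using 1 ne by (simp add: group_face_def gcontract_def hd_conv_nth drop_Suc)
      next
        case 2
        then obtain b where b: "a = Suc b" "b < p" by (cases a) auto
        have e: "gcontract G (Suc b) (?t # gs) = ?t # gcontract G b gs" by (simp add: gcontract_def)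
        have vb: "P (gcontract G b gs) (v (gcontract G b gs))" by (rule v[OF gcontract_tuple[OF gs b(2)]])
        show ?thesis using b 2 vb i by (simp add: group_face_def e P_def)
      next
        case 3
        have vb: "P (butlast gs) (v (butlast gs))" by (rule v[OF butlast_tuple[OF gs]])
        show ?thesis using 3 vb i ne by (simp add: group_face_def P_def)
      qed
    qed
    have ec: "ev i (group_face G \<rho> p v a gs) \<in> carrier (V i)" for a by (rule module_homD(1)[OF ev_hom[OF i] vcl])
    have uic: "ev i (u gs) \<in> carrier (V i)" by (rule module_homD(1)[OF ev_hom[OF i] Pi_mem[OF u gs]])
    \<comment> \<open>Face zero of \<open>u\<close> acts by the inverse of \<open>\<tau> i\<close>,
      which the operator in the homotopy cancels.\<close>
    have face0: "?h (group_face G \<rho> (Suc p) u 0 (?t # gs)) = ev i (u gs)"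
      using \<rho>_mult[OF t(2) t(1) Pi_mem[OF u gs]] t \<rho>_one[OF Pi_mem[OF u gs]] by (simp add: group_face_def)
    \<comment> \<open>The cocycle condition for \<open>u\<close> is evaluated at
      \<open>?t # gs\<close>: face zero gives \<open>u gs\<close>, and face \<open>a + 1\<close>
      gives face \<open>a\<close> of \<open>v\<close> with the opposite sign, so that
      \<open>u gs\<close> and the coboundary of \<open>v\<close> agree at \<open>i\<close>.\<close>
    let ?S = "\<Oplus>\<^bsub>V i\<^esub>a\<in>{..Suc p}. alt_sign (V i) a (ev i (group_face G \<rho> p v a gs))"
    have Sc: "?S \<in> carrier (V i)" using ec by (intro V.M.finsum_closed) auto
    have "\<zero>\<^bsub>V i\<^esub> = ?h (group_coboundary G X \<rho> (Suc p) u (?t # gs))"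
      using du tgs module_hom_zero[OF module_axioms V.module_axioms h] by (simp add: group_cochains_def product_module_simps)
    also have "\<dots> = ?h (\<Oplus>\<^bsub>X\<^esub>a\<in>{..Suc (Suc p)}. alt_sign X a (group_face G \<rho> (Suc p) u a (?t # gs)))"
      unfolding group_coboundary_faces[OF u tgs] ..
    also have "\<dots> = (\<Oplus>\<^bsub>V i\<^esub>a\<in>{..Suc (Suc p)}. ?h (alt_sign X a (group_face G \<rho> (Suc p) u a (?t # gs))))"
      using uc by (intro module_hom_finsum[OF module_axioms V.module_axioms h]) simp
    also have "\<dots> = (\<Oplus>\<^bsub>V i\<^esub>a\<in>{..Suc (Suc p)}. alt_sign (V i) a (?h (group_face G \<rho> (Suc p) u a (?t # gs))))"
      using module_hom_alt_sign[OF module_axioms V.module_axioms h uc] module_homD(1)[OF h uc]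
      by (intro V.M.finsum_cong') auto
    also have "\<dots> = (\<Oplus>\<^bsub>V i\<^esub>a\<in>{..Suc p}. alt_sign (V i) (Suc a) (?h (group_face G \<rho> (Suc p) u (Suc a) (?t # gs))))
        \<oplus>\<^bsub>V i\<^esub> alt_sign (V i) 0 (?h (group_face G \<rho> (Suc p) u 0 (?t # gs)))"
      using module_homD(1)[OF h uc] by (intro V.M.finsum_Suc2) auto
    also have "(\<Oplus>\<^bsub>V i\<^esub>a\<in>{..Suc p}. alt_sign (V i) (Suc a) (?h (group_face G \<rho> (Suc p) u (Suc a) (?t # gs)))) =
        (\<Oplus>\<^bsub>V i\<^esub>a\<in>{..Suc p}. alt_sign (V i) 1 (alt_sign (V i) a (ev i (group_face G \<rho> p v a gs))))"
      using ec face by (intro V.M.finsum_cong') auto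
    also have "\<dots> = alt_sign (V i) 1 ?S"
      using ec by (intro module_hom_finsum[OF V.module_axioms V.module_axioms V.alt_sign_hom, symmetric]) simp
    also have "?h (group_face G \<rho> (Suc p) u 0 (?t # gs)) = ev i (u gs)" by (rule face0)
    finally have z: "\<zero>\<^bsub>V i\<^esub> = alt_sign (V i) 1 ?S \<oplus>\<^bsub>V i\<^esub> alt_sign (V i) 0 (ev i (u gs))" .
    have "e = S" if "S \<in> carrier (V i)" "e \<in> carrier (V i)" "\<zero>\<^bsub>V i\<^esub> = alt_sign (V i) 1 S \<oplus>\<^bsub>V i\<^esub> alt_sign (V i) 0 e" for e S
      using V.M.minus_equality[of e "\<ominus>\<^bsub>V i\<^esub> S"] that by (simp add: alt_sign_def V.M.a_comm)
    then have "ev i (u gs) = ?S" using Sc uic z by blast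
    also have "?S = (\<Oplus>\<^bsub>V i\<^esub>a\<in>{..Suc p}. ev i (alt_sign X a (group_face G \<rho> p v a gs)))"
      using module_hom_alt_sign[OF module_axioms V.module_axioms ev_hom[OF i] vcl] ec by (intro V.M.finsum_cong') auto
    also have "\<dots> = ev i (group_coboundary G X \<rho> p v gs)"
      unfolding group_coboundary_faces[OF vX gs]
      using vcl by (intro module_hom_finsum[OF module_axioms V.module_axioms ev_hom[OF i], symmetric]) simp
    finally show "ev i (group_coboundary G X \<rho> p v gs) = ev i (u gs)" ..
  qed
  have "group_coboundary G X \<rho> p v = u"
  proof (rule extensionalityI)
    show "group_coboundary G X \<rho> p v \<in> extensional (group_tuples G (Suc p))" by (simp add: group_coboundary_def)
    show "u \<in> extensional (group_tuples G (Suc p))" by (rule ue)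
  qed (rule main)
  with vc show ?thesis by blast
qed

end

section \<open>The spectral sequence of a complex with group action\<close>

locale equivariant_complex = group G + cochain_complex k A d
  for k :: "('k, 'r) ring_scheme" and G :: "('g, 'n) monoid_scheme" and A :: "nat \<Rightarrow> ('k, 'a) module" and d +
  fixes \<rho> :: "nat \<Rightarrow> 'g \<Rightarrow> 'a \<Rightarrow> 'a"
  assumes action_hom: "s \<in> carrier G \<Longrightarrow> \<rho> q s \<in> module_hom k (A q) (A q)"
    and action_mult: "\<lbrakk>s \<in> carrier G; t \<in> carrier G; x \<in> carrier (A q)\<rbrakk> \<Longrightarrow> \<rho> q (s \<otimes>\<^bsub>G\<^esub> t) x = \<rho> q s (\<rho> q t x)"
    and action_one: "x \<in> carrier (A q) \<Longrightarrow> \<rho> q \<one>\<^bsub>G\<^esub> x = x"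
    and d_action: "\<lbrakk>s \<in> carrier G; x \<in> carrier (A q)\<rbrakk> \<Longrightarrow> d q (\<rho> q s x) = \<rho> (Suc q) s (d q x)"
begin

lemma group_module_A: "group_module k G (A q) (\<rho> q)"
  by (intro group_module.intro group_module_axioms.intro) (rule group_axioms A.plain_module_axioms action_hom, assumption?)+

sublocale gm: group_module k G "A q" "\<rho> q" for q
  by (rule group_module_A)

abbreviation K :: "nat \<Rightarrow> nat \<Rightarrow> ('k, 'g list \<Rightarrow> 'a) module"
  where "K p q \<equiv> group_cochains G (A q) p"

abbreviation dh :: "nat \<Rightarrow> nat \<Rightarrow> ('g list \<Rightarrow> 'a) \<Rightarrow> ('g list \<Rightarrow> 'a)"
  where "dh p q \<equiv> group_coboundary G (A q) (\<rho> q) p"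

definition dv :: "nat \<Rightarrow> nat \<Rightarrow> ('g list \<Rightarrow> 'a) \<Rightarrow> ('g list \<Rightarrow> 'a)"
  where "dv p q f = (\<lambda>gs\<in>group_tuples G p. d q (f gs))"

lemma K_simps:
  shows "f \<in> carrier (K p q) \<longleftrightarrow> f \<in> group_tuples G p \<rightarrow>\<^sub>E carrier (A q)"
    and "\<zero>\<^bsub>K p q\<^esub> = (\<lambda>gs\<in>group_tuples G p. \<zero>\<^bsub>A q\<^esub>)"
    and "f \<oplus>\<^bsub>K p q\<^esub> g = (\<lambda>gs\<in>group_tuples G p. f gs \<oplus>\<^bsub>A q\<^esub> g gs)"
    and "a \<odot>\<^bsub>K p q\<^esub> f = (\<lambda>gs\<in>group_tuples G p. a \<odot>\<^bsub>A q\<^esub> f gs)"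
  by (simp_all add: group_cochains_def product_module_simps)

lemma K_mem: "\<lbrakk>f \<in> carrier (K p q); gs \<in> group_tuples G p\<rbrakk> \<Longrightarrow> f gs \<in> carrier (A q)"
  by (auto simp: K_simps)

lemma double: "double_complex k K dh dv"
proof (rule double_complex.intro)
  show "cring k" using A_module by (simp add: module_def)
  show "module k (K p q)" for p q by (rule gm.group_cochains_module)
  show "dh p q \<in> module_hom k (K p q) (K (Suc p) q)" for p q by (rule gm.group_coboundary_hom)
  show "dv p q \<in> module_hom k (K p q) (K p (Suc q))" for p q
  proof (rule module_homI)
    fix f assume f: "f \<in> carrier (K p q)"
    show "dv p q f \<in> carrier (K p (Suc q))" using K_mem[OF f] by (simp add: K_simps dv_def)
    show "dv p q (f \<oplus>\<^bsub>K p q\<^esub> g) = dv p q f \<oplus>\<^bsub>K p (Suc q)\<^esub> dv p q g" if g: "g \<in> carrier (K p q)" for g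
      using K_mem[OF f] K_mem[OF g] by (simp add: K_simps dv_def d_add cong: restrict_cong)
    show "dv p q (a \<odot>\<^bsub>K p q\<^esub> f) = a \<odot>\<^bsub>K p (Suc q)\<^esub> dv p q f" if a: "a \<in> carrier k" for a
      using K_mem[OF f] a by (simp add: K_simps dv_def d_smult cong: restrict_cong)
  qed
  fix f p q assume f: "f \<in> carrier (K p q)"
  then have f': "f \<in> group_tuples G p \<rightarrow> carrier (A q)" by (auto simp: K_simps)
  show "dh (Suc p) q (dh p q f) = \<zero>\<^bsub>K (Suc (Suc p)) q\<^esub>" by (rule gm.group_coboundary_sq[OF f' action_mult])
  show "dv p (Suc q) (dv p q f) = \<zero>\<^bsub>K p (Suc (Suc q))\<^esub>"
    using K_mem[OF f] by (simp add: K_simps dv_def d_sq cong: restrict_cong)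
  have dq: "d q \<in> module_hom k (A q\<lparr>carrier := carrier (A q)\<rparr>) (A (Suc q))" using d_hom by simp
  \<comment> \<open>Commutation of the two differentials is naturality of the group coboundary for
    the equivariant map \<open>d q\<close>.\<close>
  show "dh p (Suc q) (dv p q f) = dv (Suc p) q (dh p q f)"
    unfolding dv_def
    by (rule gm.group_coboundary_natural(1)[OF group_module_A A.submodule_carrier dq _ f'])
      (simp add: d_action module_homD(1)[OF action_hom])
qed

sublocale dc: double_complex k K dh dv
  by (rule double)

lemma column_cocycles: "cocycles (K p) (dv p) q = {f \<in> carrier (K p q). \<forall>gs \<in> group_tuples G p. f gs \<in> cocycles A d q}"
proof -
  have "dv p q f = \<zero>\<^bsub>K p (Suc q)\<^esub> \<longleftrightarrow> (\<forall>gs \<in> group_tuples G p. d q (f gs) = \<zero>\<^bsub>A (Suc q)\<^esub>)" for f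
    by (simp add: dv_def K_simps fun_eq_iff restrict_def) blast
  then show ?thesis using K_mem by (auto simp: cocycles_def)
qed

text \<open>Primitives can be chosen for each tuple separately, since no condition relates the
  values at different tuples; so cohomology commutes with the product over tuples.\<close>

lemma column_coboundaries: "coboundaries (K p) (dv p) q = {f \<in> carrier (K p q). \<forall>gs \<in> group_tuples G p. f gs \<in> coboundaries A d q}"
proof (cases q)
  case 0
  show ?thesis
  proof (intro equalityI subsetI)
    fix f assume "f \<in> coboundaries (K p) (dv p) q"
    then have "f = \<zero>\<^bsub>K p 0\<^esub>" using 0 by (simp add: coboundaries_0)
    then show "f \<in> {f \<in> carrier (K p q). \<forall>gs \<in> group_tuples G p. f gs \<in> coboundaries A d q}"
      using 0 dc.K.M.zero_closed[of 0 p] by (simp add: coboundaries_0 K_simps(2))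
  next
    fix f assume "f \<in> {f \<in> carrier (K p q). \<forall>gs \<in> group_tuples G p. f gs \<in> coboundaries A d q}"
    then have f: "f \<in> extensional (group_tuples G p)" "\<And>gs. gs \<in> group_tuples G p \<Longrightarrow> f gs = \<zero>\<^bsub>A 0\<^esub>"
      using 0 by (simp_all add: coboundaries_0 K_simps(1) PiE_def)
    have "f = \<zero>\<^bsub>K p 0\<^esub>"
      by (rule extensionalityI[OF f(1)]) (simp_all add: K_simps(2) f(2))
    then show "f \<in> coboundaries (K p) (dv p) q" using 0 by (simp add: coboundaries_0)
  qed
next
  case (Suc q')
  show ?thesis unfolding Suc coboundaries_Suc
  proof (intro equalityI subsetI)
    fix f assume "f \<in> dv p q' ` carrier (K p q')"
    then obtain y where y: "y \<in> carrier (K p q')" "f = dv p q' y" by blast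
    show "f \<in> {f \<in> carrier (K p (Suc q')). \<forall>gs \<in> group_tuples G p. f gs \<in> d q' ` carrier (A q')}"
      using dc.dv_closed[OF y(1)] K_mem[OF y(1)] y(2) by (simp add: dv_def)
  next
    fix f assume "f \<in> {f \<in> carrier (K p (Suc q')). \<forall>gs \<in> group_tuples G p. f gs \<in> d q' ` carrier (A q')}"
    then have f: "f \<in> carrier (K p (Suc q'))" "\<forall>gs \<in> group_tuples G p. \<exists>y. y \<in> carrier (A q') \<and> f gs = d q' y" by auto
    obtain y where y: "\<forall>gs \<in> group_tuples G p. y gs \<in> carrier (A q') \<and> f gs = d q' (y gs)" using bchoice[OF f(2)] by blast
    have r: "restrict y (group_tuples G p) \<in> carrier (K p q')" using y by (simp add: K_simps(1))
    have fe: "f \<in> extensional (group_tuples G p)" using f(1) by (simp add: K_simps(1) PiE_def)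
    have "f = dv p q' (restrict y (group_tuples G p))"
      by (rule extensionalityI[OF fe]) (use y in \<open>simp_all add: dv_def\<close>)
    then show "f \<in> dv p q' ` carrier (K p q')" using r by blast
  qed
qed

abbreviation H :: "nat \<Rightarrow> ('k, 'a set) module"
  where "H q \<equiv> cohomology A d q"

abbreviation \<sigma> :: "nat \<Rightarrow> 'g \<Rightarrow> 'a set \<Rightarrow> 'a set"
  where "\<sigma> q s C \<equiv> \<rho> q s ` C"

lemma action_closed: "\<lbrakk>s \<in> carrier G; x \<in> carrier (A q)\<rbrakk> \<Longrightarrow> \<rho> q s x \<in> carrier (A q)"
  by (rule module_homD(1)[OF action_hom])

lemma action_cocycles: "\<lbrakk>s \<in> carrier G; x \<in> cocycles A d q\<rbrakk> \<Longrightarrow> \<rho> q s x \<in> cocycles A d q"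
  using module_hom_zero[OF A_module A_module action_hom] by (simp add: cocycles_def action_closed d_action)

lemma action_coboundaries: "\<lbrakk>s \<in> carrier G; x \<in> coboundaries A d q\<rbrakk> \<Longrightarrow> \<rho> q s x \<in> coboundaries A d q"
proof (cases q)
  case (Suc q')
  assume s: "s \<in> carrier G" and x: "x \<in> coboundaries A d q"
  then obtain y where "y \<in> carrier (A q')" "x = d q' y" using Suc by (auto simp: coboundaries_Suc)
  then show ?thesis using s Suc d_action[OF s, of y q'] action_closed[OF s, of y q']
    by (simp add: coboundaries_Suc) (metis image_eqI)
qed (simp add: coboundaries_0 module_hom_zero[OF A_module A_module action_hom])

text \<open>\<open>s\<close> is invertible on coboundaries, so the image of a coset is a full coset
  and not merely contained in one. This justifies acting on classes by taking images of
  sets.\<close>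

lemma action_coset:
  assumes s: "s \<in> carrier G" and x: "x \<in> carrier (A q)"
  shows "\<sigma> q s (coboundaries A d q +>\<^bsub>A q\<^esub> x) = coboundaries A d q +>\<^bsub>A q\<^esub> \<rho> q s x"
proof (intro subset_antisym subsetI)
  let ?W = "coboundaries A d q"
  have Wc: "w \<in> ?W \<Longrightarrow> w \<in> carrier (A q)" for w using A.subset_submodule[OF coboundaries_sub] by blast
  fix y assume "y \<in> \<sigma> q s (?W +>\<^bsub>A q\<^esub> x)"
  then obtain w where w: "w \<in> ?W" "y = \<rho> q s (w \<oplus>\<^bsub>A q\<^esub> x)" by (auto simp: A.coset_def)
  then have "y = \<rho> q s w \<oplus>\<^bsub>A q\<^esub> \<rho> q s x" using module_homD(2)[OF action_hom[OF s] Wc[OF w(1)] x] by simp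
  then show "y \<in> ?W +>\<^bsub>A q\<^esub> \<rho> q s x" using action_coboundaries[OF s w(1)] by (auto simp: A.coset_def)
next
  let ?W = "coboundaries A d q"
  have Wc: "w \<in> ?W \<Longrightarrow> w \<in> carrier (A q)" for w using A.subset_submodule[OF coboundaries_sub] by blast
  fix y assume "y \<in> ?W +>\<^bsub>A q\<^esub> \<rho> q s x"
  then obtain w where w: "w \<in> ?W" "y = w \<oplus>\<^bsub>A q\<^esub> \<rho> q s x" by (auto simp: A.coset_def)
  let ?w = "\<rho> q (inv\<^bsub>G\<^esub> s) w"
  have w': "?w \<in> ?W" using action_coboundaries[OF inv_closed[OF s] w(1)] .
  have "\<rho> q s ?w = w" using action_mult[OF s inv_closed[OF s] Wc[OF w(1)]] s action_one[OF Wc[OF w(1)]] by simp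
  then have "y = \<rho> q s (?w \<oplus>\<^bsub>A q\<^esub> x)" using module_homD(2)[OF action_hom[OF s] Wc[OF w'] x] w(2) by simp
  then show "y \<in> \<sigma> q s (?W +>\<^bsub>A q\<^esub> x)" using w' by (auto simp: A.coset_def)
qed

lemma H_rep:
  assumes "C \<in> carrier (H q)"
  obtains x where "x \<in> cocycles A d q" "C = coboundaries A d q +>\<^bsub>A q\<^esub> x"
  using assms unfolding cohomology_def subquotient_simps by blast

lemma cocycles_carrier: "x \<in> cocycles A d q \<Longrightarrow> x \<in> carrier (A q)"
  by (simp add: cocycles_def)

lemma class_hom: "(\<lambda>x. coboundaries A d q +>\<^bsub>A q\<^esub> x) \<in> module_hom k (A q\<lparr>carrier := cocycles A d q\<rparr>) (H q)"
  unfolding cohomology_def by (rule A.coset_hom[OF cocycles_sub coboundaries_sub])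

lemma group_module_H: "group_module k G (H q) (\<sigma> q)"
proof (intro group_module.intro group_module_axioms.intro)
  show "group G" by (rule group_axioms)
  show "plain_module k (H q)" using cohomology_module by (simp add: plain_module_def)
  note ch = module_homD[OF class_hom, simplified]
  fix s assume s: "s \<in> carrier G"
  show "\<sigma> q s \<in> module_hom k (H q) (H q)"
  proof (rule module_homI)
    fix C assume "C \<in> carrier (H q)"
    then obtain x where x: "x \<in> cocycles A d q" "C = coboundaries A d q +>\<^bsub>A q\<^esub> x" by (rule H_rep)
    note sx = action_cocycles[OF s x(1)] and xc = cocycles_carrier[OF x(1)]
    show "\<sigma> q s C \<in> carrier (H q)" using ch(1)[OF sx] by (simp only: x(2) action_coset[OF s xc])
    show "\<sigma> q s (a \<odot>\<^bsub>H q\<^esub> C) = a \<odot>\<^bsub>H q\<^esub> \<sigma> q s C" if a: "a \<in> carrier k" for a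
    proof -
      have "\<sigma> q s (a \<odot>\<^bsub>H q\<^esub> C) = coboundaries A d q +>\<^bsub>A q\<^esub> \<rho> q s (a \<odot>\<^bsub>A q\<^esub> x)"
        unfolding x(2) ch(3)[OF a x(1), symmetric] using a xc by (intro action_coset[OF s]) simp
      also have "\<dots> = a \<odot>\<^bsub>H q\<^esub> (coboundaries A d q +>\<^bsub>A q\<^esub> \<rho> q s x)"
        unfolding module_homD(3)[OF action_hom[OF s] a xc] by (rule ch(3)[OF a sx])
      finally show ?thesis by (simp only: x(2) action_coset[OF s xc])
    qed
    fix C' assume "C' \<in> carrier (H q)"
    then obtain x' where x': "x' \<in> cocycles A d q" "C' = coboundaries A d q +>\<^bsub>A q\<^esub> x'" by (rule H_rep)
    note sx' = action_cocycles[OF s x'(1)] and xc' = cocycles_carrier[OF x'(1)]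
    show "\<sigma> q s (C \<oplus>\<^bsub>H q\<^esub> C') = \<sigma> q s C \<oplus>\<^bsub>H q\<^esub> \<sigma> q s C'"
    proof -
      have "\<sigma> q s (C \<oplus>\<^bsub>H q\<^esub> C') = coboundaries A d q +>\<^bsub>A q\<^esub> \<rho> q s (x \<oplus>\<^bsub>A q\<^esub> x')"
        unfolding x(2) x'(2) ch(2)[OF x(1) x'(1), symmetric] using xc xc' by (intro action_coset[OF s]) simp
      also have "\<dots> = (coboundaries A d q +>\<^bsub>A q\<^esub> \<rho> q s x) \<oplus>\<^bsub>H q\<^esub> (coboundaries A d q +>\<^bsub>A q\<^esub> \<rho> q s x')"
        unfolding module_homD(2)[OF action_hom[OF s] xc xc'] by (rule ch(2)[OF sx sx'])
      finally show ?thesis by (simp only: x(2) x'(2) action_coset[OF s xc] action_coset[OF s xc'])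
    qed
  qed
qed

text \<open>Taking classes entrywise identifies the vertical cohomology of the double complex with
  the group cochains valued in \<open>H q\<close>; naturality of the coboundary on cocycles turns
  \<open>dh\<close> into the coboundary there.\<close>

theorem page_two_group_cohomology:
  "module_isomorphic k (dc.page 2 (int p) (int q)) (group_cohomology G (H q) (\<sigma> q) p)"
  unfolding group_cohomology_def
proof (rule dc.page_two)
  interpret Hm: group_module k G "H q" "\<sigma> q" by (rule group_module_H)
  let ?W = "coboundaries A d q"
  let ?c = "\<lambda>p f. \<lambda>gs\<in>group_tuples G p. ?W +>\<^bsub>A q\<^esub> f gs"
  note ch = module_homD[OF class_hom, simplified]
  show "module k (group_cochains G (H q) p)" for p by (rule Hm.group_cochains_module)
  show "group_coboundary G (H q) (\<sigma> q) p \<in> module_hom k (group_cochains G (H q) p) (group_cochains G (H q) (Suc p))" for p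
    by (rule Hm.group_coboundary_hom)
  show "?c p \<in> module_hom k (K p q\<lparr>carrier := cocycles (K p) (dv p) q\<rparr>) (group_cochains G (H q) p)" for p
  proof (rule module_homI)
    fix f assume "f \<in> carrier (K p q\<lparr>carrier := cocycles (K p) (dv p) q\<rparr>)"
    then have f: "\<And>gs. gs \<in> group_tuples G p \<Longrightarrow> f gs \<in> cocycles A d q" by (simp add: column_cocycles)
    show "?c p f \<in> carrier (group_cochains G (H q) p)" using ch(1)[OF f] by (simp add: group_cochains_def product_module_simps)
    show "?c p (a \<odot>\<^bsub>K p q\<lparr>carrier := cocycles (K p) (dv p) q\<rparr>\<^esub> f) = a \<odot>\<^bsub>group_cochains G (H q) p\<^esub> ?c p f" if a: "a \<in> carrier k" for a
      using ch(3)[OF a f] by (simp add: group_cochains_def product_module_simps cong: restrict_cong)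
    fix g assume "g \<in> carrier (K p q\<lparr>carrier := cocycles (K p) (dv p) q\<rparr>)"
    then have g: "\<And>gs. gs \<in> group_tuples G p \<Longrightarrow> g gs \<in> cocycles A d q" by (simp add: column_cocycles)
    show "?c p (f \<oplus>\<^bsub>K p q\<lparr>carrier := cocycles (K p) (dv p) q\<rparr>\<^esub> g) = ?c p f \<oplus>\<^bsub>group_cochains G (H q) p\<^esub> ?c p g"
      using ch(2)[OF f g] by (simp add: group_cochains_def product_module_simps cong: restrict_cong)
  qed
  show "?c p ` cocycles (K p) (dv p) q = carrier (group_cochains G (H q) p)" for p
  proof (intro subset_antisym subsetI)
    fix F assume "F \<in> ?c p ` cocycles (K p) (dv p) q"
    then obtain f where f: "F = ?c p f" "\<And>gs. gs \<in> group_tuples G p \<Longrightarrow> f gs \<in> cocycles A d q" by (auto simp: column_cocycles)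
    show "F \<in> carrier (group_cochains G (H q) p)" using ch(1)[OF f(2)] by (simp add: f(1) group_cochains_def product_module_simps)
  next
    fix F assume F: "F \<in> carrier (group_cochains G (H q) p)"
    then have Fe: "F \<in> extensional (group_tuples G p)" and Fc: "\<And>gs. gs \<in> group_tuples G p \<Longrightarrow> F gs \<in> carrier (H q)"
      by (auto simp: group_cochains_def product_module_simps PiE_def)
    have "\<forall>gs \<in> group_tuples G p. \<exists>x. x \<in> cocycles A d q \<and> F gs = ?W +>\<^bsub>A q\<^esub> x"
    proof
      fix gs assume gs: "gs \<in> group_tuples G p"
      obtain x where x: "x \<in> cocycles A d q" "F gs = ?W +>\<^bsub>A q\<^esub> x" by (rule H_rep[OF Fc[OF gs]])
      show "\<exists>x. x \<in> cocycles A d q \<and> F gs = ?W +>\<^bsub>A q\<^esub> x" by (intro exI conjI) (rule x)+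
    qed
    from bchoice[OF this] obtain f where f: "\<forall>gs \<in> group_tuples G p. f gs \<in> cocycles A d q \<and> F gs = ?W +>\<^bsub>A q\<^esub> f gs" ..
    have "restrict f (group_tuples G p) \<in> cocycles (K p) (dv p) q"
      using f cocycles_carrier by (simp add: column_cocycles K_simps(1))
    moreover have "F = ?c p (restrict f (group_tuples G p))"
      by (rule extensionalityI[OF Fe]) (use f in simp_all)
    ultimately show "F \<in> ?c p ` cocycles (K p) (dv p) q" by blast
  qed
  show "?c p f = \<zero>\<^bsub>group_cochains G (H q) p\<^esub> \<longleftrightarrow> f \<in> coboundaries (K p) (dv p) q" if f: "f \<in> cocycles (K p) (dv p) q" for p f
  proof -
    have fc: "f \<in> carrier (K p q)" "\<And>gs. gs \<in> group_tuples G p \<Longrightarrow> f gs \<in> cocycles A d q" using f by (auto simp: column_cocycles)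
    have z: "\<zero>\<^bsub>group_cochains G (H q) p\<^esub> = (\<lambda>gs\<in>group_tuples G p. ?W)"
      by (simp add: group_cochains_def product_module_simps cohomology_def subquotient_simps)
    have "?c p f = \<zero>\<^bsub>group_cochains G (H q) p\<^esub> \<longleftrightarrow> (\<forall>gs \<in> group_tuples G p. ?W +>\<^bsub>A q\<^esub> f gs = ?W)"
      unfolding z by (simp add: fun_eq_iff restrict_def) blast
    also have "\<dots> \<longleftrightarrow> (\<forall>gs \<in> group_tuples G p. f gs \<in> ?W)"
      using A.coset_eq_self_iff[OF coboundaries_sub cocycles_carrier[OF fc(2)]] by blast
    finally show ?thesis using fc(1) by (simp add: column_coboundaries)
  qed
  show "?c (Suc p) (dh p q f) = group_coboundary G (H q) (\<sigma> q) p (?c p f)" if f: "f \<in> cocycles (K p) (dv p) q" for p f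
  proof (rule gm.group_coboundary_natural(1)[OF group_module_H cocycles_sub class_hom, symmetric])
    show "f \<in> group_tuples G p \<rightarrow> cocycles A d q" using f by (auto simp: column_cocycles)
    show "\<rho> q s x \<in> cocycles A d q \<and> ?W +>\<^bsub>A q\<^esub> \<rho> q s x = \<sigma> q s (?W +>\<^bsub>A q\<^esub> x)"
      if "s \<in> carrier G" "x \<in> cocycles A d q" for s x
      using that action_cocycles action_coset cocycles_carrier by simp
  qed
qed

text \<open>A cochain of degree zero amounts to its value at the empty tuple, and its coboundary at
  \<open>[s]\<close> is \<open>s\<close> applied to that value minus the value.\<close>

lemma dh_zero_iff:
  assumes u: "u \<in> carrier (K 0 n)"
  shows "dh 0 n u = \<zero>\<^bsub>K 1 n\<^esub> \<longleftrightarrow> (\<forall>s \<in> carrier G. \<rho> n s (u []) = u [])"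
proof -
  have t0: "group_tuples G 0 = {[]}" by (auto simp: group_tuples_def)
  have t1: "group_tuples G (Suc 0) = (\<lambda>s. [s]) ` carrier G" by (auto simp: group_tuples_def length_Suc_conv)
  have uc: "u [] \<in> carrier (A n)" using K_mem[OF u] t0 by simp
  have e: "dh 0 n u [s] = \<rho> n s (u []) \<ominus>\<^bsub>A n\<^esub> u []" if "s \<in> carrier G" for s
    using that uc action_closed[OF that uc] t1 by (simp add: group_coboundary_def alt_sign_def a_minus_def)
  have "dh 0 n u = \<zero>\<^bsub>K 1 n\<^esub> \<longleftrightarrow> (\<forall>s \<in> carrier G. dh 0 n u [s] = \<zero>\<^bsub>A n\<^esub>)"
  proof
    assume "\<forall>s \<in> carrier G. dh 0 n u [s] = \<zero>\<^bsub>A n\<^esub>"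
    then show "dh 0 n u = \<zero>\<^bsub>K 1 n\<^esub>"
      by (intro extensionalityI[of _ "group_tuples G (Suc 0)"]) (auto simp: K_simps t1 group_coboundary_def)
  next
    assume "dh 0 n u = \<zero>\<^bsub>K 1 n\<^esub>"
    then show "\<forall>s \<in> carrier G. dh 0 n u [s] = \<zero>\<^bsub>A n\<^esub>" using t1 by (simp add: K_simps)
  qed
  then show ?thesis using e uc action_closed by simp
qed

end

text \<open>\<open>\<pi>\<close> embeds \<open>B\<close> onto the invariants, which are the kernel
  of \<open>dh\<close> in column zero; regarding \<open>\<pi> n b\<close> as a cochain on the empty
  tuple gives the augmentation.\<close>

theorem (in equivariant_complex) page_converges_to_invariants:
  fixes B :: "nat \<Rightarrow> ('k, 'e) module"
  assumes field: "field k"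
    and B: "\<And>n. module k (B n)" "\<And>n. dB n \<in> module_hom k (B n) (B (Suc n))"
    and \<pi>: "\<And>n. \<pi> n \<in> module_hom k (B n) (A n)" "\<And>n. inj_on (\<pi> n) (carrier (B n))"
      "\<And>n. \<pi> n ` carrier (B n) = {x \<in> carrier (A n). \<forall>s \<in> carrier G. \<rho> n s x = x}"
      "\<And>n b. b \<in> carrier (B n) \<Longrightarrow> d n (\<pi> n b) = \<pi> (Suc n) (dB n b)"
    and exact: "\<And>p q u. \<lbrakk>u \<in> carrier (K (Suc p) q); dh (Suc p) q u = \<zero>\<^bsub>K (Suc (Suc p)) q\<^esub>\<rbrakk> \<Longrightarrow>
      \<exists>v \<in> carrier (K p q). dh p q v = u"
  shows "converges_to k dc.page (cohomology B dB)"
proof -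
  have t0: "group_tuples G 0 = {[]}" by (auto simp: group_tuples_def)
  let ?\<epsilon> = "\<lambda>n b. \<lambda>gs\<in>group_tuples G 0. \<pi> n b"
  interpret augmented_double_complex k K dh dv B dB ?\<epsilon>
  proof (intro augmented_double_complex.intro augmented_double_complex_axioms.intro)
    show "double_complex k K dh dv" by (rule double)
    show "module k (B n)" for n by (rule B)
    show "dB n \<in> module_hom k (B n) (B (Suc n))" for n by (rule B)
    show "?\<epsilon> n \<in> module_hom k (B n) (K 0 n)" for n
      by (rule module_homI) (simp_all add: K_simps module_homD[OF \<pi>(1)] cong: restrict_cong)
    show "inj_on (?\<epsilon> n) (carrier (B n))" for n
    proof (rule inj_onI)
      fix b b' assume b: "b \<in> carrier (B n)" "b' \<in> carrier (B n)" and e: "?\<epsilon> n b = ?\<epsilon> n b'"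
      have "\<pi> n b = \<pi> n b'" using fun_cong[OF e, of "[]"] t0 by simp
      then show "b = b'" using inj_onD[OF \<pi>(2)] b by blast
    qed
    show "?\<epsilon> n ` carrier (B n) = {u \<in> carrier (K 0 n). dh 0 n u = \<zero>\<^bsub>K 1 n\<^esub>}" for n
    proof (intro subset_antisym subsetI)
      fix u assume "u \<in> ?\<epsilon> n ` carrier (B n)"
      then obtain b where b: "b \<in> carrier (B n)" "u = ?\<epsilon> n b" by blast
      have "\<pi> n b \<in> {x \<in> carrier (A n). \<forall>s \<in> carrier G. \<rho> n s x = x}" using b(1) \<pi>(3)[of n] by blast
      moreover then have "u \<in> carrier (K 0 n)" using b(2) by (simp add: K_simps)
      ultimately show "u \<in> {u \<in> carrier (K 0 n). dh 0 n u = \<zero>\<^bsub>K 1 n\<^esub>}" using dh_zero_iff[of u n] b(2) t0 by simp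
    next
      fix u assume "u \<in> {u \<in> carrier (K 0 n). dh 0 n u = \<zero>\<^bsub>K 1 n\<^esub>}"
      then have u: "u \<in> carrier (K 0 n)" "\<forall>s \<in> carrier G. \<rho> n s (u []) = u []" using dh_zero_iff[of u n] by simp_all
      then have "u [] \<in> \<pi> n ` carrier (B n)" using K_mem[OF u(1)] t0 unfolding \<pi>(3) by simp
      then obtain b where b: "b \<in> carrier (B n)" "u [] = \<pi> n b" by blast
      have "u = ?\<epsilon> n b" using b(2) u(1) t0 by (intro extensionalityI[of u "group_tuples G 0"]) (auto simp: K_simps PiE_def)
      then show "u \<in> ?\<epsilon> n ` carrier (B n)" using b(1) by blast
    qed
    show "dv 0 n (?\<epsilon> n b) = ?\<epsilon> (Suc n) (dB n b)" if "b \<in> carrier (B n)" for b n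
      using \<pi>(4)[OF that] by (simp add: dv_def cong: restrict_cong)
    show "\<exists>v \<in> carrier (K p q). dh p q v = u"
      if "u \<in> carrier (K (Suc p) q)" "dh (Suc p) q u = \<zero>\<^bsub>K (Suc (Suc p)) q\<^esub>" for p q u
      using that by (rule exact)
  qed
  show ?thesis by (rule page_converges_to_cohomology[OF field])
qed

section \<open>Direct sums and coinvariants\<close>

lemma (in plain_module) finsum_superset:
  assumes "finite B" "A \<subseteq> B" "\<And>i. i \<in> B - A \<Longrightarrow> f i = \<zero>" "\<And>i. i \<in> A \<Longrightarrow> f i \<in> carrier M"
  shows "(\<Oplus>i\<in>A. f i) = (\<Oplus>i\<in>B. f i)"
proof (rule M.add.finprod_mono_neutral_cong_left[OF assms(1,2)])
  show "f \<in> B \<rightarrow> carrier M" using assms(3,4) by (metis DiffI M.zero_closed Pi_I)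
qed (simp_all add: assms(3))

locale direct_sum =
  fixes R :: "('k, 'r) ring_scheme" and I :: "'i set" and V :: "'i \<Rightarrow> ('k, 'a) module"
  assumes R: "cring R" and V: "i \<in> I \<Longrightarrow> module R (V i)"
begin

abbreviation S :: "('k, 'i \<Rightarrow> 'a) module"
  where "S \<equiv> direct_sum_module I V"

abbreviation single :: "'i \<Rightarrow> 'a \<Rightarrow> 'i \<Rightarrow> 'a"
  where "single \<equiv> direct_sum_single I V"

definition supp :: "('i \<Rightarrow> 'a) \<Rightarrow> 'i set"
  where "supp f = {i \<in> I. f i \<noteq> \<zero>\<^bsub>V i\<^esub>}"

lemma S_simps:
  shows "f \<in> carrier S \<longleftrightarrow> f \<in> (\<Pi>\<^sub>E i\<in>I. carrier (V i)) \<and> finite (supp f)"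
    and "\<zero>\<^bsub>S\<^esub> = (\<lambda>i\<in>I. \<zero>\<^bsub>V i\<^esub>)"
    and "f \<oplus>\<^bsub>S\<^esub> g = (\<lambda>i\<in>I. f i \<oplus>\<^bsub>V i\<^esub> g i)"
    and "a \<odot>\<^bsub>S\<^esub> f = (\<lambda>i\<in>I. a \<odot>\<^bsub>V i\<^esub> f i)"
  by (simp_all add: direct_sum_module_def product_module_def supp_def)

lemma S_mem: "\<lbrakk>f \<in> carrier S; i \<in> I\<rbrakk> \<Longrightarrow> f i \<in> carrier (V i)"
  by (auto simp: S_simps)

lemma V_plain: "i \<in> I \<Longrightarrow> plain_module R (V i)"
  using V by (simp add: plain_module_def)

lemma supp_add: "supp (f \<oplus>\<^bsub>S\<^esub> g) \<subseteq> supp f \<union> supp g"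
proof
  fix i assume i: "i \<in> supp (f \<oplus>\<^bsub>S\<^esub> g)"
  then have iI: "i \<in> I" by (simp add: supp_def)
  interpret Vi: plain_module R "V i" by (rule V_plain[OF iI])
  show "i \<in> supp f \<union> supp g" using i by (auto simp: supp_def S_simps)
qed

lemma supp_smult: "a \<in> carrier R \<Longrightarrow> supp (a \<odot>\<^bsub>S\<^esub> f) \<subseteq> supp f"
proof
  fix i assume a: "a \<in> carrier R" and i: "i \<in> supp (a \<odot>\<^bsub>S\<^esub> f)"
  then have iI: "i \<in> I" by (simp add: supp_def)
  interpret Vi: plain_module R "V i" by (rule V_plain[OF iI])
  show "i \<in> supp f" using i a by (auto simp: supp_def S_simps)
qed

lemma S_module: "module R S"
proof -
  let ?P = "product_module I V"
  interpret P: plain_module R ?P using product_module_module[OF R V] by (simp add: plain_module_def)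
  have "submodule R (carrier S) ?P"
  proof (rule P.submoduleI')
    show "carrier S \<subseteq> carrier ?P" by (auto simp: S_simps product_module_simps)
    show "\<zero>\<^bsub>?P\<^esub> \<in> carrier S" using P.M.zero_closed by (simp add: S_simps product_module_simps supp_def)
    fix f g assume f: "f \<in> carrier S" and g: "g \<in> carrier S"
    have "f \<oplus>\<^bsub>?P\<^esub> g \<in> carrier ?P" using f g by (intro P.M.a_closed) (auto simp: S_simps product_module_simps)
    moreover have "finite (supp (f \<oplus>\<^bsub>S\<^esub> g))" using f g by (intro finite_subset[OF supp_add]) (auto simp: S_simps)
    ultimately show "f \<oplus>\<^bsub>?P\<^esub> g \<in> carrier S" by (simp add: S_simps product_module_simps)
  next
    fix a f assume a: "a \<in> carrier R" and f: "f \<in> carrier S"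
    have "a \<odot>\<^bsub>?P\<^esub> f \<in> carrier ?P" using a f by (intro P.smult_closed) (auto simp: S_simps product_module_simps)
    moreover have "finite (supp (a \<odot>\<^bsub>S\<^esub> f))" using a f by (intro finite_subset[OF supp_smult]) (auto simp: S_simps)
    ultimately show "a \<odot>\<^bsub>?P\<^esub> f \<in> carrier S" by (simp add: S_simps product_module_simps)
  qed
  moreover have "S = ?P\<lparr>carrier := carrier S\<rparr>" by (simp add: direct_sum_module_def)
  ultimately show ?thesis using P.submodule_is_module[of "carrier S"] by simp
qed

sublocale S: plain_module R S
  using S_module by (simp add: plain_module_def)

lemma supp_single: "supp (single i v) \<subseteq> {i}"
  by (auto simp: supp_def direct_sum_single_def)

lemma single_hom:
  assumes i: "i \<in> I"
  shows "single i \<in> module_hom R (V i) S"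
proof (rule module_homI)
  have z: "j \<in> I \<Longrightarrow> \<zero>\<^bsub>V j\<^esub> \<in> carrier (V j)" "j \<in> I \<Longrightarrow> \<zero>\<^bsub>V j\<^esub> \<oplus>\<^bsub>V j\<^esub> \<zero>\<^bsub>V j\<^esub> = \<zero>\<^bsub>V j\<^esub>"
    "\<lbrakk>j \<in> I; a \<in> carrier R\<rbrakk> \<Longrightarrow> a \<odot>\<^bsub>V j\<^esub> \<zero>\<^bsub>V j\<^esub> = \<zero>\<^bsub>V j\<^esub>" for j a
  proof -
    assume "j \<in> I"
    then interpret Vj: plain_module R "V j" by (rule V_plain)
    show "\<zero>\<^bsub>V j\<^esub> \<in> carrier (V j)" "\<zero>\<^bsub>V j\<^esub> \<oplus>\<^bsub>V j\<^esub> \<zero>\<^bsub>V j\<^esub> = \<zero>\<^bsub>V j\<^esub>" by simp_all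
    show "a \<in> carrier R \<Longrightarrow> a \<odot>\<^bsub>V j\<^esub> \<zero>\<^bsub>V j\<^esub> = \<zero>\<^bsub>V j\<^esub>" by simp
  qed
  show "single i v \<in> carrier S" if "v \<in> carrier (V i)" for v
    using that z(1) finite_subset[OF supp_single] by (auto simp: S_simps direct_sum_single_def)
  show "single i (v \<oplus>\<^bsub>V i\<^esub> w) = single i v \<oplus>\<^bsub>S\<^esub> single i w" for v w
    by (auto simp: S_simps direct_sum_single_def z intro!: restrict_ext)
  show "single i (a \<odot>\<^bsub>V i\<^esub> v) = a \<odot>\<^bsub>S\<^esub> single i v" if "a \<in> carrier R" for a v
    using that by (auto simp: S_simps direct_sum_single_def z intro!: restrict_ext)
qed

lemma single_closed: "\<lbrakk>i \<in> I; v \<in> carrier (V i)\<rbrakk> \<Longrightarrow> single i v \<in> carrier S"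
  by (rule module_homD(1)[OF single_hom])

text \<open>Each step removes one index from the finite support. Together with linearity this
  reduces statements about the direct sum to homogeneous elements.\<close>

lemma induct [consumes 1, case_names zero add]:
  assumes f: "f \<in> carrier S"
    and zero: "P \<zero>\<^bsub>S\<^esub>"
    and add: "\<And>g i v. \<lbrakk>g \<in> carrier S; P g; i \<in> I; v \<in> carrier (V i)\<rbrakk> \<Longrightarrow> P (g \<oplus>\<^bsub>S\<^esub> single i v)"
  shows "P f"
proof -
  have "finite (supp f)" using f by (simp add: S_simps)
  then show ?thesis using f
  proof (induction "supp f" arbitrary: f rule: finite_psubset_induct)
    case psubset
    show ?case
    proof (cases "supp f = {}")
      case True
      have fe: "f \<in> extensional I" using psubset.prems by (simp add: S_simps PiE_def)
      have "f = \<zero>\<^bsub>S\<^esub>" by (rule extensionalityI[OF fe]) (use True in \<open>auto simp: S_simps supp_def\<close>)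
      then show ?thesis using zero by simp
    next
      case False
      then obtain i where i: "i \<in> supp f" by blast
      then have iI: "i \<in> I" by (simp add: supp_def)
      let ?g = "f(i := \<zero>\<^bsub>V i\<^esub>)"
      interpret Vi: plain_module R "V i" by (rule V_plain[OF iI])
      have s: "supp ?g \<subset> supp f" using i by (auto simp: supp_def)
      have g: "?g \<in> carrier S" using psubset.prems iI finite_subset[OF psubset_imp_subset[OF s]]
        by (auto simp: S_simps PiE_def Pi_def extensional_def)
      have fi: "f i \<in> carrier (V i)" by (rule S_mem[OF psubset.prems iI])
      have fe: "f \<in> extensional I" using psubset.prems by (simp add: S_simps PiE_def)
      have "f = ?g \<oplus>\<^bsub>S\<^esub> single i (f i)"
      proof (rule extensionalityI[OF fe])
        fix j assume j: "j \<in> I"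
        interpret Vj: plain_module R "V j" by (rule V_plain[OF j])
        show "f j = (?g \<oplus>\<^bsub>S\<^esub> single i (f i)) j"
          using j fi S_mem[OF psubset.prems j] by (auto simp: S_simps direct_sum_single_def)
      qed (simp add: S_simps)
      then show ?thesis using add[OF g psubset.hyps(2)[OF s g] iI fi] by simp
    qed
  qed
qed

lemma hom_eqI:
  assumes W: "module R W" and h: "h \<in> module_hom R S W" and h': "h' \<in> module_hom R S W"
    and eq: "\<And>i v. \<lbrakk>i \<in> I; v \<in> carrier (V i)\<rbrakk> \<Longrightarrow> h (single i v) = h' (single i v)"
    and f: "f \<in> carrier S"
  shows "h f = h' f"
  using f
proof (induction rule: induct)
  case zero
  show ?case using module_hom_zero[OF S_module W h] module_hom_zero[OF S_module W h'] by simp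
next
  case (add g i v)
  note sc = single_closed[OF add.hyps(2,3)]
  show ?case using module_homD(2)[OF h add.hyps(1) sc] module_homD(2)[OF h' add.hyps(1) sc] add.IH eq[OF add.hyps(2,3)] by simp
qed

text \<open>The map out of the direct sum given by its universal property. The sum runs over the
  support of \<open>f\<close>, which varies; \<open>lift_superset\<close> makes it possible to
  compare different arguments over a common index set.\<close>

definition lift :: "('k, 'b) module \<Rightarrow> ('i \<Rightarrow> 'a \<Rightarrow> 'b) \<Rightarrow> ('i \<Rightarrow> 'a) \<Rightarrow> 'b"
  where "lift W h f = (\<Oplus>\<^bsub>W\<^esub>i\<in>supp f. h i (f i))"

context
  fixes W :: "('k, 'b) module" and h :: "'i \<Rightarrow> 'a \<Rightarrow> 'b"
  assumes W: "module R W" and h: "\<And>i. i \<in> I \<Longrightarrow> h i \<in> module_hom R (V i) W"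
begin

interpretation W: plain_module R W
  using W by (simp add: plain_module_def)

lemma lift_superset:
  assumes f: "f \<in> carrier S" and B: "finite B" "supp f \<subseteq> B" "B \<subseteq> I"
  shows "lift W h f = (\<Oplus>\<^bsub>W\<^esub>i\<in>B. h i (f i))"
  unfolding lift_def
proof (rule W.finsum_superset[OF B(1,2)])
  show "h i (f i) = \<zero>\<^bsub>W\<^esub>" if i: "i \<in> B - supp f" for i
  proof -
    have iI: "i \<in> I" "f i = \<zero>\<^bsub>V i\<^esub>" using i B(3) by (auto simp: supp_def)
    show ?thesis using module_hom_zero[OF V[OF iI(1)] W h[OF iI(1)]] iI(2) by simp
  qed
  show "h i (f i) \<in> carrier W" if i: "i \<in> supp f" for i
  proof -
    have iI: "i \<in> I" using i by (simp add: supp_def)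
    show ?thesis by (rule module_homD(1)[OF h[OF iI] S_mem[OF f iI]])
  qed
qed

lemma lift_hom: "lift W h \<in> module_hom R S W"
proof (rule module_homI)
  have hc: "h i (f i) \<in> carrier W" if "i \<in> I" "f \<in> carrier S" for i f
    by (rule module_homD(1)[OF h[OF that(1)] S_mem[OF that(2,1)]])
  fix f assume f: "f \<in> carrier S"
  have sI: "supp f \<subseteq> I" for f by (auto simp: supp_def)
  have fin: "finite (supp f)" if "f \<in> carrier S" for f using that by (simp add: S_simps)
  show "lift W h f \<in> carrier W" unfolding lift_def using hc[OF _ f] sI by (intro W.M.finsum_closed) auto
  {
    fix g assume g: "g \<in> carrier S"
    let ?B = "supp f \<union> supp g"
    have B: "finite ?B" "?B \<subseteq> I" "supp f \<subseteq> ?B" "supp g \<subseteq> ?B" using fin[OF f] fin[OF g] sI by auto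
    have fg: "f \<oplus>\<^bsub>S\<^esub> g \<in> carrier S" using f g by simp
    have "lift W h (f \<oplus>\<^bsub>S\<^esub> g) = (\<Oplus>\<^bsub>W\<^esub>i\<in>?B. h i ((f \<oplus>\<^bsub>S\<^esub> g) i))" by (rule lift_superset[OF fg B(1) supp_add B(2)])
    also have "\<dots> = (\<Oplus>\<^bsub>W\<^esub>i\<in>?B. h i (f i) \<oplus>\<^bsub>W\<^esub> h i (g i))"
    proof (rule W.M.finsum_cong'[OF refl])
      fix i assume i: "i \<in> ?B"
      then have iI: "i \<in> I" using B(2) by blast
      show "h i ((f \<oplus>\<^bsub>S\<^esub> g) i) = h i (f i) \<oplus>\<^bsub>W\<^esub> h i (g i)"
        using iI module_homD(2)[OF h[OF iI] S_mem[OF f iI] S_mem[OF g iI]] by (simp add: S_simps)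
    qed (use hc[OF _ f] hc[OF _ g] B(2) in auto)
    also have "\<dots> = (\<Oplus>\<^bsub>W\<^esub>i\<in>?B. h i (f i)) \<oplus>\<^bsub>W\<^esub> (\<Oplus>\<^bsub>W\<^esub>i\<in>?B. h i (g i))"
      using hc[OF _ f] hc[OF _ g] B(2) by (intro W.M.finsum_addf) auto
    finally show "lift W h (f \<oplus>\<^bsub>S\<^esub> g) = lift W h f \<oplus>\<^bsub>W\<^esub> lift W h g"
      by (simp only: lift_superset[OF f B(1,3,2)] lift_superset[OF g B(1,4,2)])
  next
    fix a assume a: "a \<in> carrier R"
    have af: "a \<odot>\<^bsub>S\<^esub> f \<in> carrier S" using f a by simp
    have "lift W h (a \<odot>\<^bsub>S\<^esub> f) = (\<Oplus>\<^bsub>W\<^esub>i\<in>supp f. h i ((a \<odot>\<^bsub>S\<^esub> f) i))"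
      by (rule lift_superset[OF af fin[OF f] supp_smult[OF a] sI])
    also have "\<dots> = (\<Oplus>\<^bsub>W\<^esub>i\<in>supp f. a \<odot>\<^bsub>W\<^esub> h i (f i))"
    proof (rule W.M.finsum_cong'[OF refl])
      fix i assume i: "i \<in> supp f"
      then have iI: "i \<in> I" using sI by blast
      show "h i ((a \<odot>\<^bsub>S\<^esub> f) i) = a \<odot>\<^bsub>W\<^esub> h i (f i)"
        using iI module_homD(3)[OF h[OF iI] a S_mem[OF f iI]] by (simp add: S_simps)
    qed (use hc[OF _ f] sI a in auto)
    also have "\<dots> = a \<odot>\<^bsub>W\<^esub> (\<Oplus>\<^bsub>W\<^esub>i\<in>supp f. h i (f i))"
      using hc[OF _ f] sI fin[OF f] a by (intro W.finsum_smult_ldistr[symmetric]) auto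
    finally show "lift W h (a \<odot>\<^bsub>S\<^esub> f) = a \<odot>\<^bsub>W\<^esub> lift W h f" by (simp only: lift_def)
  }
qed

lemma lift_single:
  assumes i: "i \<in> I" and v: "v \<in> carrier (V i)"
  shows "lift W h (single i v) = h i v"
proof -
  have "lift W h (single i v) = (\<Oplus>\<^bsub>W\<^esub>j\<in>{i}. h j (single i v j))"
    using i by (intro lift_superset[OF single_closed[OF i v] _ supp_single]) auto
  also have "\<dots> = h i v" using i module_homD(1)[OF h[OF i] v] by (simp add: direct_sum_single_def)
  finally show ?thesis .
qed

end

end

section \<open>Coinvariants\<close>

lemma (in plain_module) finsum_smult_rdistr:
  assumes "finite A" "a \<in> A \<rightarrow> carrier R" "x \<in> carrier M"
  shows "(\<Oplus>\<^bsub>R\<^esub>i\<in>A. a i) \<odot> x = (\<Oplus>i\<in>A. a i \<odot> x)"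
  using assms(1,2)
proof (induction A)
  case (insert i A)
  have "(\<Oplus>\<^bsub>R\<^esub>j\<in>insert i A. a j) \<odot> x = (a i \<oplus>\<^bsub>R\<^esub> (\<Oplus>\<^bsub>R\<^esub>j\<in>A. a j)) \<odot> x"
    using insert by (subst R.finsum_insert) auto
  also have "\<dots> = a i \<odot> x \<oplus> (\<Oplus>j\<in>A. a j \<odot> x)"
    using insert assms(3) by (subst smult_l_distr) auto
  also have "\<dots> = (\<Oplus>j\<in>insert i A. a j \<odot> x)"
    using insert assms(3) by (subst M.finsum_insert) auto
  finally show ?case .
qed (use assms(3) in simp)

context group_module
begin

lemma group_algebra_action_closed:
  assumes "a \<in> carrier G \<rightarrow> carrier k" "x \<in> carrier X"
  shows "group_algebra_action k G X \<rho> a x \<in> carrier X"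
  unfolding group_algebra_action_def
proof (rule M.finsum_closed, rule Pi_I)
  fix s assume "s \<in> {s \<in> carrier G. a s \<noteq> \<zero>\<^bsub>k\<^esub>}"
  then have s: "s \<in> carrier G" by simp
  show "a s \<odot>\<^bsub>X\<^esub> \<rho> s x \<in> carrier X" using assms(1) s module_homD(1)[OF \<rho>_hom[OF s] assms(2)] by auto
qed

lemma augmentation_generators:
  "{group_algebra_action k G X \<rho> a x | a x. a \<in> augmentation_ideal k G \<and> x \<in> carrier X} \<subseteq> carrier X"
  using group_algebra_action_closed by (auto simp: augmentation_ideal_def PiE_def)

lemma augmentation_submodule: "submodule k (augmentation_submodule k G X \<rho>) X"
  unfolding augmentation_submodule_def by (rule span_is_submodule[OF augmentation_generators])

text \<open>\<open>s - 1\<close> belongs to the augmentation ideal and sends \<open>x\<close> to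
  this difference. For \<open>s = 1\<close> the two coefficients would fall on the same group
  element, so that case is separate.\<close>

lemma augmentation_submodule_difference:
  assumes field: "field k" and one: "\<And>x. x \<in> carrier X \<Longrightarrow> \<rho> \<one>\<^bsub>G\<^esub> x = x"
    and s: "s \<in> carrier G" and x: "x \<in> carrier X"
  shows "\<rho> s x \<ominus>\<^bsub>X\<^esub> x \<in> augmentation_submodule k G X \<rho>"
proof (cases "s = \<one>\<^bsub>G\<^esub>")
  case True
  then show ?thesis using one[OF x] x submodule.zero_closed[OF augmentation_submodule] by simp
next
  case False
  interpret field k by fact
  have G1: "\<one>\<^bsub>G\<^esub> \<in> carrier G" using group_axioms by (simp add: group_def monoid.one_closed)
  define a where "a = (\<lambda>t\<in>carrier G. if t = s then \<one>\<^bsub>k\<^esub> else if t = \<one>\<^bsub>G\<^esub> then \<ominus>\<^bsub>k\<^esub> \<one>\<^bsub>k\<^esub> else \<zero>\<^bsub>k\<^esub>)"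
  have a: "a s = \<one>\<^bsub>k\<^esub>" "a \<one>\<^bsub>G\<^esub> = \<ominus>\<^bsub>k\<^esub> \<one>\<^bsub>k\<^esub>" "a \<in> carrier G \<rightarrow>\<^sub>E carrier k"
    using False s G1 by (auto simp: a_def)
  have m1: "\<ominus>\<^bsub>k\<^esub> \<one>\<^bsub>k\<^esub> \<noteq> \<zero>\<^bsub>k\<^esub>" using one_not_zero by (metis R.minus_minus R.minus_zero R.one_closed)
  have supp: "{t \<in> carrier G. a t \<noteq> \<zero>\<^bsub>k\<^esub>} = {s, \<one>\<^bsub>G\<^esub>}" using s G1 m1 one_not_zero by (auto simp: a_def)
  have sx: "\<rho> s x \<in> carrier X" by (rule module_homD(1)[OF \<rho>_hom[OF s] x])
  have 1: "(\<Oplus>\<^bsub>k\<^esub>t\<in>{s, \<one>\<^bsub>G\<^esub>}. a t) = \<zero>\<^bsub>k\<^esub>"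
    using False by (subst R.finsum_insert) (auto simp: a R.r_neg)
  have 2: "(\<Oplus>\<^bsub>X\<^esub>t\<in>{s, \<one>\<^bsub>G\<^esub>}. a t \<odot>\<^bsub>X\<^esub> \<rho> t x) = \<rho> s x \<ominus>\<^bsub>X\<^esub> x"
    using False x sx by (subst M.finsum_insert) (auto simp: a one smult_l_minus a_minus_def)
  have "a \<in> augmentation_ideal k G" unfolding augmentation_ideal_def mem_Collect_eq supp
    using 1 a(3) by simp
  then have "group_algebra_action k G X \<rho> a x \<in> augmentation_submodule k G X \<rho>"
    unfolding augmentation_submodule_def using x by (intro subsetD[OF in_own_span[OF augmentation_generators]]) blast
  then show ?thesis unfolding group_algebra_action_def supp 2 .
qed

text \<open>An invariant \<open>h\<close> sends the action of \<open>a\<close> on \<open>x\<close>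
  to \<open>h x\<close> times the sum of the coefficients of \<open>a\<close>, which is zero on the
  augmentation ideal. Hence invariant maps factor through the coinvariants.\<close>

lemma augmentation_submodule_kernel:
  fixes Y :: "('k, 'b) module"
  assumes Y: "module k Y" and h: "h \<in> module_hom k X Y"
    and inv: "\<And>s x. \<lbrakk>s \<in> carrier G; x \<in> carrier X\<rbrakk> \<Longrightarrow> h (\<rho> s x) = h x"
    and x: "x \<in> augmentation_submodule k G X \<rho>"
  shows "h x = \<zero>\<^bsub>Y\<^esub>"
proof -
  interpret Y: plain_module k Y using Y by (simp add: plain_module_def)
  have "group_algebra_action k G X \<rho> a x \<in> {x \<in> carrier X. h x = \<zero>\<^bsub>Y\<^esub>}"
    if a: "a \<in> augmentation_ideal k G" and x: "x \<in> carrier X" for a x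
  proof -
    let ?A = "{s \<in> carrier G. a s \<noteq> \<zero>\<^bsub>k\<^esub>}"
    have aP: "a \<in> carrier G \<rightarrow> carrier k" and fin: "finite ?A" and sum: "(\<Oplus>\<^bsub>k\<^esub>s\<in>?A. a s) = \<zero>\<^bsub>k\<^esub>"
      using a by (auto simp: augmentation_ideal_def PiE_def)
    have t: "a s \<odot>\<^bsub>X\<^esub> \<rho> s x \<in> carrier X" "h (a s \<odot>\<^bsub>X\<^esub> \<rho> s x) = a s \<odot>\<^bsub>Y\<^esub> h x" if "s \<in> ?A" for s
    proof -
      have s: "s \<in> carrier G" "a s \<in> carrier k" using that aP by auto
      have sx: "\<rho> s x \<in> carrier X" by (rule module_homD(1)[OF \<rho>_hom[OF s(1)] x])
      show "a s \<odot>\<^bsub>X\<^esub> \<rho> s x \<in> carrier X" using s(2) sx by simp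
      show "h (a s \<odot>\<^bsub>X\<^esub> \<rho> s x) = a s \<odot>\<^bsub>Y\<^esub> h x" using module_homD(3)[OF h s(2) sx] inv[OF s(1) x] by simp
    qed
    have hx: "h x \<in> carrier Y" by (rule module_homD(1)[OF h x])
    have "h (group_algebra_action k G X \<rho> a x) = (\<Oplus>\<^bsub>Y\<^esub>s\<in>?A. h (a s \<odot>\<^bsub>X\<^esub> \<rho> s x))"
      unfolding group_algebra_action_def by (rule module_hom_finsum[OF module_axioms Y h t(1)])
    also have "\<dots> = (\<Oplus>\<^bsub>Y\<^esub>s\<in>?A. a s \<odot>\<^bsub>Y\<^esub> h x)" using t aP hx by (intro Y.M.finsum_cong') auto
    also have "\<dots> = (\<Oplus>\<^bsub>k\<^esub>s\<in>?A. a s) \<odot>\<^bsub>Y\<^esub> h x" using aP hx fin by (intro Y.finsum_smult_rdistr[symmetric]) auto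
    also have "\<dots> = \<zero>\<^bsub>Y\<^esub>" using hx by (simp add: sum)
    finally show ?thesis using group_algebra_action_closed[OF aP x] by simp
  qed
  moreover have "submodule k {x \<in> carrier X. h x = \<zero>\<^bsub>Y\<^esub>} X"
    using kernel_submodule[OF Y submodule_carrier, of h] h by simp
  ultimately have "augmentation_submodule k G X \<rho> \<subseteq> {x \<in> carrier X. h x = \<zero>\<^bsub>Y\<^esub>}"
    unfolding augmentation_submodule_def by (intro span_is_subset) auto
  then show ?thesis using x by blast
qed

end

section \<open>Morphisms of the quotient category\<close>

context free_action
begin

sublocale Gr: group G
  using group_hom by (simp add: group_hom_def)

abbreviation B :: "('o set, 'k, ('o \<times> 'o \<Rightarrow> 'm) set) kcat"
  where "B \<equiv> quotient_category k C G \<phi> \<psi>"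

abbreviation orb :: "'o \<Rightarrow> 'o set"
  where "orb \<equiv> orbit G \<phi>"

abbreviation mc :: "'o \<Rightarrow> 'o \<Rightarrow> 'm \<Rightarrow> ('o \<times> 'o \<Rightarrow> 'm) set"
  where "mc \<equiv> morphism_class k C G \<phi> \<psi>"

lemma \<phi>_closed: "\<lbrakk>s \<in> carrier G; x \<in> Obj C\<rbrakk> \<Longrightarrow> \<phi> s x \<in> Obj C"
  by (rule element_image[OF _ _ refl])

lemma \<phi>_one: "x \<in> Obj C \<Longrightarrow> \<phi> \<one>\<^bsub>G\<^esub> x = x"
  using id_eq_one by (metis restrict_apply')

lemma \<phi>_inv:
  assumes "s \<in> carrier G" "x \<in> Obj C"
  shows "\<phi> (inv\<^bsub>G\<^esub> s) (\<phi> s x) = x" "\<phi> s (\<phi> (inv\<^bsub>G\<^esub> s) x) = x"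
  using assms by (simp_all add: composition_rule[symmetric] \<phi>_one)

lemma \<phi>_eq_iff: "\<lbrakk>s \<in> carrier G; x \<in> Obj C; y \<in> Obj C\<rbrakk> \<Longrightarrow> \<phi> s x = \<phi> s y \<longleftrightarrow> x = y"
  using \<phi>_inv(1) by metis

lemma \<phi>_inv_eq_iff: "\<lbrakk>s \<in> carrier G; x \<in> Obj C; y \<in> Obj C\<rbrakk> \<Longrightarrow> \<phi> (inv\<^bsub>G\<^esub> s) y = x \<longleftrightarrow> y = \<phi> s x"
  using \<phi>_inv by metis

lemma orbit_obj: "v \<in> Obj B \<Longrightarrow> y \<in> v \<Longrightarrow> y \<in> Obj C"
  by (auto simp: quotient_category_def orbits_def orbit_def \<phi>_closed)

lemma orbit_\<phi>: "\<lbrakk>s \<in> carrier G; x \<in> Obj C\<rbrakk> \<Longrightarrow> orb (\<phi> s x) = orb x"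
proof (intro equalityI subsetI)
  assume s: "s \<in> carrier G" and x: "x \<in> Obj C"
  fix y
  { assume "y \<in> orb (\<phi> s x)"
    then obtain t where "t \<in> carrier G" "y = \<phi> t (\<phi> s x)" by (auto simp: orbit_def)
    then show "y \<in> orb x" using s x unfolding orbit_def by (auto simp: composition_rule[symmetric] intro!: exI[of _ "t \<otimes>\<^bsub>G\<^esub> s"]) }
  { assume "y \<in> orb x"
    then obtain t where t: "t \<in> carrier G" "y = \<phi> t x" by (auto simp: orbit_def)
    then have "y = \<phi> (t \<otimes>\<^bsub>G\<^esub> inv\<^bsub>G\<^esub> s) (\<phi> s x)" using s x by (simp add: composition_rule \<phi>_closed \<phi>_inv)
    then show "y \<in> orb (\<phi> s x)" using s t by (auto simp: orbit_def) }
qed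

lemma orb_Obj: "x \<in> Obj C \<Longrightarrow> orb x \<in> Obj B"
  by (auto simp: quotient_category_def orbits_def)

lemma orbit_eq:
  assumes "v \<in> Obj B" "y \<in> v"
  shows "orb y = v"
proof -
  obtain x where x: "x \<in> Obj C" "v = orb x" using assms(1) by (auto simp: quotient_category_def orbits_def)
  obtain s where "s \<in> carrier G" "y = \<phi> s x" using assms(2) x(2) by (auto simp: orbit_def)
  then show ?thesis using orbit_\<phi>[of s x] x by simp
qed

lemma orbit_closed: "\<lbrakk>v \<in> Obj B; y \<in> v; s \<in> carrier G\<rbrakk> \<Longrightarrow> \<phi> s y \<in> v"
  using orbit_eq[of v y] by (auto simp: orbit_def)

lemma orbit_nonempty: "v \<in> Obj B \<Longrightarrow> \<exists>y. y \<in> v"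
  using orbit_refl by (auto simp: quotient_category_def orbits_def)

text \<open>Freeness makes this element unique for two objects of one orbit; it is the group element
  used in \<open>orbit_sum_comp\<close>.\<close>

definition tr :: "'o \<Rightarrow> 'o \<Rightarrow> 'g"
  where "tr y' y = (THE s. s \<in> carrier G \<and> \<phi> s y' = y)"

lemma tr_eq: "\<lbrakk>s \<in> carrier G; y \<in> Obj C\<rbrakk> \<Longrightarrow> tr y (\<phi> s y) = s"
  unfolding tr_def
proof (rule the_equality)
  fix t assume s: "s \<in> carrier G" and y: "y \<in> Obj C" and t: "t \<in> carrier G \<and> \<phi> t y = \<phi> s y"
  then have "\<phi> (inv\<^bsub>G\<^esub> s \<otimes>\<^bsub>G\<^esub> t) y = y" by (simp add: composition_rule \<phi>_inv)
  then have "inv\<^bsub>G\<^esub> s \<otimes>\<^bsub>G\<^esub> t = \<one>\<^bsub>G\<^esub>" using s t y by (intro free[OF _ y]) auto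
  then show "t = s" using s t by (metis Gr.inv_closed Gr.inv_equality Gr.inv_inv Gr.inv_comm)
qed simp

lemma tr:
  assumes "v \<in> Obj B" "y \<in> v" "y' \<in> v"
  shows "tr y y' \<in> carrier G" "\<phi> (tr y y') y = y'"
proof -
  have "y' \<in> orb y" using orbit_eq[OF assms(1,2)] assms(3) by simp
  then obtain s where "s \<in> carrier G" "y' = \<phi> s y" by (auto simp: orbit_def)
  then show "tr y y' \<in> carrier G" "\<phi> (tr y y') y = y'" using tr_eq[of s y] orbit_obj[OF assms(1,2)] by simp_all
qed

lemma tr_self: "y \<in> Obj C \<Longrightarrow> tr y y = \<one>\<^bsub>G\<^esub>"
  using tr_eq[of "\<one>\<^bsub>G\<^esub>" y] by (simp add: \<phi>_one)

lemma tr_\<phi>: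
  assumes "v \<in> Obj B" "y \<in> v" "y' \<in> v" "s \<in> carrier G"
  shows "tr y (\<phi> s y') = s \<otimes>\<^bsub>G\<^esub> tr y y'" "tr (\<phi> s y) y' = tr y y' \<otimes>\<^bsub>G\<^esub> inv\<^bsub>G\<^esub> s"
proof -
  note t = tr[OF assms(1-3)] and o = orbit_obj[OF assms(1,2)]
  show "tr y (\<phi> s y') = s \<otimes>\<^bsub>G\<^esub> tr y y'"
    using tr_eq[of "s \<otimes>\<^bsub>G\<^esub> tr y y'" y] t o assms(4) by (simp add: composition_rule)
  show "tr (\<phi> s y) y' = tr y y' \<otimes>\<^bsub>G\<^esub> inv\<^bsub>G\<^esub> s"
    using tr_eq[of "tr y y' \<otimes>\<^bsub>G\<^esub> inv\<^bsub>G\<^esub> s" "\<phi> s y"] t o assms(4) by (simp add: composition_rule \<phi>_closed \<phi>_inv)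
qed

lemma Mor_C_module: "\<lbrakk>x \<in> Obj C; y \<in> Obj C\<rbrakk> \<Longrightarrow> module k (Mor C y x)"
  using Mor_vectorspace by (simp add: vectorspace_def)

lemma \<psi>_closed: "\<lbrakk>s \<in> carrier G; x \<in> Obj C; y \<in> Obj C; c \<in> carrier (Mor C y x)\<rbrakk> \<Longrightarrow>
  \<psi> s y x c \<in> carrier (Mor C (\<phi> s y) (\<phi> s x))"
  by (rule module_homD(1)[OF act_linear])

end

section \<open>The space of morphisms between two orbits\<close>

locale orbit_pair = free_action k C G \<phi> \<psi>
  for k :: "('k, 'r) ring_scheme" and C :: "('o, 'k, 'm) kcat"
    and G :: "('g, 'n) monoid_scheme" and \<phi> :: "'g \<Rightarrow> 'o \<Rightarrow> 'o"
    and \<psi> :: "'g \<Rightarrow> 'o \<Rightarrow> 'o \<Rightarrow> 'm \<Rightarrow> 'm" +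
  fixes v u :: "'o set"
  assumes v: "v \<in> Obj B" and u: "u \<in> Obj B"
begin

sublocale D: direct_sum k "v \<times> u" "\<lambda>(y, x). Mor C y x"
  by (rule direct_sum.intro) (auto intro: Mor_C_module orbit_obj[OF v] orbit_obj[OF u] is_cring)

abbreviation ac :: "'g \<Rightarrow> ('o \<times> 'o \<Rightarrow> 'm) \<Rightarrow> ('o \<times> 'o \<Rightarrow> 'm)"
  where "ac \<equiv> orbit_sum_action G \<phi> \<psi> v u"

abbreviation cls :: "('o \<times> 'o \<Rightarrow> 'm) \<Rightarrow> ('o \<times> 'o \<Rightarrow> 'm) set"
  where "cls \<equiv> orbit_class k C G \<phi> \<psi> v u"

lemma orbit_sum_S: "orbit_sum C v u = D.S"
  by (simp add: orbit_sum_def)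

lemma orbit_single_single: "orbit_single C v u y x c = D.single (y, x) c"
  by (simp add: orbit_single_def)

lemma ac_single:
  assumes s: "s \<in> carrier G" and y: "y \<in> v" and x: "x \<in> u" and c: "c \<in> carrier (Mor C y x)"
  shows "ac s (D.single (y, x) c) = D.single (\<phi> s y, \<phi> s x) (\<psi> s y x c)"
proof
  fix p :: "'o \<times> 'o"
  obtain y1 x1 where p: "p = (y1, x1)" by (cases p)
  have si: "inv\<^bsub>G\<^esub> s \<in> carrier G" using s by simp
  have z: "\<psi> s a b \<zero>\<^bsub>Mor C a b\<^esub> = \<zero>\<^bsub>Mor C (\<phi> s a) (\<phi> s b)\<^esub>" if "a \<in> Obj C" "b \<in> Obj C" for a b
    using that s by (intro module_hom_zero[OF Mor_C_module Mor_C_module act_linear]) (auto simp: \<phi>_closed)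
  show "ac s (D.single (y, x) c) p = D.single (\<phi> s y, \<phi> s x) (\<psi> s y x c) p"
  proof (cases "y1 \<in> v \<and> x1 \<in> u")
    case True
    then have o: "y1 \<in> Obj C" "x1 \<in> Obj C" "y \<in> Obj C" "x \<in> Obj C" using orbit_obj[OF v] orbit_obj[OF u] y x by auto
    have m: "\<phi> (inv\<^bsub>G\<^esub> s) y1 \<in> v" "\<phi> (inv\<^bsub>G\<^esub> s) x1 \<in> u" using True si orbit_closed[OF v] orbit_closed[OF u] by auto
    have o': "\<phi> (inv\<^bsub>G\<^esub> s) y1 \<in> Obj C" "\<phi> (inv\<^bsub>G\<^esub> s) x1 \<in> Obj C" using m orbit_obj[OF v] orbit_obj[OF u] by auto
    show ?thesis
    proof (cases "y1 = \<phi> s y \<and> x1 = \<phi> s x")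
      case e: True
      then show ?thesis using True s o m by (simp add: p orbit_sum_action_def direct_sum_single_def Let_def \<phi>_inv y x)
    next
      case False
      then have "(\<phi> (inv\<^bsub>G\<^esub> s) y1, \<phi> (inv\<^bsub>G\<^esub> s) x1) \<noteq> (y, x)"
        using o s by (simp add: \<phi>_inv_eq_iff)
      then show ?thesis using False True m o o' s
        by (auto simp: p orbit_sum_action_def direct_sum_single_def Let_def z \<phi>_inv(2))
    qed
  next
    case False
    then show ?thesis by (auto simp: p orbit_sum_action_def direct_sum_single_def)
  qed
qed

lemma ac_simp:
  assumes "y \<in> v" "x \<in> u"
  shows "ac s f (y, x) = \<psi> s (\<phi> (inv\<^bsub>G\<^esub> s) y) (\<phi> (inv\<^bsub>G\<^esub> s) x) (f (\<phi> (inv\<^bsub>G\<^esub> s) y, \<phi> (inv\<^bsub>G\<^esub> s) x))"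
  using assms by (simp add: orbit_sum_action_def Let_def)

lemma ac_hom:
  assumes s: "s \<in> carrier G"
  shows "ac s \<in> module_hom k D.S D.S"
proof (rule module_homI)
  have si: "inv\<^bsub>G\<^esub> s \<in> carrier G" using s by simp
  have o: "\<phi> (inv\<^bsub>G\<^esub> s) y \<in> Obj C" "\<phi> (inv\<^bsub>G\<^esub> s) x \<in> Obj C" "(\<phi> (inv\<^bsub>G\<^esub> s) y, \<phi> (inv\<^bsub>G\<^esub> s) x) \<in> v \<times> u"
    "\<phi> s (\<phi> (inv\<^bsub>G\<^esub> s) y) = y" "\<phi> s (\<phi> (inv\<^bsub>G\<^esub> s) x) = x" if "y \<in> v" "x \<in> u" for y x
    using that si s orbit_closed[OF v] orbit_closed[OF u] orbit_obj[OF v] orbit_obj[OF u] by (auto simp: \<phi>_inv)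
  have hom: "\<psi> s (\<phi> (inv\<^bsub>G\<^esub> s) y) (\<phi> (inv\<^bsub>G\<^esub> s) x) \<in> module_hom k (Mor C (\<phi> (inv\<^bsub>G\<^esub> s) y) (\<phi> (inv\<^bsub>G\<^esub> s) x)) (Mor C y x)"
    if "y \<in> v" "x \<in> u" for y x
    using act_linear[OF s o(2,1)[OF that]] o(4,5)[OF that] by simp
  have mem: "f (\<phi> (inv\<^bsub>G\<^esub> s) y, \<phi> (inv\<^bsub>G\<^esub> s) x) \<in> carrier (Mor C (\<phi> (inv\<^bsub>G\<^esub> s) y) (\<phi> (inv\<^bsub>G\<^esub> s) x))"
    if "y \<in> v" "x \<in> u" "f \<in> carrier D.S" for y x f
    using D.S_mem[OF that(3) o(3)[OF that(1,2)]] by simp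
  have e: "ac s f \<in> extensional (v \<times> u)" for f by (auto simp: orbit_sum_action_def extensional_def)
  fix f assume f: "f \<in> carrier D.S"
  show "ac s f \<in> carrier D.S" unfolding D.S_simps
  proof
    show "ac s f \<in> (\<Pi>\<^sub>E i\<in>v \<times> u. carrier (case i of (y, x) \<Rightarrow> Mor C y x))"
      using e[of f] module_homD(1)[OF hom mem[OF _ _ f]] by (auto simp: PiE_def ac_simp)
    have "D.supp (ac s f) \<subseteq> (\<lambda>(y, x). (\<phi> s y, \<phi> s x)) ` D.supp f"
    proof
      fix p assume p: "p \<in> D.supp (ac s f)"
      obtain y x where yx: "p = (y, x)" by (cases p)
      have m: "y \<in> v" "x \<in> u" "ac s f (y, x) \<noteq> \<zero>\<^bsub>Mor C y x\<^esub>" using p yx by (auto simp: D.supp_def)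
      have "(\<phi> (inv\<^bsub>G\<^esub> s) y, \<phi> (inv\<^bsub>G\<^esub> s) x) \<in> D.supp f"
        using m o(3)[OF m(1,2)] module_hom_zero[OF Mor_C_module Mor_C_module hom[OF m(1,2)]] o(1,2)[OF m(1,2)] orbit_obj[OF v m(1)] orbit_obj[OF u m(2)]
        by (auto simp: D.supp_def ac_simp)
      then show "p \<in> (\<lambda>(y, x). (\<phi> s y, \<phi> s x)) ` D.supp f" using o(4,5)[OF m(1,2)] yx by force
    qed
    then show "finite (D.supp (ac s f))" using f by (auto simp: D.S_simps intro: finite_subset)
  qed
  show "ac s (f \<oplus>\<^bsub>D.S\<^esub> g) = ac s f \<oplus>\<^bsub>D.S\<^esub> ac s g" if g: "g \<in> carrier D.S" for g
  proof (rule extensionalityI[OF e])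
    fix p assume "p \<in> v \<times> u"
    then obtain y x where yx: "p = (y, x)" "y \<in> v" "x \<in> u" by (cases p) auto
    show "ac s (f \<oplus>\<^bsub>D.S\<^esub> g) p = (ac s f \<oplus>\<^bsub>D.S\<^esub> ac s g) p"
      using yx o(3)[OF yx(2,3)] module_homD(2)[OF hom[OF yx(2,3)] mem[OF yx(2,3) f] mem[OF yx(2,3) g]]
      by (simp add: ac_simp D.S_simps)
  qed (simp add: D.S_simps)
  show "ac s (a \<odot>\<^bsub>D.S\<^esub> f) = a \<odot>\<^bsub>D.S\<^esub> ac s f" if a: "a \<in> carrier k" for a
  proof (rule extensionalityI[OF e])
    fix p assume "p \<in> v \<times> u"
    then obtain y x where yx: "p = (y, x)" "y \<in> v" "x \<in> u" by (cases p) auto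
    show "ac s (a \<odot>\<^bsub>D.S\<^esub> f) p = (a \<odot>\<^bsub>D.S\<^esub> ac s f) p"
      using yx o(3)[OF yx(2,3)] module_homD(3)[OF hom[OF yx(2,3)] a mem[OF yx(2,3) f]]
      by (simp add: ac_simp D.S_simps)
  qed (simp add: D.S_simps)
qed

lemma ac_one:
  assumes f: "f \<in> carrier D.S"
  shows "ac \<one>\<^bsub>G\<^esub> f = f"
proof (rule extensionalityI[of _ "v \<times> u"])
  show "ac \<one>\<^bsub>G\<^esub> f \<in> extensional (v \<times> u)" by (auto simp: orbit_sum_action_def extensional_def)
  show "f \<in> extensional (v \<times> u)" using f by (simp add: D.S_simps PiE_def)
  fix p assume "p \<in> v \<times> u"
  then obtain y x where yx: "p = (y, x)" "y \<in> v" "x \<in> u" by (cases p) auto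
  then show "ac \<one>\<^bsub>G\<^esub> f p = f p" using D.S_mem[OF f, of p] orbit_obj[OF v] orbit_obj[OF u]
    by (simp add: ac_simp \<phi>_one act_one)
qed

lemma group_module_S: "group_module k G (orbit_sum C v u) ac"
  unfolding orbit_sum_S
  by (intro group_module.intro group_module_axioms.intro Gr.group_axioms D.S.plain_module_axioms ac_hom)

sublocale A: group_module k G "orbit_sum C v u" ac
  by (rule group_module_S)

abbreviation N :: "('o \<times> 'o \<Rightarrow> 'm) set"
  where "N \<equiv> augmentation_submodule k G (orbit_sum C v u) ac"

lemma cls_eq: "cls f = N +>\<^bsub>D.S\<^esub> f"
  by (simp add: orbit_class_def orbit_sum_S)

lemma N_sub: "submodule k N D.S"
  using A.augmentation_submodule by (simp add: orbit_sum_S)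

lemma Mor_B: "Mor B v u = subquotient D.S (carrier D.S) N"
  by (simp add: quotient_category_def coinvariants_def orbit_sum_S)

lemma Mor_B_module: "module k (Mor B v u)"
  unfolding Mor_B by (rule D.S.subquotient_module[OF D.S.submodule_carrier N_sub D.S.subset_submodule[OF N_sub]])

sublocale Q: plain_module k "Mor B v u"
  using Mor_B_module by (simp add: plain_module_def)

lemma cls_hom: "cls \<in> module_hom k D.S (Mor B v u)"
  using D.S.coset_hom[OF D.S.submodule_carrier N_sub] by (simp add: Mor_B cls_eq[abs_def])

lemma cls_closed: "f \<in> carrier D.S \<Longrightarrow> cls f \<in> carrier (Mor B v u)"
  by (rule module_homD(1)[OF cls_hom])

lemma cls_rep:
  assumes "E \<in> carrier (Mor B v u)"
  obtains f where "f \<in> carrier D.S" "E = cls f"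
  using assms unfolding Mor_B subquotient_simps cls_eq by blast

lemma cls_mem: "\<lbrakk>f \<in> carrier D.S; g \<in> cls f\<rbrakk> \<Longrightarrow> g \<in> carrier D.S \<and> cls g = cls f"
  unfolding cls_eq using D.S.mem_coset_iff[OF N_sub] D.S.coset_of_mem[OF N_sub] by blast

lemma cls_self: "f \<in> carrier D.S \<Longrightarrow> f \<in> cls f"
  unfolding cls_eq by (rule D.S.coset_self[OF N_sub])

lemma cls_ac:
  assumes s: "s \<in> carrier G" and f: "f \<in> carrier D.S"
  shows "cls (ac s f) = cls f"
  unfolding cls_eq
proof (subst D.S.coset_eq_iff[OF N_sub module_homD(1)[OF ac_hom[OF s] f] f])
  show "ac s f \<ominus>\<^bsub>D.S\<^esub> f \<in> N"
    using A.augmentation_submodule_difference[OF field_axioms _ s, unfolded orbit_sum_S] ac_one f by (simp add: orbit_sum_S)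
qed

lemma invariant_cls_eq:
  fixes Y :: "('k, 'c) module"
  assumes Y: "module k Y" and h: "h \<in> module_hom k D.S Y"
    and inv: "\<And>s f. \<lbrakk>s \<in> carrier G; f \<in> carrier D.S\<rbrakk> \<Longrightarrow> h (ac s f) = h f"
    and f: "f \<in> carrier D.S" "g \<in> carrier D.S" "cls f = cls g"
  shows "h f = h g"
proof -
  interpret Y: plain_module k Y using Y by (simp add: plain_module_def)
  have "f \<ominus>\<^bsub>D.S\<^esub> g \<in> N" using f D.S.coset_eq_iff[OF N_sub f(1,2)] by (simp add: cls_eq)
  then have "h (f \<ominus>\<^bsub>D.S\<^esub> g) = \<zero>\<^bsub>Y\<^esub>"
    using h inv by (intro A.augmentation_submodule_kernel[OF Y, of h]) (simp_all add: orbit_sum_S)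
  then have "h f \<ominus>\<^bsub>Y\<^esub> h g = \<zero>\<^bsub>Y\<^esub>" using module_hom_minus[OF D.S_module Y h f(1,2)] by simp
  then show ?thesis using module_homD(1)[OF h f(1)] module_homD(1)[OF h f(2)] by simp
qed

text \<open>For an invariant \<open>h\<close> the value is the same for every representative, by
  \<open>invariant_cls_eq\<close>; only such \<open>h\<close> are considered.\<close>

definition desc :: "(('o \<times> 'o \<Rightarrow> 'm) \<Rightarrow> 'c) \<Rightarrow> ('o \<times> 'o \<Rightarrow> 'm) set \<Rightarrow> 'c"
  where "desc h E = h (SOME f. f \<in> carrier D.S \<and> cls f = E)"

lemma desc:
  fixes Y :: "('k, 'c) module"
  assumes Y: "module k Y" and h: "h \<in> module_hom k D.S Y"
    and inv: "\<And>s f. \<lbrakk>s \<in> carrier G; f \<in> carrier D.S\<rbrakk> \<Longrightarrow> h (ac s f) = h f"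
  shows "f \<in> carrier D.S \<Longrightarrow> desc h (cls f) = h f" and "desc h \<in> module_hom k (Mor B v u) Y"
proof -
  show 1: "desc h (cls f) = h f" if f: "f \<in> carrier D.S" for f
  proof -
    have ex: "\<exists>g. g \<in> carrier D.S \<and> cls g = cls f" using f by blast
    show ?thesis unfolding desc_def
      using someI_ex[OF ex] f by (intro invariant_cls_eq[OF Y h inv]) auto
  qed
  show "desc h \<in> module_hom k (Mor B v u) Y"
  proof (rule module_homI)
    fix E assume "E \<in> carrier (Mor B v u)"
    then obtain f where f: "f \<in> carrier D.S" "E = cls f" by (rule cls_rep)
    show "desc h E \<in> carrier Y" using module_homD(1)[OF h f(1)] by (simp add: f 1)
    show "desc h (a \<odot>\<^bsub>Mor B v u\<^esub> E) = a \<odot>\<^bsub>Y\<^esub> desc h E" if a: "a \<in> carrier k" for a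
      using module_homD(3)[OF cls_hom a f(1), symmetric] module_homD(3)[OF h a f(1)] f(1) a by (simp add: f(2) 1)
    fix E' assume "E' \<in> carrier (Mor B v u)"
    then obtain g where g: "g \<in> carrier D.S" "E' = cls g" by (rule cls_rep)
    show "desc h (E \<oplus>\<^bsub>Mor B v u\<^esub> E') = desc h E \<oplus>\<^bsub>Y\<^esub> desc h E'"
      using module_homD(2)[OF cls_hom f(1) g(1), symmetric] module_homD(2)[OF h f(1) g(1)] f(1) g(1) by (simp add: f(2) g(2) 1)
  qed
qed

lemma mc_cls: "\<lbrakk>y \<in> v; x \<in> u\<rbrakk> \<Longrightarrow> mc y x c = cls (D.single (y, x) c)"
  using orbit_eq[OF v] orbit_eq[OF u] by (simp add: morphism_class_def orbit_single_single)

lemma single_closed: "\<lbrakk>y \<in> v; x \<in> u; c \<in> carrier (Mor C y x)\<rbrakk> \<Longrightarrow> D.single (y, x) c \<in> carrier D.S"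
  by (rule D.single_closed) auto

lemma mc_hom':
  assumes "y \<in> v" "x \<in> u"
  shows "mc y x \<in> module_hom k (Mor C y x) (Mor B v u)"
proof -
  have "mc y x = (\<lambda>c. cls (D.single (y, x) c))" by (rule ext) (rule mc_cls[OF assms])
  then show ?thesis using module_hom_compose[OF D.single_hom[of "(y, x)"] cls_hom] assms by simp
qed

lemma mc_\<phi>':
  assumes s: "s \<in> carrier G" and "y \<in> v" "x \<in> u" and c: "c \<in> carrier (Mor C y x)"
  shows "mc (\<phi> s y) (\<phi> s x) (\<psi> s y x c) = mc y x c"
  using assms ac_single[OF s assms(2,3) c] cls_ac[OF s single_closed[OF assms(2,3) c]]
  by (simp add: mc_cls orbit_closed[OF v] orbit_closed[OF u])

text \<open>The coordinates of a morphism with respect to the decomposition of \<open>Mor B v u\<close> as the direct sum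
  of the spaces \<open>Mor C y x\<close> for a fixed \<open>y \<in> v\<close> and \<open>x \<in> u\<close>.\<close>

definition th :: "'o \<Rightarrow> 'o \<Rightarrow> 'o \<times> 'o \<Rightarrow> 'm \<Rightarrow> 'm"
  where "th y x = (\<lambda>(y1, x1) c. if \<phi> (tr y y1) x = x1 then \<psi> (inv\<^bsub>G\<^esub> (tr y y1)) y1 x1 c else \<zero>\<^bsub>Mor C y x\<^esub>)"

definition coord :: "'o \<Rightarrow> 'o \<Rightarrow> ('o \<times> 'o \<Rightarrow> 'm) set \<Rightarrow> 'm"
  where "coord y x = desc (D.lift (Mor C y x) (th y x))"

context
  fixes y assumes y: "y \<in> v"
begin

lemma th_hom:
  assumes x: "x \<in> u" and p: "p \<in> v \<times> u"
  shows "th y x p \<in> module_hom k (case p of (y, x) \<Rightarrow> Mor C y x) (Mor C y x)"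
proof -
  obtain y1 x1 where p': "p = (y1, x1)" "y1 \<in> v" "x1 \<in> u" using p by (cases p) auto
  note o = orbit_obj[OF v p'(2)] orbit_obj[OF u p'(3)] orbit_obj[OF v y] orbit_obj[OF u x]
  note t = tr[OF v y p'(2)]
  interpret V: plain_module k "Mor C y x" using Mor_C_module[OF o(4,3)] by (simp add: plain_module_def)
  show ?thesis
  proof (cases "\<phi> (tr y y1) x = x1")
    case True
    have "\<phi> (inv\<^bsub>G\<^esub> (tr y y1)) x1 = x" "\<phi> (inv\<^bsub>G\<^esub> (tr y y1)) y1 = y"
      using t o True by (auto simp: \<phi>_inv_eq_iff)
    then show ?thesis using act_linear[OF Gr.inv_closed[OF t(1)] o(2,1)] True by (simp add: th_def p' eta_contract_eq)
  next
    case False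
    then show ?thesis by (auto simp: th_def p' intro!: module_homI)
  qed
qed

lemma lift_th_hom:
  assumes "x \<in> u"
  shows "D.lift (Mor C y x) (th y x) \<in> module_hom k D.S (Mor C y x)"
  by (rule D.lift_hom[OF Mor_C_module[OF orbit_obj[OF u assms] orbit_obj[OF v y]] th_hom[OF assms]])

text \<open>A homogeneous element is translated so that its target becomes \<open>y\<close>.
  Translating it by \<open>s\<close> beforehand multiplies \<open>tr y y1\<close> by
  \<open>s\<close>, and the inverse that is applied then undoes \<open>s\<close>; the total
  translation is the same.\<close>

lemma lift_th_ac:
  assumes x: "x \<in> u" and s: "s \<in> carrier G" and f: "f \<in> carrier D.S"
  shows "D.lift (Mor C y x) (th y x) (ac s f) = D.lift (Mor C y x) (th y x) f"
proof (rule D.hom_eqI[OF _ module_hom_compose[OF ac_hom[OF s] lift_th_hom[OF x]] lift_th_hom[OF x] _ f])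
  note M = Mor_C_module[OF orbit_obj[OF u x] orbit_obj[OF v y]]
  show "module k (Mor C y x)" by (rule M)
  fix p c assume "p \<in> v \<times> u" and c: "c \<in> carrier (case p of (y, x) \<Rightarrow> Mor C y x)"
  then obtain y1 x1 where p: "p = (y1, x1)" "y1 \<in> v" "x1 \<in> u" by (cases p) auto
  have c: "c \<in> carrier (Mor C y1 x1)" using c p by simp
  note o = orbit_obj[OF v p(2)] orbit_obj[OF u p(3)] orbit_obj[OF v y] orbit_obj[OF u x]
  note t = tr[OF v y p(2)]
  have sc: "\<psi> s y1 x1 c \<in> carrier (Mor C (\<phi> s y1) (\<phi> s x1))" by (rule \<psi>_closed[OF s o(2,1) c])
  have m: "\<phi> s y1 \<in> v" "\<phi> s x1 \<in> u" using orbit_closed[OF v p(2) s] orbit_closed[OF u p(3) s] by auto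
  have e: "inv\<^bsub>G\<^esub> (s \<otimes>\<^bsub>G\<^esub> tr y y1) \<otimes>\<^bsub>G\<^esub> s = inv\<^bsub>G\<^esub> (tr y y1)"
    using s t(1) by (simp add: Gr.inv_mult_group Gr.m_assoc)
  have "D.lift (Mor C y x) (th y x) (ac s (D.single p c)) = th y x (\<phi> s y1, \<phi> s x1) (\<psi> s y1 x1 c)"
    unfolding p(1) ac_single[OF s p(2,3) c] using m sc by (intro D.lift_single[OF M th_hom[OF x]]) auto
  also have "\<dots> = th y x (y1, x1) c"
    using t s o act_act[of "inv\<^bsub>G\<^esub> (s \<otimes>\<^bsub>G\<^esub> tr y y1)" s x1 y1 c] c
    by (simp add: th_def tr_\<phi>[OF v y p(2) s] composition_rule \<phi>_eq_iff \<phi>_closed e)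
  also have "\<dots> = D.lift (Mor C y x) (th y x) (D.single p c)"
    unfolding p(1) using p c by (intro D.lift_single[OF M th_hom[OF x], symmetric]) auto
  finally show "D.lift (Mor C y x) (th y x) (ac s (D.single p c)) = D.lift (Mor C y x) (th y x) (D.single p c)" .
qed

lemma coord_hom: "x \<in> u \<Longrightarrow> coord y x \<in> module_hom k (Mor B v u) (Mor C y x)"
  unfolding coord_def
  by (rule desc(2)[OF Mor_C_module lift_th_hom lift_th_ac]) (auto intro: orbit_obj[OF u] orbit_obj[OF v y])

lemma coord_mc:
  assumes x: "x \<in> u" and x': "x' \<in> u" and c: "c \<in> carrier (Mor C y x')"
  shows "coord y x (mc y x' c) = (if x = x' then c else \<zero>\<^bsub>Mor C y x\<^esub>)"
proof -
  note o = orbit_obj[OF v y] orbit_obj[OF u x] orbit_obj[OF u x']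
  have "coord y x (mc y x' c) = D.lift (Mor C y x) (th y x) (D.single (y, x') c)"
    unfolding coord_def mc_cls[OF y x']
    by (rule desc(1)[OF Mor_C_module lift_th_hom lift_th_ac]) (use o x single_closed[OF y x' c] in auto)
  also have "\<dots> = th y x (y, x') c"
    using y x' c by (intro D.lift_single[OF Mor_C_module[OF o(2,1)] th_hom[OF x]]) auto
  finally show ?thesis using o c by (auto simp: th_def tr_self \<phi>_one act_one)
qed

text \<open>Induction on a representative. A homogeneous element at \<open>(y1, x1)\<close> is
  translated to one with target \<open>y\<close>, and adding it changes the single coordinate at
  \<open>x0\<close>. The expansion is claimed for all finite sets between \<open>X\<close> and
  \<open>u\<close>, so that the old and the new expansion can be taken over the same set.\<close>

lemma coord_expansion_ex:
  assumes E: "E \<in> carrier (Mor B v u)"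
  shows "\<exists>X. finite X \<and> X \<subseteq> u \<and> (\<forall>x \<in> u - X. coord y x E = \<zero>\<^bsub>Mor C y x\<^esub>) \<and>
    (\<forall>Y. finite Y \<and> X \<subseteq> Y \<and> Y \<subseteq> u \<longrightarrow> E = (\<Oplus>\<^bsub>Mor B v u\<^esub>x\<in>Y. mc y x (coord y x E)))"
proof -
  obtain f where f: "f \<in> carrier D.S" "E = cls f" using E by (rule cls_rep)
  have M: "module k (Mor C y x)" if "x \<in> u" for x by (rule Mor_C_module[OF orbit_obj[OF u that] orbit_obj[OF v y]])
  note mh = mc_hom'[OF y]
  have cc: "coord y x E \<in> carrier (Mor C y x)" if "x \<in> u" "E \<in> carrier (Mor B v u)" for x E
    by (rule module_homD(1)[OF coord_hom[OF that(1)] that(2)])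
  have mcc: "mc y x (coord y x E) \<in> carrier (Mor B v u)" if "x \<in> u" "E \<in> carrier (Mor B v u)" for x E
    by (rule module_homD(1)[OF mh[OF that(1)] cc[OF that]])
  show ?thesis unfolding f(2) using f(1)
  proof (induction rule: D.induct)
    case zero
    have e: "cls \<zero>\<^bsub>D.S\<^esub> = \<zero>\<^bsub>Mor B v u\<^esub>" by (rule module_hom_zero[OF D.S_module Mor_B_module cls_hom])
    have cz: "coord y x \<zero>\<^bsub>Mor B v u\<^esub> = \<zero>\<^bsub>Mor C y x\<^esub>" "mc y x \<zero>\<^bsub>Mor C y x\<^esub> = \<zero>\<^bsub>Mor B v u\<^esub>" if "x \<in> u" for x
      using module_hom_zero[OF Mor_B_module M[OF that] coord_hom[OF that]] module_hom_zero[OF M[OF that] Mor_B_module mh[OF that]] by auto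
    have "(\<Oplus>\<^bsub>Mor B v u\<^esub>x\<in>Y. mc y x (coord y x \<zero>\<^bsub>Mor B v u\<^esub>)) = \<zero>\<^bsub>Mor B v u\<^esub>" if "Y \<subseteq> u" for Y
    proof -
      have "(\<Oplus>\<^bsub>Mor B v u\<^esub>x\<in>Y. mc y x (coord y x \<zero>\<^bsub>Mor B v u\<^esub>)) = (\<Oplus>\<^bsub>Mor B v u\<^esub>x\<in>Y. \<zero>\<^bsub>Mor B v u\<^esub>)"
        using that by (intro Q.M.finsum_cong') (auto simp: cz subset_iff)
      then show ?thesis by simp
    qed
    then show ?case unfolding e using cz by (intro exI[of _ "{}"]) auto
  next
    case (add g p a)
    obtain y1 x1 where p: "p = (y1, x1)" "y1 \<in> v" "x1 \<in> u" using add.hyps(2) by (cases p) auto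
    have a: "a \<in> carrier (Mor C y1 x1)" using add.hyps(3) p by simp
    \<comment> \<open>Translation by \<open>s\<close> moves the target \<open>y1\<close> to
      \<open>y\<close> without changing the class.\<close>
    define s where "s = tr y1 y"
    have s: "s \<in> carrier G" "\<phi> s y1 = y" using tr[OF v p(2) y] by (auto simp: s_def)
    define x0 where "x0 = \<phi> s x1"
    define a0 where "a0 = \<psi> s y1 x1 a"
    have x0: "x0 \<in> u" using orbit_closed[OF u p(3) s(1)] by (simp add: x0_def)
    have a0: "a0 \<in> carrier (Mor C y x0)"
      using \<psi>_closed[OF s(1) orbit_obj[OF u p(3)] orbit_obj[OF v p(2)] a] s(2) by (simp add: a0_def x0_def)
    have e1: "cls (D.single p a) = mc y x0 a0"
      using mc_\<phi>'[OF s(1) p(2,3) a] s(2) by (simp add: p mc_cls a0_def x0_def)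
    let ?m = "mc y x0 a0"
    have mcl: "?m \<in> carrier (Mor B v u)" by (rule module_homD(1)[OF mh[OF x0] a0])
    have gc: "cls g \<in> carrier (Mor B v u)" by (rule cls_closed[OF add.hyps(1)])
    have e: "cls (g \<oplus>\<^bsub>D.S\<^esub> D.single p a) = cls g \<oplus>\<^bsub>Mor B v u\<^esub> ?m"
      unfolding e1[symmetric] by (rule module_homD(2)[OF cls_hom add.hyps(1) D.single_closed[OF add.hyps(2,3)]])
    obtain X where X: "finite X" "X \<subseteq> u" "\<And>x. x \<in> u - X \<Longrightarrow> coord y x (cls g) = \<zero>\<^bsub>Mor C y x\<^esub>"
      "\<And>Y. \<lbrakk>finite Y; X \<subseteq> Y; Y \<subseteq> u\<rbrakk> \<Longrightarrow> cls g = (\<Oplus>\<^bsub>Mor B v u\<^esub>x\<in>Y. mc y x (coord y x (cls g)))"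
      using add.IH by auto
    have ca: "coord y x (cls g \<oplus>\<^bsub>Mor B v u\<^esub> ?m) = coord y x (cls g) \<oplus>\<^bsub>Mor C y x\<^esub> (if x = x0 then a0 else \<zero>\<^bsub>Mor C y x\<^esub>)"
      if x: "x \<in> u" for x
      using module_homD(2)[OF coord_hom[OF x] gc mcl] coord_mc[OF x x0 a0] by simp
    have Z: "\<zero>\<^bsub>Mor C y x\<^esub> \<in> carrier (Mor C y x)" "\<zero>\<^bsub>Mor C y x\<^esub> \<oplus>\<^bsub>Mor C y x\<^esub> \<zero>\<^bsub>Mor C y x\<^esub> = \<zero>\<^bsub>Mor C y x\<^esub>" if x: "x \<in> u" for x
    proof -
      interpret Vx: plain_module k "Mor C y x" using M[OF x] by (simp add: plain_module_def)
      show "\<zero>\<^bsub>Mor C y x\<^esub> \<in> carrier (Mor C y x)" "\<zero>\<^bsub>Mor C y x\<^esub> \<oplus>\<^bsub>Mor C y x\<^esub> \<zero>\<^bsub>Mor C y x\<^esub> = \<zero>\<^bsub>Mor C y x\<^esub>" by simp_all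
    qed
    have sum: "cls g \<oplus>\<^bsub>Mor B v u\<^esub> ?m = (\<Oplus>\<^bsub>Mor B v u\<^esub>x\<in>Y. mc y x (coord y x (cls g \<oplus>\<^bsub>Mor B v u\<^esub> ?m)))"
      if Y: "finite Y" "insert x0 X \<subseteq> Y" "Y \<subseteq> u" for Y
    proof -
      let ?d = "\<lambda>x. mc y x (if x = x0 then a0 else \<zero>\<^bsub>Mor C y x\<^esub>)"
      have d: "?d x = (if x = x0 then ?m else \<zero>\<^bsub>Mor B v u\<^esub>)" if "x \<in> u" for x
        using module_hom_zero[OF M[OF that] Mor_B_module mh[OF that]] by simp
      have "(\<Oplus>\<^bsub>Mor B v u\<^esub>x\<in>Y. mc y x (coord y x (cls g \<oplus>\<^bsub>Mor B v u\<^esub> ?m))) =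
          (\<Oplus>\<^bsub>Mor B v u\<^esub>x\<in>Y. mc y x (coord y x (cls g)) \<oplus>\<^bsub>Mor B v u\<^esub> (if x = x0 then ?m else \<zero>\<^bsub>Mor B v u\<^esub>))"
      proof (rule Q.M.finsum_cong'[OF refl])
        fix x assume "x \<in> Y"
        then have x: "x \<in> u" using Y(3) by blast
        have ic: "(if x = x0 then a0 else \<zero>\<^bsub>Mor C y x\<^esub>) \<in> carrier (Mor C y x)" using a0 Z(1)[OF x] by simp
        show "mc y x (coord y x (cls g \<oplus>\<^bsub>Mor B v u\<^esub> ?m)) = mc y x (coord y x (cls g)) \<oplus>\<^bsub>Mor B v u\<^esub> (if x = x0 then ?m else \<zero>\<^bsub>Mor B v u\<^esub>)"
          unfolding ca[OF x] module_homD(2)[OF mh[OF x] cc[OF x gc] ic] d[OF x] ..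
      qed (use mcc[OF _ gc] mcl Y(3) in auto)
      also have "\<dots> = (\<Oplus>\<^bsub>Mor B v u\<^esub>x\<in>Y. mc y x (coord y x (cls g))) \<oplus>\<^bsub>Mor B v u\<^esub>
          (\<Oplus>\<^bsub>Mor B v u\<^esub>x\<in>Y. (if x = x0 then ?m else \<zero>\<^bsub>Mor B v u\<^esub>))"
        using mcc[OF _ gc] mcl Y(3) by (intro Q.M.finsum_addf) auto
      also have "(\<Oplus>\<^bsub>Mor B v u\<^esub>x\<in>Y. (if x = x0 then ?m else \<zero>\<^bsub>Mor B v u\<^esub>)) = ?m"
        using Y mcl by (intro Q.M.add.finprod_singleton_swap) auto
      also have "(\<Oplus>\<^bsub>Mor B v u\<^esub>x\<in>Y. mc y x (coord y x (cls g))) = cls g" using X(4)[of Y] Y by simp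
      finally show ?thesis ..
    qed
    have out: "coord y x (cls g \<oplus>\<^bsub>Mor B v u\<^esub> ?m) = \<zero>\<^bsub>Mor C y x\<^esub>" if "x \<in> u - insert x0 X" for x
      using that ca[of x] X(3)[of x] Z(2)[of x] by simp
    show ?case unfolding e using X(1,2) x0 sum out by (intro exI[of _ "insert x0 X"]) blast
  qed
qed

end

end

section \<open>Composition in the quotient category\<close>

context free_action
begin

lemma orbit_pairI: "\<lbrakk>v \<in> Obj B; u \<in> Obj B\<rbrakk> \<Longrightarrow> orbit_pair k C G \<phi> \<psi> v u"
  by (intro orbit_pair.intro orbit_pair_axioms.intro free_action_axioms)

end

locale orbit_triple = free_action k C G \<phi> \<psi>
  for k :: "('k, 'r) ring_scheme" and C :: "('o, 'k, 'm) kcat"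
    and G :: "('g, 'n) monoid_scheme" and \<phi> :: "'g \<Rightarrow> 'o \<Rightarrow> 'o"
    and \<psi> :: "'g \<Rightarrow> 'o \<Rightarrow> 'o \<Rightarrow> 'm \<Rightarrow> 'm" +
  fixes w v u :: "'o set"
  assumes w: "w \<in> Obj B" and v: "v \<in> Obj B" and u: "u \<in> Obj B"
begin

sublocale wv: orbit_pair k C G \<phi> \<psi> w v by (rule orbit_pairI[OF w v])
sublocale vu: orbit_pair k C G \<phi> \<psi> v u by (rule orbit_pairI[OF v u])
sublocale wu: orbit_pair k C G \<phi> \<psi> w u by (rule orbit_pairI[OF w u])

abbreviation comp :: "('o \<times> 'o \<Rightarrow> 'm) \<Rightarrow> ('o \<times> 'o \<Rightarrow> 'm) \<Rightarrow> ('o \<times> 'o \<Rightarrow> 'm)"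
  where "comp \<equiv> orbit_sum_comp C G \<phi> \<psi> w v u"

definition hterm :: "'o \<times> 'o \<Rightarrow> 'o \<times> 'o \<Rightarrow> 'm \<Rightarrow> 'm \<Rightarrow> ('o \<times> 'o \<Rightarrow> 'm)"
  where "hterm = (\<lambda>(z, y') (y, x) a b. wu.D.single (\<phi> (tr y' y) z, x)
    (Cmp C (\<phi> (tr y' y) z) y x (\<psi> (tr y' y) z y' a) b))"

lemma hterm_objects:
  assumes "z \<in> w" "y' \<in> v" "y \<in> v" "x \<in> u"
  shows "tr y' y \<in> carrier G" "\<phi> (tr y' y) y' = y" "\<phi> (tr y' y) z \<in> w"
    "z \<in> Obj C" "y' \<in> Obj C" "y \<in> Obj C" "x \<in> Obj C" "\<phi> (tr y' y) z \<in> Obj C"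
proof -
  show t: "tr y' y \<in> carrier G" "\<phi> (tr y' y) y' = y" using tr[OF v assms(2,3)] by auto
  show "\<phi> (tr y' y) z \<in> w" by (rule orbit_closed[OF w assms(1) t(1)])
  then show "z \<in> Obj C" "y' \<in> Obj C" "y \<in> Obj C" "x \<in> Obj C" "\<phi> (tr y' y) z \<in> Obj C"
    using assms orbit_obj[OF w] orbit_obj[OF v] orbit_obj[OF u] by auto
qed

lemma hterm_left_closed:
  assumes "z \<in> w" "y' \<in> v" "y \<in> v" "x \<in> u" "a \<in> carrier (Mor C z y')"
  shows "\<psi> (tr y' y) z y' a \<in> carrier (Mor C (\<phi> (tr y' y) z) y)"
  using \<psi>_closed[of "tr y' y" y' z a] hterm_objects[OF assms(1-4)] assms(5) by simp

lemma hterm_hom_right: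
  assumes p: "z \<in> w" "y' \<in> v" "y \<in> v" "x \<in> u" and a: "a \<in> carrier (Mor C z y')"
  shows "hterm (z, y') (y, x) a \<in> module_hom k (Mor C y x) wu.D.S"
proof -
  note o = hterm_objects[OF p]
  have "Cmp C (\<phi> (tr y' y) z) y x (\<psi> (tr y' y) z y' a) \<in> module_hom k (Mor C y x) (Mor C (\<phi> (tr y' y) z) x)"
    using bilinear_mapD(1)[OF Cmp_bilinear[OF o(7,6,8)] hterm_left_closed[OF p a]] .
  moreover have "wu.D.single (\<phi> (tr y' y) z, x) \<in> module_hom k (Mor C (\<phi> (tr y' y) z) x) wu.D.S"
    using wu.D.single_hom[of "(\<phi> (tr y' y) z, x)"] o(3) p(4) by simp
  ultimately have "(\<lambda>b. wu.D.single (\<phi> (tr y' y) z, x) (Cmp C (\<phi> (tr y' y) z) y x (\<psi> (tr y' y) z y' a) b)) \<in> module_hom k (Mor C y x) wu.D.S"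
    by (rule module_hom_compose)
  then show ?thesis by (simp add: hterm_def)
qed

lemma hterm_hom_left:
  assumes p: "z \<in> w" "y' \<in> v" "y \<in> v" "x \<in> u" and b: "b \<in> carrier (Mor C y x)"
  shows "(\<lambda>a. hterm (z, y') (y, x) a b) \<in> module_hom k (Mor C z y') wu.D.S"
proof -
  note o = hterm_objects[OF p]
  have 1: "\<psi> (tr y' y) z y' \<in> module_hom k (Mor C z y') (Mor C (\<phi> (tr y' y) z) y)"
    using act_linear[OF o(1,5,4)] o(2) by simp
  have 2: "(\<lambda>c. Cmp C (\<phi> (tr y' y) z) y x c b) \<in> module_hom k (Mor C (\<phi> (tr y' y) z) y) (Mor C (\<phi> (tr y' y) z) x)"
    using bilinear_mapD(2)[OF Cmp_bilinear[OF o(7,6,8)] b] .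
  have 3: "wu.D.single (\<phi> (tr y' y) z, x) \<in> module_hom k (Mor C (\<phi> (tr y' y) z) x) wu.D.S"
    using wu.D.single_hom[of "(\<phi> (tr y' y) z, x)"] o(3) p(4) by simp
  show ?thesis using module_hom_compose[OF module_hom_compose[OF 1 2] 3] by (simp add: hterm_def)
qed

abbreviation inner :: "'o \<times> 'o \<Rightarrow> 'm \<Rightarrow> ('o \<times> 'o \<Rightarrow> 'm) \<Rightarrow> ('o \<times> 'o \<Rightarrow> 'm)"
  where "inner p a g \<equiv> vu.D.lift wu.D.S (\<lambda>q. hterm p q a) g"

lemma hterm_right:
  assumes p: "p \<in> w \<times> v" "a \<in> carrier (case p of (z, y) \<Rightarrow> Mor C z y)" and q: "q \<in> v \<times> u"
  shows "hterm p q a \<in> module_hom k (case q of (y, x) \<Rightarrow> Mor C y x) wu.D.S"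
  using hterm_hom_right[of "fst p" "snd p" "fst q" "snd q" a] assms by (cases p; cases q) simp

lemma inner_hom_right:
  assumes "p \<in> w \<times> v" "a \<in> carrier (case p of (z, y) \<Rightarrow> Mor C z y)"
  shows "inner p a \<in> module_hom k vu.D.S wu.D.S"
  by (rule vu.D.lift_hom[OF wu.D.S_module hterm_right[OF assms]])

lemma inner_hom_left:
  assumes p: "p \<in> w \<times> v" and g: "g \<in> carrier vu.D.S"
  shows "(\<lambda>a. inner p a g) \<in> module_hom k (case p of (z, y) \<Rightarrow> Mor C z y) wu.D.S"
  unfolding vu.D.lift_def
proof (rule wu.D.S.finsum_hom)
  show "module k (case p of (z, y) \<Rightarrow> Mor C z y)" by (rule wv.D.V[OF p])
  fix q assume "q \<in> vu.D.supp g"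
  then have q: "q \<in> v \<times> u" by (simp add: vu.D.supp_def)
  show "(\<lambda>a. hterm p q a (g q)) \<in> module_hom k (case p of (z, y) \<Rightarrow> Mor C z y) wu.D.S"
    using hterm_hom_left[of "fst p" "snd p" "fst q" "snd q" "g q"] p q vu.D.S_mem[OF g q] by (cases p; cases q) simp
qed

lemma inner_single:
  assumes p: "p \<in> w \<times> v" "a \<in> carrier (case p of (z, y) \<Rightarrow> Mor C z y)"
    and q: "q \<in> v \<times> u" "b \<in> carrier (case q of (y, x) \<Rightarrow> Mor C y x)"
  shows "inner p a (vu.D.single q b) = hterm p q a b"
  by (rule vu.D.lift_single[OF wu.D.S_module hterm_right[OF p] q])

text \<open>The defining sum runs over the product of two supports, which vary with the arguments.
  Written as an iterated \<open>lift\<close>, the composite is seen to be linear in either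
  argument.\<close>

lemma comp_lift:
  assumes f: "f \<in> carrier wv.D.S" and g: "g \<in> carrier vu.D.S"
  shows "comp f g = wv.D.lift wu.D.S (\<lambda>p a. inner p a g) f"
proof -
  have s: "{(z, y'). (z, y') \<in> w \<times> v \<and> f (z, y') \<noteq> \<zero>\<^bsub>Mor C z y'\<^esub>} = wv.D.supp f"
    "{(y, x). (y, x) \<in> v \<times> u \<and> g (y, x) \<noteq> \<zero>\<^bsub>Mor C y x\<^esub>} = vu.D.supp g"
    by (auto simp: wv.D.supp_def vu.D.supp_def)
  have fin: "finite (wv.D.supp f)" "finite (vu.D.supp g)" using f g by (simp_all add: wv.D.S_simps vu.D.S_simps)
  have e: "(\<lambda>((z, y'), (y, x)). let s = THE s. s \<in> carrier G \<and> \<phi> s y' = y in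
         orbit_single C w u (\<phi> s z) x (Cmp C (\<phi> s z) y x (\<psi> s z y' (f (z, y'))) (g (y, x)))) =
      (\<lambda>pq. hterm (fst pq) (snd pq) (f (fst pq)) (g (snd pq)))"
    by (auto simp: fun_eq_iff hterm_def Let_def tr_def[symmetric] orbit_single_def)
  have "comp f g = (\<Oplus>\<^bsub>wu.D.S\<^esub>pq\<in>wv.D.supp f \<times> vu.D.supp g. hterm (fst pq) (snd pq) (f (fst pq)) (g (snd pq)))"
    unfolding orbit_sum_comp_def e wu.orbit_sum_S s ..
  also have "\<dots> = (\<Oplus>\<^bsub>wu.D.S\<^esub>p\<in>wv.D.supp f. \<Oplus>\<^bsub>wu.D.S\<^esub>q\<in>vu.D.supp g. hterm p q (f p) (g q))"
  proof (rule wu.D.S.finsum_Sigma[symmetric])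
    fix p q assume "p \<in> wv.D.supp f" "q \<in> vu.D.supp g"
    then have pq: "p \<in> w \<times> v" "q \<in> v \<times> u" by (simp_all add: wv.D.supp_def vu.D.supp_def)
    show "hterm p q (f p) (g q) \<in> carrier wu.D.S"
      by (rule module_homD(1)[OF hterm_right[OF pq(1) wv.D.S_mem[OF f pq(1)] pq(2)] vu.D.S_mem[OF g pq(2)]])
  qed (use fin in auto)
  finally show ?thesis unfolding wv.D.lift_def vu.D.lift_def .
qed

lemma comp_hom_left:
  assumes g: "g \<in> carrier vu.D.S"
  shows "(\<lambda>f. comp f g) \<in> module_hom k wv.D.S wu.D.S"
  by (rule module_hom_cong[OF wv.D.S_module wv.D.lift_hom[OF wu.D.S_module inner_hom_left[OF _ g]] comp_lift[OF _ g]])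

lemma comp_hom_right:
  assumes f: "f \<in> carrier wv.D.S"
  shows "comp f \<in> module_hom k vu.D.S wu.D.S"
proof (rule module_hom_cong[OF vu.D.S_module _ comp_lift[OF f]])
  show "(\<lambda>g. wv.D.lift wu.D.S (\<lambda>p a. inner p a g) f) \<in> module_hom k vu.D.S wu.D.S"
    unfolding wv.D.lift_def
  proof (rule wu.D.S.finsum_hom[OF vu.D.S_module])
    fix p assume "p \<in> wv.D.supp f"
    then have p: "p \<in> w \<times> v" by (simp add: wv.D.supp_def)
    show "inner p (f p) \<in> module_hom k vu.D.S wu.D.S" by (rule inner_hom_right[OF p wv.D.S_mem[OF f p]])
  qed
qed

lemma comp_single:
  assumes p: "p \<in> w \<times> v" "a \<in> carrier (case p of (z, y) \<Rightarrow> Mor C z y)"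
    and q: "q \<in> v \<times> u" "b \<in> carrier (case q of (y, x) \<Rightarrow> Mor C y x)"
  shows "comp (wv.D.single p a) (vu.D.single q b) = hterm p q a b"
  using comp_lift[OF wv.D.single_closed[OF p] vu.D.single_closed[OF q]] inner_single[OF p q]
    wv.D.lift_single[OF wu.D.S_module inner_hom_left[OF _ vu.D.single_closed[OF q]] p] by simp

abbreviation ccomp :: "('o \<times> 'o \<Rightarrow> 'm) \<Rightarrow> ('o \<times> 'o \<Rightarrow> 'm) \<Rightarrow> ('o \<times> 'o \<Rightarrow> 'm) set"
  where "ccomp f g \<equiv> wu.cls (comp f g)"

lemma ccomp_hom_left: "g \<in> carrier vu.D.S \<Longrightarrow> (\<lambda>f. ccomp f g) \<in> module_hom k wv.D.S (Mor B w u)"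
  by (rule module_hom_compose[OF comp_hom_left wu.cls_hom])

lemma ccomp_hom_right: "f \<in> carrier wv.D.S \<Longrightarrow> (\<lambda>g. ccomp f g) \<in> module_hom k vu.D.S (Mor B w u)"
  by (rule module_hom_compose[OF comp_hom_right wu.cls_hom])

text \<open>On homogeneous elements the composites agree even before passing to classes: translating
  the left factor by \<open>s\<close> multiplies the connecting element \<open>tr\<close> by the
  inverse of \<open>s\<close>, and the translated factor that enters the composite stays the
  same.\<close>

lemma ccomp_ac_left:
  assumes s: "s \<in> carrier G" and f: "f \<in> carrier wv.D.S" and g: "g \<in> carrier vu.D.S"
  shows "ccomp (wv.ac s f) g = ccomp f g"
proof (rule wv.D.hom_eqI[OF wu.Mor_B_module module_hom_compose[OF wv.ac_hom[OF s] ccomp_hom_left[OF g]] ccomp_hom_left[OF g] _ f])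
  fix p a assume p: "p \<in> w \<times> v" and a: "a \<in> carrier (case p of (y, x) \<Rightarrow> Mor C y x)"
  note sc = wv.D.single_closed[OF p a]
  note asc = module_homD(1)[OF wv.ac_hom[OF s] sc]
  show "ccomp (wv.ac s (wv.D.single p a)) g = ccomp (wv.D.single p a) g"
  proof (rule vu.D.hom_eqI[OF wu.Mor_B_module ccomp_hom_right[OF asc] ccomp_hom_right[OF sc] _ g])
    fix q b assume q: "q \<in> v \<times> u" and b: "b \<in> carrier (case q of (y, x) \<Rightarrow> Mor C y x)"
    obtain z y' where p': "p = (z, y')" "z \<in> w" "y' \<in> v" using p by (cases p) auto
    obtain y x where q': "q = (y, x)" "y \<in> v" "x \<in> u" using q by (cases q) auto
    have a': "a \<in> carrier (Mor C z y')" using a p' by simp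
    note o = hterm_objects[OF p'(2,3) q'(2,3)]
    have si: "inv\<^bsub>G\<^esub> s \<in> carrier G" using s by simp
    have sa: "\<psi> s z y' a \<in> carrier (Mor C (\<phi> s z) (\<phi> s y'))" by (rule \<psi>_closed[OF s o(5,4) a'])
    have t: "tr (\<phi> s y') y = tr y' y \<otimes>\<^bsub>G\<^esub> inv\<^bsub>G\<^esub> s" by (rule tr_\<phi>(2)[OF v p'(3) q'(2) s])
    have e1: "\<phi> (tr (\<phi> s y') y) (\<phi> s z) = \<phi> (tr y' y) z"
      using s o by (simp add: t composition_rule \<phi>_closed \<phi>_inv)
    have e2: "\<psi> (tr (\<phi> s y') y) (\<phi> s z) (\<phi> s y') (\<psi> s z y' a) = \<psi> (tr y' y) z y' a"
      using s si o act_act[of "tr y' y \<otimes>\<^bsub>G\<^esub> inv\<^bsub>G\<^esub> s" s y' z a] a' by (simp add: t Gr.m_assoc)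
    have "comp (wv.ac s (wv.D.single p a)) (vu.D.single q b) = hterm (\<phi> s z, \<phi> s y') q (\<psi> s z y' a) b"
      unfolding p'(1) wv.ac_single[OF s p'(2,3) a']
      using q b sa orbit_closed[OF w p'(2) s] orbit_closed[OF v p'(3) s] by (intro comp_single) auto
    also have "\<dots> = hterm p q a b" by (simp add: hterm_def p' q' e1 e2)
    also have "\<dots> = comp (wv.D.single p a) (vu.D.single q b)" by (rule comp_single[OF p a q b, symmetric])
    finally show "ccomp (wv.ac s (wv.D.single p a)) (vu.D.single q b) = ccomp (wv.D.single p a) (vu.D.single q b)" by simp
  qed
qed

text \<open>On homogeneous elements, translating the right factor translates the composite itself by
  \<open>s\<close>, so the equality comes from passing to classes.\<close>

lemma ccomp_ac_right:
  assumes s: "s \<in> carrier G" and f: "f \<in> carrier wv.D.S" and g: "g \<in> carrier vu.D.S"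
  shows "ccomp f (vu.ac s g) = ccomp f g"
proof (rule vu.D.hom_eqI[OF wu.Mor_B_module module_hom_compose[OF vu.ac_hom[OF s] ccomp_hom_right[OF f]] ccomp_hom_right[OF f] _ g])
  fix q b assume q: "q \<in> v \<times> u" and b: "b \<in> carrier (case q of (y, x) \<Rightarrow> Mor C y x)"
  note sc = vu.D.single_closed[OF q b]
  note asc = module_homD(1)[OF vu.ac_hom[OF s] sc]
  show "ccomp f (vu.ac s (vu.D.single q b)) = ccomp f (vu.D.single q b)"
  proof (rule wv.D.hom_eqI[OF wu.Mor_B_module ccomp_hom_left[OF asc] ccomp_hom_left[OF sc] _ f])
    fix p a assume p: "p \<in> w \<times> v" and a: "a \<in> carrier (case p of (y, x) \<Rightarrow> Mor C y x)"
    obtain z y' where p': "p = (z, y')" "z \<in> w" "y' \<in> v" using p by (cases p) auto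
    obtain y x where q': "q = (y, x)" "y \<in> v" "x \<in> u" using q by (cases q) auto
    have a': "a \<in> carrier (Mor C z y')" using a p' by simp
    have b': "b \<in> carrier (Mor C y x)" using b q' by simp
    note o = hterm_objects[OF p'(2,3) q'(2,3)]
    let ?r = "tr y' y"
    have sb: "\<psi> s y x b \<in> carrier (Mor C (\<phi> s y) (\<phi> s x))" by (rule \<psi>_closed[OF s o(7,6) b'])
    have ra: "\<psi> ?r z y' a \<in> carrier (Mor C (\<phi> ?r z) y)" by (rule hterm_left_closed[OF p'(2,3) q'(2,3) a'])
    have t: "tr y' (\<phi> s y) = s \<otimes>\<^bsub>G\<^esub> ?r" by (rule tr_\<phi>(1)[OF v p'(3) q'(2) s])
    have e1: "\<phi> (tr y' (\<phi> s y)) z = \<phi> s (\<phi> ?r z)" using s o by (simp add: t composition_rule)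
    have e2: "\<psi> (tr y' (\<phi> s y)) z y' a = \<psi> s (\<phi> ?r z) y (\<psi> ?r z y' a)"
      using s o act_act[of s ?r y' z a] a' by (simp add: t)
    have cc: "Cmp C (\<phi> ?r z) y x (\<psi> ?r z y' a) b \<in> carrier (Mor C (\<phi> ?r z) x)"
      by (rule bilinear_mapD(3)[OF Cmp_bilinear[OF o(7,6,8)] ra b'])
    have "comp (wv.D.single p a) (vu.ac s (vu.D.single q b)) = hterm p (\<phi> s y, \<phi> s x) a (\<psi> s y x b)"
      unfolding q'(1) vu.ac_single[OF s q'(2,3) b']
      using p a sb orbit_closed[OF v q'(2) s] orbit_closed[OF u q'(3) s] by (intro comp_single) auto
    also have "\<dots> = wu.ac s (hterm p q a b)"
      using wu.ac_single[OF s o(3) q'(3) cc] act_Cmp[OF s o(7,6,8) b' ra] by (simp add: hterm_def p' q' e1 e2)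
    finally have "ccomp (wv.D.single p a) (vu.ac s (vu.D.single q b)) = wu.cls (wu.ac s (hterm p q a b))" by simp
    also have "\<dots> = wu.cls (hterm p q a b)"
      using cc o(3) q'(3) by (intro wu.cls_ac[OF s]) (simp add: hterm_def p' q' wu.single_closed)
    also have "hterm p q a b = comp (wv.D.single p a) (vu.D.single q b)" by (rule comp_single[OF p a q b, symmetric])
    finally show "ccomp (wv.D.single p a) (vu.ac s (vu.D.single q b)) = ccomp (wv.D.single p a) (vu.D.single q b)" .
  qed
qed

text \<open>The union over representatives is a union of equal sets by the two invariance lemmas,
  and it is nonempty since cosets are.\<close>

lemma Cmp_B:
  assumes f: "f \<in> carrier wv.D.S" and g: "g \<in> carrier vu.D.S"
  shows "Cmp B w v u (wv.cls f) (vu.cls g) = ccomp f g"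
proof -
  have "ccomp f' g' = ccomp f g" if "f' \<in> wv.cls f" "g' \<in> vu.cls g" for f' g'
  proof -
    note f' = wv.cls_mem[OF f that(1)] and g' = vu.cls_mem[OF g that(2)]
    have "ccomp f' g' = ccomp f g'"
      using f' g' f by (intro wv.invariant_cls_eq[OF wu.Mor_B_module ccomp_hom_left ccomp_ac_left]) auto
    also have "\<dots> = ccomp f g"
      using g' g f by (intro vu.invariant_cls_eq[OF wu.Mor_B_module ccomp_hom_right ccomp_ac_right]) auto
    finally show ?thesis .
  qed
  then have "(\<Union>f' \<in> wv.cls f. \<Union>g' \<in> vu.cls g. ccomp f' g') = (\<Union>f' \<in> wv.cls f. \<Union>g' \<in> vu.cls g. ccomp f g)"
    by (intro SUP_cong refl)
  also have "\<dots> = ccomp f g"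
  proof -
    have "wv.cls f \<noteq> {}" "vu.cls g \<noteq> {}" using wv.cls_self[OF f] vu.cls_self[OF g] by auto
    then show ?thesis by (simp only: UN_constant if_False)
  qed
  finally show ?thesis by (simp only: quotient_category_def kcat.select_convs)
qed

lemma Cmp_B_bilinear: "bilinear_map k (Mor B w v) (Mor B v u) (Mor B w u) (Cmp B w v u)"
  unfolding bilinear_map_def
proof (intro conjI ballI module_homI)
  fix D E assume "D \<in> carrier (Mor B w v)" "E \<in> carrier (Mor B v u)"
  then obtain f g where f: "f \<in> carrier wv.D.S" "D = wv.cls f" and g: "g \<in> carrier vu.D.S" "E = vu.cls g"
    using wv.cls_rep vu.cls_rep by metis
  show c: "Cmp B w v u D E \<in> carrier (Mor B w u)"
    using module_homD(1)[OF ccomp_hom_right[OF f(1)] g(1)] by (simp add: f g Cmp_B)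
  show "Cmp B w v u D E \<in> carrier (Mor B w u)" by (rule c)
  show "Cmp B w v u D (a \<odot>\<^bsub>Mor B v u\<^esub> E) = a \<odot>\<^bsub>Mor B w u\<^esub> Cmp B w v u D E" if a: "a \<in> carrier k" for a
    unfolding f(2) g(2) module_homD(3)[OF vu.cls_hom a g(1), symmetric]
    using Cmp_B[OF f(1), of "a \<odot>\<^bsub>vu.D.S\<^esub> g"] Cmp_B[OF f(1) g(1)] module_homD(3)[OF ccomp_hom_right[OF f(1)] a g(1)] a g(1) by simp
  show "Cmp B w v u (a \<odot>\<^bsub>Mor B w v\<^esub> D) E = a \<odot>\<^bsub>Mor B w u\<^esub> Cmp B w v u D E" if a: "a \<in> carrier k" for a
    unfolding f(2) g(2) module_homD(3)[OF wv.cls_hom a f(1), symmetric]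
    using Cmp_B[of "a \<odot>\<^bsub>wv.D.S\<^esub> f", OF _ g(1)] Cmp_B[OF f(1) g(1)] module_homD(3)[OF ccomp_hom_left[OF g(1)] a f(1)] a f(1) by simp
  show "Cmp B w v u D (E \<oplus>\<^bsub>Mor B v u\<^esub> E') = Cmp B w v u D E \<oplus>\<^bsub>Mor B w u\<^esub> Cmp B w v u D E'" if "E' \<in> carrier (Mor B v u)" for E'
  proof -
    obtain g' where g': "g' \<in> carrier vu.D.S" "E' = vu.cls g'" using vu.cls_rep \<open>E' \<in> carrier (Mor B v u)\<close> by metis
    show ?thesis unfolding f(2) g(2) g'(2) module_homD(2)[OF vu.cls_hom g(1) g'(1), symmetric]
      using Cmp_B[OF f(1), of "g \<oplus>\<^bsub>vu.D.S\<^esub> g'"] Cmp_B[OF f(1) g(1)] Cmp_B[OF f(1) g'(1)]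
        module_homD(2)[OF ccomp_hom_right[OF f(1)] g(1) g'(1)] g(1) g'(1) by simp
  qed
  show "Cmp B w v u (D \<oplus>\<^bsub>Mor B w v\<^esub> D') E = Cmp B w v u D E \<oplus>\<^bsub>Mor B w u\<^esub> Cmp B w v u D' E" if "D' \<in> carrier (Mor B w v)" for D'
  proof -
    obtain f' where f': "f' \<in> carrier wv.D.S" "D' = wv.cls f'" using wv.cls_rep \<open>D' \<in> carrier (Mor B w v)\<close> by metis
    show ?thesis unfolding f(2) g(2) f'(2) module_homD(2)[OF wv.cls_hom f(1) f'(1), symmetric]
      using Cmp_B[of "f \<oplus>\<^bsub>wv.D.S\<^esub> f'", OF _ g(1)] Cmp_B[OF f(1) g(1)] Cmp_B[OF f'(1) g(1)]
        module_homD(2)[OF ccomp_hom_left[OF g(1)] f(1) f'(1)] f(1) f'(1) by simp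
  qed
qed

lemma mc_Cmp':
  assumes o: "z \<in> w" "y \<in> v" "x \<in> u" and d: "d \<in> carrier (Mor C z y)" and c: "c \<in> carrier (Mor C y x)"
  shows "Cmp B w v u (mc z y d) (mc y x c) = mc z x (Cmp C z y x d c)"
proof -
  note o' = orbit_obj[OF w o(1)] orbit_obj[OF v o(2)]
  have "Cmp B w v u (mc z y d) (mc y x c) = wu.cls (hterm (z, y) (y, x) d c)"
    using o d c Cmp_B[OF wv.single_closed[OF o(1,2) d] vu.single_closed[OF o(2,3) c]]
      comp_single[of "(z, y)" d "(y, x)" c] by (simp add: wv.mc_cls vu.mc_cls)
  also have "\<dots> = mc z x (Cmp C z y x d c)"
    using o o' d by (simp add: hterm_def tr_self \<phi>_one act_one wu.mc_cls)
  finally show ?thesis .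
qed

end

section \<open>The lifted bimodule and the functors on cells\<close>

context free_action
begin

lemma orbit_tripleI: "\<lbrakk>w \<in> Obj B; v \<in> Obj B; u \<in> Obj B\<rbrakk> \<Longrightarrow> orbit_triple k C G \<phi> \<psi> w v u"
  by (intro orbit_triple.intro orbit_triple_axioms.intro free_action_axioms)

lemma mem_orb: "x \<in> Obj C \<Longrightarrow> x \<in> orb x"
  by (rule orbit_refl)

lemma mc_hom: "\<lbrakk>x \<in> Obj C; y \<in> Obj C\<rbrakk> \<Longrightarrow> mc y x \<in> module_hom k (Mor C y x) (Mor B (orb y) (orb x))"
  using orbit_pair.mc_hom'[OF orbit_pairI[OF orb_Obj orb_Obj] mem_orb mem_orb] .

lemma mc_closed: "\<lbrakk>x \<in> Obj C; y \<in> Obj C; c \<in> carrier (Mor C y x)\<rbrakk> \<Longrightarrow> mc y x c \<in> carrier (Mor B (orb y) (orb x))"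
  by (rule module_homD(1)[OF mc_hom])

lemma mc_\<phi>: "\<lbrakk>s \<in> carrier G; x \<in> Obj C; y \<in> Obj C; c \<in> carrier (Mor C y x)\<rbrakk> \<Longrightarrow> mc (\<phi> s y) (\<phi> s x) (\<psi> s y x c) = mc y x c"
  using orbit_pair.mc_\<phi>'[OF orbit_pairI[OF orb_Obj orb_Obj] _ mem_orb mem_orb] .

lemma mc_Cmp: "\<lbrakk>x \<in> Obj C; y \<in> Obj C; z \<in> Obj C; c \<in> carrier (Mor C y x); d \<in> carrier (Mor C z y)\<rbrakk> \<Longrightarrow>
    mc z x (Cmp C z y x d c) = Cmp B (orb z) (orb y) (orb x) (mc z y d) (mc y x c)"
  using orbit_triple.mc_Cmp'[OF orbit_tripleI[OF orb_Obj orb_Obj orb_Obj] mem_orb mem_orb mem_orb] by simp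

lemma quotient_precategory:
  assumes "bimodule k B M"
  shows "linear_precategory k B M"
proof -
  interpret M: bimodule k B M by fact
  show ?thesis
  proof (rule linear_precategory.intro)
    show "cring k" by (rule is_cring)
    show "module k (Mor B v u)" if "u \<in> Obj B" "v \<in> Obj B" for u v
      by (rule orbit_pair.Mor_B_module[OF orbit_pairI[OF that(2,1)]])
    show "bilinear_map k (Mor B w v) (Mor B v u) (Mor B w u) (Cmp B w v u)" if "u \<in> Obj B" "v \<in> Obj B" "w \<in> Obj B" for u v w
      by (rule orbit_triple.Cmp_B_bilinear[OF orbit_tripleI[OF that(3,2,1)]])
    show "module k (Bim M v u)" if "u \<in> Obj B" "v \<in> Obj B" for u v
      using M.Bim_vectorspace[OF that] by (simp add: vectorspace_def)
  qed (rule M.Lact_bilinear M.Ract_bilinear; assumption)+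
qed

abbreviation LM :: "('o set, 'k, ('o \<times> 'o \<Rightarrow> 'm) set, 'b) bimod \<Rightarrow> ('o, 'k, 'm, 'b) bimod"
  where "LM M \<equiv> lifted_bimodule k C G \<phi> \<psi> M"

lemma LM_simps:
  shows "Bim (LM M) y x = Bim M (orb y) (orb x)"
    and "Lact (LM M) z y x c m = Lact M (orb z) (orb y) (orb x) (mc z y c) m"
    and "Ract (LM M) y x t m c = Ract M (orb y) (orb x) (orb t) m (mc x t c)"
  by (simp_all add: lifted_bimodule_def)

text \<open>The laws for the actions on \<open>LM M\<close> are those of \<open>M\<close> read
  through \<open>mc\<close>; the two associativity laws use that \<open>mc\<close> respects
  composition.\<close>

lemma lifted_category:
  assumes "bimodule k B M"
  shows "linear_category k C (LM M)"
proof -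
  interpret M: bimodule k B M by fact
  interpret P: linear_precategory k B M by (rule quotient_precategory[OF assms])
  have pre: "linear_precategory k C (LM M)"
  proof (rule linear_precategory.intro)
    show "cring k" by (rule is_cring)
    show "module k (Mor C y x)" if "x \<in> Obj C" "y \<in> Obj C" for x y by (rule Mor_C_module[OF that])
    show "bilinear_map k (Mor C z y) (Mor C y x) (Mor C z x) (Cmp C z y x)" if "x \<in> Obj C" "y \<in> Obj C" "z \<in> Obj C" for x y z
      by (rule Cmp_bilinear[OF that])
    show "module k (Bim (LM M) y x)" if "x \<in> Obj C" "y \<in> Obj C" for x y
      unfolding LM_simps by (rule P.Bim_module[OF orb_Obj[OF that(1)] orb_Obj[OF that(2)]])
    show "bilinear_map k (Mor C z y) (Bim (LM M) y x) (Bim (LM M) z x) (Lact (LM M) z y x)"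
      if o: "x \<in> Obj C" "y \<in> Obj C" "z \<in> Obj C" for x y z
    proof -
      note b = bilinear_mapD[OF M.Lact_bilinear[OF orb_Obj[OF o(1)] orb_Obj[OF o(2)] orb_Obj[OF o(3)]]]
      show ?thesis unfolding bilinear_map_def LM_simps(1) LM_simps(2)[abs_def]
        using b(1)[OF mc_closed[OF o(2,3)]] module_hom_compose[OF mc_hom[OF o(2,3)] b(2)] by blast
    qed
    show "bilinear_map k (Bim (LM M) y x) (Mor C x t) (Bim (LM M) y t) (Ract (LM M) y x t)"
      if o: "y \<in> Obj C" "x \<in> Obj C" "t \<in> Obj C" for y x t
    proof -
      note b = bilinear_mapD[OF M.Ract_bilinear[OF orb_Obj[OF o(1)] orb_Obj[OF o(2)] orb_Obj[OF o(3)]]]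
      show ?thesis unfolding bilinear_map_def LM_simps(1) LM_simps(3)[abs_def]
        using b(2)[OF mc_closed[OF o(3,2)]] module_hom_compose[OF mc_hom[OF o(3,2)] b(1)] by blast
    qed
  qed
  show ?thesis
  proof (intro linear_category.intro linear_category_axioms.intro pre)
  qed (simp_all add: LM_simps Cmp_assoc mc_Cmp M.Lact_assoc M.Ract_assoc M.Lact_Ract mc_closed orb_Obj)
qed

lemma projection_functor:
  assumes "bimodule k B M"
  shows "coefficient_functor k C (LM M) B M orb mc"
proof -
  interpret L: linear_category k C "LM M" by (rule lifted_category[OF assms])
  show ?thesis
    by (intro coefficient_functor.intro coefficient_functor_axioms.intro L.linear_precategory_axioms quotient_precategory[OF assms])
      (simp_all add: LM_simps orb_Obj mc_hom mc_Cmp)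
qed

text \<open>\<open>mc\<close> does not distinguish a morphism from its translates, so the lifted
  bimodule is its own pullback along the action of \<open>s\<close>. The action on cochains becomes
  an instance of pulling back.\<close>

lemma action_functor:
  assumes "bimodule k B M" and s: "s \<in> carrier G"
  shows "coefficient_functor k C (LM M) C (LM M) (\<phi> s) (\<psi> s)"
proof -
  interpret L: linear_category k C "LM M" by (rule lifted_category[OF assms(1)])
  show ?thesis
    by (intro coefficient_functor.intro coefficient_functor_axioms.intro L.linear_precategory_axioms)
      (simp_all add: LM_simps s \<phi>_closed act_linear act_Cmp orbit_\<phi> mc_\<phi>)
qed

end

section \<open>Cochains of the quotient category are invariant cochains\<close>

context free_action
begin

text \<open>\<open>coord\<close> with the two orbits recovered from the objects, so that it can be
  used along a list of objects without an \<open>orbit_pair\<close> for each step.\<close>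

definition cd :: "'o \<Rightarrow> 'o \<Rightarrow> ('o \<times> 'o \<Rightarrow> 'm) set \<Rightarrow> 'm"
  where "cd y x = orbit_pair.coord k C G \<phi> \<psi> (orb y) (orb x) y x"

lemma cd_hom:
  assumes "v \<in> Obj B" "u \<in> Obj B" "y \<in> v" "x \<in> u"
  shows "cd y x \<in> module_hom k (Mor B v u) (Mor C y x)"
  using orbit_pair.coord_hom[OF orbit_pairI[OF assms(1,2)] assms(3,4)] by (simp add: cd_def orbit_eq[OF assms(1,3)] orbit_eq[OF assms(2,4)])

lemma cd_mc:
  assumes "v \<in> Obj B" "u \<in> Obj B" "y \<in> v" "x \<in> u" "x' \<in> u" "c \<in> carrier (Mor C y x')"
  shows "cd y x (mc y x' c) = (if x = x' then c else \<zero>\<^bsub>Mor C y x\<^esub>)"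
  using orbit_pair.coord_mc[OF orbit_pairI[OF assms(1,2)] assms(3-6)] by (simp add: cd_def orbit_eq[OF assms(1,3)] orbit_eq[OF assms(2,4)])

lemma cd_expansion:
  assumes v: "v \<in> Obj B" and u: "u \<in> Obj B" and y: "y \<in> v" and E: "E \<in> carrier (Mor B v u)"
  obtains X where "finite X" "X \<subseteq> u" "\<And>x. \<lbrakk>x \<in> u; x \<notin> X\<rbrakk> \<Longrightarrow> cd y x E = \<zero>\<^bsub>Mor C y x\<^esub>"
    "E = (\<Oplus>\<^bsub>Mor B v u\<^esub>x\<in>X. mc y x (cd y x E))"
proof -
  interpret orbit_pair k C G \<phi> \<psi> v u by (rule orbit_pairI[OF v u])
  have e: "coord y x = cd y x" if "x \<in> u" for x by (simp add: cd_def orbit_eq[OF v y] orbit_eq[OF u that])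
  from coord_expansion_ex[OF y E] obtain X where "finite X \<and> X \<subseteq> u \<and> (\<forall>x \<in> u - X. coord y x E = \<zero>\<^bsub>Mor C y x\<^esub>) \<and>
    (\<forall>Y. finite Y \<and> X \<subseteq> Y \<and> Y \<subseteq> u \<longrightarrow> E = (\<Oplus>\<^bsub>Mor B v u\<^esub>x\<in>Y. mc y x (coord y x E)))" ..
  then have X: "finite X" "X \<subseteq> u" "\<And>x. x \<in> u - X \<Longrightarrow> coord y x E = \<zero>\<^bsub>Mor C y x\<^esub>"
    "E = (\<Oplus>\<^bsub>Mor B v u\<^esub>x\<in>X. mc y x (coord y x E))"
    by simp_all
  have "(\<Oplus>\<^bsub>Mor B v u\<^esub>x\<in>X. mc y x (coord y x E)) = (\<Oplus>\<^bsub>Mor B v u\<^esub>x\<in>X. mc y x (cd y x E))"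
  proof (rule Q.M.finsum_cong'[OF refl])
    show "(\<lambda>x. mc y x (cd y x E)) \<in> X \<rightarrow> carrier (Mor B v u)"
    proof (rule Pi_I)
      fix x assume "x \<in> X"
      then have x: "x \<in> u" using X(2) by blast
      show "mc y x (cd y x E) \<in> carrier (Mor B v u)"
        by (rule module_homD(1)[OF mc_hom'[OF y x] module_homD(1)[OF cd_hom[OF v u y x] E]])
    qed
    show "mc y x (coord y x E) = mc y x (cd y x E)" if "x \<in> X" for x
      using e[OF subsetD[OF X(2) that]] by (rule arg_cong)
  qed
  with X(4) have 4: "E = (\<Oplus>\<^bsub>Mor B v u\<^esub>x\<in>X. mc y x (cd y x E))" by (rule trans)
  have 3: "cd y x E = \<zero>\<^bsub>Mor C y x\<^esub>" if "x \<in> u" "x \<notin> X" for x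
    using X(3)[of x] e[OF that(1)] that by simp
  show ?thesis by (rule that[OF X(1,2) 3 4])
qed

end

locale galois_bimodule = free_action k C G \<phi> \<psi>
  for k :: "('k, 'r) ring_scheme" and C :: "('o, 'k, 'm) kcat"
    and G :: "('g, 'n) monoid_scheme" and \<phi> :: "'g \<Rightarrow> 'o \<Rightarrow> 'o"
    and \<psi> :: "'g \<Rightarrow> 'o \<Rightarrow> 'o \<Rightarrow> 'm \<Rightarrow> 'm" +
  fixes M :: "('o set, 'k, ('o \<times> 'o \<Rightarrow> 'm) set, 'b) bimod"
  assumes bim: "bimodule k B M"
begin

sublocale L: linear_category k C "LM M" by (rule lifted_category[OF bim])
sublocale P: linear_precategory k B M by (rule quotient_precategory[OF bim])
sublocale pr: coefficient_functor k C "LM M" B M orb mc by (rule projection_functor[OF bim])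

abbreviation X :: "nat \<Rightarrow> ('k, 'o list \<times> 'm list \<Rightarrow> 'b) module"
  where "X \<equiv> HM_cochains k C (LM M)"

abbreviation Y :: "nat \<Rightarrow> ('k, 'o set list \<times> ('o \<times> 'o \<Rightarrow> 'm) set list \<Rightarrow> 'b) module"
  where "Y \<equiv> HM_cochains k B M"

lemma act_cell_action:
  assumes c: "p \<in> cells C n" and s: "s \<in> carrier G"
  shows "pr.act (cell_action \<phi> \<psi> s p) = pr.act p"
proof -
  obtain xs cs where p: "p = (xs, cs)" by (cases p)
  note l = cellsD[OF c[unfolded p]]
  show ?thesis unfolding p cell_action_functor_cell
  proof (rule prod_eqI)
    show "fst (pr.act (functor_cell (\<phi> s) (\<psi> s) (xs, cs))) = fst (pr.act (xs, cs))"
      using l(1,3) s by (intro nth_equalityI) (auto simp: functor_cell_simps orbit_\<phi>)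
    show "snd (pr.act (functor_cell (\<phi> s) (\<psi> s) (xs, cs))) = snd (pr.act (xs, cs))"
    proof (rule nth_equalityI)
      fix j assume "j < length (snd (pr.act (functor_cell (\<phi> s) (\<psi> s) (xs, cs))))"
      then have j: "j < n" using l(2) by (simp add: functor_cell_simps)
      have o: "xs ! j \<in> Obj C" "xs ! Suc j \<in> Obj C" using l(3)[of j] l(3)[of "Suc j"] j by auto
      show "snd (pr.act (functor_cell (\<phi> s) (\<psi> s) (xs, cs))) ! j = snd (pr.act (xs, cs)) ! j"
        using j l(1,2) mc_\<phi>[OF s o(2,1) l(4)[OF j]] by (simp add: functor_cell_simps)
    qed (simp add: functor_cell_simps)
  qed
qed

lemma pull_cell: "p \<in> cells C n \<Longrightarrow> pr.pull n F p = F (pr.act p)"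
  by (simp add: pr.pull_def)

text \<open>Descending induction on the number \<open>m\<close> of slots of the form \<open>mc \<dots>\<close>: the next slot is a sum of
  such morphisms.\<close>

lemma pull_eq_imp_eq:
  assumes F: "F \<in> carrier (Y n)" and F': "F' \<in> carrier (Y n)" and eq: "pr.pull n F = pr.pull n F'"
    and "m \<le> n" "(us, Ds) \<in> cells B n" "\<And>i. i \<le> m \<Longrightarrow> xs i \<in> us ! i"
    "\<And>j. j < m \<Longrightarrow> cs j \<in> carrier (Mor C (xs j) (xs (Suc j))) \<and> Ds ! j = mc (xs j) (xs (Suc j)) (cs j)"
  shows "F (us, Ds) = F' (us, Ds)"
  using assms(4-)
proof (induction "n - m" arbitrary: m Ds xs cs)
  case 0
  then have m: "m = n" by simp
  note c = cellsD[OF "0.prems"(2)]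
  \<comment> \<open>All slots are classes of homogeneous morphisms whose objects fit together, so
    the cell is the image of a cell of \<open>C\<close>, where the two pullbacks agree.\<close>
  let ?p = "(map xs [0..<Suc n], map cs [0..<n])"
  have xs: "xs i \<in> us ! i" "us ! i \<in> Obj B" if "i \<le> n" for i using "0.prems"(3) m that c(3) by auto
  have o: "xs i \<in> Obj C" "orb (xs i) = us ! i" if "i \<le> n" for i
    using orbit_obj[OF xs(2)[OF that] xs(1)[OF that]] orbit_eq[OF xs(2)[OF that] xs(1)[OF that]] by auto
  have p: "?p \<in> cells C n"
    using o(1) "0.prems"(4) m by (intro cellsI) (auto simp del: upt_Suc)
  have e: "pr.act ?p = (us, Ds)"
  proof (rule prod_eqI)
    show "fst (pr.act ?p) = fst (us, Ds)"
      using c(1) o(2) by (intro nth_equalityI) (auto simp: functor_cell_simps simp del: upt_Suc)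
    show "snd (pr.act ?p) = snd (us, Ds)"
      using c(2) "0.prems"(4) m by (intro nth_equalityI) (auto simp: functor_cell_simps simp del: upt_Suc)
  qed
  show ?case using fun_cong[OF eq, of ?p] pull_cell[OF p, of F] pull_cell[OF p, of F'] by (simp only: e)
next
  case (Suc d)
  then have mn: "m < n" by simp
  note c = cellsD[OF Suc.prems(2)]
  have o: "us ! m \<in> Obj B" "us ! Suc m \<in> Obj B" using c(3)[of m] c(3)[of "Suc m"] mn by auto
  have y: "xs m \<in> us ! m" using Suc.prems(3) by simp
  have E: "Ds ! m \<in> carrier (Mor B (us ! m) (us ! Suc m))" by (rule c(4)[OF mn])
  obtain S where S: "finite S" "S \<subseteq> us ! Suc m" "Ds ! m = (\<Oplus>\<^bsub>Mor B (us ! m) (us ! Suc m)\<^esub>x\<in>S. mc (xs m) x (cd (xs m) x (Ds ! m)))"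
    by (rule cd_expansion[OF o y E])
  define t where "t x = mc (xs m) x (cd (xs m) x (Ds ! m))" for x
  have cc: "cd (xs m) x (Ds ! m) \<in> carrier (Mor C (xs m) x)" if "x \<in> S" for x
    by (rule module_homD(1)[OF cd_hom[OF o y] E]) (use that S(2) in blast)
  have tc: "t x \<in> carrier (Mor B (us ! m) (us ! Suc m))" if "x \<in> S" for x
  proof -
    have x: "x \<in> us ! Suc m" using that S(2) by blast
    show ?thesis unfolding t_def
      by (rule module_homD(1)[OF orbit_pair.mc_hom'[OF orbit_pairI[OF o] y x] cc[OF that]])
  qed
  interpret V: plain_module k "Bim M (hd us) (last us)" by (rule P.Bim_plain[OF Suc.prems(2)])
  have sum: "H (us, Ds) = (\<Oplus>\<^bsub>Bim M (hd us) (last us)\<^esub>x\<in>S. H (us, Ds[m := t x]))" if H: "H \<in> carrier (Y n)" for H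
  proof -
    have "H (us, Ds) = H (us, Ds[m := \<Oplus>\<^bsub>Mor B (us ! m) (us ! Suc m)\<^esub>x\<in>S. t x])"
      using S(3) unfolding t_def by simp
    also have "\<dots> = (\<Oplus>\<^bsub>Bim M (hd us) (last us)\<^esub>x\<in>S. H (us, Ds[m := t x]))"
      by (rule module_hom_finsum[OF P.Mor_module[OF o(2,1)] V.module_axioms HM_cochainsD(2)[OF H Suc.prems(2) mn] tc])
    finally show ?thesis .
  qed
  \<comment> \<open>The source \<open>x\<close> of the new component becomes the lift of the next
    object, so the following slot can again be expanded with its target fixed.\<close>
  have "F (us, Ds[m := t x]) = F' (us, Ds[m := t x])" if x: "x \<in> S" for x
  proof (rule Suc.hyps(1)[of "Suc m" "Ds[m := t x]" "xs(Suc m := x)" "cs(m := cd (xs m) x (Ds ! m))"])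
    show "d = n - Suc m" using Suc.hyps(2) by simp
    show "Suc m \<le> n" using mn by simp
    show "(us, Ds[m := t x]) \<in> cells B n" by (rule cells_update[OF Suc.prems(2) mn tc[OF x]])
    show "(xs(Suc m := x)) i \<in> us ! i" if "i \<le> Suc m" for i
      using that Suc.prems(3)[of i] S(2) x by (auto simp: le_Suc_eq)
    fix j assume j: "j < Suc m"
    show "(cs(m := cd (xs m) x (Ds ! m))) j \<in> carrier (Mor C ((xs(Suc m := x)) j) ((xs(Suc m := x)) (Suc j))) \<and>
      Ds[m := t x] ! j = mc ((xs(Suc m := x)) j) ((xs(Suc m := x)) (Suc j)) ((cs(m := cd (xs m) x (Ds ! m))) j)"
    proof (cases "j = m")
      case True
      then show ?thesis using cc[OF x] mn c(2) by (simp add: t_def)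
    next
      case False
      then show ?thesis using j Suc.prems(4)[of j] by simp
    qed
  qed
  then show ?case unfolding sum[OF F] sum[OF F']
    using HM_cochainsD(1)[OF F' cells_update[OF Suc.prems(2) mn tc]] by (intro V.M.finsum_cong') auto
qed

lemma pull_inj: "inj_on (pr.pull n) (carrier (Y n))"
proof (rule inj_onI)
  fix F F' assume F: "F \<in> carrier (Y n)" and F': "F' \<in> carrier (Y n)" and eq: "pr.pull n F = pr.pull n F'"
  show "F = F'"
  proof (rule HM_cochains_ext[where C=B and n=n])
    show "F \<in> extensional (cells B n)" "F' \<in> extensional (cells B n)" using F F' HM_cochains_extensional by blast+
    fix us Ds assume c: "(us, Ds) \<in> cells B n"
    have "us ! 0 \<in> Obj B" using cellsD(3)[OF c] by simp
    then obtain y where "y \<in> us ! 0" using orbit_nonempty by blast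
    \<comment> \<open>No slot is lifted yet: any point of the first orbit serves as
      \<open>xs 0\<close>, and the morphisms \<open>cs\<close> are arbitrary.\<close>
    then show "F (us, Ds) = F' (us, Ds)"
      by (intro pull_eq_imp_eq[OF F F' eq _ c, of 0 "\<lambda>_. y" undefined]) auto
  qed
qed

text \<open>An invariant cochain \<open>f\<close> extends to the quotient by summing over the lifts of a chain of orbits to
  a path of objects with a fixed starting point; the morphisms are lifted by their coordinates.\<close>

definition base :: "'o set \<Rightarrow> 'o"
  where "base u = (SOME x. x \<in> u)"

lemma base: "u \<in> Obj B \<Longrightarrow> base u \<in> u"
  unfolding base_def by (rule someI_ex) (rule orbit_nonempty)

definition lifts :: "nat \<Rightarrow> 'o set list \<Rightarrow> 'o list set"
  where "lifts m us = {xs. length xs = Suc m \<and> xs ! 0 = base (us ! 0) \<and> (\<forall>i \<le> m. xs ! i \<in> us ! i)}"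

definition coords :: "nat \<Rightarrow> 'o list \<Rightarrow> ('o \<times> 'o \<Rightarrow> 'm) set list \<Rightarrow> 'm list"
  where "coords n xs Ds = map (\<lambda>j. cd (xs ! j) (xs ! Suc j) (Ds ! j)) [0..<n]"

text \<open>There may be infinitely many lifts; keeping those all of whose coordinates are nonzero
  leaves finitely many summands, and the omitted ones would vanish anyway.\<close>

definition supports :: "nat \<Rightarrow> 'o set list \<Rightarrow> ('o \<times> 'o \<Rightarrow> 'm) set list \<Rightarrow> 'o list set"
  where "supports m us Ds = {xs \<in> lifts m us. \<forall>j < m. cd (xs ! j) (xs ! Suc j) (Ds ! j) \<noteq> \<zero>\<^bsub>Mor C (xs ! j) (xs ! Suc j)\<^esub>}"

definition extend :: "nat \<Rightarrow> ('o list \<times> 'm list \<Rightarrow> 'b) \<Rightarrow> ('o set list \<times> ('o \<times> 'o \<Rightarrow> 'm) set list \<Rightarrow> 'b)"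
  where "extend n f = (\<lambda>(us, Ds) \<in> cells B n. \<Oplus>\<^bsub>Bim M (hd us) (last us)\<^esub>xs\<in>supports n us Ds. f (xs, coords n xs Ds))"

text \<open>Induction along the list: once the object at position \<open>m\<close> is fixed,
  \<open>cd_expansion\<close> leaves finitely many choices for the next one.\<close>

lemma finite_supports:
  assumes c: "(us, Ds) \<in> cells B n" and "m \<le> n"
  shows "finite (supports m us Ds)"
  using \<open>m \<le> n\<close>
proof (induction m)
  case 0
  have "supports 0 us Ds \<subseteq> {[base (us ! 0)]}"
    by (auto simp: supports_def lifts_def length_Suc_conv)
  then show ?case by (rule finite_subset) simp
next
  case (Suc m)
  then have m: "m < n" "m \<le> n" by auto
  have o: "us ! m \<in> Obj B" "us ! Suc m \<in> Obj B" using cellsD(3)[OF c, of m] cellsD(3)[OF c, of "Suc m"] m by auto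
  let ?A = "\<lambda>xs. {x \<in> us ! Suc m. cd (xs ! m) x (Ds ! m) \<noteq> \<zero>\<^bsub>Mor C (xs ! m) x\<^esub>}"
  have fin: "finite (?A xs)" if "xs \<in> supports m us Ds" for xs
  proof -
    have y: "xs ! m \<in> us ! m" using that by (simp add: supports_def lifts_def)
    obtain S where S: "finite S" "\<And>x. \<lbrakk>x \<in> us ! Suc m; x \<notin> S\<rbrakk> \<Longrightarrow> cd (xs ! m) x (Ds ! m) = \<zero>\<^bsub>Mor C (xs ! m) x\<^esub>"
      by (rule cd_expansion[OF o y cellsD(4)[OF c m(1)]]) (rule that)
    show ?thesis by (rule finite_subset[OF _ S(1)]) (use S(2) in auto)
  qed
  have "supports (Suc m) us Ds \<subseteq> (\<Union>xs \<in> supports m us Ds. (\<lambda>x. xs @ [x]) ` ?A xs)"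
  proof
    fix xs assume xs: "xs \<in> supports (Suc m) us Ds"
    then have l: "length xs = Suc (Suc m)" by (simp add: supports_def lifts_def)
    have n: "butlast xs ! i = xs ! i" if "i \<le> m" for i using that l by (simp add: nth_butlast)
    have "xs ! Suc m \<in> us ! Suc m" using xs unfolding supports_def lifts_def by blast
    moreover have "cd (xs ! m) (xs ! Suc m) (Ds ! m) \<noteq> \<zero>\<^bsub>Mor C (xs ! m) (xs ! Suc m)\<^esub>" using xs unfolding supports_def by blast
    moreover have "butlast xs \<in> supports m us Ds" using xs l n by (auto simp: supports_def lifts_def)
    moreover have "xs = butlast xs @ [xs ! Suc m]" using l by (metis append_butlast_last_id diff_Suc_1 last_conv_nth length_0_conv nat.distinct(1))
    ultimately show "xs \<in> (\<Union>xs \<in> supports m us Ds. (\<lambda>x. xs @ [x]) ` ?A xs)" using n[of m] by (intro UN_I[of "butlast xs"]) auto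
  qed
  then show ?case by (rule finite_subset) (intro finite_UN_I finite_imageI Suc.IH[OF m(2)] fin)
qed

context
  fixes n f assumes f: "f \<in> carrier (X n)"
begin

lemma lift_cell:
  assumes c: "(us, Ds) \<in> cells B n" and xs: "xs \<in> lifts n us"
  shows "(xs, coords n xs Ds) \<in> cells C n" "Bim (LM M) (hd xs) (last xs) = Bim M (hd us) (last us)"
proof -
  have m: "us ! i \<in> Obj B" "xs ! i \<in> us ! i" if "i \<le> n" for i using that xs cellsD(3)[OF c] by (auto simp: lifts_def)
  have o: "xs ! i \<in> Obj C" "orb (xs ! i) = us ! i" if "i \<le> n" for i
    using orbit_obj[OF m[OF that]] orbit_eq[OF m[OF that]] by auto
  show cell: "(xs, coords n xs Ds) \<in> cells C n"
  proof (rule cellsI)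
    show "length xs = Suc n" using xs by (simp add: lifts_def)
    show "length (coords n xs Ds) = n" by (simp add: coords_def)
    show "xs ! i \<in> Obj C" if "i \<le> n" for i by (rule o(1)[OF that])
    show "coords n xs Ds ! j \<in> carrier (Mor C (xs ! j) (xs ! Suc j))" if j: "j < n" for j
      using module_homD(1)[OF cd_hom[OF m(1) m(1) m(2) m(2)] cellsD(4)[OF c j]] j by (simp add: coords_def)
  qed
  show "Bim (LM M) (hd xs) (last xs) = Bim M (hd us) (last us)"
    using cells_hd_last(1,2)[OF cell] cells_hd_last(1,2)[OF c] o(2) by (simp add: LM_simps)
qed

lemma lift_value:
  assumes "(us, Ds) \<in> cells B n" "xs \<in> lifts n us"
  shows "f (xs, coords n xs Ds) \<in> carrier (Bim M (hd us) (last us))"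
  using HM_cochainsD(1)[OF f lift_cell(1)[OF assms]] lift_cell(2)[OF assms] by simp

text \<open>A vanishing coordinate fills a slot of a multilinear cochain with zero.\<close>

lemma lift_value_zero:
  assumes c: "(us, Ds) \<in> cells B n" and xs: "xs \<in> lifts n us" "xs \<notin> supports n us Ds"
  shows "f (xs, coords n xs Ds) = \<zero>\<^bsub>Bim M (hd us) (last us)\<^esub>"
proof -
  note cell = lift_cell[OF c xs(1)]
  obtain j where j: "j < n" "cd (xs ! j) (xs ! Suc j) (Ds ! j) = \<zero>\<^bsub>Mor C (xs ! j) (xs ! Suc j)\<^esub>"
    using xs by (auto simp: supports_def)
  have o: "xs ! j \<in> Obj C" "xs ! Suc j \<in> Obj C" using cellsD(3)[OF cell(1), of j] cellsD(3)[OF cell(1), of "Suc j"] j by auto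
  have "coords n xs Ds = (coords n xs Ds)[j := \<zero>\<^bsub>Mor C (xs ! j) (xs ! Suc j)\<^esub>]"
    using j by (intro nth_equalityI) (auto simp: coords_def nth_list_update)
  moreover have "f (xs, (coords n xs Ds)[j := \<zero>\<^bsub>Mor C (xs ! j) (xs ! Suc j)\<^esub>]) = \<zero>\<^bsub>Bim (LM M) (hd xs) (last xs)\<^esub>"
    using L.Bim_plain[OF cell(1)] unfolding plain_module_def
    by (rule module_hom_zero[OF Mor_C_module[OF o(2,1)] _ HM_cochainsD(2)[OF f cell(1) j(1)]])
  ultimately show ?thesis using cell(2) by simp
qed

text \<open>The set \<open>supports\<close> depends on the morphisms; enlarging it adds zeros only,
  so sums for different morphisms become comparable.\<close>

lemma extend_sum:
  assumes c: "(us, Ds) \<in> cells B n" and Q: "finite Q" "supports n us Ds \<subseteq> Q" "Q \<subseteq> lifts n us"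
  shows "extend n f (us, Ds) = (\<Oplus>\<^bsub>Bim M (hd us) (last us)\<^esub>xs\<in>Q. f (xs, coords n xs Ds))"
proof -
  interpret V: plain_module k "Bim M (hd us) (last us)" by (rule P.Bim_plain[OF c])
  have "(\<Oplus>\<^bsub>Bim M (hd us) (last us)\<^esub>xs\<in>supports n us Ds. f (xs, coords n xs Ds)) =
      (\<Oplus>\<^bsub>Bim M (hd us) (last us)\<^esub>xs\<in>Q. f (xs, coords n xs Ds))"
    using lift_value_zero[OF c] lift_value[OF c] Q by (intro V.finsum_superset) auto
  then show ?thesis using c by (simp add: extend_def)
qed

lemma coords_update:
  assumes "j < n" "length Ds = n"
  shows "coords n xs (Ds[j := D]) = (coords n xs Ds)[j := cd (xs ! j) (xs ! Suc j) D]"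
  using assms by (intro nth_equalityI) (auto simp: coords_def nth_list_update)

lemma supports_lifts: "supports n us Ds \<subseteq> lifts n us"
  by (auto simp: supports_def)

text \<open>For a fixed lift the summand is a value of \<open>f\<close> with one slot composed with
  a coordinate map, hence linear in that slot. The index sets for two arguments and for their sum
  differ, so all three sums are taken over the union; scalar multiples are treated likewise.\<close>

lemma extend_closed: "extend n f \<in> carrier (Y n)"
proof (rule HM_cochainsI)
  show "extend n f \<in> extensional (cells B n)" by (simp add: extend_def)
  fix us Ds assume c: "(us, Ds) \<in> cells B n"
  interpret V: plain_module k "Bim M (hd us) (last us)" by (rule P.Bim_plain[OF c])
  show "extend n f (us, Ds) \<in> carrier (Bim M (hd us) (last us))"
    unfolding extend_sum[OF c finite_supports[OF c le_refl] subset_refl supports_lifts]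
    using lift_value[OF c] supports_lifts by (intro V.M.finsum_closed) blast
  fix j assume j: "j < n"
  note l = cellsD(2)[OF c]
  have o: "us ! j \<in> Obj B" "us ! Suc j \<in> Obj B" using cellsD(3)[OF c, of j] cellsD(3)[OF c, of "Suc j"] j by auto
  interpret U: plain_module k "Mor B (us ! j) (us ! Suc j)" using P.Mor_module[OF o(2,1)] by (simp add: plain_module_def)
  note cu = cells_update[OF c j]
  define v where "v xs D = f (xs, coords n xs (Ds[j := D]))" for xs D
  have vh: "v xs \<in> module_hom k (Mor B (us ! j) (us ! Suc j)) (Bim M (hd us) (last us))" if xs: "xs \<in> lifts n us" for xs
  proof -
    have m: "xs ! j \<in> us ! j" "xs ! Suc j \<in> us ! Suc j" using xs j by (simp_all add: lifts_def)
    note lc = lift_cell[OF c xs]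
    show ?thesis
      using module_hom_compose[OF cd_hom[OF o m] HM_cochainsD(2)[OF f lc(1) j]] lc(2)
      by (simp add: v_def[abs_def] coords_update[OF j l])
  qed
  let ?s = "\<lambda>D. supports n us (Ds[j := D])"
  have fin: "finite (?s D)" if "D \<in> carrier (Mor B (us ! j) (us ! Suc j))" for D
    by (rule finite_supports[OF cu[OF that] le_refl])
  have es: "extend n f (us, Ds[j := D]) = (\<Oplus>\<^bsub>Bim M (hd us) (last us)\<^esub>xs\<in>Q. v xs D)"
    if "D \<in> carrier (Mor B (us ! j) (us ! Suc j))" "finite Q" "?s D \<subseteq> Q" "Q \<subseteq> lifts n us" for D Q
    unfolding v_def by (rule extend_sum[OF cu[OF that(1)] that(2-4)])
  have vc: "v xs D \<in> carrier (Bim M (hd us) (last us))" if "xs \<in> lifts n us" "D \<in> carrier (Mor B (us ! j) (us ! Suc j))" for xs D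
    by (rule module_homD(1)[OF vh[OF that(1)] that(2)])
  show "(\<lambda>D. extend n f (us, Ds[j := D])) \<in> module_hom k (Mor B (us ! j) (us ! Suc j)) (Bim M (hd us) (last us))"
  proof (rule module_homI)
    fix D assume D: "D \<in> carrier (Mor B (us ! j) (us ! Suc j))"
    show "extend n f (us, Ds[j := D]) \<in> carrier (Bim M (hd us) (last us))"
      unfolding es[OF D fin[OF D] subset_refl supports_lifts] using vc[OF _ D] supports_lifts by (intro V.M.finsum_closed) blast
    {
      fix D' assume D': "D' \<in> carrier (Mor B (us ! j) (us ! Suc j))"
      let ?D = "D \<oplus>\<^bsub>Mor B (us ! j) (us ! Suc j)\<^esub> D'"
      let ?Q = "?s D \<union> ?s D' \<union> ?s ?D"
      have DD: "?D \<in> carrier (Mor B (us ! j) (us ! Suc j))" using D D' by simp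
      have Q: "finite ?Q" "?Q \<subseteq> lifts n us" "?s D \<subseteq> ?Q" "?s D' \<subseteq> ?Q" "?s ?D \<subseteq> ?Q"
        using fin[OF D] fin[OF D'] fin[OF DD] supports_lifts by auto
      have "extend n f (us, Ds[j := ?D]) = (\<Oplus>\<^bsub>Bim M (hd us) (last us)\<^esub>xs\<in>?Q. v xs ?D)" by (rule es[OF DD Q(1,5,2)])
      also have "\<dots> = (\<Oplus>\<^bsub>Bim M (hd us) (last us)\<^esub>xs\<in>?Q. v xs D \<oplus>\<^bsub>Bim M (hd us) (last us)\<^esub> v xs D')"
      proof (rule V.M.finsum_cong'[OF refl])
        show "v xs ?D = v xs D \<oplus>\<^bsub>Bim M (hd us) (last us)\<^esub> v xs D'" if "xs \<in> ?Q" for xs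
          by (rule module_homD(2)[OF vh[OF subsetD[OF Q(2) that]] D D'])
        show "(\<lambda>xs. v xs D \<oplus>\<^bsub>Bim M (hd us) (last us)\<^esub> v xs D') \<in> ?Q \<rightarrow> carrier (Bim M (hd us) (last us))"
          using vc[OF subsetD[OF Q(2)] D] vc[OF subsetD[OF Q(2)] D'] by (intro Pi_I V.M.a_closed)
      qed
      also have "\<dots> = (\<Oplus>\<^bsub>Bim M (hd us) (last us)\<^esub>xs\<in>?Q. v xs D) \<oplus>\<^bsub>Bim M (hd us) (last us)\<^esub> (\<Oplus>\<^bsub>Bim M (hd us) (last us)\<^esub>xs\<in>?Q. v xs D')"
        using vc[OF subsetD[OF Q(2)] D] vc[OF subsetD[OF Q(2)] D'] by (intro V.M.finsum_addf Pi_I)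
      finally show "extend n f (us, Ds[j := ?D]) = extend n f (us, Ds[j := D]) \<oplus>\<^bsub>Bim M (hd us) (last us)\<^esub> extend n f (us, Ds[j := D'])"
        unfolding es[OF D Q(1,3,2)] es[OF D' Q(1,4,2)] .
    next
      fix a assume a: "a \<in> carrier k"
      let ?D = "a \<odot>\<^bsub>Mor B (us ! j) (us ! Suc j)\<^esub> D"
      let ?Q = "?s D \<union> ?s ?D"
      have DD: "?D \<in> carrier (Mor B (us ! j) (us ! Suc j))" using D a by simp
      have Q: "finite ?Q" "?Q \<subseteq> lifts n us" "?s D \<subseteq> ?Q" "?s ?D \<subseteq> ?Q"
        using fin[OF D] fin[OF DD] supports_lifts by auto
      have "extend n f (us, Ds[j := ?D]) = (\<Oplus>\<^bsub>Bim M (hd us) (last us)\<^esub>xs\<in>?Q. v xs ?D)" by (rule es[OF DD Q(1,4,2)])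
      also have "\<dots> = (\<Oplus>\<^bsub>Bim M (hd us) (last us)\<^esub>xs\<in>?Q. a \<odot>\<^bsub>Bim M (hd us) (last us)\<^esub> v xs D)"
      proof (rule V.M.finsum_cong'[OF refl])
        show "v xs ?D = a \<odot>\<^bsub>Bim M (hd us) (last us)\<^esub> v xs D" if "xs \<in> ?Q" for xs
          by (rule module_homD(3)[OF vh[OF subsetD[OF Q(2) that]] a D])
        show "(\<lambda>xs. a \<odot>\<^bsub>Bim M (hd us) (last us)\<^esub> v xs D) \<in> ?Q \<rightarrow> carrier (Bim M (hd us) (last us))"
          using vc[OF subsetD[OF Q(2)] D] a by (intro Pi_I V.smult_closed)
      qed
      also have "\<dots> = a \<odot>\<^bsub>Bim M (hd us) (last us)\<^esub> (\<Oplus>\<^bsub>Bim M (hd us) (last us)\<^esub>xs\<in>?Q. v xs D)"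
        using vc[OF subsetD[OF Q(2)] D] Q(1) a by (intro V.finsum_smult_ldistr[symmetric] Pi_I)
      finally show "extend n f (us, Ds[j := ?D]) = a \<odot>\<^bsub>Bim M (hd us) (last us)\<^esub> extend n f (us, Ds[j := D])"
        unfolding es[OF D Q(1,3,2)] .
    }
  qed
qed

text \<open>In the image of a path that starts at the base point every slot is homogeneous, so a
  nonzero coordinate can occur only at the next object of the path. By induction from the base point
  the path itself is the only lift that can contribute.\<close>

lemma extend_act_based:
  assumes c: "(ys, cs) \<in> cells C n" and y: "ys ! 0 = base (orb (ys ! 0))"
  shows "extend n f (pr.act (ys, cs)) = f (ys, cs)"
proof -
  define us Ds where ud: "us = fst (pr.act (ys, cs))" "Ds = snd (pr.act (ys, cs))"
  have pa: "pr.act (ys, cs) = (us, Ds)" by (simp add: ud)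
  have cB: "(us, Ds) \<in> cells B n" using pr.act_cell[OF c] by (simp add: ud)
  note l = cellsD[OF c]
  have us: "us ! i = orb (ys ! i)" if "i \<le> n" for i using that l(1) by (simp add: ud functor_cell_simps)
  have Ds: "Ds ! j = mc (ys ! j) (ys ! Suc j) (cs ! j)" if "j < n" for j using that l(2) by (simp add: ud functor_cell_simps)
  have m: "us ! i \<in> Obj B" "ys ! i \<in> us ! i" if "i \<le> n" for i using cellsD(3)[OF cB that] l(3)[OF that] us[OF that] mem_orb by auto
  have ysl: "ys \<in> lifts n us" using l(1) y m(2) us[of 0] by (simp add: lifts_def)
  have cdj: "cd (ys ! j) x (Ds ! j) = (if x = ys ! Suc j then cs ! j else \<zero>\<^bsub>Mor C (ys ! j) x\<^esub>)" if j: "j < n" and x: "x \<in> us ! Suc j" for j x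
    unfolding Ds[OF j] using j by (intro cd_mc[OF m(1) m(1) m(2) x m(2) l(4)]) auto
  have sub: "supports n us Ds \<subseteq> {ys}"
  proof
    fix xs assume xs: "xs \<in> supports n us Ds"
    then have xl: "length xs = Suc n" "xs ! 0 = base (us ! 0)" "\<And>i. i \<le> n \<Longrightarrow> xs ! i \<in> us ! i"
      "\<And>j. j < n \<Longrightarrow> cd (xs ! j) (xs ! Suc j) (Ds ! j) \<noteq> \<zero>\<^bsub>Mor C (xs ! j) (xs ! Suc j)\<^esub>"
      by (auto simp: supports_def lifts_def)
    have "xs ! i = ys ! i" if "i \<le> n" for i
      using that
    proof (induction i)
      case 0
      show ?case using xl(2) y us[of 0] by simp
    next
      case (Suc i)
      then have i: "i < n" "xs ! i = ys ! i" by auto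
      show ?case using xl(4)[OF i(1)] cdj[OF i(1) xl(3)[OF Suc.prems]] i(2) by (auto split: if_splits)
    qed
    then have "xs = ys" using xl(1) l(1) by (intro nth_equalityI) auto
    then show "xs \<in> {ys}" by simp
  qed
  have co: "coords n ys Ds = cs"
    using l(2) cdj[OF _ m(2)] by (intro nth_equalityI) (auto simp: coords_def)
  have "extend n f (us, Ds) = (\<Oplus>\<^bsub>Bim M (hd us) (last us)\<^esub>xs\<in>{ys}. f (xs, coords n xs Ds))"
    using ysl by (intro extend_sum[OF cB _ sub]) auto
  also have "\<dots> = f (ys, cs)"
  proof -
    interpret V: plain_module k "Bim M (hd us) (last us)" by (rule P.Bim_plain[OF cB])
    show ?thesis using lift_value[OF cB ysl] by (simp add: co)
  qed
  finally show ?thesis unfolding pa .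
qed

end

lemma cell_action_cell: "\<lbrakk>s \<in> carrier G; p \<in> cells C n\<rbrakk> \<Longrightarrow> cell_action \<phi> \<psi> s p \<in> cells C n"
  unfolding cell_action_functor_cell by (rule coefficient_functor.act_cell'[OF action_functor[OF bim]])

text \<open>The projection identifies a cell with its translates, so pullbacks are invariant.
  Conversely an invariant cochain agrees with the pullback of its extension on cells starting at the
  base point, and every cell is a translate of such a cell.\<close>

lemma pull_image:
  "pr.pull n ` carrier (Y n) = {f \<in> carrier (X n). \<forall>s \<in> carrier G. cochain_action C G \<phi> \<psi> n s f = f}"
proof (intro equalityI subsetI)
  fix f assume "f \<in> pr.pull n ` carrier (Y n)"
  then obtain F where F: "F \<in> carrier (Y n)" "f = pr.pull n F" by blast
  have fX: "f \<in> carrier (X n)" unfolding F(2) by (rule module_homD(1)[OF pr.pull_hom F(1)])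
  have "cochain_action C G \<phi> \<psi> n s f = f" if s: "s \<in> carrier G" for s
    unfolding cochain_action_def F(2) pr.pull_def
    by (rule restrict_ext) (simp add: cell_action_cell[OF Gr.inv_closed[OF s]] act_cell_action[OF _ Gr.inv_closed[OF s]])
  then show "f \<in> {f \<in> carrier (X n). \<forall>s \<in> carrier G. cochain_action C G \<phi> \<psi> n s f = f}" using fX by blast
next
  fix f assume "f \<in> {f \<in> carrier (X n). \<forall>s \<in> carrier G. cochain_action C G \<phi> \<psi> n s f = f}"
  then have f: "f \<in> carrier (X n)" "\<And>s. s \<in> carrier G \<Longrightarrow> cochain_action C G \<phi> \<psi> n s f = f" by auto
  have inv: "f (cell_action \<phi> \<psi> s p) = f p" if s: "s \<in> carrier G" and p: "p \<in> cells C n" for s p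
    using fun_cong[OF f(2)[OF Gr.inv_closed[OF s]], of p] s p by (simp add: cochain_action_def)
  have "pr.pull n (extend n f) = f"
  proof (rule HM_cochains_ext[where C=C and n=n])
    show "pr.pull n (extend n f) \<in> extensional (cells C n)" by (simp add: pr.pull_def)
    show "f \<in> extensional (cells C n)" by (rule HM_cochains_extensional[OF f(1)])
    fix ys cs assume c: "(ys, cs) \<in> cells C n"
    have y: "ys ! 0 \<in> Obj C" using cellsD(3)[OF c] by simp
    note b = base[OF orb_Obj[OF y]]
    note t = tr[OF orb_Obj[OF y] mem_orb[OF y] b]
    \<comment> \<open>The translation that moves the first object of the cell to the base point of
      its orbit.\<close>
    define s where "s = tr (ys ! 0) (base (orb (ys ! 0)))"
    define ys' cs' where d: "ys' = fst (cell_action \<phi> \<psi> s (ys, cs))" "cs' = snd (cell_action \<phi> \<psi> s (ys, cs))"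
    have s: "s \<in> carrier G" using t(1) by (simp add: s_def)
    have p': "cell_action \<phi> \<psi> s (ys, cs) = (ys', cs')" by (simp add: d)
    have c': "(ys', cs') \<in> cells C n" using cell_action_cell[OF s c] p' by simp
    have y0: "ys' ! 0 = base (orb (ys ! 0))"
      using t(2) cellsD(1)[OF c] by (simp add: d cell_action_functor_cell functor_cell_simps s_def)
    have "orb (ys' ! 0) = orb (ys ! 0)" unfolding y0 by (rule orbit_eq[OF orb_Obj[OF y] b])
    then have "extend n f (pr.act (ys', cs')) = f (ys', cs')" using y0 by (intro extend_act_based[OF f(1) c']) simp
    moreover have "pr.act (ys', cs') = pr.act (ys, cs)" using act_cell_action[OF c s] p' by simp
    moreover have "f (ys', cs') = f (ys, cs)" using inv[OF s c] p' by simp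
    ultimately show "pr.pull n (extend n f) (ys, cs) = f (ys, cs)" by (simp add: pull_cell[OF c])
  qed
  then show "f \<in> pr.pull n ` carrier (Y n)" using extend_closed[OF f(1)] by (metis image_eqI)
qed

end

section \<open>The spectral sequence of a Galois covering\<close>

context galois_bimodule
begin

lemma cell_action_mult:
  assumes c: "p \<in> cells C n" and s: "s \<in> carrier G" and t: "t \<in> carrier G"
  shows "cell_action \<phi> \<psi> (s \<otimes>\<^bsub>G\<^esub> t) p = cell_action \<phi> \<psi> s (cell_action \<phi> \<psi> t p)"
proof -
  obtain xs cs where p: "p = (xs, cs)" by (cases p)
  note l = cellsD[OF c[unfolded p]]
  show ?thesis unfolding p cell_action_functor_cell
  proof (rule prod_eqI)
    show "fst (functor_cell (\<phi> (s \<otimes>\<^bsub>G\<^esub> t)) (\<psi> (s \<otimes>\<^bsub>G\<^esub> t)) (xs, cs)) = fst (functor_cell (\<phi> s) (\<psi> s) (functor_cell (\<phi> t) (\<psi> t) (xs, cs)))"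
      using l(1,3) s t by (intro nth_equalityI) (auto simp: functor_cell_simps composition_rule)
    show "snd (functor_cell (\<phi> (s \<otimes>\<^bsub>G\<^esub> t)) (\<psi> (s \<otimes>\<^bsub>G\<^esub> t)) (xs, cs)) = snd (functor_cell (\<phi> s) (\<psi> s) (functor_cell (\<phi> t) (\<psi> t) (xs, cs)))"
    proof (rule nth_equalityI)
      fix j assume "j < length (snd (functor_cell (\<phi> (s \<otimes>\<^bsub>G\<^esub> t)) (\<psi> (s \<otimes>\<^bsub>G\<^esub> t)) (xs, cs)))"
      then have j: "j < n" using l(2) by (simp add: functor_cell_simps)
      have o: "xs ! j \<in> Obj C" "xs ! Suc j \<in> Obj C" using l(3)[of j] l(3)[of "Suc j"] j by auto
      show "snd (functor_cell (\<phi> (s \<otimes>\<^bsub>G\<^esub> t)) (\<psi> (s \<otimes>\<^bsub>G\<^esub> t)) (xs, cs)) ! j = snd (functor_cell (\<phi> s) (\<psi> s) (functor_cell (\<phi> t) (\<psi> t) (xs, cs))) ! j"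
        using j l(1,2) act_act[OF s t o(2,1) l(4)[OF j]] by (simp add: functor_cell_simps)
    qed (simp add: functor_cell_simps)
  qed
qed

lemma cell_action_one:
  assumes c: "p \<in> cells C n"
  shows "cell_action \<phi> \<psi> \<one>\<^bsub>G\<^esub> p = p"
proof -
  obtain xs cs where p: "p = (xs, cs)" by (cases p)
  note l = cellsD[OF c[unfolded p]]
  show ?thesis unfolding p cell_action_functor_cell
  proof (rule prod_eqI)
    show "fst (functor_cell (\<phi> \<one>\<^bsub>G\<^esub>) (\<psi> \<one>\<^bsub>G\<^esub>) (xs, cs)) = fst (xs, cs)"
      using l(1,3) by (intro nth_equalityI) (auto simp: functor_cell_simps \<phi>_one)
    show "snd (functor_cell (\<phi> \<one>\<^bsub>G\<^esub>) (\<psi> \<one>\<^bsub>G\<^esub>) (xs, cs)) = snd (xs, cs)"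
    proof (rule nth_equalityI)
      fix j assume "j < length (snd (functor_cell (\<phi> \<one>\<^bsub>G\<^esub>) (\<psi> \<one>\<^bsub>G\<^esub>) (xs, cs)))"
      then have j: "j < n" using l(2) by (simp add: functor_cell_simps)
      have o: "xs ! j \<in> Obj C" "xs ! Suc j \<in> Obj C" using l(3)[of j] l(3)[of "Suc j"] j by auto
      show "snd (functor_cell (\<phi> \<one>\<^bsub>G\<^esub>) (\<psi> \<one>\<^bsub>G\<^esub>) (xs, cs)) ! j = snd (xs, cs) ! j"
        using j l(1,2) act_one[OF o(2,1) l(4)[OF j]] by (simp add: functor_cell_simps)
    qed (simp add: functor_cell_simps)
  qed
qed

abbreviation ca :: "nat \<Rightarrow> 'g \<Rightarrow> ('o list \<times> 'm list \<Rightarrow> 'b) \<Rightarrow> ('o list \<times> 'm list \<Rightarrow> 'b)"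
  where "ca \<equiv> cochain_action C G \<phi> \<psi>"

lemma inv_action_functor: "s \<in> carrier G \<Longrightarrow> coefficient_functor k C (LM M) C (LM M) (\<phi> (inv\<^bsub>G\<^esub> s)) (\<psi> (inv\<^bsub>G\<^esub> s))"
  by (rule action_functor[OF bim Gr.inv_closed])

lemma cochain_action_pull:
  assumes s: "s \<in> carrier G"
  shows "ca n s = coefficient_functor.pull C (\<phi> (inv\<^bsub>G\<^esub> s)) (\<psi> (inv\<^bsub>G\<^esub> s)) n"
  by (rule ext) (simp add: cochain_action_def coefficient_functor.pull_def[OF inv_action_functor[OF s]] cell_action_functor_cell)

lemma ca_eval: "p \<in> cells C n \<Longrightarrow> ca n s f p = f (cell_action \<phi> \<psi> (inv\<^bsub>G\<^esub> s) p)"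
  by (simp add: cochain_action_def)

text \<open>Since \<open>ca n s\<close> is the pullback along the functor given by the inverse of
  \<open>s\<close>, linearity and compatibility with the coboundary are instances of facts about
  functors. The inverse turns pullbacks, which compose in reverse order, into a left action.\<close>

lemma equivariant: "equivariant_complex k G X (HM_coboundary C (LM M)) ca"
proof (intro equivariant_complex.intro equivariant_complex_axioms.intro)
  show "group G" by (rule Gr.group_axioms)
  show "cochain_complex k X (HM_coboundary C (LM M))" by (rule L.HM_cochain_complex)
  fix q s assume s: "s \<in> carrier G"
  show "ca q s \<in> module_hom k (X q) (X q)"
    unfolding cochain_action_pull[OF s] by (rule coefficient_functor.pull_hom[OF inv_action_functor[OF s]])
  show "ca q (s \<otimes>\<^bsub>G\<^esub> t) f = ca q s (ca q t f)" if t: "t \<in> carrier G" for t f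
    unfolding cochain_action_def
    by (rule restrict_ext) (use s t in \<open>simp add: Gr.inv_mult_group cell_action_mult cell_action_cell\<close>)
  show "HM_coboundary C (LM M) q (ca q s f) = ca (Suc q) s (HM_coboundary C (LM M) q f)" if f: "f \<in> carrier (X q)" for f
    unfolding cochain_action_pull[OF s] by (rule coefficient_functor.pull_coboundary[OF inv_action_functor[OF s] f, symmetric])
next
  fix q f assume f: "f \<in> carrier (X q)"
  show "ca q \<one>\<^bsub>G\<^esub> f = f"
  proof (rule HM_cochains_ext[where C=C and n=q])
    show "ca q \<one>\<^bsub>G\<^esub> f \<in> extensional (cells C q)" by (simp add: cochain_action_def)
    show "f \<in> extensional (cells C q)" by (rule HM_cochains_extensional[OF f])
  qed (simp add: ca_eval cell_action_one)
qed

lemma hd_cell_action: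
  assumes "(xs, cs) \<in> cells C n"
  shows "hd (fst (cell_action \<phi> \<psi> s (xs, cs))) = \<phi> s (hd xs)"
  using cellsD(1)[OF assms] by (cases xs) (auto simp: cell_action_def)

text \<open>The position of a cell is read off its first object and does not change when a morphism
  of the cell is replaced; hence a function glued from cochains for the different positions is again
  multilinear. Translating a cell by the inverse of \<open>g\<close> multiplies its position by that
  inverse from the left, as \<open>shift\<close> requires.\<close>

lemma coinduced:
  "coinduced_module k G (X q) (ca q) (cells C q) (\<lambda>p. Bim (LM M) (hd (fst p)) (last (fst p))) (\<lambda>p f. f p)
    (\<lambda>p. tr (base (orb (hd (fst p)))) (hd (fst p)))"
proof -
  interpret E: equivariant_complex k G X "HM_coboundary C (LM M)" ca by (rule equivariant)
  have o: "hd (fst p) \<in> Obj C" if "p \<in> cells C q" for p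
    using cells_hd_last(3)[of "fst p" "snd p" C q] that by simp
  have t: "tr (base (orb y)) y \<in> carrier G" if "y \<in> Obj C" for y
    by (rule tr(1)[OF orb_Obj[OF that] base[OF orb_Obj[OF that]] mem_orb[OF that]])
  show ?thesis
  proof (intro coinduced_module.intro coinduced_module_axioms.intro)
    show "group_module k G (X q) (ca q)" by (rule E.group_module_A)
    show "ca q (s \<otimes>\<^bsub>G\<^esub> t) f = ca q s (ca q t f)" if "s \<in> carrier G" "t \<in> carrier G" "f \<in> carrier (X q)" for s t f
      by (rule E.action_mult[OF that])
    show "ca q \<one>\<^bsub>G\<^esub> f = f" if "f \<in> carrier (X q)" for f by (rule E.action_one[OF that])
    fix p assume p: "p \<in> cells C q"
    then have p': "(fst p, snd p) \<in> cells C q" by simp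
    show "module k (Bim (LM M) (hd (fst p)) (last (fst p)))" using L.Bim_plain[OF p'] by (simp add: plain_module_def)
    show "(\<lambda>f. f p) \<in> module_hom k (X q) (Bim (LM M) (hd (fst p)) (last (fst p)))"
    proof (rule module_homI)
      show "f p \<in> carrier (Bim (LM M) (hd (fst p)) (last (fst p)))" if "f \<in> carrier (X q)" for f
        using HM_cochainsD(1)[OF that p'] by simp
    qed (use p in \<open>simp_all add: HM_cochains_simps case_prod_beta\<close>)
    show "tr (base (orb (hd (fst p)))) (hd (fst p)) \<in> carrier G" by (rule t[OF o[OF p]])
    fix g assume g: "g \<in> carrier G"
    then have gi: "inv\<^bsub>G\<^esub> g \<in> carrier G" by simp
    let ?j = "cell_action \<phi> \<psi> (inv\<^bsub>G\<^esub> g) p"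
    have hj: "hd (fst ?j) = \<phi> (inv\<^bsub>G\<^esub> g) (hd (fst p))" using hd_cell_action[OF p'] by simp
    have "tr (base (orb (hd (fst ?j)))) (hd (fst ?j)) = inv\<^bsub>G\<^esub> g \<otimes>\<^bsub>G\<^esub> tr (base (orb (hd (fst p)))) (hd (fst p))"
      unfolding hj orbit_\<phi>[OF gi o[OF p]] by (rule tr_\<phi>(1)[OF orb_Obj base mem_orb gi]) (simp_all add: o[OF p] orb_Obj)
    then show "\<exists>j \<in> cells C q. tr (base (orb (hd (fst j)))) (hd (fst j)) = inv\<^bsub>G\<^esub> g \<otimes>\<^bsub>G\<^esub> tr (base (orb (hd (fst p)))) (hd (fst p)) \<and>
        (\<forall>f \<in> carrier (X q). f j = ca q g f p)"
      by (intro bexI[OF _ cell_action_cell[OF gi p]] conjI ballI) (simp_all only: ca_eval[OF p])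
  next
    fix f f' assume f: "f \<in> carrier (X q)" "f' \<in> carrier (X q)" and eq: "\<And>p. p \<in> cells C q \<Longrightarrow> f p = f' p"
    show "f = f'" by (rule HM_cochains_ext[OF HM_cochains_extensional[OF f(1)] HM_cochains_extensional[OF f(2)] eq])
  next
    fix w assume w: "w \<in> carrier G \<rightarrow> carrier (X q)"
    let ?\<tau> = "\<lambda>p. tr (base (orb (hd (fst p)))) (hd (fst p))"
    let ?f = "\<lambda>p\<in>cells C q. w (?\<tau> p) p"
    have "?f \<in> carrier (X q)"
    proof (rule HM_cochainsI)
      show "?f \<in> extensional (cells C q)" by simp
      fix xs cs assume c: "(xs, cs) \<in> cells C q"
      have wx: "w (tr (base (orb (hd xs))) (hd xs)) \<in> carrier (X q)"
        using Pi_mem[OF w t[OF cells_hd_last(3)[OF c]]] .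
      show "?f (xs, cs) \<in> carrier (Bim (LM M) (hd xs) (last xs))" using c HM_cochainsD(1)[OF wx c] by simp
      fix j assume j: "j < q"
      have oj: "xs ! j \<in> Obj C" "xs ! Suc j \<in> Obj C" using cellsD(3)[OF c, of j] cellsD(3)[OF c, of "Suc j"] j by auto
      show "(\<lambda>d. ?f (xs, cs[j := d])) \<in> module_hom k (Mor C (xs ! j) (xs ! Suc j)) (Bim (LM M) (hd xs) (last xs))"
        by (rule module_hom_cong[OF Mor_C_module[OF oj(2,1)] HM_cochainsD(2)[OF wx c j]]) (simp add: cells_update[OF c j])
    qed
    then show "\<exists>f \<in> carrier (X q). \<forall>p \<in> cells C q. f p = w (?\<tau> p) p" by (intro bexI[of _ ?f]) auto
  qed
qed

sublocale eq: equivariant_complex k G X "HM_coboundary C (LM M)" ca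
  by (rule equivariant)

lemma page_two: "module_isomorphic k (eq.dc.page 2 (int p) (int q))
    (group_cohomology G (HM_cohomology k C (LM M) q) (cohomology_action C G \<phi> \<psi> q) p)"
proof -
  have "cohomology_action C G \<phi> \<psi> q = eq.\<sigma> q" by (intro ext) (simp add: cohomology_action_def)
  then show ?thesis using eq.page_two_group_cohomology[of p q] by (simp add: HM_cohomology_def)
qed

lemma page_converges: "converges_to k eq.dc.page (HM_cohomology k B M)"
  unfolding HM_cohomology_def
proof (rule eq.page_converges_to_invariants[where \<pi>=pr.pull])
  show "field k" by (rule field_axioms)
  show "module k (Y n)" for n by (rule P.HM_cochains_module)
  show "HM_coboundary B M n \<in> module_hom k (Y n) (Y (Suc n))" for n by (rule P.HM_coboundary_hom)
  show "pr.pull n \<in> module_hom k (Y n) (X n)" for n by (rule pr.pull_hom)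
  show "inj_on (pr.pull n) (carrier (Y n))" for n by (rule pull_inj)
  show "pr.pull n ` carrier (Y n) = {x \<in> carrier (X n). \<forall>s \<in> carrier G. ca n s x = x}" for n by (rule pull_image)
  show "HM_coboundary C (LM M) n (pr.pull n b) = pr.pull (Suc n) (HM_coboundary B M n b)" if "b \<in> carrier (Y n)" for n b
    by (rule pr.pull_coboundary[OF that, symmetric])
  show "\<exists>v \<in> carrier (eq.K p q). eq.dh p q v = u"
    if "u \<in> carrier (eq.K (Suc p) q)" "eq.dh (Suc p) q u = \<zero>\<^bsub>eq.K (Suc (Suc p)) q\<^esub>" for p q u
    by (rule coinduced_module.group_coboundary_exact[OF coinduced that])
qed

end

theorem theorem3p11:
  fixes k :: "('k, 'r) ring_scheme"
    and C :: "('o, 'k, 'm) kcat"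
    and G :: "('g, 'n) monoid_scheme"
    and \<phi> :: "'g \<Rightarrow> 'o \<Rightarrow> 'o"
    and \<psi> :: "'g \<Rightarrow> 'o \<Rightarrow> 'o \<Rightarrow> 'm \<Rightarrow> 'm"
    and M :: "('o set, 'k, ('o \<times> 'o \<Rightarrow> 'm) set, 'b) bimod"
  assumes "field k"
    and "k_category k C"
    and "free_action k C G \<phi> \<psi>"
    and "bimodule k (quotient_category k C G \<phi> \<psi>) M"
    and "locally_finite k (quotient_category k C G \<phi> \<psi>) M"
  shows "\<exists>(E :: nat \<Rightarrow> int \<Rightarrow> int \<Rightarrow> ('k, ('g list \<Rightarrow> ('o list \<times> 'm list \<Rightarrow> 'b) set) set) module) d.
    first_quadrant_spectral_sequence k E d \<and>
    (\<forall>p q. module_isomorphic k (E 2 (int p) (int q))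
       (group_cohomology G (HM_cohomology k C (lifted_bimodule k C G \<phi> \<psi> M) q)
          (cohomology_action C G \<phi> \<psi> q) p)) \<and>
    converges_to k E (HM_cohomology k (quotient_category k C G \<phi> \<psi>) M)"
proof -
  interpret galois_bimodule k C G \<phi> \<psi> M
    by (intro galois_bimodule.intro galois_bimodule_axioms.intro assms)
  interpret ss: first_quadrant_spectral_sequence k eq.dc.page eq.dc.page_diff
    by (rule eq.dc.page_spectral_sequence[OF assms(1)])
  \<comment> \<open>In the first quadrant page 2 is isomorphic to group cohomology, whose elements
    have the required type; elsewhere it has a single element, and every map is injective on
    it.\<close>
  have inj: "\<exists>j :: _ \<Rightarrow> ('g list \<Rightarrow> ('o list \<times> 'm list \<Rightarrow> 'b) set) set. inj_on j (carrier (eq.dc.page 2 p q))" for p q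
  proof (cases "p < 0 \<or> q < 0")
    case True
    then have "carrier (eq.dc.page 2 p q) = {\<zero>\<^bsub>eq.dc.page 2 p q\<^esub>}" by (intro ss.first_quadrant) auto
    then show ?thesis by simp
  next
    case False
    then obtain p' q' where "p = int p'" "q = int q'" by (metis nonneg_int_cases not_le)
    then show ?thesis using page_two[of p' q'] unfolding module_isomorphic_def bij_betw_def by blast
  qed
  obtain E :: "nat \<Rightarrow> int \<Rightarrow> int \<Rightarrow> ('k, ('g list \<Rightarrow> ('o list \<times> 'm list \<Rightarrow> 'b) set) set) module" and d
    where E: "first_quadrant_spectral_sequence k E d" "\<And>r p q. 2 \<le> r \<Longrightarrow> module_isomorphic k (eq.dc.page r p q) (E r p q)"
    by (rule ss.transport[OF inj]) (rule that)
  have "module_isomorphic k (E 2 (int p) (int q))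
       (group_cohomology G (HM_cohomology k C (LM M) q) (cohomology_action C G \<phi> \<psi> q) p)" for p q
  proof (rule module_isomorphic_trans[OF module_isomorphic_sym[OF E(2)[OF order_refl]] page_two])
    show "module k (eq.dc.page 2 (int p) (int q))" using ss.page_vectorspace[of 2] by (simp add: vectorspace_def)
  qed
  moreover have "converges_to k E (HM_cohomology k B M)"
    by (rule converges_to_isomorphic[OF page_converges E(2)])
  ultimately show ?thesis using E(1) by blast
qed

end
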